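(* There is a randomized algorithm that takes as input a biased graph $(G,\mathcal{B})$ (with oracle access to $\mathcal{B}$) and an integer $k$, and in time $4^k\cdot n^{O(1)}$ (where $n$ is the input size) outputs a vertex set $S \subseteq V(G)$ and an edge set $F \subseteq E(G)$ such that: (1) $\delta_G(S) \subseteq F$; (2) $(G-F)[S]$ is balanced; (3) for every (not necessarily connected) balanced subgraph $H$ of $G$ of cost at most $k$, with probability at least $1/2^{O(k^2)}$ both $V(H) \subseteq S$ and at most $k$ edges of $F$ have an endpoint in $V(H)$.
   Context: A biased graph is a pair $(G,\mathcal{B})$ where $G$ is an undirected graph and $\mathcal{B}$ is a collection of cycles of $G$ (called balanced cycles) such that for every theta subgraph of $G$ (two distinct vertices joined by three internally vertex-disjoint paths, containing three cycles), if two of its three cycles are in $\mathcal{B}$ then so is the third. A subgraph of $G$ is balanced if every cycle in it belongs to $\mathcal{B}$. For $X \subseteq V(G)$, $\delta_G(X)$ is the set of edges with exactly one endpoint in $X$. The cost of a subgraph $H$ of $G$ is $|\delta_G(V(H))| + |E(G[V(H)]) \setminus E(H)|$. Oracle access means membership in $\mathcal{B}$ of a given cycle can be queried in unit time. *)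

theory Defs
  imports "HOL-Probability.Probability" "HOL-Library.Landau_Symbols"
begin

section \<open>Undirected graphs and biased graphs\<close>

text \<open>
  Graphs are finite and undirected; parallel edges and loops are allowed, as is usual for biased
  graphs (simple graphs are the special case in which the endpoint map is injective with
  two-element values).  The endpoint set of a loop is a singleton.
\<close>

record ('v, 'e) mgraph =
  verts :: "'v set"
  edges :: "'e set"
  ends :: "'e \<Rightarrow> 'v set"

definition wf_mgraph :: "('v, 'e) mgraph \<Rightarrow> bool" where
  "wf_mgraph G \<longleftrightarrow> finite (verts G) \<and> finite (edges G) \<and>
     (\<forall>e\<in>edges G. \<exists>u\<in>verts G. \<exists>v\<in>verts G. ends G e = {u, v})"

definition subgraph :: "('v, 'e) mgraph \<Rightarrow> ('v, 'e) mgraph \<Rightarrow> bool" where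
  "subgraph H G \<longleftrightarrow> wf_mgraph H \<and> verts H \<subseteq> verts G \<and> edges H \<subseteq> edges G \<and>
     (\<forall>e\<in>edges H. ends H e = ends G e)"

definition delete_edges :: "('v, 'e) mgraph \<Rightarrow> 'e set \<Rightarrow> ('v, 'e) mgraph" where
  "delete_edges G F = G\<lparr>edges := edges G - F\<rparr>"

definition induced :: "('v, 'e) mgraph \<Rightarrow> 'v set \<Rightarrow> ('v, 'e) mgraph" where
  "induced G X = G\<lparr>verts := verts G \<inter> X, edges := {e \<in> edges G. ends G e \<subseteq> X}\<rparr>"

text \<open>The formulation via intersection and inclusion excludes loops.\<close>

definition boundary :: "('v, 'e) mgraph \<Rightarrow> 'v set \<Rightarrow> 'e set" where
  "boundary G X = {e \<in> edges G. ends G e \<inter> X \<noteq> {} \<and> \<not> ends G e \<subseteq> X}"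

definition cost :: "('v, 'e) mgraph \<Rightarrow> ('v, 'e) mgraph \<Rightarrow> nat" where
  "cost G H = card (boundary G (verts H)) + card (edges (induced G (verts H)) - edges H)"

definition walk :: "('v, 'e) mgraph \<Rightarrow> 'v list \<Rightarrow> 'e list \<Rightarrow> bool" where
  "walk G vs es \<longleftrightarrow> length vs = Suc (length es) \<and> set vs \<subseteq> verts G \<and> set es \<subseteq> edges G \<and>
     (\<forall>i<length es. ends G (es ! i) = {vs ! i, vs ! Suc i})"

definition path_between :: "('v, 'e) mgraph \<Rightarrow> 'v \<Rightarrow> 'v \<Rightarrow> 'v list \<Rightarrow> 'e list \<Rightarrow> bool" where
  "path_between G u v vs es \<longleftrightarrow> walk G vs es \<and> distinct vs \<and> hd vs = u \<and> last vs = v"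

text \<open>
  A cycle is identified with its edge set, which determines it.  Loops are cycles of length one,
  and two parallel edges form a cycle of length two.
\<close>

definition is_cycle :: "('v, 'e) mgraph \<Rightarrow> 'e set \<Rightarrow> bool" where
  "is_cycle G C \<longleftrightarrow> (\<exists>vs es. walk G vs es \<and> es \<noteq> [] \<and> hd vs = last vs \<and>
     distinct (tl vs) \<and> distinct es \<and> C = set es)"

text \<open>
  Edge-disjointness is only needed to keep the same single edge from being used as two of
  the three paths.
\<close>

definition theta :: "('v, 'e) mgraph \<Rightarrow> 'e set \<Rightarrow> 'e set \<Rightarrow> 'e set \<Rightarrow> bool" where
  "theta G P Q R \<longleftrightarrow> (\<exists>u v ps qs rs p q r. u \<noteq> v \<and>
     path_between G u v ps p \<and> path_between G u v qs q \<and> path_between G u v rs r \<and>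
     set ps \<inter> set qs = {u, v} \<and> set ps \<inter> set rs = {u, v} \<and> set qs \<inter> set rs = {u, v} \<and>
     P = set p \<and> Q = set q \<and> R = set r \<and>
     P \<inter> Q = {} \<and> P \<inter> R = {} \<and> Q \<inter> R = {})"

text \<open>Since the three paths may be permuted, one implication per ordering suffices.\<close>

definition biased_graph :: "('v, 'e) mgraph \<Rightarrow> 'e set set \<Rightarrow> bool" where
  "biased_graph G \<B> \<longleftrightarrow> wf_mgraph G \<and> (\<forall>C\<in>\<B>. is_cycle G C) \<and>
     (\<forall>P Q R. theta G P Q R \<longrightarrow> P \<union> Q \<in> \<B> \<longrightarrow> P \<union> R \<in> \<B> \<longrightarrow> Q \<union> R \<in> \<B>)"

definition balanced :: "'e set set \<Rightarrow> ('v, 'e) mgraph \<Rightarrow> bool" where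
  "balanced \<B> H \<longleftrightarrow> (\<forall>C. is_cycle H C \<longrightarrow> C \<in> \<B>)"

section \<open>Randomized oracle programs\<close>

text \<open>
  The machine model is the WHILE language over binary trees (N. D. Jones, Computability and
  Complexity from a Programming Perspective), extended by fair coin flips and oracle queries.
  Every step takes constant time on a pointer machine that stores trees with sharing: expressions
  have a size bounded by the program text, and tests only inspect the root of a tree.
  Time in this model is therefore polynomially related to Turing machine time, and neither
  arithmetic on large numbers nor equality of trees comes for free.
\<close>

datatype tree = Leaf | Node tree tree

datatype expr =
    Var nat
  | Nil_tree
  | Cons_tree expr expr
  | Left expr
  | Right expr

datatype com =
    Skip
  | Assign nat expr
  | Flip nat
  | Query nat expr
  | Seq com com
  | If expr com com
  | While expr com

type_synonym store = "nat \<Rightarrow> tree"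

primrec left_tree :: "tree \<Rightarrow> tree" where
  "left_tree Leaf = Leaf"
| "left_tree (Node l r) = l"

primrec right_tree :: "tree \<Rightarrow> tree" where
  "right_tree Leaf = Leaf"
| "right_tree (Node l r) = r"

primrec value_of :: "expr \<Rightarrow> store \<Rightarrow> tree" where
  "value_of (Var x) s = s x"
| "value_of Nil_tree s = Leaf"
| "value_of (Cons_tree e1 e2) s = Node (value_of e1 s) (value_of e2 s)"
| "value_of (Left e) s = left_tree (value_of e s)"
| "value_of (Right e) s = right_tree (value_of e s)"

definition tree_of_bool :: "bool \<Rightarrow> tree" where
  "tree_of_bool b = (if b then Node Leaf Leaf else Leaf)"

text \<open>
  One computation step; \<^term>\<open>Skip\<close> is the halted program, and \<^term>\<open>Leaf\<close> counts as false.
\<close>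

primrec step :: "(tree \<Rightarrow> bool) \<Rightarrow> com \<Rightarrow> store \<Rightarrow> (com \<times> store) pmf" where
  "step orc Skip s = return_pmf (Skip, s)"
| "step orc (Assign x e) s = return_pmf (Skip, s(x := value_of e s))"
| "step orc (Flip x) s = map_pmf (\<lambda>b. (Skip, s(x := tree_of_bool b))) (bernoulli_pmf (1/2))"
| "step orc (Query x e) s = return_pmf (Skip, s(x := tree_of_bool (orc (value_of e s))))"
| "step orc (Seq c1 c2) s =
     (if c1 = Skip then return_pmf (c2, s)
      else map_pmf (\<lambda>(c, s'). (Seq c c2, s')) (step orc c1 s))"
| "step orc (If e c1 c2) s = return_pmf (if value_of e s \<noteq> Leaf then c1 else c2, s)"
| "step orc (While e c) s =
     return_pmf (if value_of e s \<noteq> Leaf then Seq c (While e c) else Skip, s)"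

primrec steps :: "(tree \<Rightarrow> bool) \<Rightarrow> nat \<Rightarrow> com \<times> store \<Rightarrow> (com \<times> store) pmf" where
  "steps orc 0 cf = return_pmf cf"
| "steps orc (Suc t) cf = bind_pmf (step orc (fst cf) (snd cf)) (steps orc t)"

text \<open>Variable 0 holds the input initially and the output finally.\<close>

definition initial :: "com \<Rightarrow> tree \<Rightarrow> com \<times> store" where
  "initial P inp = (P, (\<lambda>_. Leaf)(0 := inp))"

text \<open>The time bound is a worst-case bound over all outcomes of the coin flips.\<close>

definition halts_within :: "(tree \<Rightarrow> bool) \<Rightarrow> com \<Rightarrow> tree \<Rightarrow> nat \<Rightarrow> bool" where
  "halts_within orc P inp t \<longleftrightarrow> (\<forall>cf \<in> set_pmf (steps orc t (initial P inp)). fst cf = Skip)"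

text \<open>Meaningful when \<^term>\<open>halts_within orc P inp t\<close> holds.\<close>

definition output_dist :: "(tree \<Rightarrow> bool) \<Rightarrow> com \<Rightarrow> tree \<Rightarrow> nat \<Rightarrow> tree pmf" where
  "output_dist orc P inp t = map_pmf (\<lambda>cf. snd cf 0) (steps orc t (initial P inp))"

section \<open>Encodings\<close>

primrec tree_of_nat :: "nat \<Rightarrow> tree" where
  "tree_of_nat 0 = Leaf"
| "tree_of_nat (Suc n) = Node Leaf (tree_of_nat n)"

primrec nat_of_tree :: "tree \<Rightarrow> nat" where
  "nat_of_tree Leaf = 0"
| "nat_of_tree (Node l r) = Suc (nat_of_tree r)"

primrec tree_of_list :: "tree list \<Rightarrow> tree" where
  "tree_of_list [] = Leaf"
| "tree_of_list (t # ts) = Node t (tree_of_list ts)"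

primrec list_of_tree :: "tree \<Rightarrow> tree list" where
  "list_of_tree Leaf = []"
| "list_of_tree (Node l r) = l # list_of_tree r"

definition set_of_tree :: "tree \<Rightarrow> nat set" where
  "set_of_tree t = nat_of_tree ` set (list_of_tree t)"

lemma nat_of_tree_of_nat: "nat_of_tree (tree_of_nat n) = n"
  by (induction n) auto

lemma set_of_tree_of_list: "set_of_tree (tree_of_list (map tree_of_nat ns)) = set ns"
  by (induction ns) (auto simp: set_of_tree_def nat_of_tree_of_nat)

text \<open>
  A graph is presented to a program by its number of vertices and the list of its edges, each
  given as a pair of endpoints in arbitrary order; an edge is named by its position in the list.
\<close>

definition represents :: "nat \<Rightarrow> (nat \<times> nat) list \<Rightarrow> (nat, nat) mgraph \<Rightarrow> bool" where
  "represents N ps G \<longleftrightarrow> verts G = {..<N} \<and> edges G = {..<length ps} \<and>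
     (\<forall>i<length ps. ends G i = {fst (ps ! i), snd (ps ! i)})"

definition input_tree :: "nat \<Rightarrow> (nat \<times> nat) list \<Rightarrow> nat \<Rightarrow> tree" where
  "input_tree N ps k =
     Node (Node (tree_of_nat N)
                (tree_of_list (map (\<lambda>(u, v). Node (tree_of_nat u) (tree_of_nat v)) ps)))
          (tree_of_nat k)"

definition graph_size :: "('v, 'e) mgraph \<Rightarrow> nat" where
  "graph_size G = card (verts G) + card (edges G)"

definition membership_oracle :: "nat set set \<Rightarrow> tree \<Rightarrow> bool" where
  "membership_oracle \<B> t \<longleftrightarrow> set_of_tree t \<in> \<B>"

definition decode_output :: "tree \<Rightarrow> nat set \<times> nat set" where
  "decode_output t = (set_of_tree (left_tree t), set_of_tree (right_tree t))"

end

(* Relax the cost of a connected balanced subgraph with root v to a half-integral weight, in which a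
   boundary edge counts 1/2 and a missing inner edge counts 1.  The relaxation bounds the cost from
   below and uncrosses with partial solutions: for a balanced tree T at v, a boundary edge whose
   absorption into T does not increase the minimum weight can always be absorbed.  If there is no such edge,
   then a coin decides whether the next boundary edge is absorbed or deleted.  Either choice, if it agrees
   with the subgraph sought, decreases twice the difference of the remaining cost and the minimum weight,
   so at most 2k flips are needed.  Whether the minimum weight is at most p/2 is a linear
   feasibility problem whose separation oracle is a shortest path computation that queries the bias
   of fundamental cycles; a perceptron solves it in polynomially many corrections.

   Run this at every vertex v with 2k coins.  A result is kept only if v is its least vertex, if none of
   the 4^k coin sequences at v gives a larger result at no higher cost, and, unless nothing
   was cut, if further 2k coins all show heads.  The output is the union of the kept results, together
   with the edges cut by the inclusion-maximal ones.  Given H, take a balanced subgraph containing it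
   with no higher cost and as many vertices as possible, and among those of least cost.
   At most k of its components have cut edges; these have to be found and kept.  A kept result at another
   vertex does harm only if it contains an end of one of the at most k missing edges, and by the maximality
   test each such end lies in at most 4^k candidate results.  So at most 2k 4^k vertices have to fail their second
   test, each of which has success probability 4^-k only, and this costs merely a factor 2^-O(k). *)

theory Submission
  imports Defs
begin

section \<open>Walks, paths and cycles\<close>

text \<open>Uncrossing rests on a mixed submodular inequality: the count on the union of two
  subgraphs plus the weight on their common part is at most the count of one plus the weight of the
  other. Hence \<open>csum\<close> and \<open>wsum\<close> are carried side by side, linked by
  \<open>wsum_le_csum\<close>. Doubled weights are natural numbers, so a minimum below p + 1/2 is at
  most p; this gap lets a solver with purely additive steps decide exactly, which suits a machine
  with unary numbers. The maximality test makes a kept vertex set reproducible from each of its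
  vertices, and the least-vertex rule lets the set determine its root; so roots can be counted by
  coin sequences. Every vertex owns a block of 4k coins: at most k blocks are prescribed, which
  gives 4k^2 in the exponent, and 2k 4^k tests with failure probability 1 - 4^-k give another 4k.
  The coin list has to be polynomial in the graph while k is unbounded, so k is replaced by its
  minimum with the number of edges; the time for reading the excess of the unary k is charged to
  4^k.\<close>

lemma walk_single: "walk G [x] es \<longleftrightarrow> es = [] \<and> x \<in> verts G"
  by (auto simp: walk_def)

lemma walk_Cons2: "walk G (x # y # vs) (e # es) \<longleftrightarrow>
    x \<in> verts G \<and> e \<in> edges G \<and> ends G e = {x, y} \<and> walk G (y # vs) es"
proof -
  have "(\<forall>i<length (e # es). ends G ((e # es) ! i) = {(x # y # vs) ! i, (x # y # vs) ! Suc i}) \<longleftrightarrow>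
      ends G e = {x, y} \<and> (\<forall>i<length es. ends G (es ! i) = {(y # vs) ! i, (y # vs) ! Suc i})"
    by (auto simp: All_less_Suc2)
  then show ?thesis unfolding walk_def by auto
qed

lemma walk_length: "walk G vs es \<Longrightarrow> length vs = Suc (length es)"
  by (simp add: walk_def)

lemma walk_split:
  "length es1 = length xs \<Longrightarrow>
    walk G (xs @ x # ys) (es1 @ es2) \<longleftrightarrow> walk G (xs @ [x]) es1 \<and> walk G (x # ys) es2"
proof (induction xs arbitrary: es1)
  case Nil
  then show ?case by (auto simp: walk_single walk_def)
next
  case (Cons a xs)
  then obtain e es1' where e: "es1 = e # es1'" "length es1' = length xs"
    by (cases es1) auto
  show ?case
  proof (cases xs)
    case Nil
    with e Cons.IH[of es1'] show ?thesis by (auto simp: walk_Cons2)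
  next
    case (Cons b zs)
    with e Cons.IH[of es1'] show ?thesis by (auto simp: walk_Cons2)
  qed
qed

lemma walk_splitE:
  assumes "walk G (xs @ x # ys) es"
  obtains es1 es2 where "es = es1 @ es2" "length es1 = length xs"
    "walk G (xs @ [x]) es1" "walk G (x # ys) es2"
proof -
  have l: "length es = length xs + length ys"
    using walk_length[OF assms] by simp
  let ?e1 = "take (length xs) es" and ?e2 = "drop (length xs) es"
  have "length ?e1 = length xs" using l by simp
  moreover have "walk G (xs @ x # ys) (?e1 @ ?e2)" using assms by simp
  ultimately show ?thesis using that[of ?e1 ?e2] walk_split[of ?e1 xs G x ys ?e2] by simp
qed

lemma walk_rev: "walk G vs es \<Longrightarrow> walk G (rev vs) (rev es)"
proof (induction es arbitrary: vs)
  case Nil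
  then show ?case by (cases vs) (auto simp: walk_single walk_def)
next
  case (Cons e es)
  then obtain x y ws where vs: "vs = x # y # ws"
    by (cases vs; cases "tl vs") (auto simp: walk_def)
  with Cons.prems have w: "walk G (y # ws) es" "x \<in> verts G" "e \<in> edges G" "ends G e = {x, y}"
    by (auto simp: walk_Cons2)
  then have "walk G (rev ws @ [y]) (rev es)" using Cons.IH by force
  moreover have "walk G [y, x] [e]"
    using w by (auto simp: walk_Cons2 walk_single insert_commute) (auto simp: walk_def)
  moreover have "length (rev es) = length (rev ws)"
    using walk_length[OF w(1)] by simp
  ultimately show ?case using walk_split[of "rev es" "rev ws" G y "[x]" "[e]"] vs by simp
qed

lemma walk_verts_subset:
  assumes "walk G vs es" "e \<in> set es" shows "ends G e \<subseteq> set vs"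
proof -
  obtain i where "i < length es" "e = es ! i" using assms(2) by (auto simp: in_set_conv_nth)
  then show ?thesis using assms(1) by (auto simp: walk_def)
qed

lemma walk_verts_ends: "walk G vs es \<Longrightarrow> es \<noteq> [] \<Longrightarrow> set vs = (\<Union>e\<in>set es. ends G e)"
proof (induction es arbitrary: vs)
  case Nil then show ?case by simp
next
  case (Cons e es)
  then obtain x y ws where vs: "vs = x # y # ws"
    by (cases vs; cases "tl vs") (auto simp: walk_def)
  show ?case
  proof (cases es)
    case Nil
    with Cons.prems vs have "ws = []" by (auto simp: walk_def)
    with Nil Cons.prems vs show ?thesis by (auto simp: walk_Cons2)
  next
    case (Cons f fs)
    with Cons.prems(1) Cons.IH[of "y # ws"] vs show ?thesis by (auto simp: walk_Cons2)
  qed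
qed

lemma path_rev: "path_between G a b vs es \<Longrightarrow> path_between G b a (rev vs) (rev es)"
proof -
  assume p: "path_between G a b vs es"
  then have "vs \<noteq> []" by (auto simp: path_between_def walk_def)
  with p show ?thesis by (auto simp: path_between_def walk_rev hd_rev last_rev)
qed

lemma path_distinct_edges:
  assumes "walk G vs es" "distinct vs"
  shows "distinct es"
  using assms
proof (induction es arbitrary: vs)
  case Nil then show ?case by simp
next
  case (Cons e es)
  then obtain x y ws where vs: "vs = x # y # ws"
    by (cases vs; cases "tl vs") (auto simp: walk_def)
  have w: "walk G (y # ws) es" "ends G e = {x, y}"
    using Cons.prems vs by (auto simp: walk_Cons2)
  have "e \<notin> set es"
    using walk_verts_subset[OF w(1), of e] w(2) Cons.prems(2) vs by auto
  with Cons w vs show ?case by auto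
qed

section \<open>Reachability along an edge set\<close>

inductive_set reach :: "('v, 'e) mgraph \<Rightarrow> 'e set \<Rightarrow> 'v \<Rightarrow> 'v set" for G E v where
  reach_refl: "v \<in> reach G E v"
| reach_step: "u \<in> reach G E v \<Longrightarrow> e \<in> E \<Longrightarrow> ends G e = {u, w} \<Longrightarrow> w \<in> reach G E v"

lemma reach_trans: "w \<in> reach G E u \<Longrightarrow> u \<in> reach G E v \<Longrightarrow> w \<in> reach G E v"
  by (induction rule: reach.induct) (auto intro: reach_step)

lemma reach_sym: "u \<in> reach G E v \<Longrightarrow> v \<in> reach G E u"
proof (induction rule: reach.induct)
  case reach_refl
  then show ?case by (rule reach.reach_refl)
next
  case (reach_step u e w)
  have "u \<in> reach G E w"
    using reach.reach_step[OF reach.reach_refl, of e E G w u] reach_step by (auto simp: insert_commute)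
  then show ?case using reach_step reach_trans by metis
qed

lemma reach_mono: "E \<subseteq> E' \<Longrightarrow> reach G E v \<subseteq> reach G E' v"
proof
  fix u assume E: "E \<subseteq> E'" and u: "u \<in> reach G E v"
  from u show "u \<in> reach G E' v"
    by (induction rule: reach.induct) (use E in \<open>auto intro: reach.intros\<close>)
qed

lemma reach_closed:
  assumes "u \<in> reach G E v" "v \<in> S"
    "\<And>e a b. e \<in> E \<Longrightarrow> ends G e = {a, b} \<Longrightarrow> a \<in> S \<Longrightarrow> b \<in> S"
  shows "u \<in> S"
  using assms(1) by (induction rule: reach.induct) (use assms in auto)

lemma reach_endsI: "e \<in> E \<Longrightarrow> ends G e = {a, b} \<Longrightarrow> a \<in> reach G E v \<longleftrightarrow> b \<in> reach G E v"
  using reach_step[of a G E v e b] reach_step[of b G E v e a] by (auto simp: insert_commute)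

lemma path_Nil: "v \<in> verts G \<Longrightarrow> path_between G v v [v] []"
  by (auto simp: path_between_def walk_single)

lemma path_ends_in: "path_between G a b vs es \<Longrightarrow> a \<in> set vs \<and> b \<in> set vs"
  by (cases vs) (auto simp: path_between_def walk_def)

lemma path_takeE:
  assumes "path_between G v u vs es" "w \<in> set vs"
  obtains vs' es' where "path_between G v w vs' es'" "set es' \<subseteq> set es" "set vs' \<subseteq> set vs"
    "length es' \<le> length es" "w \<noteq> u \<Longrightarrow> length es' < length es"
proof -
  obtain xs ys where vs: "vs = xs @ w # ys" using split_list[OF assms(2)] by blast
  with assms(1) have "walk G (xs @ w # ys) es" by (simp add: path_between_def)
  then obtain es1 es2 where e: "es = es1 @ es2" "length es1 = length xs"
    "walk G (xs @ [w]) es1" "walk G (w # ys) es2" by (rule walk_splitE)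
  have "path_between G v w (xs @ [w]) es1"
    using assms(1) vs e by (auto simp: path_between_def hd_append split: if_splits)
  moreover have "length es1 < length es" if "w \<noteq> u"
  proof -
    have "ys \<noteq> []" using that assms(1) vs by (auto simp: path_between_def)
    then have "length es2 \<noteq> 0" using walk_length[OF e(4)] by auto
    then show ?thesis using e by simp
  qed
  ultimately show ?thesis using that[of "xs @ [w]" es1] vs e by auto
qed

lemma wf_ends:
  assumes "wf_mgraph G" "e \<in> edges G" shows "ends G e \<subseteq> verts G"
proof -
  obtain u v where "u \<in> verts G" "v \<in> verts G" "ends G e = {u, v}"
    using assms unfolding wf_mgraph_def by metis
  then show ?thesis by simp
qed

text \<open>Simplicity of the path is kept throughout the induction: a step back to a visited vertex
  truncates the path there, any other step extends it.\<close>

lemma reach_path: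
  assumes "u \<in> reach G E v" "v \<in> verts G" "wf_mgraph G" "E \<subseteq> edges G"
  shows "\<exists>vs es. path_between G v u vs es \<and> set es \<subseteq> E"
  using assms(1)
proof (induction rule: reach.induct)
  case reach_refl
  show ?case by (rule exI[of _ "[v]"], rule exI[of _ "[]"]) (use assms path_Nil in auto)
next
  case (reach_step u e w)
  then obtain vs es where p: "path_between G v u vs es" "set es \<subseteq> E" by auto
  show ?case
  proof (cases "w \<in> set vs")
    case True
    obtain vs' es' where "path_between G v w vs' es'" "set es' \<subseteq> set es"
      by (rule path_takeE[OF p(1) True])
    then show ?thesis using p(2) by (intro exI[of _ vs'] exI[of _ es']) auto
  next
    case False
    have "e \<in> edges G" using reach_step.hyps(2) assms(4) by auto
    then have w: "w \<in> verts G"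
      using wf_ends[OF assms(3), of e] reach_step.hyps(3) by auto
    have vsne: "vs \<noteq> []" using p by (auto simp: path_between_def walk_def)
    then obtain zs where zs: "vs = zs @ [u]"
      using p(1) by (metis append_butlast_last_id path_between_def)
    have ww: "walk G (zs @ [u]) es" using p zs by (simp add: path_between_def)
    have u: "u \<in> verts G" using ww by (auto simp: walk_def)
    have "walk G [u, w] [e]" using w u \<open>e \<in> edges G\<close> reach_step.hyps(3)
      by (auto simp: walk_Cons2 walk_single)
    then have "walk G (zs @ u # [w]) (es @ [e])"
      using ww walk_split[of es zs G u "[w]" "[e]"] walk_length[OF ww] by simp
    then have "path_between G v w (vs @ [w]) (es @ [e])"
      using p(1) False zs by (auto simp: path_between_def hd_append)
    moreover have "set (es @ [e]) \<subseteq> E" using p reach_step.hyps(2) by auto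
    ultimately show ?thesis by blast
  qed
qed

lemma path_reach:
  assumes "path_between G a b vs es" "c \<in> set vs"
  shows "c \<in> reach G (set es) a"
proof -
  have "walk G vs es \<Longrightarrow> set es \<subseteq> E \<Longrightarrow> c \<in> set vs \<Longrightarrow> c \<in> reach G E (hd vs)" for vs es E
  proof (induction es arbitrary: vs)
    case Nil
    then show ?case by (cases vs) (auto simp: walk_def intro: reach_refl)
  next
    case (Cons e es)
    then obtain x y ws where vs: "vs = x # y # ws"
      by (cases vs; cases "tl vs") (auto simp: walk_def)
    with Cons.prems have w: "walk G (y # ws) es" "ends G e = {x, y}"
      by (auto simp: walk_Cons2)
    have y: "y \<in> reach G E x" using reach_step[OF reach_refl, of e E G x y] w Cons.prems by auto
    show ?case
    proof (cases "c = x")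
      case True then show ?thesis using vs by (auto intro: reach_refl)
    next
      case False
      then have "c \<in> reach G E y" using Cons.IH[OF w(1)] Cons.prems vs by auto
      then show ?thesis using y reach_trans vs by (metis list.sel(1))
    qed
  qed
  then show ?thesis using assms by (auto simp: path_between_def)
qed

text \<open>On a simple path every edge is a bridge: the pieces before and after \<open>f\<close>
  share no vertex, so the remaining edges cannot lead from one to the other. Later contradictions
  come from a connection that would have to avoid \<open>f\<close>.\<close>

lemma path_bridge:
  assumes p: "path_between G a b vs q" and f: "f \<in> set q"
  obtains S1 S2 x y where "a \<in> S1" "b \<in> S2" "S1 \<inter> S2 = {}" "S1 \<union> S2 = set vs"
    "ends G f = {x, y}" "x \<in> S1" "y \<in> S2"
    "\<And>c d. c \<in> S1 \<Longrightarrow> d \<in> S2 \<Longrightarrow> d \<notin> reach G (set q - {f}) c"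
    "\<And>c. c \<in> S1 \<Longrightarrow> c \<in> reach G (set q - {f}) a"
    "\<And>c. c \<in> S2 \<Longrightarrow> c \<in> reach G (set q - {f}) b"
proof -
  obtain q1 q2 where q: "q = q1 @ f # q2" using split_list[OF f] by blast
  have w: "walk G vs q" "distinct vs" using p by (auto simp: path_between_def)
  have dq: "distinct q" using path_distinct_edges[OF w] .
  have "length q1 < length vs" using walk_length[OF w(1)] q by simp
  then obtain xs x ys where vs: "vs = xs @ x # ys" "length xs = length q1"
    by (metis id_take_nth_drop length_take min.absorb4)
  have w1: "walk G (xs @ [x]) q1" and w2: "walk G (x # ys) (f # q2)"
    using walk_split[of q1 xs G x ys "f # q2"] w(1) vs q by auto
  obtain y zs where ys: "ys = y # zs" using w2 by (cases ys) (auto simp: walk_def)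
  have w3: "walk G (y # zs) q2" and fe: "ends G f = {x, y}" using w2 ys by (auto simp: walk_Cons2)
  let ?S1 = "set (xs @ [x])" and ?S2 = "set (y # zs)"
  have dis: "?S1 \<inter> ?S2 = {}" using w(2) vs ys by auto
  have sq: "set q - {f} = set q1 \<union> set q2" using dq q by auto
  have cl: "d \<in> ?S1" if "d \<in> reach G (set q - {f}) c" "c \<in> ?S1" for c d
  proof (rule reach_closed[OF that(1) that(2)])
    fix e a b assume e: "e \<in> set q - {f}" "ends G e = {a, b}" "a \<in> ?S1"
    then consider "e \<in> set q1" | "e \<in> set q2" using sq by auto
    then show "b \<in> ?S1"
    proof cases
      case 1 then show ?thesis using walk_verts_subset[OF w1] e by auto
    next
      case 2 then show ?thesis using walk_verts_subset[OF w3] e dis by auto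
    qed
  qed
  have ha: "a = hd (xs @ [x])" using p vs by (cases xs) (auto simp: path_between_def)
  have lb: "b = last (y # zs)" using p vs ys by (auto simp: path_between_def)
  have pa: "path_between G a x (xs @ [x]) q1"
    using w1 w(2) vs ha by (auto simp: path_between_def)
  have pb: "path_between G b y (rev (y # zs)) (rev q2)"
    by (rule path_rev) (use w3 w(2) vs ys lb in \<open>auto simp: path_between_def\<close>)
  show ?thesis
  proof (rule that[of ?S1 ?S2 x y])
    show "a \<in> ?S1" using ha by (metis hd_in_set snoc_eq_iff_butlast)
    show "b \<in> ?S2" using lb by (metis last_in_set list.distinct(1))
    show "d \<notin> reach G (set q - {f}) c" if "c \<in> ?S1" "d \<in> ?S2" for c d
      using cl[of d c] that dis by auto
    show "c \<in> reach G (set q - {f}) a" if "c \<in> ?S1" for c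
      using path_reach[OF pa] that reach_mono[of "set q1" "set q - {f}" G a] sq by auto
    show "c \<in> reach G (set q - {f}) b" if "c \<in> ?S2" for c
      using path_reach[OF pb] that reach_mono[of "set (rev q2)" "set q - {f}" G b] sq by auto
  qed (use dis vs ys fe in auto)
qed

text \<open>On a simple path the first vertex occurs only at position 0 and the last vertex only at
  the end, so an edge joining these two starts at position 0 and ends at the last position.\<close>

lemma path_edge_ends:
  assumes "path_between G a b vs q" "e \<in> set q" "ends G e = {a, b}"
  shows "q = [e]"
proof -
  obtain S1 S2 x y where S: "a \<in> S1" "b \<in> S2" "S1 \<inter> S2 = {}" "ends G e = {x, y}" "x \<in> S1" "y \<in> S2"
    by (rule path_bridge[OF assms(1,2)])
  have ab: "a \<noteq> b" using S by auto
  have w: "walk G vs q" "distinct vs" "hd vs = a" "last vs = b"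
    using assms by (auto simp: path_between_def)
  obtain i where i: "i < length q" "q ! i = e" using assms(2) by (auto simp: in_set_conv_nth)
  have l: "length vs = Suc (length q)" using walk_length[OF w(1)] .
  have e: "{vs ! i, vs ! Suc i} = {a, b}" using w(1) i assms(3) by (auto simp: walk_def)
  have a0: "a = vs ! 0" using w(3) l by (cases vs) auto
  have "vs \<noteq> []" using l by auto
  then have bn: "b = vs ! length q" using w(4) l by (simp add: last_conv_nth)
  have "i = 0"
  proof (rule ccontr)
    assume "i \<noteq> 0"
    then have "vs ! i \<noteq> a" "vs ! Suc i \<noteq> a" using a0 w(2) l i by (auto simp: nth_eq_iff_index_eq)
    moreover have "a \<in> {vs ! i, vs ! Suc i}" using e by simp
    ultimately show False by simp
  qed
  moreover have "vs ! Suc i = b" using e a0 \<open>i = 0\<close> ab by (auto simp: doubleton_eq_iff)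
  ultimately have "length q = 1" using bn w(2) l i by (auto simp: nth_eq_iff_index_eq)
  then show ?thesis using i by (cases q) auto
qed

section \<open>Cycles: rotation, splitting into two paths, joining\<close>

lemma cycle_ne: "is_cycle G C \<Longrightarrow> C \<noteq> {} \<and> C \<subseteq> edges G \<and> finite C"
  by (auto simp: is_cycle_def walk_def)

text \<open>The definition singles out a start of the closed walk. Cutting the walk at
  \<open>a\<close> and swapping the two pieces moves the start there.\<close>

lemma cycle_rotate:
  assumes "is_cycle G C" "e \<in> C" "a \<in> ends G e"
  obtains ws es where "walk G (a # ws) es" "last (a # ws) = a" "distinct ws" "distinct es"
    "es \<noteq> []" "C = set es" "ws \<noteq> []" "last ws = a" "set ws = \<Union>(ends G ` C)"
proof -
  obtain vs es where c: "walk G vs es" "es \<noteq> []" "hd vs = last vs" "distinct (tl vs)"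
    "distinct es" "C = set es" using assms(1) by (auto simp: is_cycle_def)
  have a: "a \<in> set vs" using walk_verts_subset[OF c(1)] assms c by auto
  have "length vs \<ge> 2" using walk_length[OF c(1)] c(2) by (cases es) auto
  then obtain x us where vs: "vs = x # us" "us \<noteq> []" by (cases vs; cases "tl vs") auto
  have lu: "last us = x" using c vs by auto
  have main: "\<exists>ws es'. walk G (a # ws) es' \<and> last (a # ws) = a \<and> distinct ws \<and> distinct es' \<and>
     es' \<noteq> [] \<and> C = set es' \<and> ws \<noteq> []"
  proof (cases "a = x")
    case True
    then show ?thesis using c vs lu by (intro exI[of _ us] exI[of _ es]) auto
  next
    case False
    then have aus: "a \<in> set us" using a vs by auto
    obtain xs ys where us: "us = xs @ a # ys" using split_list[OF aus] by blast
    have "ys \<noteq> []" using lu us False by auto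
    then obtain zs where ys: "ys = zs @ [x]" using lu us
      by (metis append_butlast_last_id append_is_Nil_conv last_ConsR last_append list.distinct(1))
    have "walk G ((x # xs) @ a # ys) es" using c vs us by simp
    then obtain es1 es2 where e: "es = es1 @ es2" "length es1 = length (x # xs)"
      "walk G ((x # xs) @ [a]) es1" "walk G (a # ys) es2" by (rule walk_splitE)
    have "walk G ((a # zs) @ x # (xs @ [a])) (es2 @ es1)"
      using walk_split[of es2 "a # zs" G x "xs @ [a]" es1] e ys walk_length[OF e(4)] by simp
    moreover have "distinct (zs @ x # xs @ [a])" using c vs us ys by auto
    ultimately show ?thesis using c e
      by (intro exI[of _ "zs @ x # xs @ [a]"] exI[of _ "es2 @ es1"]) auto
  qed
  then obtain ws es' where r: "walk G (a # ws) es'" "last (a # ws) = a" "distinct ws" "distinct es'"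
     "es' \<noteq> []" "C = set es'" "ws \<noteq> []" by blast
  have "set (a # ws) = \<Union>(ends G ` C)" using walk_verts_ends[OF r(1,5)] r by auto
  moreover have "a \<in> set ws" using r by (metis last_ConsR last_in_set)
  ultimately have "set ws = \<Union>(ends G ` C)" by auto
  then show ?thesis using that[of ws es'] r by auto
qed

text \<open>A loop puts its vertex at two consecutive positions. Distinctness tolerates this only
  for the start and the end of the closed walk, which then consists of a single edge.\<close>

lemma cycle_loop:
  assumes "is_cycle G C" "e \<in> C" "ends G e = {a}"
  shows "C = {e}"
proof -
  obtain ws es where c: "walk G (a # ws) es" "last (a # ws) = a" "distinct ws" "distinct es"
    "es \<noteq> []" "C = set es" "ws \<noteq> []" "last ws = a" using assms by (elim cycle_rotate) auto
  obtain i where i: "i < length es" "es ! i = e" using c assms by (auto simp: in_set_conv_nth)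
  have l: "length ws = length es" using walk_length[OF c(1)] by simp
  have "{(a # ws) ! i, (a # ws) ! Suc i} = {a}" using c(1) i assms(3) by (auto simp: walk_def)
  then have si: "ws ! i = a" "(a # ws) ! i = a" by auto
  have n: "ws ! (length ws - 1) = a" using c by (simp add: last_conv_nth)
  have i1: "i = length ws - 1" using si n c(3) i l by (auto simp: nth_eq_iff_index_eq)
  have "i = 0"
  proof (rule ccontr)
    assume "i \<noteq> 0"
    then have "ws ! (i - 1) = a" using si by (cases i) auto
    then show False using si c(3) i l \<open>i \<noteq> 0\<close> by (auto simp: nth_eq_iff_index_eq)
  qed
  then have "length es = 1" using i1 l i by auto
  then show ?thesis using c i by (cases es) auto
qed

lemma cycle_split:
  assumes "is_cycle G C" "a \<in> \<Union>(ends G ` C)" "b \<in> \<Union>(ends G ` C)" "a \<noteq> b"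
  obtains p q ps qs where "path_between G a b ps p" "path_between G a b qs q"
    "set ps \<inter> set qs = {a, b}" "set p \<inter> set q = {}" "C = set p \<union> set q"
    "set ps \<union> set qs = \<Union>(ends G ` C)"
proof -
  from assms obtain e where e: "e \<in> C" "a \<in> ends G e" by auto
  obtain ws es where c: "walk G (a # ws) es" "distinct ws" "distinct es"
    "C = set es" "ws \<noteq> []" "last ws = a" "set ws = \<Union>(ends G ` C)"
    using cycle_rotate[OF assms(1) e] by metis
  obtain xs ys where ws: "ws = xs @ b # ys" using c(7) assms(3) split_list[of b ws] by blast
  have yn: "ys \<noteq> []" using c(6) ws assms(4) by auto
  have ly: "last ys = a" using c ws yn by auto
  have "walk G ((a # xs) @ b # ys) es" using c ws by simp
  then obtain es1 es2 where e: "es = es1 @ es2" "length es1 = length (a # xs)"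
    "walk G ((a # xs) @ [b]) es1" "walk G (b # ys) es2" by (rule walk_splitE)
  have aN: "a \<notin> set (xs @ [b])" using c(2) ws ly yn last_in_set by fastforce
  have p1: "path_between G a b (a # xs @ [b]) es1"
    using e c(2) ws aN by (auto simp: path_between_def)
  have p2: "path_between G a b (rev (b # ys)) (rev es2)"
    by (rule path_rev) (use e c ws ly yn in \<open>auto simp: path_between_def\<close>)
  show ?thesis
  proof (rule that[OF p1 p2])
    show "set (a # xs @ [b]) \<inter> set (rev (b # ys)) = {a, b}"
      using c(2) ws ly yn by auto
    show "set es1 \<inter> set (rev es2) = {}" using c(3) e by auto
    show "C = set es1 \<union> set (rev es2)" using c e by auto
    show "set (a # xs @ [b]) \<union> set (rev (b # ys)) = \<Union>(ends G ` C)"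
      using c(7) ws ly yn by auto
  qed
qed

lemma cycle_join:
  assumes "path_between G a b ps p" "path_between G a b qs q" "a \<noteq> b"
    "set ps \<inter> set qs = {a, b}" "set p \<inter> set q = {}"
  shows "is_cycle G (set p \<union> set q)"
proof -
  have q': "path_between G b a (rev qs) (rev q)" using path_rev[OF assms(2)] .
  obtain ps' where ps: "ps = ps' @ [b]"
    using assms(1) by (metis append_butlast_last_id path_between_def walk_def length_greater_0_conv zero_less_Suc)
  obtain qs' where qs: "rev qs = b # qs'"
    using q' by (cases "rev qs") (auto simp: path_between_def walk_def)
  have qs_set: "set qs = insert b (set qs')" using qs by (metis list.simps(15) set_rev)
  have w1: "walk G (ps' @ [b]) p" using assms(1) ps by (simp add: path_between_def)
  have w2: "walk G (b # qs') (rev q)" using q' qs by (simp add: path_between_def)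
  have w: "walk G (ps' @ b # qs') (p @ rev q)"
    using walk_split[of p ps' G b qs' "rev q"] w1 w2 walk_length[OF w1] by simp
  have d1: "distinct (ps' @ [b])" using assms(1) ps by (simp add: path_between_def)
  have d2: "distinct (b # qs')" using q' qs by (simp add: path_between_def)
  have psn: "ps' \<noteq> []" using assms(1,3) ps by (auto simp: path_between_def)
  then obtain ps'' where ps'': "ps' = a # ps''" using assms(1) ps
    by (cases ps') (auto simp: path_between_def)
  have qn: "qs' \<noteq> []" using q' qs assms(3) by (auto simp: path_between_def)
  have lq: "last qs' = a" using q' qs qn by (auto simp: path_between_def)
  have "p \<noteq> []" using walk_length[OF w1] psn by auto
  have "distinct p" "distinct q"
    using path_distinct_edges assms by (auto simp: path_between_def)
  moreover have "distinct (ps'' @ b # qs')"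
    using d1 d2 ps'' assms(4) ps qs_set by auto
  ultimately show ?thesis unfolding is_cycle_def
    using w ps'' qn lq \<open>p \<noteq> []\<close> assms(5)
    by (intro exI[of _ "ps' @ b # qs'"] exI[of _ "p @ rev q"]) auto
qed

lemma cycle_remove_edge:
  assumes "is_cycle G C" "e \<in> C" "ends G e = {a, b}" "a \<noteq> b"
  obtains qs q where "path_between G a b qs q" "set q = C - {e}" "set qs = \<Union>(ends G ` C)"
proof -
  have V: "a \<in> \<Union>(ends G ` C)" "b \<in> \<Union>(ends G ` C)" using assms by auto
  obtain p q ps qs where s: "path_between G a b ps p" "path_between G a b qs q"
    "set ps \<inter> set qs = {a, b}" "set p \<inter> set q = {}" "C = set p \<union> set q"
    "set ps \<union> set qs = \<Union>(ends G ` C)"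
    using cycle_split[OF assms(1) V assms(4)] by metis
  have *: thesis if "e \<in> set p" "path_between G a b ps p" "path_between G a b qs q"
    "set ps \<inter> set qs = {a, b}" "set p \<inter> set q = {}" "C = set p \<union> set q"
    "set ps \<union> set qs = \<Union>(ends G ` C)" for p q ps qs
  proof -
    have p: "p = [e]" using path_edge_ends[OF that(2,1) assms(3)] .
    have "set ps = {a, b}" using that(2) p assms(3)
      by (metis assms(2) image_insert list.set(1,2) neq_Nil_conv path_between_def walk_verts_ends Union_insert Union_empty image_empty Un_empty_right list.distinct(1))
    then have "set qs = \<Union>(ends G ` C)" using that(4,7) by auto
    moreover have "set q = C - {e}" using that p by auto
    ultimately show thesis using \<open>path_between G a b qs q\<close>
      using \<open>\<And>qs q. path_between G a b qs q \<Longrightarrow> set q = C - {e} \<Longrightarrow> set qs = \<Union>(ends G ` C) \<Longrightarrow> thesis\<close> by blast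
  qed
  from assms s(5) consider "e \<in> set p" | "e \<in> set q" by auto
  then show thesis
    by cases (use *[of p ps qs q] *[of q qs ps p] s in \<open>auto simp: Int_commute Un_commute\<close>)
qed

lemma cycle_edge_path:
  assumes "path_between G a b ps p" "e \<in> edges G" "ends G e = {a, b}" "e \<notin> set p"
    "a \<in> verts G" "b \<in> verts G"
  shows "is_cycle G (insert e (set p))"
proof (cases "a = b")
  case True
  have "p = []"
  proof -
    have "hd ps = last ps" "distinct ps" "length ps = Suc (length p)"
      using assms True by (auto simp: path_between_def walk_def)
    then show ?thesis by (cases ps; cases p) (auto split: if_splits)
  qed
  have "walk G [a, a] [e]" using assms True by (auto simp: walk_Cons2 walk_single)
  then have "is_cycle G (set [e])" unfolding is_cycle_def
    by (intro exI[of _ "[a, a]"] exI[of _ "[e]"]) auto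
  then show ?thesis using \<open>p = []\<close> by simp
next
  case False
  have "walk G [a, b] [e]" using assms by (auto simp: walk_Cons2 walk_single)
  then have e: "path_between G a b [a, b] [e]" using False by (auto simp: path_between_def)
  have "a \<in> set ps" "b \<in> set ps" using assms(1)
    path_ends_in[of G a b ps p] by simp_all
  then show ?thesis using cycle_join[OF e assms(1) False] assms(4) by auto
qed

section \<open>Balanced edge sets\<close>

locale bgraph =
  fixes G :: "('v, 'e) mgraph" and \<B> :: "'e set set"
  assumes bg: "biased_graph G \<B>"
begin

lemma wf: "wf_mgraph G"
  using bg by (simp add: biased_graph_def)

lemma finite_edges: "finite (edges G)"
  using wf by (simp add: wf_mgraph_def)

lemma edge_endsE:
  assumes "e \<in> edges G"
  obtains a b where "ends G e = {a, b}" "a \<in> verts G" "b \<in> verts G"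
  using wf assms unfolding wf_mgraph_def by metis

text \<open>Since cycles are edge sets, balance can be stated for edge sets of the one graph
  \<open>G\<close>; subgraph records are needed only where the output and \<open>H\<close> are
  treated.\<close>

definition bal :: "'e set \<Rightarrow> bool" where
  "bal E \<longleftrightarrow> (\<forall>C. is_cycle G C \<longrightarrow> C \<subseteq> E \<longrightarrow> C \<in> \<B>)"

lemma bal_mono: "bal E \<Longrightarrow> E' \<subseteq> E \<Longrightarrow> bal E'"
  by (auto simp: bal_def)

lemma theta_balanced:
  assumes "path_between G a b ps p" "path_between G a b qs q" "path_between G a b rs r" "a \<noteq> b"
    "set ps \<inter> set qs = {a, b}" "set ps \<inter> set rs = {a, b}" "set qs \<inter> set rs = {a, b}"
    "set p \<inter> set q = {}" "set p \<inter> set r = {}" "set q \<inter> set r = {}"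
    "set p \<union> set q \<in> \<B>" "set p \<union> set r \<in> \<B>"
  shows "set q \<union> set r \<in> \<B>"
proof -
  have "theta G (set p) (set q) (set r)"
    unfolding theta_def using assms by blast
  then show ?thesis using bg assms by (auto simp: biased_graph_def)
qed

lemma reach_verts: "u \<in> reach G E v \<Longrightarrow> E \<subseteq> edges G \<Longrightarrow> v \<in> verts G \<Longrightarrow> u \<in> verts G"
  by (erule reach_closed) (use wf_ends[OF wf] in auto)

text \<open>
  An unbalanced cycle with as few edges outside \<open>E0\<close> as possible meets every component of \<open>E0\<close>
  in a single segment: otherwise a path of \<open>E0\<close> would split it into two cycles with fewer such
  edges, one of which is unbalanced.
\<close>

lemma min_unbalanced_cycle:
  assumes "E0 \<subseteq> E" "E \<subseteq> edges G" "\<not> bal E" "v \<in> verts G"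
  obtains C where "is_cycle G C" "C \<subseteq> E" "C \<notin> \<B>"
    "\<forall>a\<in>\<Union>(ends G ` C) \<inter> reach G E0 v. \<forall>b\<in>\<Union>(ends G ` C) \<inter> reach G E0 v. b \<in> reach G (C \<inter> E0) a"
proof -
  let ?P = "\<lambda>C. is_cycle G C \<and> C \<subseteq> E \<and> C \<notin> \<B>"
  obtain C0 where "?P C0" using assms(3) by (auto simp: bal_def)
  then obtain C where C: "?P C" and min: "\<And>C'. ?P C' \<Longrightarrow> card (C - E0) \<le> card (C' - E0)"
    using ex_has_least_nat[of ?P C0 "\<lambda>C. card (C - E0)"] by blast
  let ?V = "\<Union>(ends G ` C)" and ?A = "reach G E0 v"
  have finC: "finite C" using C cycle_ne by blast
  have False if bad: "a \<in> ?V" "b \<in> ?V" "a \<in> ?A" "b \<in> ?A" "b \<notin> reach G (C \<inter> E0) a" for a b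
  proof -
    \<comment> \<open>Among all paths in \<open>E0\<close> between two vertices of the cycle that
      \<open>C \<inter> E0\<close> does not connect, one with fewest edges is taken. An inner vertex
      on the cycle would give a shorter such path, so the path meets the cycle only in its
      ends.\<close>
    define Q where "Q a b vs es \<longleftrightarrow> a \<in> ?V \<and> b \<in> ?V \<and> a \<in> ?A \<and> b \<notin> reach G (C \<inter> E0) a \<and>
      path_between G a b vs es \<and> set es \<subseteq> E0" for a b vs es
    define R where "R n \<longleftrightarrow> (\<exists>a b vs es. Q a b vs es \<and> length es = n)" for n
    have "b \<in> reach G E0 a" using bad(3,4) reach_trans[OF _ reach_sym, of b G E0 v a] by simp
    moreover have "a \<in> verts G" "E0 \<subseteq> edges G" using reach_verts[OF bad(3)] assms by auto
    ultimately have "\<exists>vs es. path_between G a b vs es \<and> set es \<subseteq> E0"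
      using reach_path[of b G E0 a] wf by simp
    then have "\<exists>n. R n" using bad unfolding R_def Q_def by blast
    then have R: "R (LEAST n. R n)" by (rule LeastI_ex)
    then obtain x y vs es where Qx: "Q x y vs es" and l: "length es = (LEAST n. R n)"
      unfolding R_def by blast
    have mQ: "length es \<le> length es'" if "Q x' y' vs' es'" for x' y' vs' es'
    proof -
      have "R (length es')" using that unfolding R_def by blast
      then show ?thesis unfolding l by (rule Least_le)
    qed
    have Q: "x \<in> ?V" "y \<in> ?V" "x \<in> ?A" "y \<notin> reach G (C \<inter> E0) x"
      "path_between G x y vs es" "set es \<subseteq> E0" using Qx unfolding Q_def by simp_all
    have xy: "x \<noteq> y" using Q(4) reach_refl[of x G "C \<inter> E0"] by auto
    have int: "c = x \<or> c = y" if c: "c \<in> set vs" "c \<in> ?V" for c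
    proof (rule ccontr)
      assume n: "\<not> (c = x \<or> c = y)"
      have px: "path_between G x y vs es" using Q(5) .
      obtain vs1 es1 where p1: "path_between G x c vs1 es1" "set es1 \<subseteq> set es" "length es1 < length es"
        using path_takeE[OF px c(1)] n by metis
      have "c \<in> set (rev vs)" using c by simp
      then obtain vs2 es2 where p2: "path_between G y c vs2 es2" "set es2 \<subseteq> set (rev es)"
          "length es2 < length (rev es)"
        using path_takeE[OF path_rev[OF px]] n by metis
      have cA: "y \<in> ?A"
      proof -
        have "y \<in> reach G (set es) x" using path_reach[OF px] path_ends_in[OF px] by simp
        then have "y \<in> reach G E0 x" using reach_mono[OF Q(6)] by (rule rev_subsetD)
        then show ?thesis using Q(3) by (rule reach_trans)
      qed
      have "set es1 \<subseteq> E0" "set es2 \<subseteq> E0" using p1(2) p2(2) Q(6) by auto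
      then have "c \<in> reach G (C \<inter> E0) x" "c \<in> reach G (C \<inter> E0) y"
        using mQ[of x c vs1 es1] mQ[of y c vs2 es2] Q(1,2,3) p1 p2 c cA unfolding Q_def by auto
      then show False using Q(4) reach_trans[OF reach_sym, of c G "C \<inter> E0" y x] by simp
    qed
    have inC: "set es \<inter> C = {}"
    proof (rule ccontr)
      assume "set es \<inter> C \<noteq> {}"
      then obtain e where e: "e \<in> set es" "e \<in> C" by auto
      obtain S1 S2 p q where S: "x \<in> S1" "y \<in> S2" "S1 \<inter> S2 = {}" "S1 \<union> S2 = set vs"
        "ends G e = {p, q}" "p \<in> S1" "q \<in> S2"
        by (rule path_bridge[OF Q(5) e(1)])
      have "p \<in> ?V" "q \<in> ?V" using S(5) e(2) by auto
      then have "p = x" "q = y" using int[of p] int[of q] S by auto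
      then have "y \<in> reach G (C \<inter> E0) x"
        using reach_step[OF reach_refl, of e "C \<inter> E0" G x y] S(5) e Q(6) by auto
      then show False using Q(4) by simp
    qed
    obtain p q ps qs where s: "path_between G x y ps p" "path_between G x y qs q"
      "set ps \<inter> set qs = {x, y}" "set p \<inter> set q = {}" "C = set p \<union> set q"
      "set ps \<union> set qs = ?V"
      by (rule cycle_split[OF conjunct1[OF C] Q(1,2) xy])
    have xyv: "x \<in> set vs" "y \<in> set vs" "x \<in> set ps" "y \<in> set ps" "x \<in> set qs" "y \<in> set qs"
      using path_ends_in[OF Q(5)] path_ends_in[OF s(1)] path_ends_in[OF s(2)] by simp_all
    have "set vs \<inter> ?V \<subseteq> {x, y}" using int by blast
    then have i1: "set vs \<inter> set ps = {x, y}" "set vs \<inter> set qs = {x, y}"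
      using xyv unfolding s(6)[symmetric] by blast+
    have d1: "set es \<inter> set p = {}" "set es \<inter> set q = {}" using inC s by auto
    \<comment> \<open>Neither arc of the cycle lies in \<open>E0\<close>, so replacing either arc by
      the path lowers the number of edges outside \<open>E0\<close>. By minimality both new cycles
      are balanced, and the theta property transfers this to \<open>C\<close>.\<close>
    have nE: "\<not> set p \<subseteq> E0" "\<not> set q \<subseteq> E0"
    proof -
      have y: "y \<in> reach G (set p) x" "y \<in> reach G (set q) x"
        using path_reach[OF s(1)] path_reach[OF s(2)] xyv by simp_all
      show "\<not> set p \<subseteq> E0"
        using y(1) reach_mono[of "set p" "C \<inter> E0" G x] s(5) Q(4) by blast
      show "\<not> set q \<subseteq> E0"
        using y(2) reach_mono[of "set q" "C \<inter> E0" G x] s(5) Q(4) by blast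
    qed
    have px: "path_between G x y vs es" "set es \<subseteq> E0" using Q(5,6) by simp_all
    have cp: "is_cycle G (set es \<union> set p)" using cycle_join[OF px(1) s(1) xy i1(1) d1(1)] .
    have cq: "is_cycle G (set es \<union> set q)" using cycle_join[OF px(1) s(2) xy i1(2) d1(2)] .
    have lp: "card ((set es \<union> set p) - E0) < card (C - E0)"
      by (rule psubset_card_mono) (use finC s nE px in auto)
    have lq: "card ((set es \<union> set q) - E0) < card (C - E0)"
      by (rule psubset_card_mono) (use finC s nE px in auto)
    have sub: "set es \<union> set p \<subseteq> E" "set es \<union> set q \<subseteq> E" using C s(5) px(2) assms(1) by auto
    have "set es \<union> set p \<in> \<B>" using min[of "set es \<union> set p"] cp lp sub(1) by linarith
    moreover have "set es \<union> set q \<in> \<B>" using min[of "set es \<union> set q"] cq lq sub(2) by linarith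
    ultimately have "C \<in> \<B>"
      using theta_balanced[OF px(1) s(1) s(2) xy i1 s(3) d1 s(4)] s(5) by auto
    then show False using C by auto
  qed
  then show ?thesis using that[of C] C by blast
qed

text \<open>Take an unbalanced cycle from \<open>min_unbalanced_cycle\<close>, with the common edges
  as favoured set. It has an edge outside \<open>E2\<close> and an edge outside \<open>E1\<close>.
  Removing both leaves two arcs, each of which contains a vertex common to both sides. The common
  edges of the cycle join these two vertices, although they avoid both removed edges.\<close>

lemma bal_union:
  assumes b1: "bal E1" and b2: "bal E2" and sub: "E1 \<subseteq> edges G" "E2 \<subseteq> edges G"
    and v: "v \<in> verts G"
    and A: "\<Union>(ends G ` E1) \<inter> \<Union>(ends G ` E2) \<subseteq> reach G (E1 \<inter> E2) v"
  shows "bal (E1 \<union> E2)"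
proof (rule ccontr)
  assume nb: "\<not> bal (E1 \<union> E2)"
  have s1: "E1 \<inter> E2 \<subseteq> E1 \<union> E2" by auto
  obtain C where C: "is_cycle G C" "C \<subseteq> E1 \<union> E2" "C \<notin> \<B>" and
    seg: "\<forall>a\<in>\<Union>(ends G ` C) \<inter> reach G (E1 \<inter> E2) v. \<forall>b\<in>\<Union>(ends G ` C) \<inter> reach G (E1 \<inter> E2) v.
      b \<in> reach G (C \<inter> (E1 \<inter> E2)) a"
    by (rule min_unbalanced_cycle[OF s1 Un_least[OF sub] nb v])
  obtain e1 e2 where e: "e1 \<in> C" "e1 \<notin> E2" "e2 \<in> C" "e2 \<notin> E1"
    using C b1 b2 unfolding bal_def by blast
  then have e': "e1 \<in> E1" "e2 \<in> E2" using C by auto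
  let ?V1 = "\<Union>(ends G ` E1)" and ?V2 = "\<Union>(ends G ` E2)"
  have "e1 \<in> edges G" using e' sub by auto
  then obtain a b where ab: "ends G e1 = {a, b}" by (rule edge_endsE)
  show False
  proof (cases "a = b")
    case True
    then have "C = {e1}" using cycle_loop[OF C(1) e(1)] ab by auto
    then show False using e e' by auto
  next
    case False
    obtain qs q where q: "path_between G a b qs q" "set q = C - {e1}" "set qs = \<Union>(ends G ` C)"
      using cycle_remove_edge[OF C(1) e(1) ab False] by metis
    have "e2 \<in> set q" using q e e' by auto
    obtain S1 S2 x y where S: "a \<in> S1" "b \<in> S2" "S1 \<inter> S2 = {}" "S1 \<union> S2 = set qs"
      "ends G e2 = {x, y}" "x \<in> S1" "y \<in> S2"
      "\<And>c d. c \<in> S1 \<Longrightarrow> d \<in> S2 \<Longrightarrow> d \<notin> reach G (set q - {e2}) c"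
      "\<And>c. c \<in> S1 \<Longrightarrow> c \<in> reach G (set q - {e2}) a"
      "\<And>c. c \<in> S2 \<Longrightarrow> c \<in> reach G (set q - {e2}) b"
      by (rule path_bridge[OF q(1) \<open>e2 \<in> set q\<close>]) blast
    \<comment> \<open>A connection from an end of an \<open>E1\<close> edge to an end of an
      \<open>E2\<close> edge has to pass a vertex that is both, for away from such vertices it can
      use \<open>E1\<close> edges only.\<close>
    have sw: "\<exists>z \<in> reach G F c. z \<in> ?V1 \<inter> ?V2"
      if dr: "d \<in> reach G F c" and cV: "c \<in> ?V1" and dV: "d \<in> ?V2" and F: "F \<subseteq> E1 \<union> E2" for c d F
    proof (rule ccontr)
      assume no: "\<not> ?thesis"
      have "d \<in> reach G F c \<inter> ?V1"
      proof (rule reach_closed[OF dr])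
        show "c \<in> reach G F c \<inter> ?V1" using cV by (auto intro: reach_refl)
        fix f x y assume f: "f \<in> F" "ends G f = {x, y}" "x \<in> reach G F c \<inter> ?V1"
        then have y: "y \<in> reach G F c" using reach_step[of x G F c f y] by auto
        have "x \<notin> ?V2" using no f(3) by auto
        then have "f \<notin> E2" using f(2) by auto
        then have "f \<in> E1" using F f(1) by auto
        then show "y \<in> reach G F c \<inter> ?V1" using y f(2) by auto
      qed
      then show False using no dV dr by auto
    qed
    have Fs: "set q - {e2} \<subseteq> E1 \<union> E2" using q C by auto
    have xy: "x \<in> reach G (set q - {e2}) a" "y \<in> reach G (set q - {e2}) b" using S(6,7,9,10) by auto
    have V: "a \<in> ?V1" "b \<in> ?V1" "x \<in> ?V2" "y \<in> ?V2" using ab e' S(5) by auto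
    obtain z1 where z1: "z1 \<in> reach G (set q - {e2}) a" "z1 \<in> ?V1 \<inter> ?V2"
      using sw[OF xy(1) V(1,3) Fs] by auto
    obtain z2 where z2: "z2 \<in> reach G (set q - {e2}) b" "z2 \<in> ?V1 \<inter> ?V2"
      using sw[OF xy(2) V(2,4) Fs] by auto
    note z = z1 z2
    have rV: "c \<in> set qs" if "c \<in> reach G (set q - {e2}) d" "d \<in> set qs" for c d
    proof (rule reach_closed[OF that])
      fix f x y assume "f \<in> set q - {e2}" "ends G f = {x, y}"
      then have "ends G f \<subseteq> set qs" using q(1) walk_verts_subset[of G qs q f] by (simp add: path_between_def)
      then show "y \<in> set qs" using \<open>ends G f = {x, y}\<close> by simp
    qed
    have aq: "a \<in> set qs" "b \<in> set qs" using S(1,2,4) by auto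
    have z1S: "z1 \<in> S1" using rV[OF z(1) aq(1)] S(8)[OF S(1)] S(4) z(1) by auto
    have z2S: "z2 \<in> S2" using rV[OF z(3) aq(2)] S(8)[OF _ S(2), of z2] S(4) reach_sym[OF z(3)] by auto
    have "z2 \<in> reach G (C \<inter> (E1 \<inter> E2)) z1"
      by (rule bspec[OF bspec[OF seg]]) (use z A z1S z2S S(4) q(3) in auto)
    moreover have "C \<inter> (E1 \<inter> E2) \<subseteq> set q - {e2}" using q e by auto
    ultimately have "z2 \<in> reach G (set q - {e2}) z1"
      using reach_mono[of "C \<inter> (E1 \<inter> E2)" "set q - {e2}" G z1] by auto
    then show False using S(8)[OF z1S z2S] by simp
  qed
qed

text \<open>A cycle through \<open>f\<close> would contain a second connection from \<open>a\<close>
  to \<open>b\<close>, but the edges of \<open>E\<close> do not leave \<open>S\<close>. By this,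
  maximal balanced sets turn out to be as connected as the graph permits.\<close>

lemma bal_bridge:
  assumes "bal E" "f \<in> edges G" "ends G f = {a, b}" "a \<in> S" "b \<notin> S"
    and cl: "\<And>e x y. e \<in> E \<Longrightarrow> ends G e = {x, y} \<Longrightarrow> x \<in> S \<Longrightarrow> y \<in> S"
  shows "bal (insert f E)"
  unfolding bal_def
proof (intro allI impI)
  fix C assume C: "is_cycle G C" "C \<subseteq> insert f E"
  show "C \<in> \<B>"
  proof (cases "f \<in> C")
    case False then show ?thesis using C assms(1) by (auto simp: bal_def)
  next
    case True
    have "a \<noteq> b" using assms by auto
    obtain qs q where q: "path_between G a b qs q" "set q = C - {f}"
      using cycle_remove_edge[OF C(1) True assms(3) \<open>a \<noteq> b\<close>] by metis
    have "b \<in> set qs" using q path_ends_in[of G a b qs q] by simp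
    then have "b \<in> reach G (set q) a" using path_reach[OF q(1)] by auto
    then have "b \<in> S" by (rule reach_closed) (use assms q C in auto)
    then show ?thesis using assms by simp
  qed
qed

section \<open>Rooted trees\<close>

text \<open>
  A tree is given by the set \<open>P u\<close> of edges on the path from the root to \<open>u\<close>, for each of its
  vertices \<open>u\<close>.  Symmetric differences telescope along walks, so \<open>sdiff (P a) (P b)\<close> is the edge
  set of the path between \<open>a\<close> and \<open>b\<close>.
\<close>

definition sdiff :: "'e set \<Rightarrow> 'e set \<Rightarrow> 'e set" where
  "sdiff A B = (A - B) \<union> (B - A)"

lemma sdiff_commute: "sdiff A B = sdiff B A"
  by (auto simp: sdiff_def)

text \<open>The condition \<open>sdiff (P a) (P b) = {e}\<close> expresses that one end of
  \<open>e\<close> is the parent of the other without saying which; that \<open>T\<close> has no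
  cycle is implicit in the labels \<open>P\<close>.\<close>

definition tree_ok :: "'v \<Rightarrow> ('v \<Rightarrow> 'e set) \<Rightarrow> 'v set \<Rightarrow> 'e set \<Rightarrow> bool" where
  "tree_ok v P X T \<longleftrightarrow> v \<in> X \<and> v \<in> verts G \<and> P v = {} \<and> T \<subseteq> edges G \<and>
     (\<forall>e\<in>T. \<exists>a\<in>X. \<exists>b\<in>X. ends G e = {a, b} \<and> sdiff (P a) (P b) = {e}) \<and>
     (\<forall>u\<in>X. P u \<subseteq> T \<and> u \<in> reach G (P u) v)"

lemma tree_ok_ends: "tree_ok v P X T \<Longrightarrow> e \<in> T \<Longrightarrow> ends G e \<subseteq> X"
  by (auto simp: tree_ok_def)

lemma tree_ok_sdiff:
  assumes "tree_ok v P X T" "e \<in> T" "ends G e = {a, b}"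
  shows "sdiff (P a) (P b) = {e}"
proof -
  obtain x y where xy: "ends G e = {x, y}" "sdiff (P x) (P y) = {e}"
    using assms(1,2) unfolding tree_ok_def by blast
  then consider "x = a" "y = b" | "x = b" "y = a" using assms(3) by (auto simp: doubleton_eq_iff)
  then show ?thesis using xy(2) sdiff_commute[of "P b" "P a"] by cases auto
qed

lemma tree_ok_reach:
  assumes t: "tree_ok v P X T" shows "reach G T v = X"
proof
  show "X \<subseteq> reach G T v"
  proof
    fix x assume "x \<in> X"
    then have "P x \<subseteq> T" "x \<in> reach G (P x) v" using t by (auto simp: tree_ok_def)
    then show "x \<in> reach G T v" using reach_mono[of "P x" T G v] by auto
  qed
  show "reach G T v \<subseteq> X"
  proof
    fix u assume "u \<in> reach G T v"
    then show "u \<in> X"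
    proof (rule reach_closed)
      show "v \<in> X" using t by (simp add: tree_ok_def)
      show "b \<in> X" if "e \<in> T" "ends G e = {a, b}" for e a b
        using tree_ok_ends[OF t that(1)] that(2) by simp
    qed
  qed
qed

lemma tree_ok_verts: "tree_ok v P X T \<Longrightarrow> X \<subseteq> verts G"
  using tree_ok_reach[of v P X T] reach_verts[of _ T v] by (auto simp: tree_ok_def)

lemma tree_ok_single: "v \<in> verts G \<Longrightarrow> P v = {} \<Longrightarrow> tree_ok v P {v} {}"
  by (auto simp: tree_ok_def intro: reach_refl)

lemma tree_ok_extend:
  assumes t: "tree_ok v P X T" and e: "e \<in> edges G" "ends G e = {a, b}" "a \<in> X" "b \<notin> X"
    and P': "\<And>u. u \<in> X \<Longrightarrow> P' u = P u" "P' b = insert e (P a)"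
  shows "tree_ok v P' (insert b X) (insert e T)"
proof -
  have eT: "e \<notin> T" using tree_ok_ends[OF t] e by auto
  have 1: "\<exists>a\<in>insert b X. \<exists>c\<in>insert b X. ends G f = {a, c} \<and> sdiff (P' a) (P' c) = {f}"
    if "f \<in> insert e T" for f
  proof (cases "f = e")
    case True
    have "e \<notin> P a" using eT t e by (auto simp: tree_ok_def)
    then have "sdiff (P' a) (P' b) = {e}" using P' e by (auto simp: sdiff_def)
    then show ?thesis using True e by (intro bexI[of _ a] bexI[of _ b]) auto
  next
    case False
    then have "\<exists>a\<in>X. \<exists>b\<in>X. ends G f = {a, b} \<and> sdiff (P a) (P b) = {f}"
      using t that unfolding tree_ok_def by blast
    then obtain x y where "x \<in> X" "y \<in> X" "ends G f = {x, y}" "sdiff (P x) (P y) = {f}"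
      by (elim bexE conjE)
    then show ?thesis using P'(1) by (intro bexI[of _ x] bexI[of _ y]) auto
  qed
  have 2: "P' u \<subseteq> insert e T \<and> u \<in> reach G (P' u) v" if "u \<in> insert b X" for u
  proof (cases "u = b")
    case True
    have "a \<in> reach G (P a) v" using t e by (simp add: tree_ok_def)
    then have "a \<in> reach G (insert e (P a)) v" using reach_mono[OF subset_insertI] by (rule rev_subsetD)
    then have "b \<in> reach G (insert e (P a)) v" using e by (auto intro: reach_step)
    then show ?thesis using True P' t e by (auto simp: tree_ok_def)
  next
    case False
    then show ?thesis using that t P'(1) by (auto simp: tree_ok_def)
  qed
  have "v \<in> X" "v \<in> verts G" "P v = {}" "T \<subseteq> edges G" using t by (auto simp: tree_ok_def)
  then show ?thesis unfolding tree_ok_def using 1 2 e P' by (intro conjI ballI) auto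
qed

lemma tree_path_sdiff:
  assumes t: "tree_ok v P X T" and p: "path_between G a b vs es" "set es \<subseteq> T"
  shows "set es = sdiff (P a) (P b)"
proof -
  have "walk G vs es \<Longrightarrow> distinct vs \<Longrightarrow> set es \<subseteq> T \<Longrightarrow>
      set es = sdiff (P (hd vs)) (P (last vs))" for vs es
  proof (induction es arbitrary: vs)
    case Nil
    then show ?case by (cases vs) (auto simp: walk_def sdiff_def)
  next
    case (Cons e es)
    then obtain x y ws where vs: "vs = x # y # ws"
      by (cases vs; cases "tl vs") (auto simp: walk_def)
    have w: "walk G (y # ws) es" "ends G e = {x, y}" using Cons.prems vs by (auto simp: walk_Cons2)
    have IH: "set es = sdiff (P y) (P (last vs))" using Cons.IH[OF w(1)] Cons.prems vs by auto
    have 1: "sdiff (P x) (P y) = {e}" using tree_ok_sdiff[OF t _ w(2)] Cons.prems by auto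
    have 2: "e \<notin> set es" using path_distinct_edges[OF Cons.prems(1,2)] by simp
    have "insert e (set es) = sdiff (P x) (P (last vs))"
      using 1 2 IH unfolding sdiff_def set_eq_iff by (simp only: Un_iff Diff_iff insert_iff empty_iff) metis
    then show ?case by (simp add: vs)
  qed
  then show ?thesis using p by (auto simp: path_between_def)
qed

text \<open>The set \<open>insert e (sdiff (P a) (P b))\<close> is the fundamental cycle of
  \<open>e\<close>, so a single query decides the second alternative. The first alternative covers
  the tree edges, which have no fundamental cycle.\<close>

definition cons_edge :: "('v \<Rightarrow> 'e set) \<Rightarrow> 'e \<Rightarrow> 'v \<Rightarrow> 'v \<Rightarrow> bool" where
  "cons_edge P e a b \<longleftrightarrow> e \<in> sdiff (P a) (P b) \<or> insert e (sdiff (P a) (P b)) \<in> \<B>"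

lemma cons_edge_commute: "cons_edge P e a b = cons_edge P e b a"
  by (simp add: cons_edge_def sdiff_commute)

text \<open>The fundamental cycle lies in the two root paths together with \<open>e\<close>. Hence
  balance of any \<open>E\<close> containing these suffices, and the rest of the tree may lie
  outside of \<open>E\<close>.\<close>

lemma bal_cons_edge:
  assumes t: "tree_ok v P X T" and "bal E" "P a \<subseteq> E" "P b \<subseteq> E" "e \<in> E" "e \<in> edges G"
    and ab: "ends G e = {a, b}" "a \<in> X" "b \<in> X"
  shows "cons_edge P e a b"
proof (cases "e \<in> T")
  case True
  then show ?thesis using tree_ok_sdiff[OF t True ab(1)] by (auto simp: cons_edge_def)
next
  case False
  let ?R = "P a \<union> P b"
  have R: "?R \<subseteq> T" "T \<subseteq> edges G" using t ab by (auto simp: tree_ok_def)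
  have "a \<in> reach G (P a) v" "b \<in> reach G (P b) v" using t ab by (simp_all add: tree_ok_def)
  then have "a \<in> reach G ?R v" "b \<in> reach G ?R v"
    using reach_mono[of "P a" ?R G v] reach_mono[of "P b" ?R G v] by auto
  then have "b \<in> reach G ?R a" using reach_trans[OF _ reach_sym, of b G ?R v a] by simp
  moreover have "a \<in> verts G" "b \<in> verts G" using tree_ok_verts[OF t] ab by auto
  ultimately have "\<exists>vs es. path_between G a b vs es \<and> set es \<subseteq> ?R"
    using reach_path[of b G ?R a] wf subset_trans[OF R] by simp
  then obtain vs es where p: "path_between G a b vs es" "set es \<subseteq> ?R" by (elim exE conjE)
  have s: "set es = sdiff (P a) (P b)" using tree_path_sdiff[OF t p(1)] p R by auto
  have "e \<notin> set es" using p R False by auto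
  then have "is_cycle G (insert e (set es))"
    using cycle_edge_path[OF p(1) \<open>e \<in> edges G\<close> ab(1)] \<open>a \<in> verts G\<close> \<open>b \<in> verts G\<close> by simp
  moreover have "insert e (set es) \<subseteq> E" using p(2) assms(3-5) by (meson Un_least insert_subsetI subset_trans)
  ultimately have "insert e (set es) \<in> \<B>" using assms(2) by (simp add: bal_def)
  then show ?thesis using s by (simp add: cons_edge_def)
qed

text \<open>The tree spans \<open>X\<close>, so the segment property of a minimal unbalanced cycle,
  with \<open>T\<close> as favoured set, says that the vertices of the cycle are joined by its own
  tree edges. It therefore has exactly one edge outside \<open>T\<close> and is a fundamental cycle.
  A cycle inside \<open>T\<close> is excluded separately, by the labels.\<close>

lemma cons_bal:
  assumes t: "tree_ok v P X T" and E: "E \<subseteq> edges G"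
    and c: "\<And>e a b. e \<in> E \<Longrightarrow> ends G e = {a, b} \<Longrightarrow> a \<in> X \<and> b \<in> X \<and> cons_edge P e a b"
  shows "bal (E \<union> T)"
proof (rule ccontr)
  assume nb: "\<not> bal (E \<union> T)"
  have T: "T \<subseteq> edges G" "v \<in> verts G" using t by (auto simp: tree_ok_def)
  have s1: "T \<subseteq> E \<union> T" "E \<union> T \<subseteq> edges G" using E T by auto
  obtain C where C: "is_cycle G C" "C \<subseteq> E \<union> T" "C \<notin> \<B>" and
    seg: "\<forall>a\<in>\<Union>(ends G ` C) \<inter> reach G T v. \<forall>b\<in>\<Union>(ends G ` C) \<inter> reach G T v.
      b \<in> reach G (C \<inter> T) a"
    by (rule min_unbalanced_cycle[OF s1 nb T(2)])
  have ex: "\<exists>e\<in>C. e \<notin> T"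
  proof (rule ccontr)
    assume "\<not> ?thesis"
    then have CT: "C \<subseteq> T" by auto
    obtain e where e: "e \<in> C" using cycle_ne[OF C(1)] by auto
    then have "e \<in> edges G" using CT T by auto
    then obtain a b where ab: "ends G e = {a, b}" by (rule edge_endsE)
    have "sdiff (P a) (P b) = {e}" using tree_ok_sdiff[OF t _ ab] e CT by auto
    then have "a \<noteq> b" by (auto simp: sdiff_def)
    obtain qs q where q: "path_between G a b qs q" "set q = C - {e}"
      using cycle_remove_edge[OF C(1) e ab \<open>a \<noteq> b\<close>] by metis
    have "set q = {e}" using tree_path_sdiff[OF t q(1)] q CT \<open>sdiff (P a) (P b) = {e}\<close> by auto
    then show False using q by auto
  qed
  then obtain e where e: "e \<in> C" "e \<notin> T" by auto
  then have eE: "e \<in> E" using C by auto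
  then have "e \<in> edges G" using E by auto
  then obtain a b where ab: "ends G e = {a, b}" by (rule edge_endsE)
  have cab: "a \<in> X" "b \<in> X" "cons_edge P e a b" using c[OF eE ab] by auto
  have nes: "e \<notin> sdiff (P a) (P b)" using e t cab by (auto simp: tree_ok_def sdiff_def)
  show False
  proof (cases "a = b")
    case True
    then have "C = {e}" using cycle_loop[OF C(1) e(1)] ab by auto
    moreover have "sdiff (P a) (P b) = {}" using True by (auto simp: sdiff_def)
    ultimately show False using cab C nes by (auto simp: cons_edge_def)
  next
    case False
    obtain qs q where q: "path_between G a b qs q" "set q = C - {e}"
      using cycle_remove_edge[OF C(1) e(1) ab False] by metis
    have r: "b \<in> reach G (C \<inter> T) a"
      by (rule bspec[OF bspec[OF seg]]) (use e ab cab tree_ok_reach[OF t] in auto)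
    have "set q \<subseteq> T"
    proof (rule ccontr)
      assume "\<not> ?thesis"
      then obtain f where f: "f \<in> set q" "f \<notin> T" by auto
      then have "C \<inter> T \<subseteq> set q - {f}" using q e by auto
      then have "b \<in> reach G (set q - {f}) a" using r reach_mono[of "C \<inter> T" "set q - {f}" G a] by auto
      then show False using path_bridge[OF q(1) f(1)] by metis
    qed
    then have "set q = sdiff (P a) (P b)" using tree_path_sdiff[OF t q(1)] by auto
    then have "C = insert e (sdiff (P a) (P b))" using q e by auto
    then show False using cab nes C by (auto simp: cons_edge_def)
  qed
qed

end

section \<open>Uncrossing\<close>

context bgraph
begin

lemma edge_ends_ex: "e \<in> edges G \<Longrightarrow> \<exists>a b. ends G e = {a, b}"
  by (erule edge_endsE) auto

text \<open>With \<open>X\<close> the vertices and \<open>E\<close> the edges of a subgraph, the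
  touching edges outside \<open>E\<close> are its boundary edges and its missing inner edges, so the
  sum of \<open>ct\<close> over all edges is the cost.\<close>

definition ct :: "'v set \<Rightarrow> 'e set \<Rightarrow> 'e \<Rightarrow> nat" where
  "ct X E e = (if ends G e \<inter> X \<noteq> {} \<and> e \<notin> E then 1 else 0)"

text \<open>
  The half-integral relaxation of the cost, scaled by two: boundary edges count once, missing inner
  edges twice.
\<close>

definition wt :: "'v set \<Rightarrow> 'e set \<Rightarrow> 'e \<Rightarrow> nat" where
  "wt X E e = (if ends G e \<subseteq> X then (if e \<in> E then 0 else 2)
     else if ends G e \<inter> X \<noteq> {} then 1 else 0)"

definition csum :: "'e set \<Rightarrow> 'v set \<Rightarrow> 'e set \<Rightarrow> nat" where
  "csum U X E = (\<Sum>e\<in>U. ct X E e)"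

definition wsum :: "'e set \<Rightarrow> 'v set \<Rightarrow> 'e set \<Rightarrow> nat" where
  "wsum U X E = (\<Sum>e\<in>U. wt X E e)"

text \<open>Here \<open>U\<close> holds the edges not yet deleted and \<open>T\<close> those already
  absorbed; a feasible set is a balanced extension of \<open>T\<close> that consists of the root
  component only.\<close>

definition feas :: "'v \<Rightarrow> 'e set \<Rightarrow> 'e set \<Rightarrow> 'e set \<Rightarrow> bool" where
  "feas v U T E \<longleftrightarrow> T \<subseteq> E \<and> E \<subseteq> U \<and> bal E \<and> (\<forall>e\<in>E. ends G e \<subseteq> reach G E v)"

text \<open>A predicate in the bound \<open>p\<close> instead of the minimum itself: the solver
  answers exactly this question for a given \<open>p\<close>, and the minimum is recovered by
  \<open>LEAST\<close> where it is needed.\<close>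

definition lam :: "'v \<Rightarrow> 'e set \<Rightarrow> 'e set \<Rightarrow> nat \<Rightarrow> bool" where
  "lam v U T p \<longleftrightarrow> (\<exists>E. feas v U T E \<and> wsum U (reach G E v) E \<le> p)"

lemma lam_mono: "lam v U T p \<Longrightarrow> p \<le> q \<Longrightarrow> T' \<subseteq> T \<Longrightarrow> lam v U T' q"
  unfolding lam_def feas_def by (meson le_trans subset_trans)

lemma wsum_le_csum:
  assumes "\<And>e. e \<in> E \<Longrightarrow> ends G e \<subseteq> X" "U \<subseteq> edges G"
  shows "wsum U X E \<le> 2 * csum U X E"
proof -
  have "wt X E e \<le> 2 * ct X E e" if e: "e \<in> U" for e
  proof -
    obtain a b where "ends G e = {a, b}" using edge_ends_ex[of e] e assms(2) by auto
    then show ?thesis using assms(1)[of e] by (auto simp: wt_def ct_def)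
  qed
  then show ?thesis unfolding wsum_def csum_def sum_distrib_left by (intro sum_mono) auto
qed

lemma reach_inside: "reach G (E \<inter> {e. ends G e \<subseteq> reach G E v}) v = reach G E v"
proof
  let ?E = "E \<inter> {e. ends G e \<subseteq> reach G E v}"
  show "reach G ?E v \<subseteq> reach G E v" by (rule reach_mono) auto
  show "reach G E v \<subseteq> reach G ?E v"
  proof
    fix u assume "u \<in> reach G E v"
    then have "u \<in> reach G E v \<inter> reach G ?E v"
    proof (rule reach_closed)
      show "v \<in> reach G E v \<inter> reach G ?E v" by (auto intro: reach_refl)
      fix e a b assume e: "e \<in> E" "ends G e = {a, b}" "a \<in> reach G E v \<inter> reach G ?E v"
      then have b: "b \<in> reach G E v" using reach_step[of a G E v e b] by auto
      then have "e \<in> ?E" using e by auto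
      then have "b \<in> reach G ?E v" using e(2,3) reach_step[of a G ?E v e b] by auto
      with b show "b \<in> reach G E v \<inter> reach G ?E v" by simp
    qed
    then show "u \<in> reach G ?E v" by simp
  qed
qed

text \<open>Candidates arising from uncrossing and from rounding need not be connected. Cutting down
  to the component of the root raises the weight of no edge, because no edge of \<open>E\<close>
  leaves this component.\<close>

lemma lam_component:
  assumes U: "U \<subseteq> edges G" and v: "v \<in> X" and E: "E \<subseteq> U" "bal E" "\<And>e. e \<in> E \<Longrightarrow> ends G e \<subseteq> X"
    and T: "T \<subseteq> E" "\<And>e. e \<in> T \<Longrightarrow> ends G e \<subseteq> reach G T v"
    and w: "wsum U X E \<le> p"
  shows "lam v U T p"
proof -
  let ?R = "reach G E v"
  let ?E = "E \<inter> {e. ends G e \<subseteq> ?R}"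
  have RX: "?R \<subseteq> X"
  proof
    fix u assume "u \<in> ?R"
    then show "u \<in> X" by (rule reach_closed) (use v E(3) in auto)
  qed
  have "ends G e \<subseteq> ?R" if "e \<in> T" for e
    using T(2)[OF that] reach_mono[OF T(1), of G v] by (rule subset_trans)
  then have "T \<subseteq> ?E" using T(1) by auto
  then have f: "feas v U T ?E"
    using E(1) bal_mono[OF E(2), of ?E] unfolding feas_def reach_inside by auto
  have "wt ?R ?E e \<le> wt X E e" if e: "e \<in> U" for e
  proof -
    obtain a b where ab: "ends G e = {a, b}" using edge_ends_ex[of e] e U by auto
    have "a \<in> ?R \<longleftrightarrow> b \<in> ?R" if "e \<in> E" using reach_endsI[OF that ab] .
    then show ?thesis using RX ab by (auto simp: wt_def)
  qed
  then have "wsum U ?R ?E \<le> wsum U X E" unfolding wsum_def by (rule sum_mono)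
  then show ?thesis using f w unfolding lam_def reach_inside
    by (intro exI[of _ ?E]) (simp add: reach_inside)
qed

text \<open>A balanced extension of \<open>E\<close> within \<open>Z\<close> with as many edges as
  possible is connected: an edge of \<open>F\<close> leaving the component of the root would be a
  bridge and could be added.\<close>

lemma bal_connect:
  assumes U: "U \<subseteq> edges G" and v: "v \<in> verts G" and E: "E \<subseteq> U" "bal E" "\<And>e. e \<in> E \<Longrightarrow> ends G e \<subseteq> Z"
    and F: "F \<subseteq> U" "\<And>e. e \<in> F \<Longrightarrow> ends G e \<subseteq> Z" "reach G F v = Z"
  obtains E' where "E \<subseteq> E'" "E' \<subseteq> U" "bal E'" "\<And>e. e \<in> E' \<Longrightarrow> ends G e \<subseteq> Z" "reach G E' v = Z"
proof -
  define P where "P E' \<longleftrightarrow> E \<subseteq> E' \<and> E' \<subseteq> U \<inter> {e. ends G e \<subseteq> Z} \<and> bal E'" for E'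
  have finU: "finite U" using U finite_edges finite_subset by blast
  have "P E" using E by (auto simp: P_def)
  moreover have "\<forall>E'. P E' \<longrightarrow> card E' < Suc (card U)"
  proof (intro allI impI)
    fix E' assume "P E'"
    then have "E' \<subseteq> U" by (simp add: P_def)
    then show "card E' < Suc (card U)" using card_mono[OF finU] by (simp add: less_Suc_eq_le)
  qed
  ultimately obtain E' where PE': "P E'" and mx: "\<forall>E''. P E'' \<longrightarrow> card E'' \<le> card E'"
    using ex_has_greatest_nat[of P E card "Suc (card U)"] by blast
  have E': "E \<subseteq> E'" "E' \<subseteq> U \<inter> {e. ends G e \<subseteq> Z}" "bal E'" using PE' by (simp_all add: P_def)
  have finE': "finite E'" using E' finU by (auto intro: finite_subset)
  have sub: "ends G e \<subseteq> Z" if "e \<in> E'" for e using that E' by auto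
  have vZ: "v \<in> Z" using reach_refl[of v G F] F(3) by simp
  have "Z \<subseteq> reach G E' v"
  proof
    fix u assume "u \<in> Z"
    then have u: "u \<in> reach G F v" using F(3) by simp
    show "u \<in> reach G E' v"
    proof (rule reach_closed[OF u])
      show "v \<in> reach G E' v" by (rule reach_refl)
      fix e a b assume e: "e \<in> F" "ends G e = {a, b}" "a \<in> reach G E' v"
      show "b \<in> reach G E' v"
      proof (rule ccontr)
        assume nb: "b \<notin> reach G E' v"
        have eG: "e \<in> edges G" using e(1) F(1) U by auto
        have "bal (insert e E')"
        proof (rule bal_bridge[OF _ eG e(2,3) nb])
          show "bal E'" by (rule E'(3))
          show "y \<in> reach G E' v" if "f \<in> E'" "ends G f = {x, y}" "x \<in> reach G E' v" for f x y
            using reach_step[OF that(3,1,2)] .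
        qed
        then have "P (insert e E')" using E' e(1) F(1,2) by (auto simp: P_def)
        then have "card (insert e E') \<le> card E'" using mx by simp
        moreover have "e \<notin> E'" using nb e(2,3) reach_step[of a G E' v e b] by auto
        ultimately show False using finE' by simp
      qed
    qed
  qed
  moreover have "reach G E' v \<subseteq> Z"
  proof
    fix u assume "u \<in> reach G E' v"
    then show "u \<in> Z" by (rule reach_closed) (use vZ sub in auto)
  qed
  ultimately have "reach G E' v = Z" by simp
  then show ?thesis using that[of E'] E' sub by auto
qed

text \<open>
  On the common vertices of \<open>X\<close> and \<open>Y\<close> that are not reached by common edges, the subgraph of
  minimum weight wins.
\<close>

lemma uncross:
  assumes U: "U \<subseteq> edges G" and v: "v \<in> verts G"
    and X: "feas v U T FX" and Y: "feas v U T' FY" and T: "T \<subseteq> T'"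
    and conT: "\<And>e. e \<in> T \<Longrightarrow> ends G e \<subseteq> reach G T v"
    and min: "\<And>p. lam v U T p \<Longrightarrow> wsum U (reach G FY v) FY \<le> p"
  obtains E where "feas v U T' E" "reach G FX v \<subseteq> reach G E v"
    "csum U (reach G E v) E \<le> csum U (reach G FX v) FX"
proof -
  let ?X = "reach G FX v" and ?Y = "reach G FY v" and ?A = "reach G (FX \<inter> FY) v"
  let ?D = "?X \<inter> ?Y - ?A"
  let ?FA = "FY \<inter> {e. ends G e \<subseteq> ?A}"
  let ?F = "FX \<inter> {e. ends G e \<subseteq> ?X - ?D}"
  let ?FZ = "FY \<union> ?F"
  let ?Z = "?X \<union> ?Y"
  have finU: "finite U" using U finite_edges finite_subset by blast
  have AX: "?A \<subseteq> ?X" by (rule reach_mono) auto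
  have AY: "?A \<subseteq> ?Y" by (rule reach_mono) auto
  have eX: "ends G e \<subseteq> ?X" if "e \<in> FX" for e using X that by (simp add: feas_def)
  have eY: "ends G e \<subseteq> ?Y" if "e \<in> FY" for e using Y that by (simp add: feas_def)
  have subU: "FX \<subseteq> U" "FY \<subseteq> U" "T \<subseteq> FX" "T' \<subseteq> FY" "bal FX" "bal FY" using X Y by (auto simp: feas_def)
  \<comment> \<open>Omitting the edges of \<open>FX\<close> at \<open>?D\<close> leaves
    \<open>?F\<close> and \<open>FY\<close> with common vertices in \<open>?A\<close> only, and
    there their common edges connect everything to the root.\<close>
  have balZ: "bal ?FZ"
  proof (rule bal_union[where v=v])
    show "bal FY" "bal ?F" using subU bal_mono[of FX ?F] by auto
    show "FY \<subseteq> edges G" "?F \<subseteq> edges G" "v \<in> verts G" using subU U v by auto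
    have "(FX \<inter> FY) \<inter> {e. ends G e \<subseteq> ?A} \<subseteq> FY \<inter> ?F" using AX AY by auto
    then have "?A \<subseteq> reach G (FY \<inter> ?F) v"
      using reach_mono[of "(FX \<inter> FY) \<inter> {e. ends G e \<subseteq> ?A}" "FY \<inter> ?F" G v] by (simp add: reach_inside)
    moreover have "\<Union>(ends G ` FY) \<inter> \<Union>(ends G ` ?F) \<subseteq> ?A" using eY by auto
    ultimately show "\<Union>(ends G ` FY) \<inter> \<Union>(ends G ` ?F) \<subseteq> reach G (FY \<inter> ?F) v" by simp
  qed
  \<comment> \<open>The inequality holds edge by edge. The critical case is an edge of
    \<open>FX\<close> lost at \<open>?D\<close>: its count rises from 0 to 1, and this is paid by
    the weight, which is larger by at least one for \<open>?Y\<close> than for \<open>?A\<close>.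
    The remaining cases are settled by the membership facts 1 to 4.\<close>
  have ptw: "ct ?Z ?FZ e + wt ?A ?FA e \<le> ct ?X FX e + wt ?Y FY e" if e: "e \<in> U" for e
  proof -
    obtain a b where ab: "ends G e = {a, b}" using edge_ends_ex[of e] e U by auto
    have 1: "a \<in> ?A \<longleftrightarrow> b \<in> ?A" if "e \<in> FX" "e \<in> FY" using reach_endsI[OF _ ab, of "FX \<inter> FY"] that by auto
    have 2: "a \<in> ?X" "b \<in> ?X" if "e \<in> FX" using eX[OF that] ab by auto
    have 3: "a \<in> ?Y" "b \<in> ?Y" if "e \<in> FY" using eY[OF that] ab by auto
    have 4: "a \<in> ?A \<Longrightarrow> a \<in> ?X" "a \<in> ?A \<Longrightarrow> a \<in> ?Y" "b \<in> ?A \<Longrightarrow> b \<in> ?X" "b \<in> ?A \<Longrightarrow> b \<in> ?Y" using AX AY by auto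
    show ?thesis
      using 1 2 3 4 unfolding ct_def wt_def ab
      by (cases "e \<in> FX"; cases "e \<in> FY"; cases "a \<in> ?A"; cases "b \<in> ?A"; cases "a \<in> ?X"; cases "b \<in> ?X";
          cases "a \<in> ?Y"; cases "b \<in> ?Y") (simp_all add: ab)
  qed
  have "csum U ?Z ?FZ + wsum U ?A ?FA \<le> csum U ?X FX + wsum U ?Y FY"
    unfolding csum_def wsum_def sum.distrib[symmetric] by (intro sum_mono ptw)
  \<comment> \<open>The part on \<open>?A\<close> is itself a candidate extending \<open>T\<close>,
    so its weight is not below the minimum; the weights cancel and only the counts remain.\<close>
  moreover have "wsum U ?Y FY \<le> wsum U ?A ?FA"
  proof (rule min, rule lam_component[OF U])
    show "v \<in> ?A" by (rule reach_refl)
    have "reach G T v \<subseteq> ?A" by (rule reach_mono) (use subU T in auto)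
    then show "T \<subseteq> ?FA" using conT subU T by blast
  qed (use subU bal_mono[of FY ?FA] conT in auto)
  ultimately have c: "csum U ?Z ?FZ \<le> csum U ?X FX" by simp
  have rZ: "reach G (FX \<union> FY) v = ?Z"
  proof
    show "?Z \<subseteq> reach G (FX \<union> FY) v" by (intro Un_least reach_mono) auto
    show "reach G (FX \<union> FY) v \<subseteq> ?Z"
    proof
      fix u assume "u \<in> reach G (FX \<union> FY) v"
      then show "u \<in> ?Z"
      proof (rule reach_closed)
        show "v \<in> ?Z" by (auto intro: reach_refl)
        show "b \<in> ?Z" if "e \<in> FX \<union> FY" "ends G e = {a, b}" for e a b
          using that eX[of e] eY[of e] by auto
      qed
    qed
  qed
  obtain E' where E': "?FZ \<subseteq> E'" "E' \<subseteq> U" "bal E'" "\<And>e. e \<in> E' \<Longrightarrow> ends G e \<subseteq> ?Z" "reach G E' v = ?Z"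
  proof (rule bal_connect[OF U v, of ?FZ ?Z "FX \<union> FY"])
    show "?FZ \<subseteq> U" "bal ?FZ" "FX \<union> FY \<subseteq> U" "reach G (FX \<union> FY) v = ?Z" using subU balZ rZ by auto
    show "ends G e \<subseteq> ?Z" if "e \<in> ?FZ" for e using that eX eY by blast
    show "ends G e \<subseteq> ?Z" if "e \<in> FX \<union> FY" for e using that eX[of e] eY[of e] by auto
  qed blast
  have "csum U ?Z E' \<le> csum U ?Z ?FZ"
    unfolding csum_def by (intro sum_mono) (use E'(1) in \<open>auto simp: ct_def\<close>)
  then have "csum U (reach G E' v) E' \<le> csum U ?X FX" using c E'(5) by simp
  moreover have "feas v U T' E'" using E' subU unfolding feas_def by auto
  ultimately show ?thesis using that[of E'] E'(5) by auto
qed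

lemma csum_remove:
  assumes "finite U" "i \<in> U" "ends G i \<inter> X \<noteq> {}" "i \<notin> E"
  shows "csum U X E = Suc (csum (U - {i}) X E)"
  using assms by (simp add: csum_def sum.remove[of U i] ct_def)

lemma wsum_remove:
  assumes "finite U" "i \<in> U"
  shows "wsum U X E = wt X E i + wsum (U - {i}) X E"
  using assms by (simp add: wsum_def sum.remove[of U i])

end

section \<open>The branching procedure\<close>

type_synonym entry = "nat \<times> nat \<times> nat list \<times> nat list"

text \<open>
  An entry \<open>(u, d, L, P)\<close> records a vertex \<open>u\<close> of a rooted tree, the list \<open>P\<close> of edges on its path
  from the root, the part \<open>L\<close> of that path outside of the initial tree, and the length \<open>d\<close> of \<open>L\<close>.
\<close>

definition dom_of :: "entry list \<Rightarrow> nat set" where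
  "dom_of M = fst ` set M"

definition dst_of :: "entry list \<Rightarrow> nat \<Rightarrow> nat" where
  "dst_of M u = fst (the (map_of M u))"

definition lpth :: "entry list \<Rightarrow> nat \<Rightarrow> nat list" where
  "lpth M u = fst (snd (the (map_of M u)))"

definition pth :: "entry list \<Rightarrow> nat \<Rightarrow> nat list" where
  "pth M u = snd (snd (the (map_of M u)))"

definition tree_edges :: "entry list \<Rightarrow> nat set" where
  "tree_edges M = (\<Union>u\<in>dom_of M. set (pth M u))"

definition arcs :: "(nat \<times> nat) list \<Rightarrow> nat list \<Rightarrow> (nat \<times> nat \<times> nat) list" where
  "arcs ps ids = concat (map (\<lambda>i. [(i, fst (ps ! i), snd (ps ! i)), (i, snd (ps ! i), fst (ps ! i))]) ids)"

definition barcs :: "(nat \<times> nat) list \<Rightarrow> entry list \<Rightarrow> nat list \<Rightarrow> (nat \<times> nat \<times> nat) list" where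
  "barcs ps M ids = filter (\<lambda>(i, a, b). a \<in> dom_of M \<and> b \<notin> dom_of M) (arcs ps ids)"

text \<open>An absorbed vertex becomes part of the initial tree for the solver, hence the distance 0
  and the empty outer path.\<close>

definition ext :: "entry list \<Rightarrow> nat \<times> nat \<times> nat \<Rightarrow> entry list" where
  "ext M ar = (case ar of (i, a, b) \<Rightarrow> (b, 0, [], i # pth M a) # M)"

lemma dom_of_Cons [simp]: "dom_of ((u, r) # M) = insert u (dom_of M)"
  by (simp add: dom_of_def)

lemma dom_of_Nil [simp]: "dom_of [] = {}"
  by (simp add: dom_of_def)

lemma finite_dom_of [simp]: "finite (dom_of M)"
  by (simp add: dom_of_def)

locale rgraph = bgraph G \<B> for G :: "(nat, nat) mgraph" and \<B> +
  fixes N :: nat and ps :: "(nat \<times> nat) list"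
  assumes rep: "represents N ps G"
begin

lemma verts_eq: "verts G = {..<N}" and edges_eq: "edges G = {..<length ps}"
  and ends_eq: "i < length ps \<Longrightarrow> ends G i = {fst (ps ! i), snd (ps ! i)}"
  using rep by (auto simp: represents_def)

lemma set_arcs:
  "set ids \<subseteq> edges G \<Longrightarrow> (i, a, b) \<in> set (arcs ps ids) \<longleftrightarrow> i \<in> set ids \<and> ends G i = {a, b}"
proof -
  assume ids: "set ids \<subseteq> edges G"
  have *: "(i, a, b) \<in> set (arcs ps ids) \<longleftrightarrow> i \<in> set ids \<and>
      (fst (ps ! i) = a \<and> snd (ps ! i) = b \<or> fst (ps ! i) = b \<and> snd (ps ! i) = a)"
    unfolding arcs_def by (auto simp: prod_eq_iff)
  show ?thesis
  proof (cases "i \<in> set ids")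
    case True
    then have "ends G i = {fst (ps ! i), snd (ps ! i)}" using ids edges_eq by (intro ends_eq) auto
    then show ?thesis unfolding * by (simp add: doubleton_eq_iff)
  qed (simp add: *)
qed

lemma set_barcs:
  "set ids \<subseteq> edges G \<Longrightarrow> (i, a, b) \<in> set (barcs ps M ids) \<longleftrightarrow>
     i \<in> set ids \<and> ends G i = {a, b} \<and> a \<in> dom_of M \<and> b \<notin> dom_of M"
  by (auto simp: barcs_def set_arcs)

definition tree_inv :: "nat \<Rightarrow> entry list \<Rightarrow> bool" where
  "tree_inv v M \<longleftrightarrow> tree_ok v (\<lambda>u. set (pth M u)) (dom_of M) (tree_edges M)"

lemma tree_inv_single: "v \<in> verts G \<Longrightarrow> tree_inv v [(v, d, L, [])]"
  by (simp add: tree_inv_def tree_edges_def pth_def tree_ok_single)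

lemma tree_edges_Cons:
  assumes "b \<notin> dom_of M" "a \<in> dom_of M"
  shows "tree_edges ((b, d, L, i # pth M a) # M) = insert i (tree_edges M)"
proof -
  have "pth ((b, d, L, i # pth M a) # M) u = pth M u" if "u \<in> dom_of M" for u
    using that assms by (auto simp: pth_def)
  moreover have "pth ((b, d, L, i # pth M a) # M) b = i # pth M a" by (simp add: pth_def)
  ultimately show ?thesis using assms by (auto simp: tree_edges_def)
qed

lemma tree_inv_Cons:
  assumes "tree_inv v M" "i \<in> edges G" "ends G i = {a, b}" "a \<in> dom_of M" "b \<notin> dom_of M"
  shows "tree_inv v ((b, d, L, i # pth M a) # M)"
  unfolding tree_inv_def tree_edges_Cons[OF assms(5,4)] dom_of_Cons
  by (rule tree_ok_extend[OF assms(1)[unfolded tree_inv_def] assms(2-5)])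
    (use assms in \<open>auto simp: pth_def\<close>)

lemma tree_inv_reach: "tree_inv v M \<Longrightarrow> reach G (tree_edges M) v = dom_of M"
  unfolding tree_inv_def by (rule tree_ok_reach)

lemma tree_inv_ends: "tree_inv v M \<Longrightarrow> e \<in> tree_edges M \<Longrightarrow> ends G e \<subseteq> reach G (tree_edges M) v"
  using tree_inv_reach[of v M] by (auto simp: tree_inv_def dest: tree_ok_ends)

definition state_inv :: "nat \<Rightarrow> entry list \<Rightarrow> nat list \<Rightarrow> bool" where
  "state_inv v M ids \<longleftrightarrow> tree_inv v M \<and> tree_edges M \<subseteq> set ids \<and> set ids \<subseteq> edges G \<and> distinct ids \<and>
     (\<forall>(u, d, L, P)\<in>set M. d = 0 \<and> L = []) \<and> distinct (map fst M)"

text \<open>That absorption keeps the minimum is said through all bounds \<open>p\<close>. The range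
  up to \<open>2 * k\<close> is enough, since twice the cost sought already bounds the
  minimum.\<close>

definition absorbs :: "nat \<Rightarrow> nat \<Rightarrow> entry list \<Rightarrow> nat list \<Rightarrow> nat \<times> nat \<times> nat \<Rightarrow> bool" where
  "absorbs k v M ids ar \<longleftrightarrow> (\<forall>p\<le>2 * k. lam v (set ids) (tree_edges M) p \<longrightarrow>
     lam v (set ids) (insert (fst ar) (tree_edges M)) p)"

text \<open>States without boundary arcs, and states without coins in which no arc can be absorbed,
  are left unchanged; so a fixed number of iterations serves all runs.\<close>

definition bstep :: "nat \<Rightarrow> nat \<Rightarrow> entry list \<times> nat list \<times> bool list \<Rightarrow> entry list \<times> nat list \<times> bool list" where
  "bstep k v st = (case st of (M, ids, bits) \<Rightarrow>
     let bs = barcs ps M ids; gs = filter (absorbs k v M ids) bs in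
     if gs \<noteq> [] then (ext M (hd gs), ids, bits)
     else if bs \<noteq> [] \<and> bits \<noteq> [] then
       (if hd bits then (ext M (hd bs), ids, tl bits)
        else (M, filter (\<lambda>i. i \<noteq> fst (hd bs)) ids, tl bits))
     else (M, ids, bits))"

lemma state_inv_ext:
  assumes "state_inv v M ids" "(i, a, b) \<in> set (barcs ps M ids)"
  shows "state_inv v (ext M (i, a, b)) ids" "tree_edges (ext M (i, a, b)) = insert i (tree_edges M)"
    "dom_of (ext M (i, a, b)) = insert b (dom_of M)"
proof -
  have b: "i \<in> set ids" "ends G i = {a, b}" "a \<in> dom_of M" "b \<notin> dom_of M"
    using assms set_barcs by (auto simp: state_inv_def)
  show te: "tree_edges (ext M (i, a, b)) = insert i (tree_edges M)"
    using tree_edges_Cons[OF b(4,3)] by (simp add: ext_def)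
  show "dom_of (ext M (i, a, b)) = insert b (dom_of M)" by (simp add: ext_def)
  have "i \<in> edges G" using b(1) assms(1) by (auto simp: state_inv_def)
  then have "tree_inv v (ext M (i, a, b))"
    using tree_inv_Cons[of v M i a b] b assms(1) by (simp add: ext_def state_inv_def)
  then show "state_inv v (ext M (i, a, b)) ids"
    using assms(1) b te by (auto simp: state_inv_def ext_def dom_of_def)
qed

lemma state_inv_delete:
  assumes "state_inv v M ids" "(i, a, b) \<in> set (barcs ps M ids)"
  shows "state_inv v M (filter (\<lambda>j. j \<noteq> i) ids)"
proof -
  have b: "ends G i = {a, b}" "b \<notin> dom_of M"
    using assms set_barcs by (auto simp: state_inv_def)
  have "i \<notin> tree_edges M" using assms(1) b tree_inv_ends[of v M i] tree_inv_reach[of v M]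
    by (auto simp: state_inv_def)
  then show ?thesis using assms(1) by (auto simp: state_inv_def)
qed

lemma state_inv_bstep:
  assumes "state_inv v M ids"
  shows "case bstep k v (M, ids, bits) of (M', ids', _) \<Rightarrow> state_inv v M' ids'"
proof -
  let ?bs = "barcs ps M ids" and ?gs = "filter (absorbs k v M ids) (barcs ps M ids)"
  obtain i a b where g: "hd ?gs = (i, a, b)" by (cases "hd ?gs") auto
  obtain i' a' b' where h: "hd ?bs = (i', a', b')" by (cases "hd ?bs") auto
  have "(i, a, b) \<in> set ?bs" if "?gs \<noteq> []" using hd_in_set[OF that] g by simp
  moreover have "(i', a', b') \<in> set ?bs" if "?bs \<noteq> []" using hd_in_set[OF that] h by simp
  ultimately show ?thesis
    using assms state_inv_ext(1)[OF assms] state_inv_delete[OF assms] g h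
    by (auto simp: bstep_def Let_def)
qed

lemma leaving_arc:
  assumes ids: "set ids \<subseteq> edges G" and E: "E \<subseteq> set ids" and v: "v \<in> dom_of M"
    and u: "u \<in> reach G E v" "u \<notin> dom_of M"
  obtains i a b where "(i, a, b) \<in> set (barcs ps M ids)" "i \<in> E"
proof -
  have "\<exists>i a b. i \<in> E \<and> ends G i = {a, b} \<and> a \<in> dom_of M \<and> b \<notin> dom_of M"
  proof (rule ccontr)
    assume no: "\<not> ?thesis"
    have "u \<in> dom_of M" by (rule reach_closed[OF u(1) v]) (use no in blast)
    then show False using u by simp
  qed
  then show ?thesis using that set_barcs[OF ids] E by blast
qed

text \<open>
  The budget \<open>b\<close> bounds twice the remaining cost \<open>r\<close> minus the minimum weight; both outcomes of a
  branching decrease it, and absorbing an edge keeps it.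
\<close>

lemma branching_covers:
  assumes "state_inv v M ids" "feas v (set ids) (tree_edges M) E"
    "csum (set ids) (reach G E v) E \<le> r" "r \<le> k"
    "\<And>p. lam v (set ids) (tree_edges M) p \<Longrightarrow> 2 * r \<le> p + b"
    "(N - card (dom_of M)) + length ids \<le> n"
  shows "\<exists>\<beta>. length \<beta> \<le> b \<and> (\<forall>\<gamma>. \<exists>M' ids' \<delta> E'.
    (bstep k v ^^ n) (M, ids, \<beta> @ \<gamma>) = (M', ids', \<delta>) \<and> state_inv v M' ids' \<and>
    barcs ps M' ids' = [] \<and> feas v (set ids') (tree_edges M') E' \<and> reach G E v \<subseteq> reach G E' v \<and>
    csum (set ids') (reach G E' v) E' + (length ids - length ids') \<le> r \<and> length ids' \<le> length ids)"
  using assms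
proof (induction n arbitrary: M ids E r b)
  case 0
  then have "ids = []" by simp
  then have "barcs ps M ids = []" by (simp add: barcs_def arcs_def)
  then show ?case using 0 by (intro exI[of _ "[]"]) auto
next
  case (Suc n)
  let ?U = "set ids" and ?T = "tree_edges M" and ?bs = "barcs ps M ids"
  let ?gs = "filter (absorbs k v M ids) ?bs"
  note inv = Suc.prems(1) and fE = Suc.prems(2) and cE = Suc.prems(3) and rk = Suc.prems(4)
    and pot = Suc.prems(5) and meas = Suc.prems(6)
  have U: "?U \<subseteq> edges G" and ti: "tree_inv v M" and dis: "distinct ids" and TU: "?T \<subseteq> ?U"
    using inv by (auto simp: state_inv_def)
  have vv: "v \<in> verts G" and vd: "v \<in> dom_of M" using ti by (auto simp: tree_inv_def tree_ok_def)
  have domN: "dom_of M \<subseteq> {..<N}" using ti tree_ok_verts verts_eq by (auto simp: tree_inv_def)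
  have conT: "\<And>e. e \<in> ?T \<Longrightarrow> ends G e \<subseteq> reach G ?T v" using tree_inv_ends[OF ti] .
  have TE: "?T \<subseteq> E" "E \<subseteq> ?U" using fE by (auto simp: feas_def)
  have domE: "dom_of M \<subseteq> reach G E v" using reach_mono[OF TE(1), of G v] tree_inv_reach[OF ti] by simp
  have endsE: "\<And>e. e \<in> E \<Longrightarrow> ends G e \<subseteq> reach G E v" using fE by (auto simp: feas_def)
  have w2: "wsum ?U (reach G E v) E \<le> 2 * r" using wsum_le_csum[of E "reach G E v" ?U, OF endsE U] cE by simp
  have lamM: "lam v ?U ?T (2 * r)" using fE w2 by (auto simp: lam_def)
  define p0 where "p0 = (LEAST p. lam v ?U ?T p)"
  have p0: "lam v ?U ?T p0" unfolding p0_def using lamM by (rule LeastI)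
  have p0_le: "p0 \<le> p" if "lam v ?U ?T p" for p unfolding p0_def using that by (rule Least_le)
  have p0r: "p0 \<le> 2 * r" using p0_le[OF lamM] .
  show ?case
  proof (cases "?bs = []")
    case True
    then have st: "bstep k v (M, ids, \<gamma>) = (M, ids, \<gamma>)" for \<gamma> by (simp add: bstep_def)
    have fp: "(bstep k v ^^ j) (M, ids, \<gamma>) = (M, ids, \<gamma>)" for j \<gamma> by (induction j) (simp_all add: st)
    have "length ([] :: bool list) \<le> b" by simp
    moreover have "(bstep k v ^^ Suc n) (M, ids, [] @ \<gamma>) = (M, ids, \<gamma>) \<and> state_inv v M ids \<and>
      ?bs = [] \<and> feas v ?U ?T E \<and> reach G E v \<subseteq> reach G E v \<and>
      csum ?U (reach G E v) E + (length ids - length ids) \<le> r \<and> length ids \<le> length ids" for \<gamma>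
      using True inv fE cE by (simp add: fp del: funpow.simps)
    ultimately show ?thesis by blast
  next
    case bs: False
    show ?thesis
    proof (cases "?gs = []")
      case False
      obtain i a b' where g: "hd ?gs = (i, a, b')" by (cases "hd ?gs") auto
      have "(i, a, b') \<in> set ?gs" using hd_in_set[OF False] g by simp
      then have ar: "(i, a, b') \<in> set ?bs" and ab: "absorbs k v M ids (i, a, b')" by auto
      note ie = state_inv_ext[OF inv ar]
      have bn: "b' \<notin> dom_of M" "b' < N" using ar set_barcs[OF U] U wf_ends[OF wf, of i] verts_eq by auto
      \<comment> \<open>Some set of minimum weight contains the new edge. Uncrossing the set sought
        with it gives a set that contains the edge, covers at least as many vertices and counts no
        more, so the absorption is safe.\<close>
      have "lam v ?U (insert i ?T) p0" using ab p0 p0r rk by (auto simp: absorbs_def)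
      then obtain FY where Y: "feas v ?U (insert i ?T) FY" "wsum ?U (reach G FY v) FY \<le> p0"
        by (auto simp: lam_def)
      have "wsum ?U (reach G FY v) FY \<le> p" if "lam v ?U ?T p" for p
        using p0_le[OF that] Y(2) by simp
      then obtain FZ where Z: "feas v ?U (insert i ?T) FZ" "reach G E v \<subseteq> reach G FZ v"
        "csum ?U (reach G FZ v) FZ \<le> csum ?U (reach G E v) E"
        using uncross[OF U vv fE Y(1) subset_insertI conT] by blast
      have mm: "(N - card (insert b' (dom_of M))) + length ids \<le> n"
      proof -
        have "card (insert b' (dom_of M)) \<le> card {..<N}" using bn domN by (intro card_mono) auto
        then show ?thesis using meas bn by simp
      qed
      have "\<exists>\<beta>. length \<beta> \<le> b \<and> (\<forall>\<gamma>. \<exists>M' ids' \<delta> E'.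
        (bstep k v ^^ n) (ext M (i, a, b'), ids, \<beta> @ \<gamma>) = (M', ids', \<delta>) \<and> state_inv v M' ids' \<and>
        barcs ps M' ids' = [] \<and> feas v (set ids') (tree_edges M') E' \<and> reach G FZ v \<subseteq> reach G E' v \<and>
        csum (set ids') (reach G E' v) E' + (length ids - length ids') \<le> r \<and> length ids' \<le> length ids)"
      proof (rule Suc.IH[OF ie(1)])
        show "feas v ?U (tree_edges (ext M (i, a, b'))) FZ" using Z(1) ie(2) by simp
        show "csum ?U (reach G FZ v) FZ \<le> r" "r \<le> k" using Z cE rk by auto
        show "2 * r \<le> p + b" if "lam v ?U (tree_edges (ext M (i, a, b'))) p" for p
          using pot[of p] lam_mono[OF that le_refl, of ?T] ie(2) by auto
        show "(N - card (dom_of (ext M (i, a, b')))) + length ids \<le> n" using mm ie(3) by simp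
      qed
      then obtain \<beta> where \<beta>: "length \<beta> \<le> b" "\<And>\<gamma>. \<exists>M' ids' \<delta> E'.
        (bstep k v ^^ n) (ext M (i, a, b'), ids, \<beta> @ \<gamma>) = (M', ids', \<delta>) \<and> state_inv v M' ids' \<and>
        barcs ps M' ids' = [] \<and> feas v (set ids') (tree_edges M') E' \<and> reach G FZ v \<subseteq> reach G E' v \<and>
        csum (set ids') (reach G E' v) E' + (length ids - length ids') \<le> r \<and> length ids' \<le> length ids"
        by blast
      have st: "bstep k v (M, ids, \<gamma>) = (ext M (i, a, b'), ids, \<gamma>)" for \<gamma>
        using False g by (simp add: bstep_def Let_def)
      show ?thesis
        using \<beta> Z(2) by (intro exI[of _ \<beta>]) (simp add: funpow_Suc_right st del: funpow.simps, meson subset_trans)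
    next
      case gs: True
      obtain i a b' where g: "hd ?bs = (i, a, b')" by (cases "hd ?bs") auto
      have ar: "(i, a, b') \<in> set ?bs" using hd_in_set[OF bs] g by simp
      have iU: "i \<in> ?U" and ends: "ends G i = {a, b'}" and ad: "a \<in> dom_of M" and bn: "b' \<notin> dom_of M"
        using ar set_barcs[OF U] by auto
      have bN: "b' < N" using iU U wf_ends[OF wf, of i] verts_eq ends by auto
      \<comment> \<open>No arc can be absorbed, so including any boundary arc at all strictly raises
        the minimum. This is used for the branching arc and, when it is deleted, for whichever arc a
        minimiser uses.\<close>
      have nolam: "\<not> lam v ?U (insert j ?T) p0" if "(j, x, y) \<in> set ?bs" for j x y
      proof
        assume l: "lam v ?U (insert j ?T) p0"
        have "\<not> absorbs k v M ids (j, x, y)" using gs that by (auto simp: filter_empty_conv)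
        then obtain p where p: "lam v ?U ?T p" "\<not> lam v ?U (insert j ?T) p" by (auto simp: absorbs_def)
        then show False using lam_mono[OF l p0_le[OF p(1)] subset_refl] by simp
      qed
      have st: "bstep k v (M, ids, \<beta> # \<gamma>) = (if \<beta> then (ext M (i, a, b'), ids, \<gamma>)
          else (M, filter (\<lambda>j. j \<noteq> i) ids, \<gamma>))" for \<beta> \<gamma>
        using gs bs g by (simp add: bstep_def Let_def)
      show ?thesis
      proof (cases "i \<in> E")
        case True
        note ie = state_inv_ext[OF inv ar]
        have fE': "feas v ?U (insert i ?T) E" using fE True by (auto simp: feas_def)
        then have "lam v ?U (insert i ?T) (2 * r)" using w2 by (auto simp: lam_def)
        \<comment> \<open>Following the set sought keeps \<open>r\<close> and raises the minimum by
          at least one. As the raised minimum is still at most \<open>2 * r\<close>, the budget was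
          positive.\<close>
        then have "p0 < 2 * r" using nolam[OF ar] lam_mono[of v ?U "insert i ?T" "2 * r" p0 "insert i ?T"]
          by (metis not_less order_refl)
        then have b1: "b \<ge> 1" using pot[OF p0] by simp
        have mm: "(N - card (insert b' (dom_of M))) + length ids \<le> n"
        proof -
          have "card (insert b' (dom_of M)) \<le> card {..<N}" using bn bN domN by (intro card_mono) auto
          then show ?thesis using meas bn by simp
        qed
        have "\<exists>\<beta>. length \<beta> \<le> b - 1 \<and> (\<forall>\<gamma>. \<exists>M' ids' \<delta> E'.
          (bstep k v ^^ n) (ext M (i, a, b'), ids, \<beta> @ \<gamma>) = (M', ids', \<delta>) \<and> state_inv v M' ids' \<and>
          barcs ps M' ids' = [] \<and> feas v (set ids') (tree_edges M') E' \<and> reach G E v \<subseteq> reach G E' v \<and>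
          csum (set ids') (reach G E' v) E' + (length ids - length ids') \<le> r \<and> length ids' \<le> length ids)"
        proof (rule Suc.IH[OF ie(1)])
          show "feas v ?U (tree_edges (ext M (i, a, b'))) E" using fE' ie(2) by simp
          show "csum ?U (reach G E v) E \<le> r" "r \<le> k" using cE rk by auto
          show "2 * r \<le> p + (b - 1)" if "lam v ?U (tree_edges (ext M (i, a, b'))) p" for p
          proof -
            have l: "lam v ?U (insert i ?T) p" using that ie(2) by simp
            have "p0 < p"
              using nolam[OF ar] lam_mono[OF l, of p0 "insert i ?T"] by (metis not_less order_refl)
            then show ?thesis using pot[OF p0] b1 by simp
          qed
          show "(N - card (dom_of (ext M (i, a, b')))) + length ids \<le> n" using mm ie(3) by simp
        qed
        then obtain \<beta> where \<beta>: "length \<beta> \<le> b - 1" "\<And>\<gamma>. \<exists>M' ids' \<delta> E'.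
          (bstep k v ^^ n) (ext M (i, a, b'), ids, \<beta> @ \<gamma>) = (M', ids', \<delta>) \<and> state_inv v M' ids' \<and>
          barcs ps M' ids' = [] \<and> feas v (set ids') (tree_edges M') E' \<and> reach G E v \<subseteq> reach G E' v \<and>
          csum (set ids') (reach G E' v) E' + (length ids - length ids') \<le> r \<and> length ids' \<le> length ids"
          by blast
        show ?thesis
          using \<beta> b1 by (intro exI[of _ "True # \<beta>"]) (simp add: funpow_Suc_right st del: funpow.simps)
      next
        case False
        let ?ids = "filter (\<lambda>j. j \<noteq> i) ids"
        have U': "set ?ids = ?U - {i}" by auto
        have fE': "feas v (?U - {i}) ?T E" using fE False by (auto simp: feas_def)
        have tch: "ends G i \<inter> reach G E v \<noteq> {}" using ends ad domE by auto
        have cU: "csum ?U (reach G E v) E = Suc (csum (?U - {i}) (reach G E v) E)"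
          using csum_remove[OF _ iU tch False] by simp
        then have r1: "r \<ge> 1" "csum (?U - {i}) (reach G E v) E \<le> r - 1" using cE by auto
        \<comment> \<open>Putting the deleted edge back adds 1 to the weight of a minimiser with one
          end inside. With both ends inside it adds 2, but then the minimiser leaves the tree by
          some boundary arc, which by \<open>nolam\<close> costs more than the minimum. So deletion
          lowers the minimum by at most one, while \<open>2 * r\<close> drops by two.\<close>
        have low: "p0 \<le> p + 1" if l: "lam v (?U - {i}) ?T p" for p
        proof -
          obtain FY where Y: "feas v (?U - {i}) ?T FY" "wsum (?U - {i}) (reach G FY v) FY \<le> p"
            using l by (auto simp: lam_def)
          have Y': "feas v ?U ?T FY" using Y(1) by (auto simp: feas_def)
          have w: "wsum ?U (reach G FY v) FY = wt (reach G FY v) FY i + wsum (?U - {i}) (reach G FY v) FY"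
            using wsum_remove[OF _ iU] by simp
          show ?thesis
          proof (cases "b' \<in> reach G FY v")
            case True
            have "FY \<subseteq> ?U" using Y' by (simp add: feas_def)
            then obtain j x y where j: "(j, x, y) \<in> set ?bs" "j \<in> FY"
              using leaving_arc[OF U _ vd True bn] by blast
            have "feas v ?U (insert j ?T) FY" using Y' j by (auto simp: feas_def)
            moreover have "wsum ?U (reach G FY v) FY \<le> p + 2" using w Y(2) by (simp add: wt_def)
            ultimately have "lam v ?U (insert j ?T) (p + 2)" by (auto simp: lam_def)
            then have "p0 < p + 2" using nolam[OF j(1)] lam_mono[of v ?U "insert j ?T" "p + 2" p0 "insert j ?T"]
              by (metis not_less order_refl)
            then show ?thesis by simp
          next
            case False
            then have "wsum ?U (reach G FY v) FY \<le> p + 1" using w Y(2) ends by (simp add: wt_def)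
            then show ?thesis using p0_le[of "p + 1"] Y' by (auto simp: lam_def)
          qed
        qed
        have U'G: "?U - {i} \<subseteq> edges G" using U by auto
        have "wsum (?U - {i}) (reach G E v) E \<le> 2 * (r - 1)" using wsum_le_csum[of E "reach G E v" "?U - {i}", OF endsE U'G] r1 by simp
        then have "lam v (?U - {i}) ?T (2 * (r - 1))" using fE' by (auto simp: lam_def)
        then have b1: "b \<ge> 1" using low pot[OF p0] r1 by fastforce
        have len: "length ?ids + 1 = length ids"
          using iU dis by (metis One_nat_def Suc_eq_plus1 distinct_card distinct_filter U' card_Suc_Diff1 List.finite_set)
        have "\<exists>\<beta>. length \<beta> \<le> b - 1 \<and> (\<forall>\<gamma>. \<exists>M' ids' \<delta> E'.
          (bstep k v ^^ n) (M, ?ids, \<beta> @ \<gamma>) = (M', ids', \<delta>) \<and> state_inv v M' ids' \<and>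
          barcs ps M' ids' = [] \<and> feas v (set ids') (tree_edges M') E' \<and> reach G E v \<subseteq> reach G E' v \<and>
          csum (set ids') (reach G E' v) E' + (length ?ids - length ids') \<le> r - 1 \<and> length ids' \<le> length ?ids)"
        proof (rule Suc.IH[OF state_inv_delete[OF inv ar]])
          show "feas v (set ?ids) ?T E" "csum (set ?ids) (reach G E v) E \<le> r - 1" "r - 1 \<le> k"
            using fE' r1 rk unfolding U' by auto
          show "2 * (r - 1) \<le> p + (b - 1)" if "lam v (set ?ids) ?T p" for p
            using low[of p] that pot[OF p0] b1 r1 unfolding U' by simp
          show "(N - card (dom_of M)) + length ?ids \<le> n" using meas len by simp
        qed
        then obtain \<beta> where \<beta>: "length \<beta> \<le> b - 1" "\<And>\<gamma>. \<exists>M' ids' \<delta> E'.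
          (bstep k v ^^ n) (M, ?ids, \<beta> @ \<gamma>) = (M', ids', \<delta>) \<and> state_inv v M' ids' \<and>
          barcs ps M' ids' = [] \<and> feas v (set ids') (tree_edges M') E' \<and> reach G E v \<subseteq> reach G E' v \<and>
          csum (set ids') (reach G E' v) E' + (length ?ids - length ids') \<le> r - 1 \<and> length ids' \<le> length ?ids"
          by blast
        have "\<exists>M' ids' \<delta> E'. (bstep k v ^^ n) (M, ?ids, \<beta> @ \<gamma>) = (M', ids', \<delta>) \<and> state_inv v M' ids' \<and>
          barcs ps M' ids' = [] \<and> feas v (set ids') (tree_edges M') E' \<and> reach G E v \<subseteq> reach G E' v \<and>
          csum (set ids') (reach G E' v) E' + (length ids - length ids') \<le> r \<and> length ids' \<le> length ids" for \<gamma>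
        proof -
          obtain M' ids' \<delta> E' where *: "(bstep k v ^^ n) (M, ?ids, \<beta> @ \<gamma>) = (M', ids', \<delta>)" "state_inv v M' ids'"
            "barcs ps M' ids' = []" "feas v (set ids') (tree_edges M') E'" "reach G E v \<subseteq> reach G E' v"
            "csum (set ids') (reach G E' v) E' + (length ?ids - length ids') \<le> r - 1" "length ids' \<le> length ?ids"
            using \<beta>(2)[of \<gamma>] by blast
          have "csum (set ids') (reach G E' v) E' + (length ids - length ids') \<le> r" "length ids' \<le> length ids"
            using *(6,7) len r1 by linarith+
          then show ?thesis using * by blast
        qed
        then show ?thesis
          using \<beta>(1) b1 by (intro exI[of _ "False # \<beta>"]) (simp add: funpow_Suc_right st del: funpow.simps)
      qed
    qed
  qed
qed

end

section \<open>Deciding the relaxation\<close>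

lemma perceptron_step:
  fixes y :: "'a \<Rightarrow> int"
  assumes "\<And>i. i \<in> I \<Longrightarrow> y' i = y i + a i" "(\<Sum>i\<in>I. a i * y i) \<le> 0" "(\<Sum>i\<in>I. a i * z i) \<ge> 1"
    "(\<Sum>i\<in>I. a i * a i) \<le> K"
  shows "(\<Sum>i\<in>I. y' i * z i) \<ge> (\<Sum>i\<in>I. y i * z i) + 1"
    "(\<Sum>i\<in>I. y' i * y' i) \<le> (\<Sum>i\<in>I. y i * y i) + K"
proof -
  have "(\<Sum>i\<in>I. y' i * z i) = (\<Sum>i\<in>I. y i * z i + a i * z i)"
    by (intro sum.cong) (auto simp: assms(1) algebra_simps)
  then show "(\<Sum>i\<in>I. y' i * z i) \<ge> (\<Sum>i\<in>I. y i * z i) + 1"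
    using assms(3) by (simp add: sum.distrib)
  have "(\<Sum>i\<in>I. y' i * y' i) = (\<Sum>i\<in>I. y i * y i + 2 * (a i * y i) + a i * a i)"
    by (intro sum.cong) (auto simp: assms(1) algebra_simps)
  also have "\<dots> = (\<Sum>i\<in>I. y i * y i) + 2 * (\<Sum>i\<in>I. a i * y i) + (\<Sum>i\<in>I. a i * a i)"
    by (simp add: sum.distrib sum_distrib_left)
  finally show "(\<Sum>i\<in>I. y' i * y' i) \<le> (\<Sum>i\<in>I. y i * y i) + K"
    using assms(2,4) by simp
qed

text \<open>The classical argument: after n corrections the product with \<open>z\<close> is at
  least n while the squared norm is at most n K, and the inequality of Cauchy and Schwarz compares
  the two.\<close>

lemma perceptron_bound:
  fixes y :: "nat \<Rightarrow> 'a \<Rightarrow> int"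
  assumes y0: "\<And>i. i \<in> I \<Longrightarrow> y 0 i = 0" and n: "n > 0"
    and step: "\<And>j. j < n \<Longrightarrow> (\<Sum>i\<in>I. y (Suc j) i * z i) \<ge> (\<Sum>i\<in>I. y j i * z i) + 1"
      "\<And>j. j < n \<Longrightarrow> (\<Sum>i\<in>I. y (Suc j) i * y (Suc j) i) \<le> (\<Sum>i\<in>I. y j i * y j i) + K"
  shows "int n \<le> K * (\<Sum>i\<in>I. z i * z i)"
proof -
  have a: "j \<le> n \<Longrightarrow> (\<Sum>i\<in>I. y j i * z i) \<ge> int j" for j
  proof (induction j)
    case 0 then show ?case using y0 by simp
  next
    case (Suc j) then show ?case using step(1)[of j] by simp
  qed
  have b: "j \<le> n \<Longrightarrow> (\<Sum>i\<in>I. y j i * y j i) \<le> int j * K" for j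
  proof (induction j)
    case 0 then show ?case using y0 by simp
  next
    case (Suc j) then show ?case using step(2)[of j] by (simp add: algebra_simps)
  qed
  let ?Z = "\<Sum>i\<in>I. z i * z i"
  have Z0: "?Z \<ge> 0" by (intro sum_nonneg) simp
  have "(\<Sum>i\<in>I. y n i * z i)\<^sup>2 \<le> (\<Sum>i\<in>I. (y n i)\<^sup>2) * (\<Sum>i\<in>I. (z i)\<^sup>2)"
  proof -
    have "(\<Sum>i\<in>I. real_of_int (y n i) * real_of_int (z i))\<^sup>2
        \<le> (\<Sum>i\<in>I. (real_of_int (y n i))\<^sup>2) * (\<Sum>i\<in>I. (real_of_int (z i))\<^sup>2)"
      by (rule Cauchy_Schwarz_ineq_sum)
    then have "real_of_int ((\<Sum>i\<in>I. y n i * z i)\<^sup>2) \<le> real_of_int ((\<Sum>i\<in>I. (y n i)\<^sup>2) * (\<Sum>i\<in>I. (z i)\<^sup>2))"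
      by simp
    then show ?thesis by (simp only: of_int_le_iff)
  qed
  also have "\<dots> = (\<Sum>i\<in>I. y n i * y n i) * ?Z" by (simp add: power2_eq_square)
  also have "\<dots> \<le> (int n * K) * ?Z" using b[of n] Z0 by (intro mult_right_mono) auto
  finally have 1: "(\<Sum>i\<in>I. y n i * z i)\<^sup>2 \<le> int n * (K * ?Z)" by (simp add: mult.assoc)
  have "(int n)\<^sup>2 \<le> (\<Sum>i\<in>I. y n i * z i)\<^sup>2" using a[of n] by (intro power_mono) auto
  then have "int n * int n \<le> int n * (K * ?Z)" using 1 by (simp add: power2_eq_square)
  then show ?thesis using n by simp
qed

lemma sum_greater: "(\<Sum>r\<in>{1..t}. if A < r then 1 else 0) = t - (A::nat)"
  by (induction t) (auto simp: Suc_diff_le)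

section \<open>Shortest path trees grown from the absorbed tree\<close>

definition arc_key :: "entry list \<Rightarrow> (nat \<Rightarrow> nat) \<Rightarrow> nat \<times> nat \<times> nat \<Rightarrow> nat" where
  "arc_key M x c = (case c of (i, a, b) \<Rightarrow> dst_of M a + x i)"

definition gext :: "entry list \<Rightarrow> (nat \<Rightarrow> nat) \<Rightarrow> nat \<times> nat \<times> nat \<Rightarrow> entry list" where
  "gext M x c = (case c of (i, a, b) \<Rightarrow> (b, dst_of M a + x i, i # lpth M a, i # pth M a) # M)"

text \<open>A step of Dijkstra's algorithm that recomputes the keys of all boundary arcs instead of
  keeping a queue.\<close>

definition gstep :: "(nat \<times> nat) list \<Rightarrow> nat list \<Rightarrow> (nat \<Rightarrow> nat) \<Rightarrow> entry list \<Rightarrow> entry list" where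
  "gstep ps ids x M = (let bs = barcs ps M ids;
     cs = filter (\<lambda>c. \<not> (\<exists>c'\<in>set bs. arc_key M x c' < arc_key M x c)) bs
     in if cs = [] then M else gext M x (hd cs))"

context rgraph
begin

lemma gstep_cases:
  obtains "barcs ps M ids = []" "gstep ps ids x M = M"
  | i a b where "(i, a, b) \<in> set (barcs ps M ids)"
    "\<forall>c\<in>set (barcs ps M ids). arc_key M x (i, a, b) \<le> arc_key M x c"
    "gstep ps ids x M = (b, dst_of M a + x i, i # lpth M a, i # pth M a) # M"
proof (cases "barcs ps M ids = []")
  case True
  then show ?thesis using that(1) by (simp add: gstep_def)
next
  case False
  let ?bs = "barcs ps M ids"
  let ?cs = "filter (\<lambda>c. \<not> (\<exists>c'\<in>set ?bs. arc_key M x c' < arc_key M x c)) ?bs"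
  obtain c where "c \<in> set ?bs" "\<forall>c'\<in>set ?bs. arc_key M x c \<le> arc_key M x c'"
    using ex_min_if_finite[of "arc_key M x ` set ?bs"] False by (auto simp: not_less)
  then have "c \<in> set ?cs" by (auto simp: not_less)
  then have ne: "?cs \<noteq> []" by (metis empty_iff empty_set)
  obtain i a b where h: "hd ?cs = (i, a, b)" by (cases "hd ?cs") auto
  have "(i, a, b) \<in> set ?cs" using hd_in_set[OF ne] h by simp
  then show ?thesis using that(2)[of i a b] ne h by (auto simp: gstep_def Let_def gext_def not_less)
qed

text \<open>The last two clauses are the triangle inequality inside the tree and the monotonicity of
  Dijkstra's algorithm: no boundary arc has a key below a settled distance. Distances are sums over
  the edges outside the initial tree only.\<close>

definition ginv :: "nat \<Rightarrow> nat set \<Rightarrow> nat set \<Rightarrow> nat list \<Rightarrow> (nat \<Rightarrow> nat) \<Rightarrow> entry list \<Rightarrow> bool" where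
  "ginv v T0 D0 ids x M \<longleftrightarrow> tree_inv v M \<and> tree_edges M \<subseteq> set ids \<and> D0 \<subseteq> dom_of M \<and> T0 \<subseteq> tree_edges M \<and>
     (\<forall>u\<in>D0. dst_of M u = 0) \<and>
     (\<forall>u\<in>dom_of M. distinct (lpth M u) \<and> dst_of M u = (\<Sum>i\<in>set (lpth M u). x i) \<and>
        set (lpth M u) \<subseteq> tree_edges M) \<and>
     (\<forall>i\<in>set ids. \<forall>a\<in>dom_of M. \<forall>b\<in>dom_of M. ends G i = {a, b} \<longrightarrow> dst_of M b \<le> dst_of M a + x i) \<and>
     (\<forall>i\<in>set ids. \<forall>a\<in>dom_of M. \<forall>b. b \<notin> dom_of M \<longrightarrow> ends G i = {a, b} \<longrightarrow>
        (\<forall>c\<in>dom_of M. dst_of M c \<le> dst_of M a + x i))"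

lemma state_inv_dst:
  assumes s: "state_inv v M ids" and u: "u \<in> dom_of M"
  shows "dst_of M u = 0 \<and> lpth M u = []"
proof -
  obtain r where r: "map_of M u = Some r" using u by (metis dom_of_def map_of_eq_None_iff not_None_eq)
  then have "(u, r) \<in> set M" by (rule map_of_SomeD)
  then show ?thesis using s r
    by (cases r) (auto simp: state_inv_def dst_of_def lpth_def)
qed

lemma ginv_init:
  assumes s: "state_inv v M ids" shows "ginv v (tree_edges M) (dom_of M) ids x M"
  unfolding ginv_def using state_inv_dst[OF s] s by (auto simp: state_inv_def)

lemma ginv_gstep:
  assumes inv: "ginv v T0 D0 ids x M" and ids: "set ids \<subseteq> edges G"
  shows "ginv v T0 D0 ids x (gstep ps ids x M)"
proof (rule gstep_cases[of M ids x])
  assume "gstep ps ids x M = M" then show ?thesis using inv by simp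
next
  fix i a b
  assume ar: "(i, a, b) \<in> set (barcs ps M ids)"
    and mn: "\<forall>c\<in>set (barcs ps M ids). arc_key M x (i, a, b) \<le> arc_key M x c"
    and g: "gstep ps ids x M = (b, dst_of M a + x i, i # lpth M a, i # pth M a) # M"
  let ?M = "(b, dst_of M a + x i, i # lpth M a, i # pth M a) # M"
  have i: "i \<in> set ids" "ends G i = {a, b}" "a \<in> dom_of M" "b \<notin> dom_of M"
    using ar set_barcs[OF ids] by auto
  have ti: "tree_inv v M" using inv by (simp add: ginv_def)
  have te: "tree_edges ?M = insert i (tree_edges M)" by (rule tree_edges_Cons[OF i(4,3)])
  have iT: "i \<notin> tree_edges M" using tree_inv_ends[OF ti] tree_inv_reach[OF ti] i by auto
  have ne: "u \<noteq> b" if "u \<in> dom_of M" for u using that i by auto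
  have db: "dst_of ?M b = dst_of M a + x i" "lpth ?M b = i # lpth M a"
    by (simp_all add: dst_of_def lpth_def)
  have du: "dst_of ?M u = dst_of M u" "lpth ?M u = lpth M u" if "u \<in> dom_of M" for u
    using ne[OF that] by (simp_all add: dst_of_def lpth_def)
  have lp: "distinct (lpth M u)" "dst_of M u = (\<Sum>i\<in>set (lpth M u). x i)" "set (lpth M u) \<subseteq> tree_edges M"
    if "u \<in> dom_of M" for u using inv that by (auto simp: ginv_def)
  have g2: "dst_of M d \<le> dst_of M c + x j" if "j \<in> set ids" "c \<in> dom_of M" "d \<in> dom_of M" "ends G j = {c, d}" for j c d
    using inv that unfolding ginv_def by blast
  have g3: "dst_of M e \<le> dst_of M c + x j"
    if "j \<in> set ids" "c \<in> dom_of M" "d \<notin> dom_of M" "ends G j = {c, d}" "e \<in> dom_of M" for j c d e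
    using inv that unfolding ginv_def by blast
  have mn': "dst_of M a + x i \<le> dst_of M c + x j"
    if "j \<in> set ids" "c \<in> dom_of M" "d \<notin> dom_of M" "ends G j = {c, d}" for j c d
  proof -
    have "(j, c, d) \<in> set (barcs ps M ids)" using set_barcs[OF ids] that by blast
    then show ?thesis using mn by (fastforce simp: arc_key_def)
  qed
  have big: "dst_of M e \<le> dst_of M a + x i" if "e \<in> dom_of M" for e using g3[OF i(1,3,4,2) that] .
  have "tree_inv v ?M" by (rule tree_inv_Cons) (use ti i ids in auto)
  moreover have "\<forall>u\<in>dom_of ?M. distinct (lpth ?M u) \<and> dst_of ?M u = (\<Sum>i\<in>set (lpth ?M u). x i) \<and>
        set (lpth ?M u) \<subseteq> tree_edges ?M"
  proof
    fix u assume u: "u \<in> dom_of ?M"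
    show "distinct (lpth ?M u) \<and> dst_of ?M u = (\<Sum>i\<in>set (lpth ?M u). x i) \<and> set (lpth ?M u) \<subseteq> tree_edges ?M"
    proof (cases "u = b")
      case True
      have "i \<notin> set (lpth M a)" using lp(3)[OF i(3)] iT by auto
      then show ?thesis using True db lp[OF i(3)] te by auto
    next
      case False
      then have uM: "u \<in> dom_of M" using u by simp
      show ?thesis unfolding du[OF uM] te using lp[OF uM] by (simp add: subset_insertI2)
    qed
  qed
  moreover have "\<forall>j\<in>set ids. \<forall>c\<in>dom_of ?M. \<forall>d\<in>dom_of ?M. ends G j = {c, d} \<longrightarrow> dst_of ?M d \<le> dst_of ?M c + x j"
  proof (intro ballI impI)
    fix j c d assume j: "j \<in> set ids" "c \<in> dom_of ?M" "d \<in> dom_of ?M" "ends G j = {c, d}"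
    consider "c = b" "d = b" | "c = b" "d \<in> dom_of M" | "c \<in> dom_of M" "d = b" | "c \<in> dom_of M" "d \<in> dom_of M"
      using j(2,3) by auto
    then show "dst_of ?M d \<le> dst_of ?M c + x j"
    proof cases
      case 2
      then show ?thesis using big[of d] db du[of d] by simp
    next
      case 3
      then show ?thesis using mn'[of j c b] j i db du[of c] by simp
    next
      case 4
      then show ?thesis using g2[of j c d] j du by simp
    qed simp
  qed
  moreover have "\<forall>j\<in>set ids. \<forall>c\<in>dom_of ?M. \<forall>d. d \<notin> dom_of ?M \<longrightarrow> ends G j = {c, d} \<longrightarrow>
        (\<forall>e\<in>dom_of ?M. dst_of ?M e \<le> dst_of ?M c + x j)"
  proof (intro ballI impI allI)
    fix j c d e assume j: "j \<in> set ids" "c \<in> dom_of ?M" "d \<notin> dom_of ?M" "ends G j = {c, d}" "e \<in> dom_of ?M"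
    have d: "d \<notin> dom_of M" using j by simp
    have "dst_of ?M e \<le> dst_of M a + x i" using j(5) db du[of e] big[of e] by auto
    moreover have "dst_of M a + x i \<le> dst_of ?M c + x j"
      using j(2) db du[of c] mn'[of j c d] j d by auto
    ultimately show "dst_of ?M e \<le> dst_of ?M c + x j" by simp
  qed
  moreover have "\<forall>u\<in>D0. dst_of ?M u = 0"
  proof
    fix u assume "u \<in> D0"
    then have "u \<in> dom_of M" "dst_of M u = 0" using inv by (auto simp: ginv_def)
    then show "dst_of ?M u = 0" using du by simp
  qed
  moreover have "D0 \<subseteq> dom_of ?M" "T0 \<subseteq> tree_edges ?M" "tree_edges ?M \<subseteq> set ids"
    using inv te i by (auto simp: ginv_def)
  ultimately show ?thesis unfolding g ginv_def by blast
qed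

lemma ginv_funpow:
  assumes "ginv v T0 D0 ids x M" "set ids \<subseteq> edges G"
  shows "ginv v T0 D0 ids x ((gstep ps ids x ^^ n) M)"
  by (induction n) (use assms ginv_gstep in auto)

lemma tree_inv_dom:
  assumes "tree_inv v M" shows "dom_of M \<subseteq> {..<N} \<and> v \<in> dom_of M"
  using tree_ok_verts[OF assms[unfolded tree_inv_def]] assms verts_eq
  by (simp add: tree_inv_def tree_ok_def)

text \<open>Every step adds a vertex until no boundary arc is left, and there are only
  \<open>N\<close> vertices.\<close>

lemma grow_complete:
  assumes inv: "ginv v T0 D0 ids x M" and ids: "set ids \<subseteq> edges G"
  shows "barcs ps ((gstep ps ids x ^^ N) M) ids = []"
proof -
  have "barcs ps ((gstep ps ids x ^^ n) M) ids = [] \<or> card (dom_of ((gstep ps ids x ^^ n) M)) > n" for n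
  proof (induction n)
    case 0
    have "v \<in> dom_of M" using inv tree_inv_dom by (auto simp: ginv_def)
    then show ?case by (auto simp: card_gt_0_iff)
  next
    case (Suc n)
    let ?M = "(gstep ps ids x ^^ n) M"
    show ?case
    proof (rule gstep_cases[of ?M ids x])
      fix i a b assume h: "(i, a, b) \<in> set (barcs ps ?M ids)"
        "gstep ps ids x ?M = (b, dst_of ?M a + x i, i # lpth ?M a, i # pth ?M a) # ?M"
      then have "b \<notin> dom_of ?M" using set_barcs[OF ids] by auto
      moreover have "barcs ps ?M ids \<noteq> []" using h by auto
      ultimately show ?thesis using Suc h by simp
    qed simp
  qed
  moreover have "card (dom_of ((gstep ps ids x ^^ N) M)) \<le> N"
    using tree_inv_dom[of v "(gstep ps ids x ^^ N) M"] ginv_funpow[OF inv ids, of N]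
      card_mono[of "{..<N}" "dom_of ((gstep ps ids x ^^ N) M)"] by (auto simp: ginv_def)
  ultimately show ?thesis using not_le by blast
qed

text \<open>The constraint of the linear program: the closed walk from the root to \<open>a\<close>,
  across \<open>i\<close>, and back from \<open>b\<close> must be longer than \<open>t\<close>
  whenever the fundamental cycle of \<open>i\<close> is unbalanced. The two orientations of an edge
  give the same constraint.\<close>

definition viol :: "entry list \<Rightarrow> (nat \<Rightarrow> nat) \<Rightarrow> nat \<Rightarrow> nat \<times> nat \<times> nat \<Rightarrow> bool" where
  "viol M x t c = (case c of (i, a, b) \<Rightarrow> a \<in> dom_of M \<and> b \<in> dom_of M \<and>
     dst_of M a + dst_of M b + x i \<le> t \<and> \<not> cons_edge (\<lambda>u. set (pth M u)) i a b)"

text \<open>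
  Rounding: the balls of radius \<open>r / 2\<close> for \<open>r = 1, \<dots>, t\<close> have average weight at most
  \<open>2 (\<Sum>x) / t\<close>.
\<close>

lemma rounding:
  assumes inv: "ginv v T0 D0 ids x M" and ids: "set ids \<subseteq> edges G" and full: "barcs ps M ids = []"
    and T0: "\<And>e. e \<in> T0 \<Longrightarrow> ends G e \<subseteq> D0" "\<And>e. e \<in> T0 \<Longrightarrow> ends G e \<subseteq> reach G T0 v" "v \<in> D0"
    and nv: "\<forall>c\<in>set (arcs ps ids). \<not> viol M x t c"
    and small: "4 * (\<Sum>i\<in>set ids. x i) < (2 * p + 1) * t"
  shows "lam v (set ids) T0 p"
proof -
  let ?U = "set ids" and ?P = "\<lambda>u. set (pth M u)" and ?X = "dom_of M" and ?T = "tree_edges M"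
  have t: "tree_ok v ?P ?X ?T" using inv by (auto simp: ginv_def tree_inv_def)
  define cn where "cn i \<longleftrightarrow> (\<forall>a b. ends G i = {a, b} \<longrightarrow> cons_edge ?P i a b)" for i
  define Y where "Y r = {u \<in> ?X. 2 * dst_of M u < r}" for r
  define E where "E r = {i \<in> ?U. ends G i \<subseteq> Y r \<and> cn i}" for r
  have balE: "bal (E r)" for r
  proof (rule bal_mono)
    show "bal ({i \<in> ?U. ends G i \<subseteq> ?X \<and> cn i} \<union> ?T)"
      by (rule cons_bal[OF t]) (use ids in \<open>auto simp: cn_def\<close>)
    show "E r \<subseteq> {i \<in> ?U. ends G i \<subseteq> ?X \<and> cn i} \<union> ?T" by (auto simp: E_def Y_def)
  qed
  \<comment> \<open>A consistent edge is cut by the radii between the doubled distances of its ends,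
    which are at most \<open>2 * x i\<close> many. An inconsistent edge is charged t - 2 d(a) plus t
    - 2 d(b), less than \<open>2 * x i\<close> because its closed walk is longer than
    \<open>t\<close>; if one term is truncated to 0, the triangle inequality bounds the
    other.\<close>
  have ptw: "(\<Sum>r\<in>{1..t}. wt (Y r) (E r) i) \<le> 2 * x i" if i: "i \<in> ?U" for i
  proof -
    obtain a' b' where ab': "ends G i = {a', b'}" using edge_ends_ex[of i] i ids by auto
    obtain a b where ab: "ends G i = {a, b}" and le: "dst_of M a \<le> dst_of M b"
    proof (cases "dst_of M a' \<le> dst_of M b'")
      case True then show ?thesis using that ab' by blast
    next
      case False then show ?thesis using that[of b' a'] ab' by auto
    qed
    have nb: "(i, c, d) \<notin> set (barcs ps M ids)" for c d using full by simp
    have ab2: "ends G i = {b, a}" using ab by auto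
    have X: "a \<in> ?X \<longleftrightarrow> b \<in> ?X" using nb[of a b] nb[of b a] set_barcs[OF ids] i ab ab2 by blast
    show ?thesis
    proof (cases "a \<in> ?X")
      case False
      then have "wt (Y r) (E r) i = 0" for r using X ab by (auto simp: wt_def Y_def)
      then show ?thesis by simp
    next
      case aX: True
      let ?A = "2 * dst_of M a" and ?B = "2 * dst_of M b"
      have tri: "dst_of M b \<le> dst_of M a + x i" using inv i aX X ab unfolding ginv_def by blast
      have cn: "cn i \<longleftrightarrow> cons_edge ?P i a b"
        unfolding cn_def ab using cons_edge_commute[of ?P i] by (auto simp: doubleton_eq_iff)
      have Yr: "a \<in> Y r \<longleftrightarrow> ?A < r" "b \<in> Y r \<longleftrightarrow> ?B < r" for r using aX X by (auto simp: Y_def)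
      show ?thesis
      proof (cases "cn i")
        case True
        have "wt (Y r) (E r) i + (if ?B < r then 1 else 0) = (if ?A < r then 1 else 0)" for r
          using True le i ab Yr[of r] by (auto simp: wt_def E_def)
        then have "(\<Sum>r\<in>{1..t}. wt (Y r) (E r) i) + (\<Sum>r\<in>{1..t}. if ?B < r then 1 else 0)
            = (\<Sum>r\<in>{1..t}. if ?A < r then 1 else 0)" unfolding sum.distrib[symmetric] by simp
        then show ?thesis using tri le unfolding sum_greater by linarith
      next
        case False
        have "wt (Y r) (E r) i = (if ?A < r then 1 else 0) + (if ?B < r then 1 else 0)" for r
          using False le i ab Yr[of r] by (auto simp: wt_def E_def)
        then have "(\<Sum>r\<in>{1..t}. wt (Y r) (E r) i) = (\<Sum>r\<in>{1..t}. if ?A < r then 1 else 0) +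
            (\<Sum>r\<in>{1..t}. if ?B < r then 1 else 0)" unfolding sum.distrib[symmetric] by simp
        moreover have "t < dst_of M a + dst_of M b + x i"
        proof -
          have "(i, a, b) \<in> set (arcs ps ids)" using set_arcs[OF ids] i ab by simp
          then have "\<not> viol M x t (i, a, b)" using nv by blast
          then show ?thesis using False cn X aX by (auto simp: viol_def)
        qed
        ultimately show ?thesis using tri le unfolding sum_greater by linarith
      qed
    qed
  qed
  \<comment> \<open>The hypothesis keeps the average weight below p + 1/2, and weights are
    integral.\<close>
  have "\<exists>r\<in>{1..t}. wsum ?U (Y r) (E r) \<le> p"
  proof (rule ccontr)
    assume no: "\<not> ?thesis"
    have "t * (p + 1) = (\<Sum>r\<in>{1..t}. p + 1)" by simp
    also have "\<dots> \<le> (\<Sum>r\<in>{1..t}. wsum ?U (Y r) (E r))" using no by (intro sum_mono) force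
    also have "\<dots> = (\<Sum>i\<in>?U. \<Sum>r\<in>{1..t}. wt (Y r) (E r) i)" unfolding wsum_def by (rule sum.swap)
    also have "\<dots> \<le> (\<Sum>i\<in>?U. 2 * x i)" by (intro sum_mono ptw)
    also have "\<dots> = 2 * (\<Sum>i\<in>?U. x i)" by (simp add: sum_distrib_left)
    finally have "2 * (t * (p + 1)) \<le> 4 * (\<Sum>i\<in>?U. x i)" by simp
    then show False using small by (simp add: algebra_simps)
  qed
  then obtain r where r: "r \<in> {1..t}" "wsum ?U (Y r) (E r) \<le> p" by blast
  have D0: "D0 \<subseteq> Y r" using inv r by (auto simp: ginv_def Y_def)
  show ?thesis
  proof (rule lam_component[OF ids, of v "Y r" "E r"])
    show "v \<in> Y r" using T0(3) D0 by auto
    show "T0 \<subseteq> E r"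
    proof
      fix e assume e: "e \<in> T0"
      then have eT: "e \<in> ?T" "e \<in> ?U" using inv by (auto simp: ginv_def)
      have "cons_edge ?P e a b" if "ends G e = {a, b}" for a b
        using tree_ok_sdiff[OF t eT(1) that] by (simp add: cons_edge_def)
      then show "e \<in> E r" using eT(2) subset_trans[OF T0(1)[OF e] D0] by (simp add: E_def cn_def)
    qed
  qed (use T0(2) r(2) balE in \<open>auto simp: E_def\<close>)
qed

end

section \<open>The perceptron iteration and its number of corrections\<close>

definition bump :: "entry list \<Rightarrow> (nat \<Rightarrow> nat) \<Rightarrow> nat \<times> nat \<times> nat \<Rightarrow> nat \<Rightarrow> nat" where
  "bump M u c = (case c of (i, a, b) \<Rightarrow> (\<lambda>j. u j + (if j = i then 1 else 0) +
     (if j \<in> set (lpth M a) then 1 else 0) + (if j \<in> set (lpth M b) then 1 else 0)))"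

lemma sum_arcs:
  assumes "distinct ids"
  shows "sum_list (map (\<lambda>(i, a, b). x i) (arcs ps ids)) = 2 * (\<Sum>i\<in>set ids. x i :: nat)"
  using assms by (induction ids) (auto simp: arcs_def)

context rgraph
begin

text \<open>
  A state \<open>(fl, u, s, q)\<close> of the perceptron stands for the lengths \<open>u i - 4 s\<close> and the target
  \<open>t = (2 p + 1) s - q\<close>: only the counters \<open>u\<close>, \<open>s\<close> and \<open>q\<close> ever grow.  The flag tells that the last step
  found no violated constraint.
\<close>

definition pstep :: "nat \<Rightarrow> entry list \<Rightarrow> nat list \<Rightarrow> bool \<times> (nat \<Rightarrow> nat) \<times> nat \<times> nat \<Rightarrow>
    bool \<times> (nat \<Rightarrow> nat) \<times> nat \<times> nat" where
  "pstep p M ids y = (case y of (fl, u, s, q) \<Rightarrow>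
     if \<exists>i\<in>set ids. u i \<le> 4 * s then (False, \<lambda>i. if u i \<le> 4 * s then Suc (u i) else u i, s, q)
     else let x = (\<lambda>i. u i - 4 * s); M' = (gstep ps ids x ^^ N) M; t = (2 * p + 1) * s - q;
         vs = filter (viol M' x t) (arcs ps ids) in
       if vs \<noteq> [] then (False, bump M' u (hd vs), s, Suc q)
       else if (2 * p + 1) * t \<le> 2 * sum_list (map (\<lambda>(i, a, b). x i) (arcs ps ids)) then (False, u, Suc s, q)
       else (True, u, s, q))"

definition solve :: "nat \<Rightarrow> nat \<Rightarrow> entry list \<Rightarrow> nat list \<Rightarrow> bool" where
  "solve T p M ids = fst ((pstep p M ids ^^ T) (False, \<lambda>_. 0, 0, 0))"

text \<open>A raised flag certifies that the current lengths and target satisfy every constraint, so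
  rounding applies. The iteration count matters for completeness only.\<close>

lemma solve_sound:
  assumes inv: "state_inv v M ids" and s: "solve T p M ids"
  shows "lam v (set ids) (tree_edges M) p"
proof -
  obtain T' where T: "T = Suc T'" using s by (cases T) (auto simp: solve_def)
  obtain fl u s0 q where y: "(pstep p M ids ^^ T') (False, \<lambda>_. 0, 0, 0) = (fl, u, s0, q)"
    by (cases "(pstep p M ids ^^ T') (False, \<lambda>_. 0, 0, 0)") auto
  have fl: "fst (pstep p M ids (fl, u, s0, q))" using s T y by (simp add: solve_def)
  have ids: "set ids \<subseteq> edges G" "distinct ids" and ti: "tree_inv v M" using inv by (auto simp: state_inv_def)
  define x where "x = (\<lambda>i. u i - 4 * s0)"
  define M' where "M' = (gstep ps ids x ^^ N) M"
  define t where "t = (2 * p + 1) * s0 - q"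
  have nv: "filter (viol M' x t) (arcs ps ids) = []"
    and small: "\<not> (2 * p + 1) * t \<le> 2 * sum_list (map (\<lambda>(i, a, b). x i) (arcs ps ids))"
    using fl unfolding pstep_def Let_def x_def M'_def t_def by (auto split: if_splits)
  show ?thesis
  proof (rule rounding)
    show "ginv v (tree_edges M) (dom_of M) ids x M'" unfolding M'_def
      by (rule ginv_funpow[OF ginv_init[OF inv] ids(1)])
    show "barcs ps M' ids = []" unfolding M'_def by (rule grow_complete[OF ginv_init[OF inv] ids(1)])
    show "\<forall>c\<in>set (arcs ps ids). \<not> viol M' x t c" using nv by (auto simp: filter_empty_conv)
    show "4 * (\<Sum>i\<in>set ids. x i) < (2 * p + 1) * t" using small sum_arcs[OF ids(2)] by simp
    show "v \<in> dom_of M" using tree_inv_dom[OF ti] by simp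
    show "ends G e \<subseteq> reach G (tree_edges M) v" if "e \<in> tree_edges M" for e using tree_inv_ends[OF ti that] .
    show "ends G e \<subseteq> dom_of M" if "e \<in> tree_edges M" for e
      using tree_inv_ends[OF ti that] tree_inv_reach[OF ti] by simp
  qed (rule ids)
qed

text \<open>Lengths are measured here by the half-integral solution \<open>wt\<close> instead of the
  current \<open>x\<close>. A tree path of length 0 has stayed inside the solution, one of length 1
  has left it and not returned.\<close>

definition phi_inv :: "nat \<Rightarrow> nat set \<Rightarrow> entry list \<Rightarrow> bool" where
  "phi_inv v E M \<longleftrightarrow> (\<forall>u\<in>dom_of M.
     ((\<Sum>i\<in>set (lpth M u). wt (reach G E v) E i) = 0 \<longrightarrow> u \<in> reach G E v \<and> set (pth M u) \<subseteq> E) \<and>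
     ((\<Sum>i\<in>set (lpth M u). wt (reach G E v) E i) = 1 \<longrightarrow> u \<notin> reach G E v))"

lemma phi_gstep:
  assumes ph: "phi_inv v E M" and inv: "ginv v T0 D0 ids x M" and ids: "set ids \<subseteq> edges G"
    and E: "\<And>e. e \<in> E \<Longrightarrow> ends G e \<subseteq> reach G E v"
  shows "phi_inv v E (gstep ps ids x M)"
proof (rule gstep_cases[of M ids x])
  assume "gstep ps ids x M = M" then show ?thesis using ph by simp
next
  fix i a b
  assume ar: "(i, a, b) \<in> set (barcs ps M ids)"
    and g: "gstep ps ids x M = (b, dst_of M a + x i, i # lpth M a, i # pth M a) # M"
  let ?M = "(b, dst_of M a + x i, i # lpth M a, i # pth M a) # M"
  let ?X = "reach G E v" and ?W = "wt (reach G E v) E"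
  have i: "i \<in> set ids" "ends G i = {a, b}" "a \<in> dom_of M" "b \<notin> dom_of M"
    using ar set_barcs[OF ids] by auto
  have ti: "tree_inv v M" using inv by (simp add: ginv_def)
  have "i \<notin> tree_edges M" using tree_inv_ends[OF ti] tree_inv_reach[OF ti] i by auto
  moreover have "set (lpth M a) \<subseteq> tree_edges M" using inv i(3) by (simp add: ginv_def)
  ultimately have il: "i \<notin> set (lpth M a)" by auto
  have old: "lpth ?M u = lpth M u" "pth ?M u = pth M u" if "u \<in> dom_of M" for u
    using that i(4) by (auto simp: lpth_def pth_def)
  have new: "lpth ?M b = i # lpth M a" "pth ?M b = i # pth M a" by (simp_all add: lpth_def pth_def)
  have sm: "(\<Sum>j\<in>set (lpth ?M b). ?W j) = ?W i + (\<Sum>j\<in>set (lpth M a). ?W j)"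
    using il by (simp add: new)
  have pa: "(\<Sum>j\<in>set (lpth M a). ?W j) = 0 \<longrightarrow> a \<in> ?X \<and> set (pth M a) \<subseteq> E"
    "(\<Sum>j\<in>set (lpth M a). ?W j) = 1 \<longrightarrow> a \<notin> ?X" using ph i(3) by (auto simp: phi_inv_def)
  have w0: "b \<in> ?X \<and> i \<in> E" if "?W i = 0" "a \<in> ?X"
    using that i(2) E[of i] by (auto simp: wt_def split: if_splits)
  have w0': "b \<notin> ?X" if "?W i = 0" "a \<notin> ?X"
    using that i(2) by (auto simp: wt_def split: if_splits)
  have w1: "b \<notin> ?X" if "?W i = 1" "a \<in> ?X"
    using that i(2) by (auto simp: wt_def split: if_splits)
  show ?thesis unfolding g phi_inv_def
  proof
    fix u assume u: "u \<in> dom_of ?M"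
    show "((\<Sum>j\<in>set (lpth ?M u). ?W j) = 0 \<longrightarrow> u \<in> ?X \<and> set (pth ?M u) \<subseteq> E) \<and>
       ((\<Sum>j\<in>set (lpth ?M u). ?W j) = 1 \<longrightarrow> u \<notin> ?X)"
    proof (cases "u = b")
      case True
      have "b \<in> ?X \<and> set (pth ?M b) \<subseteq> E" if "(\<Sum>j\<in>set (lpth ?M b). ?W j) = 0"
        using that sm pa w0 new by simp
      moreover have "b \<notin> ?X" if "(\<Sum>j\<in>set (lpth ?M b). ?W j) = 1"
      proof -
        have "?W i = 0 \<and> (\<Sum>j\<in>set (lpth M a). ?W j) = 1 \<or> ?W i = 1 \<and> (\<Sum>j\<in>set (lpth M a). ?W j) = 0"
          using that sm by linarith
        then show ?thesis using pa w0' w1 by blast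
      qed
      ultimately show ?thesis using True by simp
    next
      case False
      then have uM: "u \<in> dom_of M" using u by simp
      show ?thesis unfolding old[OF uM] using ph uM unfolding phi_inv_def by blast
    qed
  qed
qed

lemma phi_funpow:
  assumes "phi_inv v E M" "ginv v T0 D0 ids x M" "set ids \<subseteq> edges G"
    "\<And>e. e \<in> E \<Longrightarrow> ends G e \<subseteq> reach G E v"
  shows "phi_inv v E ((gstep ps ids x ^^ n) M)"
proof (induction n)
  case (Suc n)
  then show ?case using phi_gstep[OF Suc ginv_funpow[OF assms(2,3)] assms(3,4)] by simp
qed (use assms in simp)

lemma phi_init:
  assumes "state_inv v M ids" "feas v U (tree_edges M) E"
  shows "phi_inv v E M"
proof -
  have ti: "tree_inv v M" and T: "tree_edges M \<subseteq> E" using assms by (auto simp: state_inv_def feas_def)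
  have "u \<in> reach G E v \<and> set (pth M u) \<subseteq> E \<and> lpth M u = []" if u: "u \<in> dom_of M" for u
  proof -
    have "u \<in> reach G (tree_edges M) v" using tree_inv_reach[OF ti] u by simp
    then have "u \<in> reach G E v" using reach_mono[OF T] by (rule rev_subsetD)
    moreover have "set (pth M u) \<subseteq> tree_edges M" using u by (auto simp: tree_edges_def)
    ultimately show ?thesis using T state_inv_dst[OF assms(1) u] by auto
  qed
  then show ?thesis by (auto simp: phi_inv_def)
qed

text \<open>If both root paths have weight 0, they lie in \<open>E\<close>; then balance forces
  \<open>i\<close> to be a missing inner edge, of weight 2. If one has weight 0 and the other weight
  1, \<open>i\<close> crosses the boundary and adds the second unit. In all other cases the paths
  alone have weight 2.\<close>

lemma viol_weight:
  assumes inv: "ginv v T0 D0 ids x M" and ph: "phi_inv v E M" and f: "feas v (set ids) T E"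
    and ids: "set ids \<subseteq> edges G" and c: "(i, a, b) \<in> set (arcs ps ids)" "viol M x t (i, a, b)"
  shows "wt (reach G E v) E i + (\<Sum>j\<in>set (lpth M a). wt (reach G E v) E j) +
    (\<Sum>j\<in>set (lpth M b). wt (reach G E v) E j) \<ge> 2"
proof -
  let ?X = "reach G E v" and ?W = "wt (reach G E v) E"
  let ?fa = "\<Sum>j\<in>set (lpth M a). ?W j" and ?fb = "\<Sum>j\<in>set (lpth M b). ?W j"
  have ab: "ends G i = {a, b}" "i \<in> edges G" "a \<in> dom_of M" "b \<in> dom_of M"
    and nc: "\<not> cons_edge (\<lambda>u. set (pth M u)) i a b"
    using c set_arcs[OF ids] ids by (auto simp: viol_def)
  have pa: "?fa = 0 \<Longrightarrow> a \<in> ?X \<and> set (pth M a) \<subseteq> E" "?fa = 1 \<Longrightarrow> a \<notin> ?X"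
    and pb: "?fb = 0 \<Longrightarrow> b \<in> ?X \<and> set (pth M b) \<subseteq> E" "?fb = 1 \<Longrightarrow> b \<notin> ?X"
    using ph ab unfolding phi_inv_def by blast+
  have t: "tree_ok v (\<lambda>u. set (pth M u)) (dom_of M) (tree_edges M)"
    using inv by (simp add: ginv_def tree_inv_def)
  consider "?fa \<ge> 2 \<or> ?fb \<ge> 2 \<or> (?fa = 1 \<and> ?fb = 1)" | "?fa = 0" "?fb = 0" | "?fa = 0" "?fb = 1" | "?fa = 1" "?fb = 0"
    by linarith
  then show ?thesis
  proof cases
    case 1 then show ?thesis by linarith
  next
    case 2
    have "i \<notin> E"
    proof
      assume "i \<in> E"
      then have "cons_edge (\<lambda>u. set (pth M u)) i a b"
        using bal_cons_edge[OF t, of E a b i] f pa(1)[OF 2(1)] pb(1)[OF 2(2)] ab by (simp add: feas_def)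
      then show False using nc by simp
    qed
    then have "?W i = 2" using pa(1)[OF 2(1)] pb(1)[OF 2(2)] ab by (simp add: wt_def)
    then show ?thesis by simp
  next
    case 3
    then have "?W i = 1" using pa(1) pb(2) ab by (simp add: wt_def)
    then show ?thesis using 3 by simp
  next
    case 4
    then have "?W i = 1" using pa(2) pb(1) ab by (simp add: wt_def)
    then show ?thesis using 4 by simp
  qed
qed

text \<open>Making the target a coordinate, \<open>None\<close>, turns all constraints into
  homogeneous ones, as the perceptron requires.\<close>

definition vec :: "nat \<Rightarrow> bool \<times> (nat \<Rightarrow> nat) \<times> nat \<times> nat \<Rightarrow> nat option \<Rightarrow> int" where
  "vec p y i = (case y of (fl, u, s, q) \<Rightarrow> (case i of None \<Rightarrow> (2 * int p + 1) * int s - int q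
     | Some i \<Rightarrow> int (u i) - 4 * int s))"

lemma sum_option:
  fixes f :: "nat option \<Rightarrow> int"
  shows "finite U \<Longrightarrow> (\<Sum>i\<in>insert None (Some ` U). f i) = f None + (\<Sum>i\<in>U. f (Some i))"
  by (simp add: sum.reindex)

text \<open>The comparison vector is a perturbed multiple of the half-integral solution \<open>wt\<close>.\<close>

lemma pstep_progress:
  assumes inv: "state_inv v M ids" and f: "feas v (set ids) (tree_edges M) E"
    and w: "wsum (set ids) (reach G E v) E \<le> p"
    and q: "q \<le> (2 * p + 1) * s" and nf: "\<not> fst (pstep p M ids (fl, u, s, q))"
  defines "U \<equiv> set ids" and "m \<equiv> card (set ids)"
  defines "I \<equiv> insert None (Some ` U)"
  defines "z \<equiv> (\<lambda>i. case i of None \<Rightarrow> 2 * (2 * int m + 1)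
     | Some i \<Rightarrow> (2 * int m + 1) * int (wt (reach G E v) E i) + 1)"
  defines "y \<equiv> (fl, u, s, q)" and "y' \<equiv> pstep p M ids (fl, u, s, q)"
  defines "K \<equiv> 25 * int m + (2 * int p + 1)\<^sup>2 + 1"
  shows "(\<Sum>i\<in>I. vec p y' i * z i) \<ge> (\<Sum>i\<in>I. vec p y i * z i) + 1"
    "(\<Sum>i\<in>I. vec p y' i * vec p y' i) \<le> (\<Sum>i\<in>I. vec p y i * vec p y i) + K"
    "snd (snd (snd y')) \<le> (2 * p + 1) * fst (snd (snd y'))"
proof -
  have ids: "set ids \<subseteq> edges G" "distinct ids" using inv by (auto simp: state_inv_def)
  have finU: "finite U" by (simp add: U_def)
  have mU: "m = card U" by (simp add: m_def U_def)
  let ?W = "wt (reach G E v) E"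
  let ?A = "2 * int m + 1"
  define x where "x = (\<lambda>i. u i - 4 * s)"
  define M' where "M' = (gstep ps ids x ^^ N) M"
  define t where "t = (2 * p + 1) * s - q"
  define vs where "vs = filter (viol M' x t) (arcs ps ids)"
  \<comment> \<open>The perturbation by 1 makes all lengths strictly positive. It costs
    \<open>4 * m\<close> in the objective, whereas the gap between p and p + 1/2, scaled by 2m + 1,
    leaves \<open>4 * m + 2\<close>.\<close>
  have z1: "z (Some i) \<ge> 1" for i by (simp add: z_def)
  have ps_def: "y' = (if \<exists>i\<in>U. u i \<le> 4 * s then (False, \<lambda>i. if u i \<le> 4 * s then Suc (u i) else u i, s, q)
     else if vs \<noteq> [] then (False, bump M' u (hd vs), s, Suc q)
     else if (2 * p + 1) * t \<le> 2 * sum_list (map (\<lambda>(i, a, b). x i) (arcs ps ids)) then (False, u, Suc s, q)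
     else (True, u, s, q))"
    unfolding y'_def pstep_def Let_def x_def M'_def t_def vs_def U_def by simp
  have ti: "int t = vec p y None" using q by (simp add: t_def y_def vec_def of_nat_diff algebra_simps)
  have sc: "(\<Sum>i\<in>I. vec p y' i * z i) \<ge> (\<Sum>i\<in>I. vec p y i * z i) + 1 \<and>
      (\<Sum>i\<in>I. vec p y' i * vec p y' i) \<le> (\<Sum>i\<in>I. vec p y i * vec p y i) + K"
    if "\<And>i. i \<in> I \<Longrightarrow> vec p y' i = vec p y i + a i" "(\<Sum>i\<in>I. a i * vec p y i) \<le> 0" "(\<Sum>i\<in>I. a i * z i) \<ge> 1"
    "(\<Sum>i\<in>I. a i * a i) \<le> K" for a
    using perceptron_step[of I "vec p y'" "vec p y" a z K] that by blast
  have so: "(\<Sum>i\<in>I. g i) = g None + (\<Sum>i\<in>U. g (Some i))" for g :: "nat option \<Rightarrow> int"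
    unfolding I_def by (rule sum_option[OF finU])
  have main: "((\<Sum>i\<in>I. vec p y' i * z i) \<ge> (\<Sum>i\<in>I. vec p y i * z i) + 1 \<and>
      (\<Sum>i\<in>I. vec p y' i * vec p y' i) \<le> (\<Sum>i\<in>I. vec p y i * vec p y i) + K) \<and>
      snd (snd (snd y')) \<le> (2 * p + 1) * fst (snd (snd y'))"
  proof (cases "\<exists>i\<in>U. u i \<le> 4 * s")
    case True
    then have y': "y' = (False, \<lambda>i. if u i \<le> 4 * s then Suc (u i) else u i, s, q)" by (simp add: ps_def)
    define a where "a = (\<lambda>i. case i of None \<Rightarrow> 0 | Some i \<Rightarrow> (if u i \<le> 4 * s then 1 else 0 :: int))"
    obtain i0 where i0: "i0 \<in> U" "u i0 \<le> 4 * s" using True by auto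
    have "(\<Sum>i\<in>U. a (Some i) * z (Some i)) \<ge> a (Some i0) * z (Some i0)"
      by (rule member_le_sum[OF i0(1) _ finU]) (use z1 in \<open>auto simp: a_def z_def\<close>)
    then have az: "(\<Sum>i\<in>I. a i * z i) \<ge> 1" using so z1[of i0] i0 by (simp add: a_def)
    \<comment> \<open>The constant \<open>K\<close> dominates the squared lengths of the three kinds
      of corrections: at most \<open>m\<close> here, \<open>9 * m + 1\<close> for a closed walk, on
      which an edge is counted up to three times, and \<open>16 * m\<close> plus the square of
      \<open>2 * p + 1\<close> for the objective.\<close>
    have "(\<Sum>i\<in>U. a (Some i) * a (Some i)) \<le> (\<Sum>i\<in>U. 1)" by (intro sum_mono) (auto simp: a_def)
    then have "(\<Sum>i\<in>I. a i * a i) \<le> int m"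
      using so[of "\<lambda>i. a i * a i"] mU by (simp add: a_def)
    then have aa: "(\<Sum>i\<in>I. a i * a i) \<le> K"
      using zero_le_power2[of "2 * int p + 1"] unfolding K_def by linarith
    have "(\<Sum>i\<in>U. a (Some i) * vec p y (Some i)) \<le> 0"
      by (intro sum_nonpos) (auto simp: a_def vec_def y_def)
    then have ay: "(\<Sum>i\<in>I. a i * vec p y i) \<le> 0" using so by (simp add: a_def)
    have "vec p y' i = vec p y i + a i" for i
      by (auto simp: y' y_def vec_def a_def split: option.splits)
    then show ?thesis using sc[of a] ay az aa q y' by simp
  next
    case pos: False
    have xi: "int (x i) = vec p y (Some i)" "x i \<ge> 1" if "i \<in> U" for i
      using pos that by (auto simp: x_def y_def vec_def not_le of_nat_diff)
    have gi: "ginv v (tree_edges M) (dom_of M) ids x M'" unfolding M'_def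
      by (rule ginv_funpow[OF ginv_init[OF inv] ids(1)])
    have endsE: "\<And>e. e \<in> E \<Longrightarrow> ends G e \<subseteq> reach G E v" using f by (auto simp: feas_def)
    have ph: "phi_inv v E M'" unfolding M'_def
      by (rule phi_funpow[OF phi_init[OF inv f] ginv_init[OF inv] ids(1) endsE])
    show ?thesis
    proof (cases "vs = []")
      case False
      then have y': "y' = (False, bump M' u (hd vs), s, Suc q)" using pos by (simp add: ps_def)
      obtain i a b where h: "hd vs = (i, a, b)" by (cases "hd vs") auto
      have "(i, a, b) \<in> set vs" using hd_in_set[OF False] h by simp
      then have c: "(i, a, b) \<in> set (arcs ps ids)" "viol M' x t (i, a, b)" by (auto simp: vs_def)
      have iU: "i \<in> U" using c set_arcs[OF ids(1)] by (simp add: U_def)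
      have dab: "a \<in> dom_of M'" "b \<in> dom_of M'" "dst_of M' a + dst_of M' b + x i \<le> t"
        using c by (auto simp: viol_def)
      have L: "set (lpth M' w) \<subseteq> U" "dst_of M' w = (\<Sum>j\<in>set (lpth M' w). x j)" if "w \<in> dom_of M'" for w
      proof -
        have "set (lpth M' w) \<subseteq> tree_edges M'" "tree_edges M' \<subseteq> U"
          using gi that by (simp_all add: ginv_def U_def)
        then show "set (lpth M' w) \<subseteq> U" by (rule subset_trans)
        show "dst_of M' w = (\<Sum>j\<in>set (lpth M' w). x j)" using gi that by (simp add: ginv_def)
      qed
      define g where "g w = (\<lambda>j. if j \<in> set (lpth M' w) then 1 else 0 :: int)" for w
      define e where "e = (\<lambda>j. if j = i then 1 else 0 :: int)"
      define d where "d = (\<lambda>j. case j of None \<Rightarrow> -1 | Some j \<Rightarrow> e j + g a j + g b j)"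
      have sg: "(\<Sum>j\<in>U. g w j * h j) = (\<Sum>j\<in>set (lpth M' w). h j)" if "w \<in> dom_of M'" for w and h :: "nat \<Rightarrow> int"
      proof -
        have "(\<Sum>j\<in>U. g w j * h j) = (\<Sum>j\<in>U. if j \<in> set (lpth M' w) then h j else 0)"
          by (intro sum.cong) (auto simp: g_def)
        also have "\<dots> = (\<Sum>j\<in>U \<inter> set (lpth M' w). h j)" by (simp add: sum.inter_restrict finU)
        also have "U \<inter> set (lpth M' w) = set (lpth M' w)" using L(1)[OF that] by auto
        finally show ?thesis .
      qed
      have se: "(\<Sum>j\<in>U. e j * h j) = h i" for h :: "nat \<Rightarrow> int"
      proof -
        have "(\<Sum>j\<in>U. e j * h j) = (\<Sum>j\<in>U. if j = i then h j else 0)" by (intro sum.cong) (auto simp: e_def)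
        then show ?thesis using finU iU by simp
      qed
      have sd: "(\<Sum>j\<in>U. d (Some j) * h j) = h i + (\<Sum>j\<in>set (lpth M' a). h j) + (\<Sum>j\<in>set (lpth M' b). h j)"
        for h :: "nat \<Rightarrow> int"
      proof -
        have "(\<Sum>j\<in>U. d (Some j) * h j) = (\<Sum>j\<in>U. e j * h j) + (\<Sum>j\<in>U. g a j * h j) + (\<Sum>j\<in>U. g b j * h j)"
          by (simp add: d_def distrib_right sum.distrib)
        then show ?thesis unfolding sg[OF dab(1)] sg[OF dab(2)] se .
      qed
      have sx: "(\<Sum>j\<in>set (lpth M' w). vec p y (Some j)) = int (dst_of M' w)" if "w \<in> dom_of M'" for w
      proof -
        have "(\<Sum>j\<in>set (lpth M' w). vec p y (Some j)) = (\<Sum>j\<in>set (lpth M' w). int (x j))"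
          by (intro sum.cong refl, rule xi(1)[symmetric]) (use L(1)[OF that] in auto)
        then show ?thesis using L(2)[OF that] by simp
      qed
      have ay: "(\<Sum>j\<in>I. d j * vec p y j) \<le> 0"
        using so[of "\<lambda>j. d j * vec p y j"] sd[of "\<lambda>j. vec p y (Some j)"] sx dab xi(1)[OF iU] ti
        by (simp add: d_def)
      have sz: "(\<Sum>j\<in>S. z (Some j)) \<ge> ?A * int (\<Sum>j\<in>S. ?W j)" for S
      proof -
        have "?A * int (\<Sum>j\<in>S. ?W j) = (\<Sum>j\<in>S. ?A * int (?W j))" by (simp add: sum_distrib_left)
        also have "\<dots> \<le> (\<Sum>j\<in>S. z (Some j))" by (intro sum_mono) (simp add: z_def)
        finally show ?thesis .
      qed
      have az: "(\<Sum>j\<in>I. d j * z j) \<ge> 1"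
      proof -
        have "int (?W i + (\<Sum>j\<in>set (lpth M' a). ?W j) + (\<Sum>j\<in>set (lpth M' b). ?W j)) \<ge> 2"
          using viol_weight[OF gi ph f ids(1) c] by linarith
        then have "?A * int (?W i + (\<Sum>j\<in>set (lpth M' a). ?W j) + (\<Sum>j\<in>set (lpth M' b). ?W j)) \<ge> ?A * 2"
          by (intro mult_left_mono) auto
        moreover have "(\<Sum>j\<in>I. d j * z j) = - (2 * ?A) + (z (Some i) + (\<Sum>j\<in>set (lpth M' a). z (Some j)) +
            (\<Sum>j\<in>set (lpth M' b). z (Some j)))"
          using so[of "\<lambda>j. d j * z j"] sd[of "\<lambda>j. z (Some j)"] by (simp add: d_def z_def)
        moreover have "z (Some i) = ?A * int (?W i) + 1" by (simp add: z_def)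
        ultimately show ?thesis using sz[of "set (lpth M' a)"] sz[of "set (lpth M' b)"]
          by (simp add: algebra_simps)
      qed
      have "(\<Sum>j\<in>U. d (Some j) * d (Some j)) \<le> (\<Sum>j\<in>U. 9)"
        by (intro sum_mono) (auto simp: d_def e_def g_def)
      then have "(\<Sum>j\<in>I. d j * d j) \<le> 9 * int m + 1"
        using so[of "\<lambda>j. d j * d j"] mU by (simp add: d_def)
      then have aa: "(\<Sum>j\<in>I. d j * d j) \<le> K"
        using zero_le_power2[of "2 * int p + 1"] unfolding K_def by linarith
      have "vec p y' j = vec p y j + d j" for j
        by (auto simp: y' y_def vec_def d_def e_def g_def bump_def h split: option.splits)
      \<comment> \<open>Lengths are at least 1 at this point, so a violated constraint shows that
        the target is at least 1; decreasing it keeps the truncated subtraction exact.\<close>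
      moreover have "Suc q \<le> (2 * p + 1) * s" using dab(3) xi(2)[OF iU] by (simp add: t_def)
      ultimately show ?thesis using sc[of d] ay az aa y' by simp
    next
      case True
      have c: "(2 * p + 1) * t \<le> 4 * (\<Sum>i\<in>U. x i)" and y': "y' = (False, u, Suc s, q)"
        using nf pos True sum_arcs[OF ids(2), of x ps] unfolding U_def[symmetric]
        by (auto simp: ps_def y'_def[symmetric] split: if_splits)
      define a where "a = (\<lambda>i. case i of None \<Rightarrow> 2 * int p + 1 | Some (i :: nat) \<Rightarrow> -4)"
      have sx: "(\<Sum>i\<in>U. vec p y (Some i)) = int (\<Sum>i\<in>U. x i)" using xi by simp
      have "int ((2 * p + 1) * t) \<le> int (4 * (\<Sum>i\<in>U. x i))" using c by (simp only: of_nat_le_iff)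
      then have ay: "(\<Sum>i\<in>I. a i * vec p y i) \<le> 0"
        using so[of "\<lambda>j. a j * vec p y j"] sx ti
        by (simp add: a_def sum_distrib_left[symmetric] sum_negf distrib_right)
      have zz: "(\<Sum>i\<in>U. z (Some i)) = ?A * int (wsum U (reach G E v) E) + int m"
        by (simp add: z_def sum.distrib sum_distrib_left wsum_def mU)
      have "int (wsum U (reach G E v) E) \<le> int p" using w by (simp add: U_def)
      then have "?A * int (wsum U (reach G E v) E) \<le> ?A * int p" by (intro mult_left_mono) auto
      then have "(\<Sum>i\<in>U. z (Some i)) \<le> ?A * int p + int m" using zz by simp
      then have az: "(\<Sum>i\<in>I. a i * z i) \<ge> 1"
      proof -
        have zN: "z None = 2 * ?A" by (simp add: z_def)
        have "(\<Sum>i\<in>I. a i * z i) = (2 * int p + 1) * z None - 4 * (\<Sum>i\<in>U. z (Some i))"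
          using so[of "\<lambda>j. a j * z j"] by (simp add: a_def sum_distrib_left[symmetric] sum_negf)
        moreover have "(2 * int p + 1) * z None = 4 * (?A * int p + int m) + 2"
          unfolding zN by (simp add: algebra_simps)
        ultimately have eq: "(\<Sum>i\<in>I. a i * z i) = (4 * (?A * int p + int m) + 2) - 4 * (\<Sum>i\<in>U. z (Some i))"
          by (simp only:)
        have "1 \<le> (4 * c + 2) - 4 * d" if "d \<le> c" for c d :: int using that by simp
        then show ?thesis unfolding eq using \<open>(\<Sum>i\<in>U. z (Some i)) \<le> ?A * int p + int m\<close> .
      qed
      have aa: "(\<Sum>i\<in>I. a i * a i) \<le> K"
      proof -
        have "(\<Sum>i\<in>I. a i * a i) = (2 * int p + 1)\<^sup>2 + 16 * int m"
          using so[of "\<lambda>j. a j * a j"] mU by (simp add: a_def power2_eq_square)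
        then show ?thesis unfolding K_def by simp
      qed
      have "vec p y' j = vec p y j + a j" for j
        by (auto simp: y' y_def vec_def a_def algebra_simps split: option.splits)
      then show ?thesis using sc[of a] ay az aa q y' by simp
    qed
  qed
  then show "(\<Sum>i\<in>I. vec p y' i * z i) \<ge> (\<Sum>i\<in>I. vec p y i * z i) + 1"
    "(\<Sum>i\<in>I. vec p y' i * vec p y' i) \<le> (\<Sum>i\<in>I. vec p y i * vec p y i) + K"
    "snd (snd (snd y')) \<le> (2 * p + 1) * fst (snd (snd y'))" by blast+
qed

text \<open>A finished state is a fixed point, so the flag read after exactly \<open>T\<close>
  iterations tells whether it was ever raised.\<close>

lemma pstep_stable:
  assumes "fst (pstep p M ids y)" shows "pstep p M ids (pstep p M ids y) = pstep p M ids y"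
proof -
  obtain fl u s q where y: "y = (fl, u, s, q)" by (cases y) auto
  have flag: "r = (True, D)"
    if "fst r" "r = (if a then (False, A) else if b then (False, B) else if c then (False, C) else (True, D))"
    for r :: "bool \<times> (nat \<Rightarrow> nat) \<times> nat \<times> nat" and a b c A B C D
    using that by (auto split: if_splits)
  have "pstep p M ids (fl, u, s, q) = (True, u, s, q)"
    by (rule flag[OF assms[unfolded y]]) (simp only: pstep_def Let_def prod.case)
  moreover have "pstep p M ids (True, u, s, q) = pstep p M ids (fl, u, s, q)"
    by (simp only: pstep_def prod.case)
  ultimately show ?thesis by (simp only: y)
qed

text \<open>Otherwise all \<open>T\<close> iterations are corrections. With B = m + k + 1 one has K
  at most 41 B^2 and the squared norm of \<open>z\<close> at most 16 B^3, so their number is at most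
  656 B^5, which is below (4 B)^5.\<close>

lemma solve_complete:
  assumes inv: "state_inv v M ids" and l: "lam v (set ids) (tree_edges M) p"
    and p: "p \<le> 2 * k" and T: "T \<ge> (4 * (card (set ids) + k + 1)) ^ 5"
  shows "solve T p M ids"
proof (rule ccontr)
  assume ns: "\<not> ?thesis"
  define Y where "Y j = (pstep p M ids ^^ j) (False, \<lambda>_. 0, 0, 0)" for j
  have YS: "Y (Suc j) = pstep p M ids (Y j)" for j by (simp add: Y_def)
  have stab: "fst (Y (j + i))" if "fst (Y (Suc j))" "i > 0" for i j
  proof -
    have "Y (Suc j + i') = Y (Suc j)" for i'
    proof (induction i')
      case (Suc i')
      have "Y (Suc j + Suc i') = pstep p M ids (Y (Suc j + i'))" using YS by simp
      then show ?case using Suc pstep_stable[of p M ids "Y j"] that(1) by (simp add: YS)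
    qed simp
    from this[of "i - 1"] show ?thesis using that by simp
  qed
  have nf: "\<not> fst (Y (Suc j))" if "j < T" for j
    using stab[of j "T - j"] ns that by (auto simp: solve_def Y_def)
  obtain E where f: "feas v (set ids) (tree_edges M) E" "wsum (set ids) (reach G E v) E \<le> p"
    using l by (auto simp: lam_def)
  define m where "m = card (set ids)"
  define z where "z = (\<lambda>i. case i of None \<Rightarrow> 2 * (2 * int m + 1)
     | Some i \<Rightarrow> (2 * int m + 1) * int (wt (reach G E v) E i) + 1)"
  define I where "I = insert None (Some ` set ids)"
  define K where "K = 25 * int m + (2 * int p + 1)\<^sup>2 + 1"
  have ok: "snd (snd (snd (Y j))) \<le> (2 * p + 1) * fst (snd (snd (Y j)))" if "j \<le> T" for j
    using that
  proof (induction j)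
    case 0 then show ?case by (simp add: Y_def)
  next
    case (Suc j)
    obtain fl u s q where y: "Y j = (fl, u, s, q)" by (cases "Y j") auto
    show ?case using pstep_progress(3)[OF inv f, of q s fl u] Suc nf[of j] y by (simp add: YS)
  qed
  have prog: "(\<Sum>i\<in>I. vec p (Y (Suc j)) i * z i) \<ge> (\<Sum>i\<in>I. vec p (Y j) i * z i) + 1"
    "(\<Sum>i\<in>I. vec p (Y (Suc j)) i * vec p (Y (Suc j)) i) \<le> (\<Sum>i\<in>I. vec p (Y j) i * vec p (Y j) i) + K"
    if "j < T" for j
  proof -
    obtain fl u s q where y: "Y j = (fl, u, s, q)" by (cases "Y j") auto
    have 1: "q \<le> (2 * p + 1) * s" using ok[of j] that y by simp
    have 2: "\<not> fst (pstep p M ids (fl, u, s, q))" using nf[OF that] y by (simp add: YS)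
    show "(\<Sum>i\<in>I. vec p (Y (Suc j)) i * z i) \<ge> (\<Sum>i\<in>I. vec p (Y j) i * z i) + 1"
      using pstep_progress(1)[OF inv f 1 2] unfolding YS y I_def z_def m_def by simp
    show "(\<Sum>i\<in>I. vec p (Y (Suc j)) i * vec p (Y (Suc j)) i) \<le> (\<Sum>i\<in>I. vec p (Y j) i * vec p (Y j) i) + K"
      using pstep_progress(2)[OF inv f 1 2] unfolding YS y I_def z_def m_def K_def by simp
  qed
  have y0: "vec p (Y 0) i = 0" if "i \<in> I" for i by (auto simp: Y_def vec_def split: option.splits)
  let ?B = "int m + int k + 1"
  have "0 < (4 * (card (set ids) + k + 1)) ^ 5" by simp
  then have "T > 0" using T by linarith
  then have le: "int T \<le> K * (\<Sum>i\<in>I. z i * z i)"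
    using perceptron_bound[of I "\<lambda>j. vec p (Y j)" T z K] prog y0 by blast
  have zb: "0 \<le> z i \<and> z i \<le> 4 * int m + 3" for i
  proof (cases i)
    case (Some j)
    have "wt (reach G E v) E j \<le> 2" by (simp add: wt_def)
    then have "(2 * int m + 1) * int (wt (reach G E v) E j) \<le> (2 * int m + 1) * 2"
      by (intro mult_left_mono) auto
    then show ?thesis using Some by (simp add: z_def)
  qed (simp add: z_def)
  have "z i * z i \<le> (4 * ?B) * (4 * ?B)" for i using zb[of i] by (intro mult_mono) auto
  then have "(\<Sum>i\<in>I. z i * z i) \<le> (\<Sum>i\<in>I. (4 * ?B) * (4 * ?B))" by (intro sum_mono)
  also have "\<dots> = int (card I) * ((4 * ?B) * (4 * ?B))" by simp
  also have "card I = m + 1" unfolding I_def m_def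
    by (subst card_insert_disjoint) (auto simp: card_image)
  also have "int (m + 1) * ((4 * ?B) * (4 * ?B)) \<le> ?B * ((4 * ?B) * (4 * ?B))"
    by (intro mult_right_mono) auto
  also have "?B * ((4 * ?B) * (4 * ?B)) = 16 * ?B ^ 3"
  proof -
    have "x * ((4 * x) * (4 * x)) = 16 * x ^ 3" for x :: int by (simp add: power3_eq_cube)
    then show ?thesis .
  qed
  finally have zs: "(\<Sum>i\<in>I. z i * z i) \<le> 16 * ?B ^ 3" .
  have "2 * int p + 1 \<le> 4 * ?B" using p by simp
  then have "(2 * int p + 1)\<^sup>2 \<le> (4 * ?B)\<^sup>2" by (intro power_mono) auto
  also have "(4 * ?B)\<^sup>2 = 16 * ?B\<^sup>2" unfolding power_mult_distrib by simp
  finally have "(2 * int p + 1)\<^sup>2 \<le> 16 * ?B\<^sup>2" .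
  moreover have "25 * int m + 1 \<le> 25 * ?B\<^sup>2"
  proof -
    have "?B \<le> ?B\<^sup>2" by (rule self_le_power) auto
    moreover have "25 * int m + 1 \<le> 25 * ?B" by simp
    ultimately show ?thesis by linarith
  qed
  ultimately have Kb: "K \<le> 41 * ?B\<^sup>2" unfolding K_def by linarith
  have "K * (\<Sum>i\<in>I. z i * z i) \<le> (41 * ?B\<^sup>2) * (16 * ?B ^ 3)"
    by (intro mult_mono Kb zs) (auto intro!: sum_nonneg)
  also have "\<dots> = 656 * ?B ^ 5"
  proof -
    have "(41 * x\<^sup>2) * (16 * x ^ 3) = 656 * x ^ 5" for x :: int by (simp add: eval_nat_numeral)
    then show ?thesis .
  qed
  also have "\<dots> < 1024 * ?B ^ 5" by simp
  also have "1024 * ?B ^ 5 = (4 * ?B) ^ 5" unfolding power_mult_distrib by simp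
  also have "\<dots> = int ((4 * (card (set ids) + k + 1)) ^ 5)"
    by (simp only: m_def of_nat_power of_nat_mult of_nat_add of_nat_numeral of_nat_1)
  also have "\<dots> \<le> int T" using T by (simp only: of_nat_le_iff)
  finally show False using le by simp
qed

lemma solve_iff:
  assumes "state_inv v M ids" "p \<le> 2 * k" "T \<ge> (4 * (card (set ids) + k + 1)) ^ 5"
  shows "solve T p M ids \<longleftrightarrow> lam v (set ids) (tree_edges M) p"
  using solve_sound solve_complete assms by blast

end

section \<open>Running programs\<close>

lemma steps_Skip [simp]: "steps orc t (Skip, s) = return_pmf (Skip, s)"
  by (induction t) (auto simp: bind_return_pmf)

lemma steps_add: "steps orc (a + b) cf = bind_pmf (steps orc a cf) (steps orc b)"
  by (induction a arbitrary: cf) (auto simp: bind_return_pmf bind_assoc_pmf intro: bind_pmf_cong)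

lemma steps_halted:
  assumes "\<forall>cf\<in>set_pmf (steps orc t cf0). fst cf = Skip" "t \<le> t'"
  shows "steps orc t' cf0 = steps orc t cf0"
proof -
  obtain d where d: "t' = t + d" using assms(2) le_Suc_ex by blast
  have "steps orc t' cf0 = bind_pmf (steps orc t cf0) return_pmf"
    unfolding d steps_add
  proof (rule bind_pmf_cong[OF refl])
    fix cf assume "cf \<in> set_pmf (steps orc t cf0)"
    then have "cf = (Skip, snd cf)" using assms(1) by (cases cf) auto
    then show "steps orc d cf = return_pmf cf" using steps_Skip by metis
  qed
  then show ?thesis by (simp add: bind_return_pmf')
qed

text \<open>Outcomes that halt early idle in \<open>Skip\<close> until the budget is used up, so one
  time bound per part serves all coin flips. The extra step leaves the composition.\<close>

lemma steps_Seq: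
  assumes "\<forall>cf\<in>set_pmf (steps orc t1 (c1, s)). fst cf = Skip"
    and "\<forall>cf\<in>set_pmf (steps orc t1 (c1, s)). \<forall>cf'\<in>set_pmf (steps orc t2 (c2, snd cf)). fst cf' = Skip"
  shows "steps orc (t1 + 1 + t2) (Seq c1 c2, s) = bind_pmf (steps orc t1 (c1, s)) (\<lambda>cf. steps orc t2 (c2, snd cf))"
  using assms
proof (induction t1 arbitrary: c1 s)
  case 0
  then have "c1 = Skip" by simp
  then show ?case by (simp add: bind_return_pmf)
next
  case (Suc t1)
  show ?case
  proof (cases "c1 = Skip")
    case True
    then have "steps orc (Suc t1 + 1 + t2) (Seq c1 c2, s) = steps orc (t2 + (t1 + 1)) (c2, s)"
      by (simp add: bind_return_pmf add.commute)
    also have "\<dots> = steps orc t2 (c2, s)" by (rule steps_halted) (use Suc.prems True in auto)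
    finally show ?thesis using True by (simp add: bind_return_pmf del: steps.simps)
  next
    case False
    have "steps orc (Suc t1 + 1 + t2) (Seq c1 c2, s) =
        bind_pmf (step orc c1 s) (\<lambda>cf. steps orc (t1 + 1 + t2) (Seq (fst cf) c2, snd cf))"
      using False by (simp add: bind_map_pmf case_prod_unfold)
    also have "\<dots> = bind_pmf (step orc c1 s)
        (\<lambda>cf. bind_pmf (steps orc t1 (fst cf, snd cf)) (\<lambda>cf. steps orc t2 (c2, snd cf)))"
    proof (rule bind_pmf_cong[OF refl])
      fix cf assume "cf \<in> set_pmf (step orc c1 s)"
      then have "set_pmf (steps orc t1 (fst cf, snd cf)) \<subseteq> set_pmf (steps orc (Suc t1) (c1, s))"
        by auto
      then show "steps orc (t1 + 1 + t2) (Seq (fst cf) c2, snd cf) =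
          bind_pmf (steps orc t1 (fst cf, snd cf)) (\<lambda>cf. steps orc t2 (c2, snd cf))"
        using Suc.prems by (intro Suc.IH) blast+
    qed
    finally show ?thesis by (simp add: bind_assoc_pmf)
  qed
qed

text \<open>The resulting distribution is a point mass. Everything except the loop that draws the
  coins is treated in this deterministic form.\<close>

definition runs :: "(tree \<Rightarrow> bool) \<Rightarrow> com \<Rightarrow> store \<Rightarrow> nat \<Rightarrow> store \<Rightarrow> bool" where
  "runs orc c s t s' \<longleftrightarrow> steps orc t (c, s) = return_pmf (Skip, s')"

lemma runs_mono: "runs orc c s t s' \<Longrightarrow> t \<le> t' \<Longrightarrow> runs orc c s t' s'"
  using steps_halted[of orc t "(c, s)" t'] by (auto simp: runs_def)

lemma runs_Skip: "runs orc Skip s 0 s"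
  by (simp add: runs_def)

lemma runs_Assign: "runs orc (Assign x e) s 1 (s(x := value_of e s))"
  by (simp add: runs_def bind_return_pmf)

lemma runs_Query: "runs orc (Query x e) s 1 (s(x := tree_of_bool (orc (value_of e s))))"
  by (simp add: runs_def bind_return_pmf)

lemma runs_Seq:
  assumes "runs orc c1 s t1 s1" "runs orc c2 s1 t2 s2"
  shows "runs orc (Seq c1 c2) s (t1 + 1 + t2) s2"
  using steps_Seq[of orc t1 c1 s t2 c2] assms by (auto simp: runs_def bind_return_pmf)

lemma runs_If:
  assumes "runs orc (if value_of e s \<noteq> Leaf then c1 else c2) s t s'"
  shows "runs orc (If e c1 c2) s (t + 1) s'"
  using assms by (simp add: runs_def bind_return_pmf)

lemma runs_While_False: "value_of e s = Leaf \<Longrightarrow> runs orc (While e c) s 1 s"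
  by (simp add: runs_def bind_return_pmf)

lemma runs_While_True:
  assumes "value_of e s \<noteq> Leaf" "runs orc c s t1 s1" "runs orc (While e c) s1 t2 s2"
  shows "runs orc (While e c) s (t1 + t2 + 2) s2"
proof -
  have "steps orc (Suc (t1 + 1 + t2)) (While e c, s) = steps orc (t1 + 1 + t2) (Seq c (While e c), s)"
    using assms(1) by (simp add: bind_return_pmf)
  moreover have "t1 + t2 + 2 = Suc (t1 + 1 + t2)" by simp
  ultimately show ?thesis using runs_Seq[OF assms(2,3)] unfolding runs_def by (simp del: steps.simps)
qed

section \<open>Functions on trees\<close>

text \<open>
  Variable 0 holds argument and value, variable 1 is a stack that has to be restored, and variable 2
  is scratch space.
\<close>

type_synonym tfun = "(tree \<Rightarrow> bool) \<Rightarrow> tree \<Rightarrow> tree"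

text \<open>The program is chosen before the oracle and the store, hence is uniform in both, while
  its time may depend on the oracle and the argument.\<close>

definition RT :: "tfun \<Rightarrow> ((tree \<Rightarrow> bool) \<Rightarrow> tree \<Rightarrow> nat) \<Rightarrow> bool" where
  "RT f T \<longleftrightarrow> (\<exists>C. \<forall>orc s. \<exists>s'. runs orc C s (T orc (s 0)) s' \<and> s' 0 = f orc (s 0) \<and> s' 1 = s 1)"

lemma RT_mono: "RT f T \<Longrightarrow> (\<And>orc x. T orc x \<le> T' orc x) \<Longrightarrow> RT f T'"
  unfolding RT_def using runs_mono by meson

lemma RT_id: "RT (\<lambda>orc x. x) (\<lambda>_ _. 0)"
  unfolding RT_def by (rule exI[of _ Skip]) (auto intro: runs_Skip)

lemma RT_Leaf: "RT (\<lambda>orc x. Leaf) (\<lambda>_ _. 1)"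
  unfolding RT_def
  by (rule exI[of _ "Assign 0 Nil_tree"]) (use runs_Assign in fastforce)

lemma RT_left: "RT (\<lambda>orc x. left_tree x) (\<lambda>_ _. 1)"
  unfolding RT_def
  by (rule exI[of _ "Assign 0 (Left (Var 0))"]) (use runs_Assign in fastforce)

lemma RT_right: "RT (\<lambda>orc x. right_tree x) (\<lambda>_ _. 1)"
  unfolding RT_def
  by (rule exI[of _ "Assign 0 (Right (Var 0))"]) (use runs_Assign in fastforce)

lemma RT_query: "RT (\<lambda>orc x. tree_of_bool (orc x)) (\<lambda>_ _. 1)"
  unfolding RT_def
  by (rule exI[of _ "Query 0 (Var 0)"]) (use runs_Query in fastforce)

lemma RT_comp:
  assumes "RT f Tf" "RT g Tg"
  shows "RT (\<lambda>orc x. f orc (g orc x)) (\<lambda>orc x. Tg orc x + 1 + Tf orc (g orc x))"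
proof -
  obtain Cf Cg where f: "\<And>orc s. \<exists>s'. runs orc Cf s (Tf orc (s 0)) s' \<and> s' 0 = f orc (s 0) \<and> s' 1 = s 1"
    and g: "\<And>orc s. \<exists>s'. runs orc Cg s (Tg orc (s 0)) s' \<and> s' 0 = g orc (s 0) \<and> s' 1 = s 1"
    using assms unfolding RT_def by blast
  have "\<exists>s'. runs orc (Seq Cg Cf) s (Tg orc (s 0) + 1 + Tf orc (g orc (s 0))) s' \<and>
    s' 0 = f orc (g orc (s 0)) \<and> s' 1 = s 1" for orc s
  proof -
    obtain s1 where 1: "runs orc Cg s (Tg orc (s 0)) s1" "s1 0 = g orc (s 0)" "s1 1 = s 1" using g by blast
    obtain s2 where 2: "runs orc Cf s1 (Tf orc (s1 0)) s2" "s2 0 = f orc (s1 0)" "s2 1 = s1 1" using f by blast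
    show ?thesis using runs_Seq[OF 1(1) 2(1)] 1 2 by auto
  qed
  then show ?thesis unfolding RT_def by blast
qed

text \<open>The argument is pushed on the stack to survive the run of \<open>f\<close>, and the
  value of \<open>f\<close> takes its place during the run of \<open>g\<close>. The 13 additional
  steps are six assignments and seven compositions.\<close>

lemma RT_pair:
  assumes "RT f Tf" "RT g Tg"
  shows "RT (\<lambda>orc x. Node (f orc x) (g orc x)) (\<lambda>orc x. Tf orc x + Tg orc x + 13)"
proof -
  obtain Cf Cg where f: "\<And>orc s. \<exists>s'. runs orc Cf s (Tf orc (s 0)) s' \<and> s' 0 = f orc (s 0) \<and> s' 1 = s 1"
    and g: "\<And>orc s. \<exists>s'. runs orc Cg s (Tg orc (s 0)) s' \<and> s' 0 = g orc (s 0) \<and> s' 1 = s 1"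
    using assms unfolding RT_def by blast
  let ?C = "Seq (Assign 1 (Cons_tree (Var 0) (Var 1))) (Seq Cf (Seq (Assign 2 (Left (Var 1)))
    (Seq (Assign 1 (Cons_tree (Var 0) (Right (Var 1)))) (Seq (Assign 0 (Var 2)) (Seq Cg
    (Seq (Assign 0 (Cons_tree (Left (Var 1)) (Var 0))) (Assign 1 (Right (Var 1)))))))))"
  have "\<exists>s'. runs orc ?C s (Tf orc (s 0) + Tg orc (s 0) + 13) s' \<and>
    s' 0 = Node (f orc (s 0)) (g orc (s 0)) \<and> s' 1 = s 1" for orc s
  proof -
    define s0 where "s0 = s(1 := Node (s 0) (s 1))"
    have r0: "runs orc (Assign 1 (Cons_tree (Var 0) (Var 1))) s 1 s0"
      using runs_Assign[of orc 1 "Cons_tree (Var 0) (Var 1)" s] by (simp add: s0_def)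
    obtain s1 where 1: "runs orc Cf s0 (Tf orc (s 0)) s1" "s1 0 = f orc (s 0)" "s1 1 = Node (s 0) (s 1)"
      using f[of orc s0] by (auto simp: s0_def)
    define s2 where "s2 = s1(2 := s 0)"
    have r2: "runs orc (Assign 2 (Left (Var 1))) s1 1 s2"
      using runs_Assign[of orc 2 "Left (Var 1)" s1] 1 by (simp add: s2_def)
    define s3 where "s3 = s2(1 := Node (f orc (s 0)) (s 1))"
    have r3: "runs orc (Assign 1 (Cons_tree (Var 0) (Right (Var 1)))) s2 1 s3"
      using runs_Assign[of orc 1 "Cons_tree (Var 0) (Right (Var 1))" s2] 1 by (simp add: s2_def s3_def)
    define s4 where "s4 = s3(0 := s 0)"
    have r4: "runs orc (Assign 0 (Var 2)) s3 1 s4"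
      using runs_Assign[of orc 0 "Var 2" s3] by (simp add: s2_def s3_def s4_def)
    obtain s5 where 5: "runs orc Cg s4 (Tg orc (s 0)) s5" "s5 0 = g orc (s 0)" "s5 1 = Node (f orc (s 0)) (s 1)"
      using g[of orc s4] by (auto simp: s4_def s3_def)
    define s6 where "s6 = s5(0 := Node (f orc (s 0)) (g orc (s 0)))"
    have r6: "runs orc (Assign 0 (Cons_tree (Left (Var 1)) (Var 0))) s5 1 s6"
      using runs_Assign[of orc 0 "Cons_tree (Left (Var 1)) (Var 0)" s5] 5 by (simp add: s6_def)
    define s7 where "s7 = s6(1 := s 1)"
    have r7: "runs orc (Assign 1 (Right (Var 1))) s6 1 s7"
      using runs_Assign[of orc 1 "Right (Var 1)" s6] 5 by (simp add: s6_def s7_def)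
    note R = runs_Seq[OF r0 runs_Seq[OF 1(1) runs_Seq[OF r2 runs_Seq[OF r3 runs_Seq[OF r4
      runs_Seq[OF 5(1) runs_Seq[OF r6 r7]]]]]]]
    have "runs orc ?C s (Tf orc (s 0) + Tg orc (s 0) + 13) s7" by (rule runs_mono[OF R]) simp
    then show ?thesis by (intro exI[of _ s7]) (simp add: s7_def s6_def)
  qed
  then show ?thesis unfolding RT_def by blast
qed

definition ifT :: "tree \<Rightarrow> tree \<Rightarrow> tree \<Rightarrow> tree" where
  "ifT b t e = (if b \<noteq> Leaf then t else e)"

lemma RT_if:
  assumes "RT b Tb" "RT f Tf" "RT g Tg"
  shows "RT (\<lambda>orc x. ifT (b orc x) (f orc x) (g orc x)) (\<lambda>orc x. Tb orc x + Tf orc x + Tg orc x + 10)"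
proof -
  obtain Cb Cf Cg where b: "\<And>orc s. \<exists>s'. runs orc Cb s (Tb orc (s 0)) s' \<and> s' 0 = b orc (s 0) \<and> s' 1 = s 1"
    and f: "\<And>orc s. \<exists>s'. runs orc Cf s (Tf orc (s 0)) s' \<and> s' 0 = f orc (s 0) \<and> s' 1 = s 1"
    and g: "\<And>orc s. \<exists>s'. runs orc Cg s (Tg orc (s 0)) s' \<and> s' 0 = g orc (s 0) \<and> s' 1 = s 1"
    using assms unfolding RT_def by blast
  let ?C = "Seq (Assign 1 (Cons_tree (Var 0) (Var 1))) (Seq Cb (Seq (Assign 2 (Var 0))
    (Seq (Assign 0 (Left (Var 1))) (Seq (Assign 1 (Right (Var 1))) (If (Var 2) Cf Cg)))))"
  have "\<exists>s'. runs orc ?C s (Tb orc (s 0) + Tf orc (s 0) + Tg orc (s 0) + 10) s' \<and>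
    s' 0 = ifT (b orc (s 0)) (f orc (s 0)) (g orc (s 0)) \<and> s' 1 = s 1" for orc s
  proof -
    define s0 where "s0 = s(1 := Node (s 0) (s 1))"
    have r0: "runs orc (Assign 1 (Cons_tree (Var 0) (Var 1))) s 1 s0"
      using runs_Assign[of orc 1 "Cons_tree (Var 0) (Var 1)" s] by (simp add: s0_def)
    obtain s1 where 1: "runs orc Cb s0 (Tb orc (s 0)) s1" "s1 0 = b orc (s 0)" "s1 1 = Node (s 0) (s 1)"
      using b[of orc s0] by (auto simp: s0_def)
    define s2 where "s2 = s1(2 := b orc (s 0))"
    have r2: "runs orc (Assign 2 (Var 0)) s1 1 s2"
      using runs_Assign[of orc 2 "Var 0" s1] 1 by (simp add: s2_def)
    define s3 where "s3 = s2(0 := s 0)"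
    have r3: "runs orc (Assign 0 (Left (Var 1))) s2 1 s3"
      using runs_Assign[of orc 0 "Left (Var 1)" s2] 1 by (simp add: s2_def s3_def)
    define s4 where "s4 = s3(1 := s 1)"
    have r4: "runs orc (Assign 1 (Right (Var 1))) s3 1 s4"
      using runs_Assign[of orc 1 "Right (Var 1)" s3] 1 by (simp add: s2_def s3_def s4_def)
    have s4: "s4 0 = s 0" "s4 1 = s 1" "s4 2 = b orc (s 0)" by (auto simp: s4_def s3_def s2_def)
    obtain s5 where 5: "runs orc (If (Var 2) Cf Cg) s4 (Tf orc (s 0) + Tg orc (s 0) + 1) s5"
      "s5 0 = ifT (b orc (s 0)) (f orc (s 0)) (g orc (s 0))" "s5 1 = s 1"
    proof (cases "b orc (s 0) = Leaf")
      case True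
      obtain s5 where "runs orc Cg s4 (Tg orc (s 0)) s5" "s5 0 = g orc (s 0)" "s5 1 = s 1"
        using g[of orc s4] s4 by auto
      note 5 = this
      have "runs orc (If (Var 2) Cf Cg) s4 (Tg orc (s 0) + 1) s5"
        by (rule runs_If) (use 5 True s4 in simp)
      then have "runs orc (If (Var 2) Cf Cg) s4 (Tf orc (s 0) + Tg orc (s 0) + 1) s5"
        by (rule runs_mono) simp
      then show ?thesis using that[of s5] 5 True by (simp add: ifT_def)
    next
      case False
      obtain s5 where "runs orc Cf s4 (Tf orc (s 0)) s5" "s5 0 = f orc (s 0)" "s5 1 = s 1"
        using f[of orc s4] s4 by auto
      note 5 = this
      have "runs orc (If (Var 2) Cf Cg) s4 (Tf orc (s 0) + 1) s5"
        by (rule runs_If) (use 5 False s4 in simp)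
      then have "runs orc (If (Var 2) Cf Cg) s4 (Tf orc (s 0) + Tg orc (s 0) + 1) s5"
        by (rule runs_mono) simp
      then show ?thesis using that[of s5] 5 False by (simp add: ifT_def)
    qed
    note R = runs_Seq[OF r0 runs_Seq[OF 1(1) runs_Seq[OF r2 runs_Seq[OF r3 runs_Seq[OF r4 5(1)]]]]]
    have "runs orc ?C s (Tb orc (s 0) + Tf orc (s 0) + Tg orc (s 0) + 10) s5" by (rule runs_mono[OF R]) simp
    then show ?thesis using 5 by blast
  qed
  then show ?thesis unfolding RT_def by blast
qed

primrec foldT :: "(tree \<Rightarrow> tree \<Rightarrow> tree) \<Rightarrow> tree \<Rightarrow> tree \<Rightarrow> tree" where
  "foldT b Leaf a = a"
| "foldT b (Node h t) a = foldT b t (b h a)"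

lemma foldT_fold: "foldT b t a = fold b (list_of_tree t) a"
  by (induction t arbitrary: a) auto

text \<open>The body receives the context, the element and the accumulator as one nested pair. Its
  time is bounded only at accumulators that really occur, those reached after a prefix of the list;
  a bound on the growth of the accumulator can thus be supplied later.\<close>

lemma RT_fold:
  assumes body: "RT (\<lambda>orc y. body orc (left_tree y) (left_tree (right_tree y)) (right_tree (right_tree y))) Tb"
    and l: "RT l Tl" and i: "RT i Ti"
    and B: "\<And>orc x ys h zs. list_of_tree (l orc x) = ys @ h # zs \<Longrightarrow>
      Tb orc (Node x (Node h (fold (body orc x) ys (i orc x)))) \<le> B orc x"
  shows "RT (\<lambda>orc x. foldT (body orc x) (l orc x) (i orc x))
    (\<lambda>orc x. Tl orc x + Ti orc x + 30 + nat_of_tree (l orc x) * (B orc x + 11))"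
proof -
  obtain CB where CB: "\<And>orc s. \<exists>s'. runs orc CB s (Tb orc (s 0)) s' \<and>
      s' 0 = body orc (left_tree (s 0)) (left_tree (right_tree (s 0))) (right_tree (right_tree (s 0))) \<and> s' 1 = s 1"
    using body unfolding RT_def by blast
  obtain CP where CP: "\<And>orc s. \<exists>s'. runs orc CP s (0 + (Tl orc (s 0) + Ti orc (s 0) + 13) + 13) s' \<and>
      s' 0 = Node (s 0) (Node (l orc (s 0)) (i orc (s 0))) \<and> s' 1 = s 1"
    using RT_pair[OF RT_id RT_pair[OF l i]] unfolding RT_def by blast
  let ?A1 = "Assign 1 (Cons_tree (Var 0) (Var 1))"
  let ?e2 = "Cons_tree (Left (Var 0)) (Cons_tree (Left (Left (Right (Var 0)))) (Right (Right (Var 0))))"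
  let ?e3 = "Cons_tree (Left (Left (Var 1))) (Cons_tree (Right (Left (Right (Left (Var 1))))) (Var 0))"
  let ?B = "Seq ?A1 (Seq (Assign 0 ?e2) (Seq CB (Seq (Assign 0 ?e3) (Assign 1 (Right (Var 1))))))"
  let ?W = "While (Left (Right (Var 0))) ?B"
  let ?C = "Seq CP (Seq ?W (Assign 0 (Right (Right (Var 0)))))"
  have loop: "\<exists>s'. runs orc ?W s (nat_of_tree t * (B' + 11) + 1) s' \<and>
      s' 0 = Node x (Node Leaf (foldT (body orc x) t a)) \<and> s' 1 = s 1"
    if "s 0 = Node x (Node t a)"
      "\<And>ys h zs. list_of_tree t = ys @ h # zs \<Longrightarrow> Tb orc (Node x (Node h (fold (body orc x) ys a))) \<le> B'"
    for orc s x t a B'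
    using that
  proof (induction t arbitrary: s a)
    case Leaf
    then show ?case using runs_While_False[of "Left (Right (Var 0))" s orc ?B] by (intro exI[of _ s]) auto
  next
    case (Node h t)
    let ?st = "s 0"
    define s1 where "s1 = s(1 := Node (s 0) (s 1))"
    have r1: "runs orc ?A1 s 1 s1"
      using runs_Assign[of orc 1 "Cons_tree (Var 0) (Var 1)" s] by (simp add: s1_def)
    define s2 where "s2 = s1(0 := Node x (Node h a))"
    have r2: "runs orc (Assign 0 ?e2) s1 1 s2"
      using runs_Assign[of orc 0 ?e2 s1] Node.prems by (simp add: s1_def s2_def)
    obtain s3 where 3: "runs orc CB s2 (Tb orc (Node x (Node h a))) s3" "s3 0 = body orc x h a"
      "s3 1 = Node (s 0) (s 1)" using CB[of orc s2] by (auto simp: s2_def s1_def)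
    define s4 where "s4 = s3(0 := Node x (Node t (body orc x h a)))"
    have r4: "runs orc (Assign 0 ?e3) s3 1 s4"
      using runs_Assign[of orc 0 ?e3 s3] 3 Node.prems by (simp add: s4_def)
    define s5 where "s5 = s4(1 := s 1)"
    have r5: "runs orc (Assign 1 (Right (Var 1))) s4 1 s5"
      using runs_Assign[of orc 1 "Right (Var 1)" s4] 3 by (simp add: s4_def s5_def)
    note R = runs_Seq[OF r1 runs_Seq[OF r2 runs_Seq[OF 3(1) runs_Seq[OF r4 r5]]]]
    have TB: "Tb orc (Node x (Node h a)) \<le> B'" using Node.prems(2)[of "[]" h "list_of_tree t"] by simp
    have rB: "runs orc ?B s (B' + 9) s5" by (rule runs_mono[OF R]) (use TB in simp)
    have "\<exists>s'. runs orc ?W s5 (nat_of_tree t * (B' + 11) + 1) s' \<and>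
      s' 0 = Node x (Node Leaf (foldT (body orc x) t (body orc x h a))) \<and> s' 1 = s5 1"
    proof (rule Node.IH(2))
      show "s5 0 = Node x (Node t (body orc x h a))" by (simp add: s5_def s4_def)
      show "Tb orc (Node x (Node h' (fold (body orc x) ys (body orc x h a)))) \<le> B'"
        if "list_of_tree t = ys @ h' # zs" for ys h' zs
        using Node.prems(2)[of "h # ys" h' zs] that by simp
    qed
    then obtain s6 where 6: "runs orc ?W s5 (nat_of_tree t * (B' + 11) + 1) s6"
      "s6 0 = Node x (Node Leaf (foldT (body orc x) t (body orc x h a)))" "s6 1 = s 1"
      by (auto simp: s5_def)
    have "value_of (Left (Right (Var 0))) s \<noteq> Leaf" using Node.prems by simp
    from runs_While_True[OF this rB 6(1)]
    have "runs orc ?W s (nat_of_tree (Node h t) * (B' + 11) + 1) s6" by (rule runs_mono) simp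
    then show ?case using 6 by auto
  qed
  have "\<exists>s'. runs orc ?C s (Tl orc (s 0) + Ti orc (s 0) + 30 + nat_of_tree (l orc (s 0)) * (B orc (s 0) + 11)) s' \<and>
    s' 0 = foldT (body orc (s 0)) (l orc (s 0)) (i orc (s 0)) \<and> s' 1 = s 1" for orc s
  proof -
    obtain s1 where 1: "runs orc CP s (0 + (Tl orc (s 0) + Ti orc (s 0) + 13) + 13) s1"
      "s1 0 = Node (s 0) (Node (l orc (s 0)) (i orc (s 0)))" "s1 1 = s 1" using CP by blast
    obtain s2 where 2: "runs orc ?W s1 (nat_of_tree (l orc (s 0)) * (B orc (s 0) + 11) + 1) s2"
      "s2 0 = Node (s 0) (Node Leaf (foldT (body orc (s 0)) (l orc (s 0)) (i orc (s 0))))" "s2 1 = s1 1"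
      using loop[of s1 "s 0" "l orc (s 0)" "i orc (s 0)" orc "B orc (s 0)"] 1(2) B[of orc "s 0"] by blast
    have r3: "runs orc (Assign 0 (Right (Right (Var 0)))) s2 1
        (s2(0 := foldT (body orc (s 0)) (l orc (s 0)) (i orc (s 0))))"
      using runs_Assign[of orc 0 "Right (Right (Var 0))" s2] 2 by simp
    note R = runs_Seq[OF 1(1) runs_Seq[OF 2(1) r3]]
    show ?thesis
      by (rule exI, rule conjI, rule runs_mono[OF R]) (use 1 2 in auto)
  qed
  then show ?thesis unfolding RT_def by blast
qed

section \<open>Polynomial time\<close>

text \<open>
  Duplicating subtrees makes the number of nodes useless as a measure of size.  We use the maximal
  length of a list at any level of nesting instead.
\<close>

primrec mu :: "tree \<Rightarrow> nat" where
  "mu Leaf = 0"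
| "mu (Node l r) = max (mu l) (max (mu r) (Suc (nat_of_tree r)))"

lemma nat_of_tree_le_mu: "nat_of_tree t \<le> mu t"
  by (cases t) auto

lemma mu_Node: "mu (Node l r) \<le> max (mu l) (mu r) + 1"
  using nat_of_tree_le_mu[of r] by auto

lemma mu_left: "mu (left_tree t) \<le> mu t"
  by (cases t) auto

lemma mu_right: "mu (right_tree t) \<le> mu t"
  by (cases t) auto

lemma length_list_of_tree: "length (list_of_tree t) = nat_of_tree t"
  by (induction t) auto

lemma mu_list_of_tree: "h \<in> set (list_of_tree t) \<Longrightarrow> mu h \<le> mu t"
  by (induction t) (auto simp: max_def)

text \<open>The base is at least 2, so one exponent absorbs constants and sums as well.\<close>

definition polyb :: "((tree \<Rightarrow> bool) \<Rightarrow> tree \<Rightarrow> nat) \<Rightarrow> bool" where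
  "polyb g \<longleftrightarrow> (\<exists>c. \<forall>orc x. g orc x \<le> (mu x + 2) ^ c)"

lemma polyb_le: "polyb g \<Longrightarrow> (\<And>orc x. f orc x \<le> g orc x) \<Longrightarrow> polyb f"
  unfolding polyb_def by (meson le_trans)

lemma polyb_const: "polyb (\<lambda>_ _. k)"
proof -
  have "k \<le> (mu x + 2) ^ k" for x
  proof -
    have "k \<le> 2 ^ k" by (simp add: less_imp_le)
    also have "(2::nat) ^ k \<le> (mu x + 2) ^ k" by (rule power_mono) auto
    finally show ?thesis .
  qed
  then show ?thesis unfolding polyb_def by blast
qed

lemma polyb_add: "polyb f \<Longrightarrow> polyb g \<Longrightarrow> polyb (\<lambda>orc x. f orc x + g orc x)"
proof -
  assume "polyb f" "polyb g"
  then obtain c d where c: "\<And>orc x. f orc x \<le> (mu x + 2) ^ c" and d: "\<And>orc x. g orc x \<le> (mu x + 2) ^ d"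
    unfolding polyb_def by blast
  have "f orc x + g orc x \<le> (mu x + 2) ^ (c + d + 1)" for orc x
  proof -
    have "(mu x + 2) ^ c \<le> (mu x + 2) ^ (c + d)" "(mu x + 2) ^ d \<le> (mu x + 2) ^ (c + d)"
      by (intro power_increasing; simp)+
    then have "f orc x + g orc x \<le> 2 * (mu x + 2) ^ (c + d)" using c[of orc x] d[of orc x] by linarith
    also have "\<dots> \<le> (mu x + 2) * (mu x + 2) ^ (c + d)" by (rule mult_right_mono) auto
    finally show ?thesis by simp
  qed
  then show ?thesis unfolding polyb_def by blast
qed

lemma polyb_mult: "polyb f \<Longrightarrow> polyb g \<Longrightarrow> polyb (\<lambda>orc x. f orc x * g orc x)"
proof -
  assume "polyb f" "polyb g"
  then obtain c d where c: "\<And>orc x. f orc x \<le> (mu x + 2) ^ c" and d: "\<And>orc x. g orc x \<le> (mu x + 2) ^ d"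
    unfolding polyb_def by blast
  have "f orc x * g orc x \<le> (mu x + 2) ^ (c + d)" for orc x
    using mult_mono[OF c d] by (simp add: power_add)
  then show ?thesis unfolding polyb_def by blast
qed

lemma polyb_mu: "polyb (\<lambda>orc x. mu x)"
  unfolding polyb_def by (rule exI[of _ 1]) auto

lemma polyb_power: "polyb f \<Longrightarrow> polyb (\<lambda>orc x. f orc x ^ n)"
  by (induction n) (auto intro: polyb_mult polyb_const)

lemma polyb_comp:
  assumes "polyb g" "polyb (\<lambda>orc x. mu (f orc x))"
  shows "polyb (\<lambda>orc x. g orc (f orc x))"
proof -
  obtain c where c: "\<And>orc x. g orc x \<le> (mu x + 2) ^ c" using assms(1) unfolding polyb_def by blast
  have "polyb (\<lambda>orc x. (mu (f orc x) + 2) ^ c)" using assms(2) by (intro polyb_power polyb_add polyb_const)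
  then show ?thesis by (rule polyb_le) (rule c)
qed

text \<open>Besides the time, the measure of the value has to be polynomial, for otherwise the class
  would not be closed under composition.\<close>

definition PT :: "tfun \<Rightarrow> bool" where
  "PT f \<longleftrightarrow> (\<exists>T. RT f T \<and> polyb T) \<and> polyb (\<lambda>orc x. mu (f orc x))"

lemma PT_intro: "RT f T \<Longrightarrow> polyb T \<Longrightarrow> polyb (\<lambda>orc x. mu (f orc x)) \<Longrightarrow> PT f"
  unfolding PT_def by blast

lemma PT_id: "PT (\<lambda>orc x. x)"
  by (rule PT_intro[OF RT_id polyb_const polyb_mu])

lemma PT_Leaf: "PT (\<lambda>orc x. Leaf)"
  by (rule PT_intro[OF RT_Leaf polyb_const]) (simp add: polyb_const)

lemma PT_comp: "PT f \<Longrightarrow> PT g \<Longrightarrow> PT (\<lambda>orc x. f orc (g orc x))"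
proof -
  assume "PT f" "PT g"
  then obtain Tf Tg where T: "RT f Tf" "RT g Tg" "polyb Tf" "polyb Tg"
    "polyb (\<lambda>orc x. mu (f orc x))" "polyb (\<lambda>orc x. mu (g orc x))" unfolding PT_def by blast
  show ?thesis
  proof (rule PT_intro[OF RT_comp[OF T(1,2)]])
    show "polyb (\<lambda>orc x. Tg orc x + 1 + Tf orc (g orc x))"
      by (intro polyb_add polyb_const T polyb_comp[OF T(3,6)])
    show "polyb (\<lambda>orc x. mu (f orc (g orc x)))" by (rule polyb_comp[OF T(5,6)])
  qed
qed

lemma PT_left: "PT f \<Longrightarrow> PT (\<lambda>orc x. left_tree (f orc x))"
  by (rule PT_comp[OF PT_intro[OF RT_left polyb_const]]) (rule polyb_le[OF polyb_mu mu_left])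

lemma PT_right: "PT f \<Longrightarrow> PT (\<lambda>orc x. right_tree (f orc x))"
  by (rule PT_comp[OF PT_intro[OF RT_right polyb_const]]) (rule polyb_le[OF polyb_mu mu_right])

lemma PT_query: "PT f \<Longrightarrow> PT (\<lambda>orc x. tree_of_bool (orc (f orc x)))"
  by (rule PT_comp[OF PT_intro[OF RT_query polyb_const]])
    (rule polyb_le[OF polyb_const[of 1]], simp add: tree_of_bool_def)

lemma PT_Node: "PT f \<Longrightarrow> PT g \<Longrightarrow> PT (\<lambda>orc x. Node (f orc x) (g orc x))"
proof -
  assume "PT f" "PT g"
  then obtain Tf Tg where T: "RT f Tf" "RT g Tg" "polyb Tf" "polyb Tg"
    "polyb (\<lambda>orc x. mu (f orc x))" "polyb (\<lambda>orc x. mu (g orc x))" unfolding PT_def by blast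
  show ?thesis
  proof (rule PT_intro[OF RT_pair[OF T(1,2)]])
    show "polyb (\<lambda>orc x. Tf orc x + Tg orc x + 13)" using T by (intro polyb_add polyb_const)
    have "polyb (\<lambda>orc x. mu (f orc x) + mu (g orc x) + 1)" using T by (intro polyb_add polyb_const)
    then show "polyb (\<lambda>orc x. mu (Node (f orc x) (g orc x)))"
      by (rule polyb_le) (rule le_trans[OF mu_Node], simp)
  qed
qed

lemma PT_if: "PT b \<Longrightarrow> PT f \<Longrightarrow> PT g \<Longrightarrow> PT (\<lambda>orc x. ifT (b orc x) (f orc x) (g orc x))"
proof -
  assume "PT b" "PT f" "PT g"
  then obtain Tb Tf Tg where T: "RT b Tb" "RT f Tf" "RT g Tg" "polyb Tb" "polyb Tf" "polyb Tg"
    "polyb (\<lambda>orc x. mu (f orc x))" "polyb (\<lambda>orc x. mu (g orc x))" unfolding PT_def by blast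
  show ?thesis
  proof (rule PT_intro[OF RT_if[OF T(1-3)]])
    show "polyb (\<lambda>orc x. Tb orc x + Tf orc x + Tg orc x + 10)" using T by (intro polyb_add polyb_const)
    have "polyb (\<lambda>orc x. mu (f orc x) + mu (g orc x))" using T by (intro polyb_add polyb_const)
    then show "polyb (\<lambda>orc x. mu (ifT (b orc x) (f orc x) (g orc x)))"
      by (rule polyb_le) (simp add: ifT_def)
  qed
qed

lemma mu_fold_additive:
  assumes "\<And>h a. h \<in> set hs \<Longrightarrow> mu (b h a) \<le> mu a + q"
  shows "mu (fold b hs a) \<le> mu a + length hs * q"
  using assms
proof (induction hs arbitrary: a)
  case (Cons h hs)
  have "mu (fold b hs (b h a)) \<le> mu (b h a) + length hs * q" using Cons by simp
  also have "mu (b h a) \<le> mu a + q" using Cons.prems by simp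
  finally show ?case by simp
qed simp

text \<open>The increment of the measure per round must not depend on the accumulator; then a fold
  adds at most as many increments as there are elements. Repeated doubling of the accumulator, which
  would be exponential, is ruled out by this.\<close>

lemma PT_fold:
  assumes body: "PT (\<lambda>orc y. body orc (left_tree y) (left_tree (right_tree y)) (right_tree (right_tree y)))"
    and l: "PT l" and i: "PT i"
    and growth: "\<And>orc x h a. mu (body orc x h a) \<le> mu a + (mu x + mu h + 2) ^ c"
  shows "PT (\<lambda>orc x. foldT (body orc x) (l orc x) (i orc x))"
proof -
  obtain Tb Tl Ti where T: "RT (\<lambda>orc y. body orc (left_tree y) (left_tree (right_tree y)) (right_tree (right_tree y))) Tb"
    "RT l Tl" "RT i Ti" "polyb Tb" "polyb Tl" "polyb Ti" "polyb (\<lambda>orc x. mu (l orc x))" "polyb (\<lambda>orc x. mu (i orc x))"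
    using assms(1-3) unfolding PT_def by blast
  obtain d where d: "\<And>orc x. Tb orc x \<le> (mu x + 2) ^ d" using T(4) unfolding polyb_def by blast
  define A where "A = (\<lambda>orc x. mu (i orc x) + mu (l orc x) * (mu x + mu (l orc x) + 2) ^ c)"
  have A: "polyb A" unfolding A_def
    by (intro polyb_add polyb_mult polyb_power polyb_const polyb_mu T)
  have acc: "mu (fold (body orc x) ys (i orc x)) \<le> A orc x" if "set ys \<subseteq> set (list_of_tree (l orc x))"
    "length ys \<le> nat_of_tree (l orc x)" for orc x ys
  proof -
    have "mu (fold (body orc x) ys (i orc x)) \<le> mu (i orc x) + length ys * (mu x + mu (l orc x) + 2) ^ c"
    proof (rule mu_fold_additive)
      fix h a assume "h \<in> set ys"
      then have "mu h \<le> mu (l orc x)" using that mu_list_of_tree by blast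
      then have "(mu x + mu h + 2) ^ c \<le> (mu x + mu (l orc x) + 2) ^ c" by (intro power_mono) auto
      then show "mu (body orc x h a) \<le> mu a + (mu x + mu (l orc x) + 2) ^ c"
        using growth[of orc x h a] by linarith
    qed
    also have "\<dots> \<le> A orc x" unfolding A_def
      using that nat_of_tree_le_mu[of "l orc x"] by (intro add_left_mono mult_right_mono) auto
    finally show ?thesis .
  qed
  define B where "B = (\<lambda>orc x. (mu x + mu (l orc x) + A orc x + 4) ^ d)"
  have B: "polyb B" unfolding B_def by (intro polyb_add polyb_power polyb_const polyb_mu T A)
  have TB: "Tb orc (Node x (Node h (fold (body orc x) ys (i orc x)))) \<le> B orc x"
    if e: "list_of_tree (l orc x) = ys @ h # zs" for orc x ys h zs
  proof -
    let ?a = "fold (body orc x) ys (i orc x)"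
    have "mu ?a \<le> A orc x"
    proof (rule acc)
      show "set ys \<subseteq> set (list_of_tree (l orc x))" using e by auto
      show "length ys \<le> nat_of_tree (l orc x)" using e length_list_of_tree[of "l orc x"] by simp
    qed
    moreover have "mu h \<le> mu (l orc x)" using mu_list_of_tree[of h "l orc x"] e by simp
    moreover have "mu (Node x (Node h ?a)) \<le> max (mu x) (mu (Node h ?a)) + 1" by (rule mu_Node)
    moreover have "mu (Node h ?a) \<le> max (mu h) (mu ?a) + 1" by (rule mu_Node)
    ultimately have "mu (Node x (Node h ?a)) + 2 \<le> mu x + mu (l orc x) + A orc x + 4" by linarith
    then have "(mu (Node x (Node h ?a)) + 2) ^ d \<le> B orc x" unfolding B_def by (intro power_mono) auto
    then show ?thesis using d le_trans by blast
  qed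
  show ?thesis
  proof (rule PT_intro)
    show "RT (\<lambda>orc x. foldT (body orc x) (l orc x) (i orc x))
      (\<lambda>orc x. Tl orc x + Ti orc x + 30 + nat_of_tree (l orc x) * (B orc x + 11))"
      by (rule RT_fold[OF T(1-3)]) (rule TB)
    have "polyb (\<lambda>orc x. Tl orc x + Ti orc x + 30 + mu (l orc x) * (B orc x + 11))"
      by (intro polyb_add polyb_mult polyb_const T B)
    then show "polyb (\<lambda>orc x. Tl orc x + Ti orc x + 30 + nat_of_tree (l orc x) * (B orc x + 11))"
      by (rule polyb_le) (intro add_left_mono mult_right_mono nat_of_tree_le_mu, simp)
    show "polyb (\<lambda>orc x. mu (foldT (body orc x) (l orc x) (i orc x)))"
      by (rule polyb_le[OF A]) (simp add: foldT_fold acc length_list_of_tree)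
  qed
qed

section \<open>Tree programs\<close>

declare mu.simps(2) [simp del]

lemma mu_one [simp]: "mu (Node Leaf Leaf) = Suc 0"
  by (simp add: mu.simps(2))

text \<open>A function of several arguments is analysed once, as a function of a nested pair, and
  afterwards arbitrary polynomial-time expressions may be substituted.\<close>

lemma PT2: "PT (\<lambda>orc x. F orc (left_tree x) (right_tree x)) \<Longrightarrow> PT a \<Longrightarrow> PT b \<Longrightarrow>
    PT (\<lambda>orc x. F orc (a orc x) (b orc x))"
  using PT_comp[of "\<lambda>orc x. F orc (left_tree x) (right_tree x)" "\<lambda>orc x. Node (a orc x) (b orc x)"]
  by (simp add: PT_Node)

lemma PT3: "PT (\<lambda>orc x. F orc (left_tree x) (left_tree (right_tree x)) (right_tree (right_tree x))) \<Longrightarrow>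
    PT a \<Longrightarrow> PT b \<Longrightarrow> PT c \<Longrightarrow> PT (\<lambda>orc x. F orc (a orc x) (b orc x) (c orc x))"
  using PT2[of "\<lambda>orc x y. F orc x (left_tree y) (right_tree y)" a "\<lambda>orc x. Node (b orc x) (c orc x)"]
  by (simp add: PT_Node)

lemma PT4: "PT (\<lambda>orc x. F orc (left_tree x) (left_tree (right_tree x)) (left_tree (right_tree (right_tree x)))
      (right_tree (right_tree (right_tree x)))) \<Longrightarrow>
    PT a \<Longrightarrow> PT b \<Longrightarrow> PT c \<Longrightarrow> PT d \<Longrightarrow> PT (\<lambda>orc x. F orc (a orc x) (b orc x) (c orc x) (d orc x))"
  using PT3[of "\<lambda>orc x y z. F orc x y (left_tree z) (right_tree z)" a b "\<lambda>orc x. Node (c orc x) (d orc x)"]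
  by (simp add: PT_Node)

lemma PT5: "PT (\<lambda>orc x. F orc (left_tree x) (left_tree (right_tree x)) (left_tree (right_tree (right_tree x)))
      (left_tree (right_tree (right_tree (right_tree x)))) (right_tree (right_tree (right_tree (right_tree x))))) \<Longrightarrow>
    PT a \<Longrightarrow> PT b \<Longrightarrow> PT c \<Longrightarrow> PT d \<Longrightarrow> PT e \<Longrightarrow>
    PT (\<lambda>orc x. F orc (a orc x) (b orc x) (c orc x) (d orc x) (e orc x))"
  using PT4[of "\<lambda>orc x y z w. F orc x y z (left_tree w) (right_tree w)" a b c "\<lambda>orc x. Node (d orc x) (e orc x)"]
  by (simp add: PT_Node)

lemmas PT_basic = PT_id PT_Leaf PT_left PT_right PT_Node PT_if PT_query

definition notT :: "tree \<Rightarrow> tree" where "notT b = ifT b Leaf (Node Leaf Leaf)"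
definition andT :: "tree \<Rightarrow> tree \<Rightarrow> tree" where "andT a b = ifT a b Leaf"
definition orT :: "tree \<Rightarrow> tree \<Rightarrow> tree" where "orT a b = ifT a (Node Leaf Leaf) b"

lemma PT_not: "PT a \<Longrightarrow> PT (\<lambda>orc x. notT (a orc x))"
  unfolding notT_def by (intro PT_basic)

lemma PT_and: "PT a \<Longrightarrow> PT b \<Longrightarrow> PT (\<lambda>orc x. andT (a orc x) (b orc x))"
  unfolding andT_def by (intro PT_basic)

lemma PT_or: "PT a \<Longrightarrow> PT b \<Longrightarrow> PT (\<lambda>orc x. orT (a orc x) (b orc x))"
  unfolding orT_def by (intro PT_basic)

lemma bool_simps [simp]:
  "ifT (tree_of_bool b) t e = (if b then t else e)"
  "notT (tree_of_bool b) = tree_of_bool (\<not> b)"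
  "andT (tree_of_bool a) (tree_of_bool b) = tree_of_bool (a \<and> b)"
  "orT (tree_of_bool a) (tree_of_bool b) = tree_of_bool (a \<or> b)"
  "tree_of_bool b = Leaf \<longleftrightarrow> \<not> b"
  by (auto simp: ifT_def notT_def andT_def orT_def tree_of_bool_def)

lemma andT_False [simp]: "andT (tree_of_bool False) t = tree_of_bool False"
  by (simp add: andT_def tree_of_bool_def ifT_def)

lemma andT_True [simp]: "andT (tree_of_bool True) t = t"
  by (simp add: andT_def tree_of_bool_def ifT_def)

lemma mu_bool: "mu (tree_of_bool b) \<le> 1"
  by (simp add: tree_of_bool_def)

subsection \<open>Arithmetic\<close>

definition subT :: "tree \<Rightarrow> tree \<Rightarrow> tree" where "subT a b = foldT (\<lambda>h acc. right_tree acc) b a"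
definition leT :: "tree \<Rightarrow> tree \<Rightarrow> tree" where "leT a b = notT (subT a b)"
definition ltT :: "tree \<Rightarrow> tree \<Rightarrow> tree" where "ltT a b = notT (leT b a)"
definition eqT :: "tree \<Rightarrow> tree \<Rightarrow> tree" where "eqT a b = andT (leT a b) (leT b a)"
definition addT :: "tree \<Rightarrow> tree \<Rightarrow> tree" where "addT a b = foldT (\<lambda>h acc. Node Leaf acc) a b"
definition mulT :: "tree \<Rightarrow> tree \<Rightarrow> tree" where "mulT a b = foldT (\<lambda>h acc. addT b acc) a Leaf"

lemma PT_sub: "PT a \<Longrightarrow> PT b \<Longrightarrow> PT (\<lambda>orc x. subT (a orc x) (b orc x))"
  unfolding subT_def
  by (rule PT_fold[where body="\<lambda>orc x h acc. right_tree acc" and c=0])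
    (auto intro!: PT_basic le_SucI[OF mu_right])

lemma PT_le: "PT a \<Longrightarrow> PT b \<Longrightarrow> PT (\<lambda>orc x. leT (a orc x) (b orc x))"
  unfolding leT_def by (intro PT_not PT_sub)

lemma PT_lt: "PT a \<Longrightarrow> PT b \<Longrightarrow> PT (\<lambda>orc x. ltT (a orc x) (b orc x))"
  unfolding ltT_def by (intro PT_not PT_le)

lemma PT_eq: "PT a \<Longrightarrow> PT b \<Longrightarrow> PT (\<lambda>orc x. eqT (a orc x) (b orc x))"
  unfolding eqT_def by (intro PT_and PT_le)

lemma mu_Node_Leaf: "mu (Node Leaf a) \<le> mu a + 1"
  using mu_Node[of Leaf a] by simp

lemma PT_add: "PT a \<Longrightarrow> PT b \<Longrightarrow> PT (\<lambda>orc x. addT (a orc x) (b orc x))"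
  unfolding addT_def
  by (rule PT_fold[where body="\<lambda>orc x h acc. Node Leaf acc" and c=0])
    (auto intro!: PT_basic mu_Node_Leaf[unfolded Suc_eq_plus1[symmetric]])

lemma mu_add: "mu (addT a b) \<le> mu b + nat_of_tree a"
proof -
  have "mu (fold (\<lambda>h acc. Node Leaf acc) (list_of_tree a) b) \<le> mu b + length (list_of_tree a) * 1"
    by (rule mu_fold_additive) (rule mu_Node_Leaf)
  then show ?thesis unfolding addT_def by (simp add: foldT_fold length_list_of_tree)
qed

lemma mu_add': "mu (addT a b) \<le> mu b + mu a"
  using mu_add[of a b] nat_of_tree_le_mu[of a] by linarith

lemma PT_mul: "PT a \<Longrightarrow> PT b \<Longrightarrow> PT (\<lambda>orc x. mulT (a orc x) (b orc x))"
proof (rule PT2[where F="\<lambda>orc. mulT"])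
  show "PT (\<lambda>orc x. mulT (left_tree x) (right_tree x))"
    unfolding mulT_def
  proof (rule PT_fold[where body="\<lambda>orc x h acc. addT (right_tree x) acc" and c=1])
    show "PT (\<lambda>orc y. addT (right_tree (left_tree y)) (right_tree (right_tree y)))"
      by (intro PT_add PT_basic)
    show "mu (addT (right_tree x) acc) \<le> mu acc + (mu x + mu h + 2) ^ 1" for x h acc
      using mu_add'[of "right_tree x" acc] mu_right[of x] by simp
  qed (intro PT_basic)+
qed

lemma sub_nat [simp]: "subT (tree_of_nat a) (tree_of_nat b) = tree_of_nat (a - b)"
proof (induction b arbitrary: a)
  case (Suc b)
  have "right_tree (tree_of_nat a) = tree_of_nat (a - 1)" by (cases a) auto
  then show ?case using Suc[of "a - 1"] by (simp add: subT_def)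
qed (simp add: subT_def)

lemma nat_tree_Leaf [simp]: "tree_of_nat n = Leaf \<longleftrightarrow> n = 0"
  by (cases n) auto

lemma not_nat: "notT (tree_of_nat n) = tree_of_bool (n = 0)"
  by (auto simp: notT_def ifT_def tree_of_bool_def)

lemma le_nat [simp]: "leT (tree_of_nat a) (tree_of_nat b) = tree_of_bool (a \<le> b)"
  by (simp add: leT_def not_nat)

lemma lt_nat [simp]: "ltT (tree_of_nat a) (tree_of_nat b) = tree_of_bool (a < b)"
  by (simp add: ltT_def not_le)

lemma eq_nat [simp]: "eqT (tree_of_nat a) (tree_of_nat b) = tree_of_bool (a = b)"
  by (simp add: eqT_def order_eq_iff)

lemma add_nat [simp]: "addT (tree_of_nat a) (tree_of_nat b) = tree_of_nat (a + b)"
proof (induction a arbitrary: b)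
  case (Suc a)
  have "addT (tree_of_nat (Suc a)) (tree_of_nat b) = addT (tree_of_nat a) (tree_of_nat (Suc b))"
    by (simp add: addT_def)
  then show ?case using Suc[of "Suc b"] by simp
qed (simp add: addT_def)

lemma mul_nat [simp]: "mulT (tree_of_nat a) (tree_of_nat b) = tree_of_nat (a * b)"
proof -
  have "foldT (\<lambda>h acc. addT (tree_of_nat b) acc) (tree_of_nat a) (tree_of_nat c) = tree_of_nat (a * b + c)" for c
    by (induction a arbitrary: c) (auto simp: algebra_simps)
  from this[of 0] show ?thesis by (simp add: mulT_def)
qed

lemma bool_nat: "tree_of_bool b = tree_of_nat (if b then 1 else 0)"
  by (simp add: tree_of_bool_def)

subsection \<open>Lists\<close>

definition revT :: "tree \<Rightarrow> tree" where "revT l = foldT Node l Leaf"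
text \<open>The first list comes out reversed. This is harmless, as concatenations are only ever
  read as sets.\<close>

definition appT :: "tree \<Rightarrow> tree \<Rightarrow> tree" where "appT a b = foldT Node a b"
definition mapT :: "(tree \<Rightarrow> tree) \<Rightarrow> tree \<Rightarrow> tree" where
  "mapT f l = revT (foldT (\<lambda>h acc. Node (f h) acc) l Leaf)"
definition filterT :: "(tree \<Rightarrow> tree) \<Rightarrow> tree \<Rightarrow> tree" where
  "filterT p l = revT (foldT (\<lambda>h acc. ifT (p h) (Node h acc) acc) l Leaf)"
definition exT :: "(tree \<Rightarrow> tree) \<Rightarrow> tree \<Rightarrow> tree" where
  "exT p l = foldT (\<lambda>h acc. ifT (p h) (Node Leaf Leaf) acc) l Leaf"
definition allT :: "(tree \<Rightarrow> tree) \<Rightarrow> tree \<Rightarrow> tree" where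
  "allT p l = notT (exT (\<lambda>h. notT (p h)) l)"

lemma fold_Node: "fold Node xs (tree_of_list ys) = tree_of_list (rev xs @ ys)"
  by (induction xs arbitrary: ys) (auto simp flip: tree_of_list.simps(2))

lemma list_of_tree_of_list [simp]: "list_of_tree (tree_of_list xs) = xs"
  by (induction xs) auto

lemma tree_of_list_of_tree [simp]: "tree_of_list (list_of_tree t) = t"
  by (induction t) auto

lemma revT_eq: "revT t = tree_of_list (rev (list_of_tree t))"
  using fold_Node[of "list_of_tree t" "[]"] by (simp add: revT_def foldT_fold)

lemma appT_eq: "appT a b = tree_of_list (rev (list_of_tree a) @ list_of_tree b)"
  using fold_Node[of "list_of_tree a" "list_of_tree b"] by (simp add: appT_def foldT_fold)

lemma mapT_eq: "mapT f t = tree_of_list (map f (list_of_tree t))"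
proof -
  have "fold (\<lambda>h acc. Node (f h) acc) xs (tree_of_list ys) = tree_of_list (rev (map f xs) @ ys)" for xs ys
    by (induction xs arbitrary: ys) (auto simp flip: tree_of_list.simps(2))
  from this[of "list_of_tree t" "[]"] show ?thesis by (simp add: mapT_def foldT_fold revT_eq)
qed

lemma filterT_eq: "filterT p t = tree_of_list (filter (\<lambda>h. p h \<noteq> Leaf) (list_of_tree t))"
proof -
  have "fold (\<lambda>h acc. ifT (p h) (Node h acc) acc) xs (tree_of_list ys) =
      tree_of_list (rev (filter (\<lambda>h. p h \<noteq> Leaf) xs) @ ys)" for xs ys
    by (induction xs arbitrary: ys) (auto simp: ifT_def simp flip: tree_of_list.simps(2))
  from this[of "list_of_tree t" "[]"] show ?thesis by (simp add: filterT_def foldT_fold revT_eq)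
qed

lemma exT_eq: "exT p t = tree_of_bool (\<exists>h\<in>set (list_of_tree t). p h \<noteq> Leaf)"
proof -
  have "fold (\<lambda>h acc. ifT (p h) (Node Leaf Leaf) acc) xs acc =
      (if \<exists>h\<in>set xs. p h \<noteq> Leaf then Node Leaf Leaf else acc)" for xs acc
    by (induction xs arbitrary: acc) (auto simp: ifT_def)
  from this[of "list_of_tree t" Leaf] show ?thesis by (simp add: exT_def foldT_fold tree_of_bool_def)
qed

lemma allT_eq: "allT p t = tree_of_bool (\<forall>h\<in>set (list_of_tree t). p h \<noteq> Leaf)"
  by (auto simp: allT_def exT_eq notT_def ifT_def tree_of_bool_def)

lemma mu_leI: "(\<And>h. h \<in> set (list_of_tree t) \<Longrightarrow> mu h \<le> B) \<Longrightarrow> nat_of_tree t \<le> B \<Longrightarrow> mu t \<le> B"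
  by (induction t) (auto simp: mu.simps(2))

lemma nat_of_tree_of_list [simp]: "nat_of_tree (tree_of_list xs) = length xs"
  by (induction xs) auto

lemma mu_filter: "mu (filterT p t) \<le> mu t"
proof (rule mu_leI)
  show "nat_of_tree (filterT p t) \<le> mu t"
    using length_filter_le[of "\<lambda>h. p h \<noteq> Leaf" "list_of_tree t"] nat_of_tree_le_mu[of t]
    by (simp add: filterT_eq length_list_of_tree)
qed (auto simp: filterT_eq mu_list_of_tree)

lemma mu_map: "(\<And>h. h \<in> set (list_of_tree t) \<Longrightarrow> mu (f h) \<le> B) \<Longrightarrow> mu t \<le> B \<Longrightarrow> mu (mapT f t) \<le> B"
  by (rule mu_leI) (use nat_of_tree_le_mu[of t] in \<open>auto simp: mapT_eq length_list_of_tree\<close>)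

lemma mu_app: "mu (appT a b) \<le> mu a + mu b"
proof (rule mu_leI)
  show "mu h \<le> mu a + mu b" if "h \<in> set (list_of_tree (appT a b))" for h
    using that mu_list_of_tree[of h a] mu_list_of_tree[of h b] by (auto simp: appT_eq)
  show "nat_of_tree (appT a b) \<le> mu a + mu b"
    using nat_of_tree_le_mu[of a] nat_of_tree_le_mu[of b] by (simp add: appT_eq length_list_of_tree)
qed

lemma mu_ex: "mu (exT p t) \<le> 1"
  unfolding exT_eq by (rule mu_bool)

lemma PT_rev: "PT l \<Longrightarrow> PT (\<lambda>orc x. revT (l orc x))"
  unfolding revT_def
proof (rule PT_fold[where body="\<lambda>orc x h acc. Node h acc" and c=1])
  show "mu (Node h acc) \<le> mu acc + (mu x + mu h + 2) ^ 1" for x h acc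
    using mu_Node[of h acc] by simp
qed (intro PT_basic | assumption)+

lemma PT_app: "PT a \<Longrightarrow> PT b \<Longrightarrow> PT (\<lambda>orc x. appT (a orc x) (b orc x))"
  unfolding appT_def
proof (rule PT_fold[where body="\<lambda>orc x h acc. Node h acc" and c=1])
  show "mu (Node h acc) \<le> mu acc + (mu x + mu h + 2) ^ 1" for x h acc
    using mu_Node[of h acc] by simp
qed (intro PT_basic | assumption)+

lemma PT_lift:
  assumes "PT (\<lambda>orc y. f orc (left_tree y) (right_tree y))"
  shows "PT (\<lambda>orc y. f orc (left_tree y) (left_tree (right_tree y)))"
  using PT_comp[OF assms, of "\<lambda>orc y. Node (left_tree y) (left_tree (right_tree y))"]
  by (simp add: PT_basic)

lemma PT_map:
  assumes f: "PT (\<lambda>orc y. f orc (left_tree y) (right_tree y))" and l: "PT l"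
  shows "PT (\<lambda>orc x. mapT (f orc x) (l orc x))"
proof -
  obtain c where c: "\<And>orc y. mu (f orc (left_tree y) (right_tree y)) \<le> (mu y + 2) ^ c"
    using f unfolding PT_def polyb_def by blast
  show ?thesis unfolding mapT_def
  \<comment> \<open>The factor 2 in the exponent passes from the measure of a pair to the measures
    of its parts, since \<open>mu (Node x h) + 2\<close> is at most the square of
    \<open>mu x + mu h + 2\<close>; the additional 1 pays for the new list cell.\<close>
  proof (rule PT_rev, rule PT_fold[where body="\<lambda>orc x h acc. Node (f orc x h) acc" and c="2 * c + 1"])
    show "PT (\<lambda>orc y. Node (f orc (left_tree y) (left_tree (right_tree y))) (right_tree (right_tree y)))"
      by (intro PT_basic PT_lift[OF f])
    show "mu (Node (f orc x h) acc) \<le> mu acc + (mu x + mu h + 2) ^ (2 * c + 1)" for orc x h acc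
    proof -
      let ?m = "mu x + mu h + 2"
      have "mu (f orc x h) \<le> (mu (Node x h) + 2) ^ c" using c[of orc "Node x h"] by simp
      also have "\<dots> \<le> (?m ^ 2) ^ c"
      proof (rule power_mono)
        have "mu (Node x h) + 2 \<le> ?m + 1" using mu_Node[of x h] by simp
        also have "\<dots> \<le> ?m * 2" by simp
        also have "\<dots> \<le> ?m * ?m" by (rule mult_left_mono) auto
        finally show "mu (Node x h) + 2 \<le> ?m ^ 2" by (simp add: power2_eq_square)
      qed simp
      also have "\<dots> = ?m ^ (2 * c)" by (simp add: power_mult)
      finally have 1: "mu (f orc x h) \<le> ?m ^ (2 * c)" .
      have "?m ^ (2 * c) + 1 \<le> ?m ^ (2 * c) * 2" by simp
      also have "\<dots> \<le> ?m ^ (2 * c) * ?m" by (rule mult_left_mono) auto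
      finally have "?m ^ (2 * c) + 1 \<le> ?m ^ (2 * c + 1)" by (simp only: power_add power_one_right)
      then have "mu (f orc x h) + 1 \<le> ?m ^ (2 * c + 1)" using 1 by linarith
      then show ?thesis using mu_Node[of "f orc x h" acc] by linarith
    qed
  qed (intro PT_basic l)+
qed

lemma PT_filter:
  assumes p: "PT (\<lambda>orc y. p orc (left_tree y) (right_tree y))" and l: "PT l"
  shows "PT (\<lambda>orc x. filterT (p orc x) (l orc x))"
  unfolding filterT_def
proof (rule PT_rev, rule PT_fold[where body="\<lambda>orc x h acc. ifT (p orc x h) (Node h acc) acc" and c=1])
  show "PT (\<lambda>orc y. ifT (p orc (left_tree y) (left_tree (right_tree y)))
      (Node (left_tree (right_tree y)) (right_tree (right_tree y))) (right_tree (right_tree y)))"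
    by (intro PT_basic PT_lift[OF p])
  show "mu (ifT (p orc x h) (Node h acc) acc) \<le> mu acc + (mu x + mu h + 2) ^ 1" for orc x h acc
  proof -
    have "mu (Node h acc) \<le> mu h + mu acc + 1" using mu_Node[of h acc] by linarith
    then show ?thesis by (simp add: ifT_def)
  qed
qed (intro PT_basic l)+

lemma PT_ex:
  assumes p: "PT (\<lambda>orc y. p orc (left_tree y) (right_tree y))" and l: "PT l"
  shows "PT (\<lambda>orc x. exT (p orc x) (l orc x))"
  unfolding exT_def
proof (rule PT_fold[where body="\<lambda>orc x h acc. ifT (p orc x h) (Node Leaf Leaf) acc" and c=1])
  show "PT (\<lambda>orc y. ifT (p orc (left_tree y) (left_tree (right_tree y))) (Node Leaf Leaf) (right_tree (right_tree y)))"
    by (intro PT_basic PT_lift[OF p])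
qed (intro PT_basic l | simp add: ifT_def)+

lemma PT_all:
  assumes p: "PT (\<lambda>orc y. p orc (left_tree y) (right_tree y))" and l: "PT l"
  shows "PT (\<lambda>orc x. allT (p orc x) (l orc x))"
  unfolding allT_def by (intro PT_not PT_ex l p)

lemmas PT_rules = PT_basic PT_not PT_and PT_or PT_sub PT_le PT_lt PT_eq PT_add PT_mul PT_rev PT_app
  PT_map PT_filter PT_ex PT_all

subsection \<open>The branching procedure\<close>

text \<open>
  An arc is stored as \<open>(i, a, b, u)\<close> with its current length \<open>u\<close>, and every edge contributes both of
  its orientations.
\<close>

definition idT :: "tree \<Rightarrow> tree" where "idT c = left_tree c"
definition srcT :: "tree \<Rightarrow> tree" where "srcT c = left_tree (right_tree c)"
definition tgtT :: "tree \<Rightarrow> tree" where "tgtT c = left_tree (right_tree (right_tree c))"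
definition lenT :: "tree \<Rightarrow> tree" where "lenT c = right_tree (right_tree (right_tree c))"
definition setT :: "tree \<Rightarrow> tree \<Rightarrow> tree" where
  "setT c u = Node (idT c) (Node (srcT c) (Node (tgtT c) u))"

definition memT :: "tree \<Rightarrow> tree \<Rightarrow> tree" where "memT i l = exT (\<lambda>h. eqT h i) l"
definition inT :: "tree \<Rightarrow> tree \<Rightarrow> tree" where "inT M a = exT (\<lambda>e. eqT (left_tree e) a) M"
definition lookT :: "tree \<Rightarrow> tree \<Rightarrow> tree" where
  "lookT M a = left_tree (filterT (\<lambda>e. eqT (left_tree e) a) M)"
definition dstT :: "tree \<Rightarrow> tree \<Rightarrow> tree" where "dstT M a = left_tree (right_tree (lookT M a))"
definition lpthT :: "tree \<Rightarrow> tree \<Rightarrow> tree" where "lpthT M a = left_tree (right_tree (right_tree (lookT M a)))"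
definition pthT :: "tree \<Rightarrow> tree \<Rightarrow> tree" where "pthT M a = right_tree (right_tree (right_tree (lookT M a)))"

definition barcsT :: "tree \<Rightarrow> tree \<Rightarrow> tree" where
  "barcsT M A = filterT (\<lambda>c. andT (inT M (srcT c)) (notT (inT M (tgtT c)))) A"
definition keyT :: "tree \<Rightarrow> tree \<Rightarrow> tree" where "keyT M c = addT (dstT M (srcT c)) (lenT c)"
definition gextT :: "tree \<Rightarrow> tree \<Rightarrow> tree" where
  "gextT M c = Node (Node (tgtT c) (Node (keyT M c)
     (Node (Node (idT c) (lpthT M (srcT c))) (Node (idT c) (pthT M (srcT c)))))) M"
definition minT :: "tree \<Rightarrow> tree \<Rightarrow> tree" where
  "minT M bs = filterT (\<lambda>c. notT (exT (\<lambda>c'. ltT (keyT M c') (keyT M c)) bs)) bs"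
definition gstepT :: "tree \<Rightarrow> tree \<Rightarrow> tree" where
  "gstepT A M = ifT (minT M (barcsT M A)) (gextT M (left_tree (minT M (barcsT M A)))) M"
definition growT :: "tree \<Rightarrow> tree \<Rightarrow> tree \<Rightarrow> tree" where
  "growT V A M = foldT (\<lambda>h M. gstepT A M) V M"

definition sdT :: "tree \<Rightarrow> tree \<Rightarrow> tree" where
  "sdT P Q = appT (filterT (\<lambda>h. notT (memT h Q)) P) (filterT (\<lambda>h. notT (memT h P)) Q)"
definition consT :: "(tree \<Rightarrow> bool) \<Rightarrow> tree \<Rightarrow> tree \<Rightarrow> tree \<Rightarrow> tree" where
  "consT orc i P Q = orT (memT i (sdT P Q)) (tree_of_bool (orc (Node i (sdT P Q))))"
definition cyT :: "(tree \<Rightarrow> bool) \<Rightarrow> tree \<Rightarrow> tree \<Rightarrow> tree" where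
  "cyT orc M c = consT orc (idT c) (pthT M (srcT c)) (pthT M (tgtT c))"
definition violT :: "(tree \<Rightarrow> bool) \<Rightarrow> tree \<Rightarrow> tree \<Rightarrow> tree \<Rightarrow> tree" where
  "violT orc M t c = andT (inT M (srcT c)) (andT (inT M (tgtT c))
     (andT (leT (addT (addT (dstT M (srcT c)) (dstT M (tgtT c))) (lenT c)) t) (notT (cyT orc M c))))"
text \<open>Truth values coincide with the unary numbers 0 and 1, so the outcomes of the tests can
  be added directly.\<close>

definition bumpT :: "tree \<Rightarrow> tree \<Rightarrow> tree \<Rightarrow> tree" where
  "bumpT M e A = mapT (\<lambda>c. setT c (addT (memT (idT c) (lpthT M (tgtT e)))
     (addT (memT (idT c) (lpthT M (srcT e))) (addT (eqT (idT c) (idT e)) (lenT c))))) A"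
definition sumT :: "tree \<Rightarrow> tree" where "sumT A = foldT (\<lambda>c acc. addT (lenT c) acc) A Leaf"

definition redT :: "tree \<Rightarrow> tree \<Rightarrow> tree" where
  "redT s A = mapT (\<lambda>c. setT c (subT (lenT c) (addT (addT s s) (addT s s)))) A"
definition incT :: "tree \<Rightarrow> tree \<Rightarrow> tree" where
  "incT s A = mapT (\<lambda>c. setT c (addT (leT (lenT c) (addT (addT s s) (addT s s))) (lenT c))) A"
definition lowT :: "tree \<Rightarrow> tree \<Rightarrow> tree" where
  "lowT s A = exT (\<lambda>c. leT (lenT c) (addT (addT s s) (addT s s))) A"
definition stT :: "tree \<Rightarrow> tree \<Rightarrow> tree \<Rightarrow> tree \<Rightarrow> tree" where
  "stT fl A s q = Node fl (Node A (Node s q))"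
definition corrT :: "(tree \<Rightarrow> bool) \<Rightarrow> tree \<Rightarrow> tree \<Rightarrow> tree \<Rightarrow> tree \<Rightarrow> tree \<Rightarrow> tree" where
  "corrT orc M p2 A s q = ifT (filterT (violT orc M (subT (mulT p2 s) q)) (redT s A))
     (stT Leaf (bumpT M (left_tree (filterT (violT orc M (subT (mulT p2 s) q)) (redT s A))) A) s (Node Leaf q))
     (ifT (leT (mulT p2 (subT (mulT p2 s) q)) (addT (sumT (redT s A)) (sumT (redT s A))))
        (stT Leaf A (Node Leaf s) q) (stT (Node Leaf Leaf) A s q))"
definition pstepT :: "(tree \<Rightarrow> bool) \<Rightarrow> tree \<Rightarrow> tree \<Rightarrow> tree \<Rightarrow> tree \<Rightarrow> tree \<Rightarrow> tree \<Rightarrow> tree" where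
  "pstepT orc V M p2 A s q = ifT (lowT s A) (stT Leaf (incT s A) s q)
     (corrT orc (growT V (redT s A) M) p2 A s q)"
definition solveT :: "(tree \<Rightarrow> bool) \<Rightarrow> tree \<Rightarrow> tree \<Rightarrow> tree \<Rightarrow> tree \<Rightarrow> tree \<Rightarrow> tree" where
  "solveT orc T V M A p2 = left_tree (foldT (\<lambda>h y. pstepT orc V M p2 (left_tree (right_tree y))
     (left_tree (right_tree (right_tree y))) (right_tree (right_tree (right_tree y)))) T (stT Leaf A Leaf Leaf))"

definition extT :: "tree \<Rightarrow> tree \<Rightarrow> tree" where
  "extT M c = Node (Node (tgtT c) (Node Leaf (Node Leaf (Node (idT c) (pthT M (srcT c)))))) M"
definition absT :: "(tree \<Rightarrow> bool) \<Rightarrow> tree \<Rightarrow> tree \<Rightarrow> tree \<Rightarrow> tree \<Rightarrow> tree" where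
  "absT orc C M A c = allT (\<lambda>p2. orT (notT (solveT orc (left_tree C) (left_tree (right_tree C)) M A p2))
     (solveT orc (left_tree C) (left_tree (right_tree C)) (extT M c) A p2)) (right_tree (right_tree C))"
definition dropT :: "tree \<Rightarrow> tree \<Rightarrow> tree" where
  "dropT c A = filterT (\<lambda>c'. notT (eqT (idT c') (idT c))) A"
definition branchT :: "tree \<Rightarrow> tree \<Rightarrow> tree \<Rightarrow> tree \<Rightarrow> tree" where
  "branchT bs M A bits = ifT (andT bs bits)
     (ifT (left_tree bits) (Node (extT M (left_tree bs)) (Node A (right_tree bits)))
        (Node M (Node (dropT (left_tree bs) A) (right_tree bits))))
     (Node M (Node A bits))"
definition bstepT :: "(tree \<Rightarrow> bool) \<Rightarrow> tree \<Rightarrow> tree \<Rightarrow> tree \<Rightarrow> tree \<Rightarrow> tree" where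
  "bstepT orc C M A bits = ifT (filterT (absT orc C M A) (barcsT M A))
     (Node (extT M (left_tree (filterT (absT orc C M A) (barcsT M A)))) (Node A bits))
     (branchT (barcsT M A) M A bits)"

text \<open>The context \<open>C\<close> consists of an iteration count, and of what \<^const>\<open>absT\<close> needs.\<close>

definition outT :: "(tree \<Rightarrow> bool) \<Rightarrow> tree \<Rightarrow> tree \<Rightarrow> tree \<Rightarrow> tree \<Rightarrow> tree" where
  "outT orc C A v bits = left_tree (foldT (\<lambda>h st. bstepT orc (right_tree C) (left_tree st)
     (left_tree (right_tree st)) (right_tree (right_tree st))) (left_tree C)
     (Node (Node (Node v (Node Leaf (Node Leaf Leaf))) Leaf) (Node A bits)))"
definition lostT :: "(tree \<Rightarrow> bool) \<Rightarrow> tree \<Rightarrow> tree \<Rightarrow> tree" where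
  "lostT orc M A = filterT (\<lambda>c. andT (orT (inT M (srcT c)) (inT M (tgtT c)))
     (notT (andT (inT M (srcT c)) (andT (inT M (tgtT c)) (cyT orc M c))))) A"
definition vertsT :: "tree \<Rightarrow> tree" where "vertsT M = mapT left_tree M"
definition subsetT :: "tree \<Rightarrow> tree \<Rightarrow> tree" where "subsetT X Y = allT (\<lambda>x. memT x Y) X"

section \<open>Polynomial running time of the branching programs\<close>

lemma PT_arc: "PT c \<Longrightarrow> PT (\<lambda>orc x. idT (c orc x))" "PT c \<Longrightarrow> PT (\<lambda>orc x. srcT (c orc x))"
  "PT c \<Longrightarrow> PT (\<lambda>orc x. tgtT (c orc x))" "PT c \<Longrightarrow> PT (\<lambda>orc x. lenT (c orc x))"
  unfolding idT_def srcT_def tgtT_def lenT_def by (intro PT_basic; assumption)+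

lemma PT_set: "PT c \<Longrightarrow> PT u \<Longrightarrow> PT (\<lambda>orc x. setT (c orc x) (u orc x))"
  unfolding setT_def by (intro PT_basic PT_arc)

lemma PT_mem: "PT a \<Longrightarrow> PT b \<Longrightarrow> PT (\<lambda>orc x. memT (a orc x) (b orc x))"
  by (rule PT2[where F="\<lambda>orc. memT"]) (unfold memT_def, intro PT_rules)

lemma PT_in: "PT a \<Longrightarrow> PT b \<Longrightarrow> PT (\<lambda>orc x. inT (a orc x) (b orc x))"
  by (rule PT2[where F="\<lambda>orc. inT"]) (unfold inT_def, intro PT_rules)

lemma PT_look: "PT a \<Longrightarrow> PT b \<Longrightarrow> PT (\<lambda>orc x. lookT (a orc x) (b orc x))"
  by (rule PT2[where F="\<lambda>orc. lookT"]) (unfold lookT_def, intro PT_rules)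

lemma PT_entry: "PT a \<Longrightarrow> PT b \<Longrightarrow> PT (\<lambda>orc x. dstT (a orc x) (b orc x))"
  "PT a \<Longrightarrow> PT b \<Longrightarrow> PT (\<lambda>orc x. lpthT (a orc x) (b orc x))"
  "PT a \<Longrightarrow> PT b \<Longrightarrow> PT (\<lambda>orc x. pthT (a orc x) (b orc x))"
  unfolding dstT_def lpthT_def pthT_def by (intro PT_basic PT_look; assumption)+

lemmas PT_rules1 = PT_rules PT_arc PT_set PT_mem PT_in PT_look PT_entry

lemma PT_barcs: "PT a \<Longrightarrow> PT b \<Longrightarrow> PT (\<lambda>orc x. barcsT (a orc x) (b orc x))"
  by (rule PT2[where F="\<lambda>orc. barcsT"]) (unfold barcsT_def, intro PT_rules1)

lemma PT_key: "PT a \<Longrightarrow> PT b \<Longrightarrow> PT (\<lambda>orc x. keyT (a orc x) (b orc x))"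
  unfolding keyT_def by (intro PT_rules1)

lemma PT_gext: "PT a \<Longrightarrow> PT b \<Longrightarrow> PT (\<lambda>orc x. gextT (a orc x) (b orc x))"
  unfolding gextT_def by (intro PT_rules1 PT_key)

lemma PT_min: "PT a \<Longrightarrow> PT b \<Longrightarrow> PT (\<lambda>orc x. minT (a orc x) (b orc x))"
  by (rule PT2[where F="\<lambda>orc. minT"]) (unfold minT_def, intro PT_rules1 PT_key)

lemma PT_gstep: "PT a \<Longrightarrow> PT b \<Longrightarrow> PT (\<lambda>orc x. gstepT (a orc x) (b orc x))"
  unfolding gstepT_def by (intro PT_rules1 PT_min PT_gext PT_barcs)

lemma mu_arc: "mu (idT c) \<le> mu c" "mu (srcT c) \<le> mu c" "mu (tgtT c) \<le> mu c" "mu (lenT c) \<le> mu c"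
  unfolding idT_def srcT_def tgtT_def lenT_def using mu_left mu_right le_trans by meson+

lemma mu_entry: "mu (dstT M a) \<le> mu M" "mu (lpthT M a) \<le> mu M" "mu (pthT M a) \<le> mu M"
  unfolding dstT_def lpthT_def pthT_def lookT_def using mu_left mu_right mu_filter le_trans by meson+

lemma mu_NodeI: "mu a \<le> B \<Longrightarrow> mu b \<le> B \<Longrightarrow> mu (Node a b) \<le> B + 1"
  using mu_Node[of a b] by linarith

lemma mu_Node_le: "mu (Node a b) \<le> mu a + mu b + 1"
  using mu_Node[of a b] by linarith

lemma mu_gext: "mu (gextT M c) \<le> mu M + mu c + 4"
proof -
  let ?B = "mu M + mu c"
  have 1: "mu (keyT M c) \<le> ?B"
    unfolding keyT_def using mu_add'[of "dstT M (srcT c)" "lenT c"] mu_entry(1)[of M "srcT c"] mu_arc(4)[of c] by linarith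
  have 2: "mu (Node (idT c) (lpthT M (srcT c))) \<le> ?B + 1" "mu (Node (idT c) (pthT M (srcT c))) \<le> ?B + 1"
    using mu_entry(2,3)[of M "srcT c"] mu_arc(1)[of c] by (intro mu_NodeI; linarith)+
  have "mu (Node (Node (idT c) (lpthT M (srcT c))) (Node (idT c) (pthT M (srcT c)))) \<le> ?B + 1 + 1"
    by (intro mu_NodeI 2)
  then have "mu (Node (keyT M c) (Node (Node (idT c) (lpthT M (srcT c))) (Node (idT c) (pthT M (srcT c))))) \<le> ?B + 2 + 1"
    using 1 by (intro mu_NodeI) auto
  moreover have "Suc (nat_of_tree (Node (keyT M c) (Node (Node (idT c) (lpthT M (srcT c))) (Node (idT c) (pthT M (srcT c))))))
      \<le> ?B + 4" using nat_of_tree_le_mu[of "pthT M (srcT c)"] mu_entry(3)[of M "srcT c"] by simp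
  ultimately have "mu (Node (tgtT c) (Node (keyT M c) (Node (Node (idT c) (lpthT M (srcT c))) (Node (idT c) (pthT M (srcT c)))))) \<le> ?B + 4"
    using mu_arc(3)[of c] unfolding mu.simps(2)[of "tgtT c"] by linarith
  moreover have "Suc (nat_of_tree M) \<le> ?B + 4" using nat_of_tree_le_mu[of M] by simp
  ultimately show ?thesis unfolding gextT_def mu.simps(2)[of _ M] by simp
qed

text \<open>The new entry copies a path that is already stored. Since \<open>mu\<close> is a maximum
  over nested lists, the copy costs only a constant, which gives the additive growth that
  \<open>PT_fold\<close> demands.\<close>

lemma mu_gstep: "mu (gstepT A M) \<le> mu M + (mu A + 4)"
proof -
  let ?c = "left_tree (minT M (barcsT M A))"
  have "mu ?c \<le> mu A" unfolding minT_def barcsT_def using mu_left mu_filter le_trans by meson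
  then have "mu (gextT M ?c) \<le> mu M + (mu A + 4)" using mu_gext[of M ?c] by linarith
  then show ?thesis by (simp add: gstepT_def ifT_def)
qed

lemma PT_grow: "PT a \<Longrightarrow> PT b \<Longrightarrow> PT c \<Longrightarrow> PT (\<lambda>orc x. growT (a orc x) (b orc x) (c orc x))"
proof (rule PT3[where F="\<lambda>orc. growT"])
  show "PT (\<lambda>orc x. growT (left_tree x) (left_tree (right_tree x)) (right_tree (right_tree x)))"
    unfolding growT_def
  proof (rule PT_fold[where body="\<lambda>orc x h M. gstepT (left_tree (right_tree x)) M" and c=3])
    show "mu (gstepT (left_tree (right_tree x)) M) \<le> mu M + (mu x + mu h + 2) ^ 3" for x h M
    proof -
      have "mu (left_tree (right_tree x)) \<le> mu x" using mu_left mu_right le_trans by meson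
      moreover have "n + 4 \<le> (n + m + 2) ^ 3" for n m :: nat
      proof -
        have "n + 4 \<le> (n + m + 2) * (2 * 2)" by simp
        also have "\<dots> \<le> (n + m + 2) * ((n + m + 2) * (n + m + 2))" by (intro mult_mono) auto
        finally show ?thesis by (simp only: power3_eq_cube mult.assoc)
      qed
      from this[of "mu x" "mu h"] show ?thesis
        using mu_gstep[of "left_tree (right_tree x)" M] calculation by linarith
    qed
  qed (intro PT_gstep PT_basic)+
qed

lemma PT_sd: "PT a \<Longrightarrow> PT b \<Longrightarrow> PT (\<lambda>orc x. sdT (a orc x) (b orc x))"
  by (rule PT2[where F="\<lambda>orc. sdT"]) (unfold sdT_def, intro PT_rules1)

lemma PT_cons: "PT a \<Longrightarrow> PT b \<Longrightarrow> PT c \<Longrightarrow> PT (\<lambda>orc x. consT orc (a orc x) (b orc x) (c orc x))"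
  unfolding consT_def by (intro PT_rules1 PT_sd)

lemma PT_cy: "PT a \<Longrightarrow> PT b \<Longrightarrow> PT (\<lambda>orc x. cyT orc (a orc x) (b orc x))"
  unfolding cyT_def by (intro PT_rules1 PT_cons)

lemma PT_viol: "PT a \<Longrightarrow> PT b \<Longrightarrow> PT c \<Longrightarrow> PT (\<lambda>orc x. violT orc (a orc x) (b orc x) (c orc x))"
  unfolding violT_def by (intro PT_rules1 PT_cy)

lemma PT_bump: "PT a \<Longrightarrow> PT b \<Longrightarrow> PT c \<Longrightarrow> PT (\<lambda>orc x. bumpT (a orc x) (b orc x) (c orc x))"
  by (rule PT3[where F="\<lambda>orc. bumpT"]) (unfold bumpT_def, intro PT_rules1)

lemma PT_sum: "PT a \<Longrightarrow> PT (\<lambda>orc x. sumT (a orc x))"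
  unfolding sumT_def
proof (rule PT_fold[where body="\<lambda>orc x h acc. addT (lenT h) acc" and c=1])
  show "mu (addT (lenT h) acc) \<le> mu acc + (mu x + mu h + 2) ^ 1" for x h acc
    using mu_add'[of "lenT h" acc] mu_arc(4)[of h] by simp
qed (intro PT_rules1 | assumption)+

lemma PT_red: "PT a \<Longrightarrow> PT b \<Longrightarrow> PT (\<lambda>orc x. redT (a orc x) (b orc x))"
  by (rule PT2[where F="\<lambda>orc. redT"]) (unfold redT_def, intro PT_rules1)

lemma PT_inc: "PT a \<Longrightarrow> PT b \<Longrightarrow> PT (\<lambda>orc x. incT (a orc x) (b orc x))"
  by (rule PT2[where F="\<lambda>orc. incT"]) (unfold incT_def, intro PT_rules1)

lemma PT_low: "PT a \<Longrightarrow> PT b \<Longrightarrow> PT (\<lambda>orc x. lowT (a orc x) (b orc x))"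
  by (rule PT2[where F="\<lambda>orc. lowT"]) (unfold lowT_def, intro PT_rules1)

lemma PT_st: "PT a \<Longrightarrow> PT b \<Longrightarrow> PT c \<Longrightarrow> PT d \<Longrightarrow> PT (\<lambda>orc x. stT (a orc x) (b orc x) (c orc x) (d orc x))"
  unfolding stT_def by (intro PT_rules1)

lemma PT_corr: "PT a \<Longrightarrow> PT b \<Longrightarrow> PT c \<Longrightarrow> PT d \<Longrightarrow> PT e \<Longrightarrow>
    PT (\<lambda>orc x. corrT orc (a orc x) (b orc x) (c orc x) (d orc x) (e orc x))"
  by (rule PT5[where F="corrT"]) (unfold corrT_def, intro PT_rules1 PT_viol PT_bump PT_sum PT_red PT_st)

lemma PT_pstep: "PT a \<Longrightarrow> PT b \<Longrightarrow> PT c \<Longrightarrow> PT d \<Longrightarrow> PT e \<Longrightarrow> PT f \<Longrightarrow>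
    PT (\<lambda>orc x. pstepT orc (a orc x) (b orc x) (c orc x) (d orc x) (e orc x) (f orc x))"
  unfolding pstepT_def by (intro PT_rules1 PT_low PT_inc PT_red PT_grow PT_corr PT_st)

lemma mu_ifT: "mu t \<le> B \<Longrightarrow> mu e \<le> B \<Longrightarrow> mu (ifT b t e) \<le> B"
  by (simp add: ifT_def)

lemma mu_set: "mu (setT c u) \<le> max (mu c) (mu u + 3)"
  unfolding setT_def using mu_arc(1-3)[of c] nat_of_tree_le_mu[of u]
  by (auto simp: mu.simps(2) le_max_iff_disj)

lemma mu_le: "mu (leT a b) \<le> 1"
  by (simp add: leT_def notT_def ifT_def)

lemma mu_memT: "mu (memT a b) \<le> 1" "mu (eqT a b) \<le> 1" "mu (leT a b) \<le> 1"
  unfolding memT_def eqT_def andT_def by (rule mu_ex, cases "leT a b = Leaf") (use mu_le in \<open>auto simp: ifT_def\<close>)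

lemma mu_bump: "mu (bumpT M e A) \<le> mu A + 6"
  unfolding bumpT_def
proof (rule mu_map)
  fix c assume "c \<in> set (list_of_tree A)"
  then have c: "mu c \<le> mu A" by (rule mu_list_of_tree)
  let ?u1 = "addT (eqT (idT c) (idT e)) (lenT c)"
  let ?u2 = "addT (memT (idT c) (lpthT M (srcT e))) ?u1"
  let ?u3 = "addT (memT (idT c) (lpthT M (tgtT e))) ?u2"
  have "mu ?u1 \<le> mu c + 1" using mu_add'[of "eqT (idT c) (idT e)" "lenT c"] mu_memT(2)[of "idT c" "idT e"] mu_arc(4)[of c] by linarith
  then have "mu ?u2 \<le> mu c + 2" using mu_add'[of "memT (idT c) (lpthT M (srcT e))" ?u1] mu_memT(1)[of "idT c" "lpthT M (srcT e)"] by linarith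
  then have "mu ?u3 \<le> mu c + 3" using mu_add'[of "memT (idT c) (lpthT M (tgtT e))" ?u2] mu_memT(1)[of "idT c" "lpthT M (tgtT e)"] by linarith
  then show "mu (setT c ?u3) \<le> mu A + 6" using mu_set[of c ?u3] c by linarith
qed simp

lemma mu_inc: "mu (incT s A) \<le> mu A + 6"
  unfolding incT_def
proof (rule mu_map)
  fix c assume "c \<in> set (list_of_tree A)"
  then have c: "mu c \<le> mu A" by (rule mu_list_of_tree)
  let ?b = "leT (lenT c) (addT (addT s s) (addT s s))"
  have "mu (addT ?b (lenT c)) \<le> mu c + 1"
    using mu_add'[of ?b "lenT c"] mu_memT(3)[of "lenT c" "addT (addT s s) (addT s s)"] mu_arc(4)[of c] by linarith
  then show "mu (setT c (addT ?b (lenT c))) \<le> mu A + 6" using mu_set[of c "addT ?b (lenT c)"] c by linarith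
qed simp

lemma mu_st: "mu fl \<le> B \<Longrightarrow> mu A \<le> B \<Longrightarrow> mu s \<le> B \<Longrightarrow> mu q \<le> B \<Longrightarrow> mu (stT fl A s q) \<le> B + 3"
  unfolding stT_def using nat_of_tree_le_mu[of q] by (simp add: mu.simps(2))

text \<open>A correction raises each length by at most three and each of the two counters by at most
  one, so the measure of the state grows by a constant, whatever the lengths are.\<close>

lemma mu_pstep:
  "mu (pstepT orc V M p2 (left_tree (right_tree y)) (left_tree (right_tree (right_tree y)))
     (right_tree (right_tree (right_tree y)))) \<le> mu y + 10"
proof -
  let ?A = "left_tree (right_tree y)" and ?s = "left_tree (right_tree (right_tree y))"
    and ?q = "right_tree (right_tree (right_tree y))"
  have b: "mu ?A \<le> mu y" "mu ?s \<le> mu y" "mu ?q \<le> mu y" using mu_left mu_right le_trans by meson+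
  have st: "mu (stT fl A s q) \<le> mu y + 10" if "mu fl \<le> 1" "mu A \<le> mu y + 6" "mu s \<le> mu y + 1" "mu q \<le> mu y + 1" for fl A s q
    using mu_st[of fl "mu y + 6" A s q] that by simp
  have i: "mu (incT ?s ?A) \<le> mu y + 6" using mu_inc[of ?s ?A] b by linarith
  have u: "mu (bumpT M e ?A) \<le> mu y + 6" for M e using mu_bump[of M e ?A] b by linarith
  have n: "mu (Node Leaf ?s) \<le> mu y + 1" "mu (Node Leaf ?q) \<le> mu y + 1"
    using b mu_Node_Leaf[of ?s] mu_Node_Leaf[of ?q] by linarith+
  have w: "mu ?A \<le> mu y + 6" "mu ?s \<le> mu y + 1" "mu ?q \<le> mu y + 1" "mu Leaf \<le> 1" "mu (Node Leaf Leaf) \<le> 1"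
    using b by simp_all
  show ?thesis unfolding pstepT_def corrT_def by (intro mu_ifT st i u n w)
qed

lemma PT_solve: "PT a \<Longrightarrow> PT b \<Longrightarrow> PT c \<Longrightarrow> PT d \<Longrightarrow> PT e \<Longrightarrow>
    PT (\<lambda>orc x. solveT orc (a orc x) (b orc x) (c orc x) (d orc x) (e orc x))"
proof (rule PT5[where F="solveT"])
  let ?p = "\<lambda>orc x y. pstepT orc (left_tree (right_tree x)) (left_tree (right_tree (right_tree x)))
    (right_tree (right_tree (right_tree (right_tree x)))) (left_tree (right_tree y))
    (left_tree (right_tree (right_tree y))) (right_tree (right_tree (right_tree y)))"
  show "PT (\<lambda>orc x. solveT orc (left_tree x) (left_tree (right_tree x)) (left_tree (right_tree (right_tree x)))
      (left_tree (right_tree (right_tree (right_tree x)))) (right_tree (right_tree (right_tree (right_tree x)))))"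
    unfolding solveT_def
  proof (rule PT_left, rule PT_fold[where body="\<lambda>orc x h y. ?p orc x y" and c=4])
    show "mu (?p orc x y) \<le> mu y + (mu x + mu h + 2) ^ 4" for orc x h y
    proof -
      have "(2::nat) ^ 4 \<le> (mu x + mu h + 2) ^ 4" by (rule power_mono) auto
      moreover have "mu (?p orc x y) \<le> mu y + 10" by (rule mu_pstep)
      ultimately show ?thesis by simp
    qed
  qed (intro PT_pstep PT_st PT_basic)+
qed

lemma PT_ext: "PT a \<Longrightarrow> PT b \<Longrightarrow> PT (\<lambda>orc x. extT (a orc x) (b orc x))"
  unfolding extT_def by (intro PT_rules1)

lemma PT_abs: "PT a \<Longrightarrow> PT b \<Longrightarrow> PT c \<Longrightarrow> PT d \<Longrightarrow> PT (\<lambda>orc x. absT orc (a orc x) (b orc x) (c orc x) (d orc x))"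
  by (rule PT4[where F="absT"]) (unfold absT_def, intro PT_rules1 PT_solve PT_ext)

lemma PT_drop: "PT a \<Longrightarrow> PT b \<Longrightarrow> PT (\<lambda>orc x. dropT (a orc x) (b orc x))"
  by (rule PT2[where F="\<lambda>orc. dropT"]) (unfold dropT_def, intro PT_rules1)

lemma PT_branch: "PT a \<Longrightarrow> PT b \<Longrightarrow> PT c \<Longrightarrow> PT d \<Longrightarrow>
    PT (\<lambda>orc x. branchT (a orc x) (b orc x) (c orc x) (d orc x))"
  unfolding branchT_def by (intro PT_rules1 PT_ext PT_drop)

lemma PT_bstep: "PT a \<Longrightarrow> PT b \<Longrightarrow> PT c \<Longrightarrow> PT d \<Longrightarrow>
    PT (\<lambda>orc x. bstepT orc (a orc x) (b orc x) (c orc x) (d orc x))"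
  by (rule PT4[where F="bstepT"]) (unfold bstepT_def, intro PT_rules1 PT_abs PT_barcs PT_ext PT_branch)

lemma mu_ext: "mu (extT M c) \<le> max (mu M) (mu c) + 5"
proof -
  let ?B = "max (mu M) (mu c)"
  have "mu (Node (idT c) (pthT M (srcT c))) \<le> ?B + 1"
    using mu_arc(1)[of c] mu_entry(3)[of M "srcT c"] by (intro mu_NodeI) linarith+
  then have "mu (Node Leaf (Node (idT c) (pthT M (srcT c)))) \<le> ?B + 1 + 1" by (rule mu_NodeI[rotated]) simp
  then have "mu (Node Leaf (Node Leaf (Node (idT c) (pthT M (srcT c))))) \<le> ?B + 1 + 1 + 1"
    by (rule mu_NodeI[rotated]) simp
  then have "mu (Node (tgtT c) (Node Leaf (Node Leaf (Node (idT c) (pthT M (srcT c)))))) \<le> ?B + 1 + 1 + 1 + 1"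
    by (rule mu_NodeI[rotated]) (use mu_arc(3)[of c] in linarith)
  then have "mu (extT M c) \<le> ?B + 1 + 1 + 1 + 1 + 1" unfolding extT_def by (rule mu_NodeI) linarith
  then show ?thesis by linarith
qed

lemma mu_bstep: "mu (bstepT orc C (left_tree st) (left_tree (right_tree st)) (right_tree (right_tree st))) \<le> mu st + 6"
proof -
  let ?M = "left_tree st" and ?A = "left_tree (right_tree st)" and ?b = "right_tree (right_tree st)"
  have b: "mu ?M \<le> mu st" "mu ?A \<le> mu st" "mu ?b \<le> mu st" using mu_left mu_right le_trans by meson+
  have b': "mu (right_tree ?b) \<le> mu st" using mu_right b(3) le_trans by meson
  have N: "mu (Node M (Node A b)) \<le> mu st + 6" if "mu M \<le> mu st + 5" "mu A \<le> mu st" "mu b \<le> mu st" for M A b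
  proof -
    have "mu (Node A b) \<le> mu st + 1" using that(2,3) by (rule mu_NodeI)
    then have "mu (Node M (Node A b)) \<le> mu st + 5 + 1" using that(1) by (intro mu_NodeI) linarith+
    then show ?thesis by linarith
  qed
  have f: "mu (left_tree (filterT p t)) \<le> mu t" for p t using mu_left mu_filter le_trans by meson
  have c: "mu (left_tree (barcsT ?M ?A)) \<le> mu st" "mu (left_tree (filterT (absT orc C ?M ?A) (barcsT ?M ?A))) \<le> mu st"
    unfolding barcsT_def using f mu_filter b le_trans by meson+
  have e: "mu (extT ?M (left_tree (barcsT ?M ?A))) \<le> mu st + 5"
    "mu (extT ?M (left_tree (filterT (absT orc C ?M ?A) (barcsT ?M ?A)))) \<le> mu st + 5"
    using mu_ext[of ?M "left_tree (barcsT ?M ?A)"] mu_ext[of ?M "left_tree (filterT (absT orc C ?M ?A) (barcsT ?M ?A))"]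
      b c by linarith+
  have d: "mu (dropT x ?A) \<le> mu st" for x unfolding dropT_def using mu_filter b le_trans by meson
  have M4: "mu ?M \<le> mu st + 5" using b by simp
  show ?thesis unfolding bstepT_def branchT_def
    by (intro mu_ifT N[OF e(2) b(2,3)] N[OF e(1) b(2) b'] N[OF M4 d b'] N[OF M4 b(2,3)])
qed

lemma PT_out: "PT a \<Longrightarrow> PT b \<Longrightarrow> PT c \<Longrightarrow> PT d \<Longrightarrow>
    PT (\<lambda>orc x. outT orc (a orc x) (b orc x) (c orc x) (d orc x))"
proof (rule PT4[where F="outT"])
  let ?p = "\<lambda>orc x st. bstepT orc (right_tree (left_tree x)) (left_tree st) (left_tree (right_tree st)) (right_tree (right_tree st))"
  show "PT (\<lambda>orc x. outT orc (left_tree x) (left_tree (right_tree x)) (left_tree (right_tree (right_tree x)))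
      (right_tree (right_tree (right_tree x))))"
    unfolding outT_def
  proof (rule PT_left, rule PT_fold[where body="\<lambda>orc x h st. ?p orc x st" and c=3])
    show "mu (?p orc x st) \<le> mu st + (mu x + mu h + 2) ^ 3" for orc x h st
    proof -
      have "(2::nat) ^ 3 \<le> (mu x + mu h + 2) ^ 3" by (rule power_mono) auto
      moreover have "mu (?p orc x st) \<le> mu st + 6" by (rule mu_bstep)
      ultimately show ?thesis by simp
    qed
  qed (intro PT_bstep PT_basic)+
qed

lemma PT_lost: "PT a \<Longrightarrow> PT b \<Longrightarrow> PT (\<lambda>orc x. lostT orc (a orc x) (b orc x))"
  by (rule PT2[where F="lostT"]) (unfold lostT_def, intro PT_rules1 PT_cy)

lemma PT_verts: "PT a \<Longrightarrow> PT (\<lambda>orc x. vertsT (a orc x))"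
  unfolding vertsT_def by (intro PT_rules1)

lemma PT_subset: "PT a \<Longrightarrow> PT b \<Longrightarrow> PT (\<lambda>orc x. subsetT (a orc x) (b orc x))"
  by (rule PT2[where F="\<lambda>orc. subsetT"]) (unfold subsetT_def, intro PT_rules1)

section \<open>Correctness of the tree programs\<close>

definition nl :: "nat list \<Rightarrow> tree" where "nl xs = tree_of_list (map tree_of_nat xs)"
definition bl :: "bool list \<Rightarrow> tree" where "bl xs = tree_of_list (map tree_of_bool xs)"
definition encE :: "entry \<Rightarrow> tree" where
  "encE e = (case e of (u, d, L, P) \<Rightarrow> Node (tree_of_nat u) (Node (tree_of_nat d) (Node (nl L) (nl P))))"
definition encM :: "entry list \<Rightarrow> tree" where "encM M = tree_of_list (map encE M)"
definition encC :: "(nat \<Rightarrow> nat) \<Rightarrow> nat \<times> nat \<times> nat \<Rightarrow> tree" where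
  "encC x c = (case c of (i, a, b) \<Rightarrow>
     Node (tree_of_nat i) (Node (tree_of_nat a) (Node (tree_of_nat b) (tree_of_nat (x i)))))"
definition encA :: "(nat \<Rightarrow> nat) \<Rightarrow> (nat \<times> nat \<times> nat) list \<Rightarrow> tree" where
  "encA x cs = tree_of_list (map (encC x) cs)"

lemma tree_of_list_Leaf [simp]: "tree_of_list xs = Leaf \<longleftrightarrow> xs = []"
  by (cases xs) auto

lemma left_tree_of_list [simp]: "xs \<noteq> [] \<Longrightarrow> left_tree (tree_of_list xs) = hd xs"
  by (cases xs) auto

lemma right_tree_of_list [simp]: "right_tree (tree_of_list xs) = tree_of_list (tl xs)"
  by (cases xs) auto

lemma nl_Cons: "Node (tree_of_nat i) (nl xs) = nl (i # xs)"
  by (simp add: nl_def)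

lemma encA_Leaf [simp]: "encA x cs = Leaf \<longleftrightarrow> cs = []"
  by (simp add: encA_def)

lemma arc_simps [simp]:
  "idT (encC x (i, a, b)) = tree_of_nat i" "srcT (encC x (i, a, b)) = tree_of_nat a"
  "tgtT (encC x (i, a, b)) = tree_of_nat b" "lenT (encC x (i, a, b)) = tree_of_nat (x i)"
  "setT (encC x (i, a, b)) (tree_of_nat n) = encC (\<lambda>_. n) (i, a, b)"
  by (simp_all add: idT_def srcT_def tgtT_def lenT_def setT_def encC_def)

lemma mem_sim [simp]: "memT (tree_of_nat i) (nl L) = tree_of_bool (i \<in> set L)"
  by (auto simp: memT_def exT_eq nl_def intro: arg_cong[where f=tree_of_bool])

lemma left_encE [simp]: "left_tree (encE e) = tree_of_nat (fst e)"
  by (cases e) (simp add: encE_def)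

lemma in_sim [simp]: "inT (encM M) (tree_of_nat a) = tree_of_bool (a \<in> dom_of M)"
  by (auto simp: inT_def exT_eq encM_def dom_of_def image_iff intro!: arg_cong[where f=tree_of_bool] bexI)

lemma look_sim:
  assumes "a \<in> dom_of M"
  shows "lookT (encM M) (tree_of_nat a) = encE (a, the (map_of M a))"
proof -
  have "filter (\<lambda>e. fst e = a) M \<noteq> [] \<and> hd (filter (\<lambda>e. fst e = a) M) = (a, the (map_of M a))"
    using assms by (induction M) (auto simp: dom_of_def)
  then show ?thesis
    by (simp add: lookT_def filterT_eq encM_def filter_map comp_def hd_map)
qed

lemma entry_sim:
  assumes "a \<in> dom_of M"
  shows "dstT (encM M) (tree_of_nat a) = tree_of_nat (dst_of M a)"
    "lpthT (encM M) (tree_of_nat a) = nl (lpth M a)" "pthT (encM M) (tree_of_nat a) = nl (pth M a)"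
  by (cases "the (map_of M a)",
      simp add: dstT_def lpthT_def pthT_def look_sim[OF assms] encE_def dst_of_def lpth_def pth_def)+

lemma barcs_sim: "barcsT (encM M) (encA x (arcs ps ids)) = encA x (barcs ps M ids)"
  by (auto simp: barcsT_def filterT_eq encA_def barcs_def filter_map comp_def
      intro!: arg_cong[where f=tree_of_list] arg_cong[where f="map (encC x)"] filter_cong)

lemma key_sim: "fst (snd c) \<in> dom_of M \<Longrightarrow> keyT (encM M) (encC x c) = tree_of_nat (arc_key M x c)"
  by (cases c) (simp add: keyT_def entry_sim arc_key_def)

lemma min_sim:
  assumes "\<And>c. c \<in> set bs \<Longrightarrow> fst (snd c) \<in> dom_of M"
  shows "minT (encM M) (encA x bs) =
    encA x (filter (\<lambda>c. \<not> (\<exists>c'\<in>set bs. arc_key M x c' < arc_key M x c)) bs)"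
proof -
  have k: "keyT (encM M) (encC x c) = tree_of_nat (arc_key M x c)" if "c \<in> set bs" for c
    by (rule key_sim) (rule assms[OF that])
  have "notT (exT (\<lambda>c'. ltT (keyT (encM M) c') (keyT (encM M) (encC x c))) (encA x bs)) =
      tree_of_bool (\<not> (\<exists>c'\<in>set bs. arc_key M x c' < arc_key M x c))" if "c \<in> set bs" for c
    by (simp add: exT_eq encA_def k[OF that] k cong: bex_cong ball_cong)
  then have f: "filter (\<lambda>h. notT (exT (\<lambda>c'. ltT (keyT (encM M) c') (keyT (encM M) h)) (encA x bs)) \<noteq> Leaf)
      (map (encC x) bs) = map (encC x) (filter (\<lambda>c. \<not> (\<exists>c'\<in>set bs. arc_key M x c' < arc_key M x c)) bs)"
    by (simp add: filter_map comp_def cong: filter_cong)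
  have l: "list_of_tree (encA x bs) = map (encC x) bs" by (simp add: encA_def)
  show ?thesis unfolding minT_def filterT_eq l f by (simp add: encA_def)
qed

lemma encM_Cons: "encM (e # M) = Node (encE e) (encM M)"
  by (simp add: encM_def)

lemma gext_sim: "fst (snd c) \<in> dom_of M \<Longrightarrow> gextT (encM M) (encC x c) = encM (gext M x c)"
proof -
  assume a: "fst (snd c) \<in> dom_of M"
  obtain i u v where c: "c = (i, u, v)" by (cases c)
  have u: "u \<in> dom_of M" using a c by simp
  show ?thesis
    using key_sim[OF a, of x] unfolding c
    by (simp add: gextT_def entry_sim[OF u] gext_def encM_Cons encE_def nl_Cons arc_key_def)
qed

lemma barcs_src: "c \<in> set (barcs ps M ids) \<Longrightarrow> fst (snd c) \<in> dom_of M"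
  by (auto simp: barcs_def)

lemma hd_encA: "cs \<noteq> [] \<Longrightarrow> left_tree (encA x cs) = encC x (hd cs)"
  by (simp add: encA_def hd_map)

lemma gstep_sim: "gstepT (encA x (arcs ps ids)) (encM M) = encM (gstep ps ids x M)"
proof -
  let ?bs = "barcs ps M ids"
  let ?cs = "filter (\<lambda>c. \<not> (\<exists>c'\<in>set ?bs. arc_key M x c' < arc_key M x c)) ?bs"
  have m: "minT (encM M) (encA x ?bs) = encA x ?cs" by (rule min_sim) (rule barcs_src)
  have "gextT (encM M) (left_tree (encA x ?cs)) = encM (gext M x (hd ?cs))" if "?cs \<noteq> []"
  proof -
    have "hd ?cs \<in> set ?cs" using hd_in_set[OF that] .
    then have "hd ?cs \<in> set ?bs" by (rule subsetD[OF filter_is_subset])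
    then show ?thesis unfolding hd_encA[OF that] by (intro gext_sim barcs_src)
  qed
  then show ?thesis unfolding gstepT_def barcs_sim m ifT_def gstep_def Let_def by auto
qed

lemma grow_sim:
  "growT V (encA x (arcs ps ids)) (encM M) = encM ((gstep ps ids x ^^ nat_of_tree V) M)"
proof -
  have "fold (\<lambda>h M. gstepT (encA x (arcs ps ids)) M) hs (encM M) = encM ((gstep ps ids x ^^ length hs) M)" for hs M
    by (induction hs arbitrary: M) (simp_all add: gstep_sim funpow_swap1)
  from this[of "list_of_tree V" M] show ?thesis by (simp add: growT_def foldT_fold length_list_of_tree)
qed

lemma sum_sim: "sumT (encA x cs) = tree_of_nat (sum_list (map (\<lambda>(i, a, b). x i) cs))"
proof -
  have "foldT (\<lambda>c acc. addT (lenT c) acc) (encA x cs) (tree_of_nat n) =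
      tree_of_nat (sum_list (map (\<lambda>(i, a, b). x i) cs) + n)" for n
    by (induction cs arbitrary: n) (auto simp: encA_def algebra_simps)
  from this[of 0] show ?thesis by (simp add: sumT_def)
qed

lemma map_encA:
  assumes "\<And>c. c \<in> set cs \<Longrightarrow> f (encC x c) = encC y c"
  shows "mapT f (encA x cs) = encA y cs"
  using assms by (simp add: mapT_eq encA_def comp_def cong: map_cong)

lemma encC_eqI: "x (fst c) = y (fst c) \<Longrightarrow> encC x c = encC y c"
  by (cases c) (simp add: encC_def)

lemma red_sim: "redT (tree_of_nat s) (encA u cs) = encA (\<lambda>i. u i - 4 * s) cs"
  unfolding redT_def by (rule map_encA) (auto intro!: encC_eqI split: prod.splits)

lemma inc_sim: "incT (tree_of_nat s) (encA u cs) = encA (\<lambda>i. if u i \<le> 4 * s then Suc (u i) else u i) cs"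
  unfolding incT_def
  by (rule map_encA) (auto simp: bool_nat simp del: tree_of_nat.simps intro!: encC_eqI split: prod.splits)

lemma low_sim: "lowT (tree_of_nat s) (encA u (arcs ps ids)) = tree_of_bool (\<exists>i\<in>set ids. u i \<le> 4 * s)"
proof -
  have f: "set ids = fst ` set (arcs ps ids)" by (force simp: arcs_def)
  have "(\<exists>i\<in>set ids. u i \<le> 4 * s) \<longleftrightarrow> (\<exists>c\<in>set (arcs ps ids). u (fst c) \<le> 4 * s)"
    unfolding f by simp
  moreover have "leT (lenT (encC u c)) (addT (addT (tree_of_nat s) (tree_of_nat s)) (addT (tree_of_nat s) (tree_of_nat s)))
      = tree_of_bool (u (fst c) \<le> 4 * s)" for c
  proof -
    have "s + s + (s + s) = 4 * s" by simp
    then show ?thesis by (cases c) (simp only: arc_simps add_nat le_nat fst_conv)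
  qed
  ultimately show ?thesis by (simp add: lowT_def exT_eq encA_def)
qed

lemma bump_sim:
  assumes "a \<in> dom_of M" "b \<in> dom_of M"
  shows "bumpT (encM M) (encC x (i, a, b)) (encA u cs) = encA (bump M u (i, a, b)) cs"
  unfolding bumpT_def
proof (rule map_encA)
  fix c :: "nat \<times> nat \<times> nat"
  obtain j a' b' where c: "c = (j, a', b')" by (cases c)
  show "setT (encC u c) (addT (memT (idT (encC u c)) (lpthT (encM M) (tgtT (encC x (i, a, b)))))
     (addT (memT (idT (encC u c)) (lpthT (encM M) (srcT (encC x (i, a, b)))))
        (addT (eqT (idT (encC u c)) (idT (encC x (i, a, b)))) (lenT (encC u c))))) = encC (bump M u (i, a, b)) c"
    unfolding c by (simp add: entry_sim assms bool_nat bump_def del: tree_of_nat.simps) (auto intro!: encC_eqI)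
qed

definition lost :: "(nat \<Rightarrow> nat \<Rightarrow> nat \<Rightarrow> bool) \<Rightarrow> entry list \<Rightarrow> nat \<times> nat \<times> nat \<Rightarrow> bool" where
  "lost cn M c = (case c of (i, a, b) \<Rightarrow> (a \<in> dom_of M \<or> b \<in> dom_of M) \<and>
     \<not> (a \<in> dom_of M \<and> b \<in> dom_of M \<and> cn i a b))"

lemma verts_sim: "vertsT (encM M) = nl (map fst M)"
  by (simp add: vertsT_def mapT_eq encM_def nl_def comp_def)

lemma subset_sim: "subsetT (nl X) (nl Y) = tree_of_bool (set X \<subseteq> set Y)"
  by (auto simp: subsetT_def allT_eq nl_def[of X] intro!: arg_cong[where f=tree_of_bool])

context rgraph
begin

abbreviation "orc \<equiv> membership_oracle \<B>"

text \<open>The oracle reads its argument as a set, so the order in which the symmetric difference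
  is listed is immaterial.\<close>

lemma cons_sim: "consT orc (tree_of_nat i) (nl P) (nl Q) =
    tree_of_bool (i \<in> sdiff (set P) (set Q) \<or> insert i (sdiff (set P) (set Q)) \<in> \<B>)"
proof -
  define zs where "zs = rev (filter (\<lambda>h. h \<notin> set Q) P) @ filter (\<lambda>h. h \<notin> set P) Q"
  have fl: "filterT (\<lambda>h. notT (memT h (nl Q))) (nl P) = nl (filter (\<lambda>h. h \<notin> set Q) P)" for P Q
    unfolding filterT_eq nl_def[of P] nl_def[of "filter _ _"] by (simp add: filter_map comp_def)
  have ap: "appT (nl X) (nl Y) = nl (rev X @ Y)" for X Y
    by (simp add: appT_eq nl_def rev_map)
  have "sdT (nl P) (nl Q) = nl zs" by (simp add: sdT_def fl ap zs_def)
  moreover have "set zs = sdiff (set P) (set Q)" by (auto simp: zs_def sdiff_def)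
  moreover have "orc (Node (tree_of_nat i) (nl zs)) \<longleftrightarrow> insert i (set zs) \<in> \<B>"
    using set_of_tree_of_list[of "i # zs"] by (simp add: membership_oracle_def nl_def)
  ultimately show ?thesis by (simp add: consT_def)
qed

lemma cy_sim:
  assumes "a \<in> dom_of M" "b \<in> dom_of M"
  shows "cyT orc (encM M) (encC x (i, a, b)) = tree_of_bool (cons_edge (\<lambda>u. set (pth M u)) i a b)"
  by (simp add: cyT_def entry_sim assms cons_sim cons_edge_def)

text \<open>Looking up a vertex outside the tree yields a meaningless value. The leading membership
  tests turn the conjunction false in these cases, hence the case distinction.\<close>

lemma viol_sim: "violT orc (encM M) (tree_of_nat t) (encC x c) = tree_of_bool (viol M x t c)"
proof -
  obtain i a b where c: "c = (i, a, b)" by (cases c)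
  show ?thesis
    by (cases "a \<in> dom_of M"; cases "b \<in> dom_of M")
      (simp_all add: violT_def viol_def c entry_sim cy_sim)
qed

lemma pstep_sim:
  assumes V: "nat_of_tree V = N"
  shows "pstepT orc V (encM M) (tree_of_nat (2 * p + 1)) (encA u (arcs ps ids)) (tree_of_nat s) (tree_of_nat q) =
    (case pstep p M ids (fl, u, s, q) of (fl', u', s', q') \<Rightarrow>
       stT (tree_of_bool fl') (encA u' (arcs ps ids)) (tree_of_nat s') (tree_of_nat q'))"
proof -
  define x where "x = (\<lambda>i. u i - 4 * s)"
  define M' where "M' = (gstep ps ids x ^^ N) M"
  define t where "t = (2 * p + 1) * s - q"
  define vs where "vs = filter (viol M' x t) (arcs ps ids)"
  have xs: "redT (tree_of_nat s) (encA u (arcs ps ids)) = encA x (arcs ps ids)" by (simp add: red_sim x_def)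
  have g: "growT V (encA x (arcs ps ids)) (encM M) = encM M'" by (simp add: grow_sim V M'_def)
  have t: "subT (mulT (tree_of_nat (2 * p + 1)) (tree_of_nat s)) (tree_of_nat q) = tree_of_nat t"
    unfolding mul_nat sub_nat t_def ..
  have v: "filterT (violT orc (encM M') (tree_of_nat t)) (encA x (arcs ps ids)) = encA x vs"
    unfolding filterT_eq encA_def vs_def by (simp add: filter_map comp_def viol_sim)
  have b: "bumpT (encM M') (left_tree (encA x vs)) (encA u (arcs ps ids)) = encA (bump M' u (hd vs)) (arcs ps ids)"
    if "vs \<noteq> []"
  proof -
    obtain i a b where h: "hd vs = (i, a, b)" by (cases "hd vs") auto
    have "viol M' x t (i, a, b)" using hd_in_set[OF that] h by (auto simp: vs_def)
    then show ?thesis unfolding hd_encA[OF that] h by (intro bump_sim) (auto simp: viol_def)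
  qed
  have l: "leT (mulT (tree_of_nat (2 * p + 1)) (tree_of_nat t)) (addT (sumT (encA x (arcs ps ids))) (sumT (encA x (arcs ps ids))))
     = tree_of_bool ((2 * p + 1) * t \<le> 2 * sum_list (map (\<lambda>(i, a, b). x i) (arcs ps ids)))"
    unfolding mul_nat sum_sim add_nat le_nat mult_2 ..
  have ps: "pstep p M ids (fl, u, s, q) = (if \<exists>i\<in>set ids. u i \<le> 4 * s then (False, \<lambda>i. if u i \<le> 4 * s then Suc (u i) else u i, s, q)
     else if vs \<noteq> [] then (False, bump M' u (hd vs), s, Suc q)
     else if (2 * p + 1) * t \<le> 2 * sum_list (map (\<lambda>(i, a, b). x i) (arcs ps ids)) then (False, u, Suc s, q)
     else (True, u, s, q))"
    unfolding pstep_def Let_def x_def M'_def t_def vs_def by simp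
  have F: "tree_of_bool False = Leaf" "tree_of_bool True = Node Leaf Leaf" by (simp_all add: tree_of_bool_def)
  show ?thesis
    unfolding pstepT_def corrT_def xs g t v l ps low_sim inc_sim ifT_def
    using b by (auto simp: F)
qed

lemma solve_sim:
  assumes V: "nat_of_tree V = N"
  shows "solveT orc T V (encM M) (encA (\<lambda>_. 0) (arcs ps ids)) (tree_of_nat (2 * p + 1)) =
    tree_of_bool (solve (nat_of_tree T) p M ids)"
proof -
  let ?f = "\<lambda>h y. pstepT orc V (encM M) (tree_of_nat (2 * p + 1)) (left_tree (right_tree y))
     (left_tree (right_tree (right_tree y))) (right_tree (right_tree (right_tree y)))"
  let ?enc = "\<lambda>(fl, u, s, q). stT (tree_of_bool fl) (encA u (arcs ps ids)) (tree_of_nat s) (tree_of_nat q)"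
  have "fold ?f hs (?enc y) = ?enc ((pstep p M ids ^^ length hs) y)" for hs y
  proof (induction hs arbitrary: y)
    case (Cons h hs)
    obtain fl u s q where y: "y = (fl, u, s, q)" by (cases y) auto
    have "?f h (?enc y) = ?enc (pstep p M ids y)"
      unfolding y using pstep_sim[OF V, of M p u ids s q fl] by (simp add: stT_def case_prod_unfold)
    then show ?case using Cons[of "pstep p M ids y"] by (simp add: funpow_swap1)
  qed simp
  from this[of "list_of_tree T" "(False, \<lambda>_. 0, 0, 0)"]
  have "fold ?f (list_of_tree T) (stT Leaf (encA (\<lambda>_. 0) (arcs ps ids)) Leaf Leaf) =
      ?enc ((pstep p M ids ^^ nat_of_tree T) (False, \<lambda>_. 0, 0, 0))"
    by (simp add: length_list_of_tree tree_of_bool_def)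
  then show ?thesis unfolding solveT_def foldT_fold solve_def
    by (simp add: stT_def case_prod_unfold)
qed

lemma ext_sim: "fst (snd c) \<in> dom_of M \<Longrightarrow> extT (encM M) (encC x c) = encM (ext M c)"
proof -
  assume a: "fst (snd c) \<in> dom_of M"
  obtain i u v where c: "c = (i, u, v)" by (cases c)
  have u: "u \<in> dom_of M" using a c by simp
  have "nl [] = Leaf" by (simp add: nl_def)
  then show ?thesis unfolding c
    by (simp add: extT_def entry_sim[OF u] ext_def encM_Cons encE_def nl_Cons)
qed

text \<open>The three components are an iteration count sufficient by \<open>solve_complete\<close>
  for every subset of the edges, a list of which only the length \<open>N\<close> matters here, and
  the factors \<open>2 * p + 1\<close> for all bounds to be compared.\<close>

definition ctx_ok :: "nat \<Rightarrow> tree \<Rightarrow> bool" where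
  "ctx_ok k C \<longleftrightarrow> nat_of_tree (left_tree C) \<ge> (4 * (length ps + k + 1)) ^ 5 \<and>
     nat_of_tree (left_tree (right_tree C)) = N \<and>
     set (list_of_tree (right_tree (right_tree C))) = (\<lambda>p. tree_of_nat (2 * p + 1)) ` {..2 * k}"

lemma abs_sim:
  assumes C: "ctx_ok k C" and inv: "state_inv v M ids" and c: "c \<in> set (barcs ps M ids)"
  shows "absT orc C (encM M) (encA (\<lambda>_. 0) (arcs ps ids)) (encC (\<lambda>_. 0) c) = tree_of_bool (absorbs k v M ids c)"
proof -
  let ?T = "nat_of_tree (left_tree C)"
  obtain i a b where cc: "c = (i, a, b)" by (cases c)
  have ids: "set ids \<subseteq> edges G" using inv by (simp add: state_inv_def)
  have "card (set ids) \<le> length ps" using card_mono[OF _ ids] edges_eq by simp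
  then have "(4 * (card (set ids) + k + 1)) ^ 5 \<le> (4 * (length ps + k + 1)) ^ 5" by (intro power_mono) auto
  moreover have "(4 * (length ps + k + 1)) ^ 5 \<le> ?T" using C unfolding ctx_ok_def by blast
  ultimately have T: "(4 * (card (set ids) + k + 1)) ^ 5 \<le> ?T" by (rule le_trans)
  note e = state_inv_ext[OF inv c[unfolded cc]]
  have s: "solve ?T p M ids \<longleftrightarrow> lam v (set ids) (tree_edges M) p"
    "solve ?T p (ext M c) ids \<longleftrightarrow> lam v (set ids) (insert i (tree_edges M)) p" if "p \<le> 2 * k" for p
    using solve_iff[OF inv that T] solve_iff[OF e(1) that T] e(2) cc by simp_all
  have V: "nat_of_tree (left_tree (right_tree C)) = N" using C by (simp add: ctx_ok_def)
  have src: "fst (snd c) \<in> dom_of M" using barcs_src[OF c] .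
  have PL: "set (list_of_tree (right_tree (right_tree C))) = (\<lambda>p. tree_of_nat (2 * p + 1)) ` {..2 * k}"
    using C unfolding ctx_ok_def by blast
  have img: "(\<forall>h\<in>f ` A. Q h) \<longleftrightarrow> (\<forall>p\<in>A. Q (f p))" for f :: "nat \<Rightarrow> tree" and A Q by blast
  have or: "orT (notT (tree_of_bool x)) (tree_of_bool y) = tree_of_bool (x \<longrightarrow> y)" for x y by simp
  have "absT orc C (encM M) (encA (\<lambda>_. 0) (arcs ps ids)) (encC (\<lambda>_. 0) c) =
      tree_of_bool (\<forall>p\<in>{..2 * k}. solve ?T p M ids \<longrightarrow> solve ?T p (ext M c) ids)"
    unfolding absT_def allT_eq PL ext_sim[OF src] img solve_sim[OF V] or by simp
  then show ?thesis using s by (simp add: absorbs_def cc Ball_def)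
qed

lemma drop_sim: "dropT (encC x (i, a, b)) (encA x (arcs ps ids)) = encA x (arcs ps (filter (\<lambda>j. j \<noteq> i) ids))"
proof -
  have "filter (\<lambda>c. fst c \<noteq> i) (arcs ps ids) = arcs ps (filter (\<lambda>j. j \<noteq> i) ids)"
    by (induction ids) (auto simp: arcs_def)
  moreover have "notT (eqT (idT (encC x c)) (tree_of_nat i)) = tree_of_bool (fst c \<noteq> i)" for c by (cases c) simp
  ultimately show ?thesis by (simp add: dropT_def filterT_eq encA_def filter_map comp_def)
qed

lemma bstep_sim:
  assumes C: "ctx_ok k C" and inv: "state_inv v M ids"
  shows "bstepT orc C (encM M) (encA (\<lambda>_. 0) (arcs ps ids)) (bl bits) =
    (case bstep k v (M, ids, bits) of (M', ids', bits') \<Rightarrow>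
      Node (encM M') (Node (encA (\<lambda>_. 0) (arcs ps ids')) (bl bits')))"
proof -
  let ?bs = "barcs ps M ids" and ?gs = "filter (absorbs k v M ids) (barcs ps M ids)"
  let ?A = "encA (\<lambda>_. 0) (arcs ps ids)"
  have b: "barcsT (encM M) ?A = encA (\<lambda>_. 0) ?bs" by (rule barcs_sim)
  have g: "filterT (absT orc C (encM M) ?A) (encA (\<lambda>_. 0) ?bs) = encA (\<lambda>_. 0) ?gs"
    unfolding filterT_eq encA_def[of _ ?bs] encA_def[of _ ?gs]
    by (simp add: filter_map comp_def abs_sim[OF C inv] cong: filter_cong)
  have e: "extT (encM M) (left_tree (encA (\<lambda>_. 0) cs)) = encM (ext M (hd cs))"
    if "cs \<noteq> []" "set cs \<subseteq> set ?bs" for cs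
    unfolding hd_encA[OF that(1)] using hd_in_set[OF that(1)] that(2) by (intro ext_sim barcs_src) auto
  have d: "dropT (left_tree (encA (\<lambda>_. 0) ?bs)) ?A = encA (\<lambda>_. 0) (arcs ps (filter (\<lambda>j. j \<noteq> fst (hd ?bs)) ids))"
    if "?bs \<noteq> []" unfolding hd_encA[OF that] by (cases "hd ?bs") (simp add: drop_sim)
  have bits: "right_tree (bl bits) = bl (tl bits)" "bits \<noteq> [] \<Longrightarrow> left_tree (bl bits) = tree_of_bool (hd bits)"
    "bl bits = Leaf \<longleftrightarrow> bits = []" by (simp_all add: bl_def map_tl hd_map)
  have gsub: "set ?gs \<subseteq> set ?bs" by auto
  show ?thesis
  proof (cases "?gs = []")
    case False
    then have "bstep k v (M, ids, bits) = (ext M (hd ?gs), ids, bits)" by (simp add: bstep_def Let_def)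
    then show ?thesis unfolding bstepT_def b g using e[OF False gsub] False by (simp add: ifT_def)
  next
    case True
    then have st: "bstep k v (M, ids, bits) = (if ?bs \<noteq> [] \<and> bits \<noteq> [] then
       (if hd bits then (ext M (hd ?bs), ids, tl bits)
        else (M, filter (\<lambda>i. i \<noteq> fst (hd ?bs)) ids, tl bits)) else (M, ids, bits))"
      by (simp add: bstep_def Let_def)
    show ?thesis unfolding bstepT_def b g st branchT_def using True e[of ?bs] d
      by (simp add: ifT_def andT_def bits)
  qed
qed

text \<open>Each step that changes more than nothing adds a vertex or deletes an edge, so
  \<open>N + length ps\<close> iterations exhaust the procedure.\<close>

definition out :: "nat \<Rightarrow> nat \<Rightarrow> bool list \<Rightarrow> entry list" where
  "out k v \<beta> = fst ((bstep k v ^^ (N + length ps)) ([(v, 0, [], [])], [0..<length ps], \<beta>))"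

lemma init_inv: "v < N \<Longrightarrow> state_inv v [(v, 0, [], [])] [0..<length ps]"
  using tree_inv_single[of v 0 "[]"] verts_eq edges_eq
  by (auto simp: state_inv_def tree_edges_def pth_def)

lemma bstep_funpow_inv:
  assumes "state_inv v M ids" "(bstep k v ^^ n) (M, ids, bits) = (M', ids', bits')"
  shows "state_inv v M' ids'"
  using assms(2)
proof (induction n arbitrary: M' ids' bits')
  case (Suc n)
  obtain M1 ids1 bits1 where 1: "(bstep k v ^^ n) (M, ids, bits) = (M1, ids1, bits1)"
    by (cases "(bstep k v ^^ n) (M, ids, bits)") auto
  show ?case using state_inv_bstep[OF Suc.IH[OF 1], of k bits1] Suc.prems 1 by simp
qed (use assms(1) in simp)

lemma out_inv: "v < N \<Longrightarrow> \<exists>ids. state_inv v (out k v \<beta>) ids"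
  using bstep_funpow_inv[OF init_inv] unfolding out_def
  by (metis prod.collapse)

lemma out_sim:
  assumes C: "ctx_ok k (right_tree C)" and n: "nat_of_tree (left_tree C) = N + length ps" and v: "v < N"
  shows "outT orc C (encA (\<lambda>_. 0) (arcs ps [0..<length ps])) (tree_of_nat v) (bl \<beta>) = encM (out k v \<beta>)"
proof -
  let ?f = "\<lambda>h st. bstepT orc (right_tree C) (left_tree st)
     (left_tree (right_tree st)) (right_tree (right_tree st))"
  let ?enc = "\<lambda>(M, ids, bits). Node (encM M) (Node (encA (\<lambda>_. 0) (arcs ps ids)) (bl bits))"
  have "fold ?f hs (?enc (M, ids, bits)) = ?enc ((bstep k v ^^ length hs) (M, ids, bits))"
    if "state_inv v M ids" for hs M ids bits
    using that
  proof (induction hs arbitrary: M ids bits)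
    case (Cons h hs)
    obtain M' ids' bits' where s: "bstep k v (M, ids, bits) = (M', ids', bits')"
      by (cases "bstep k v (M, ids, bits)") auto
    have "state_inv v M' ids'" using state_inv_bstep[OF Cons.prems, of k bits] s by simp
    then show ?case using Cons.IH[of M' ids' bits'] bstep_sim[OF C Cons.prems, of bits] s
      by (simp add: funpow_swap1)
  qed simp
  from this[OF init_inv[OF v], of "list_of_tree (left_tree C)" \<beta>]
  have f: "fold ?f (list_of_tree (left_tree C)) (?enc ([(v, 0, [], [])], [0..<length ps], \<beta>)) =
    ?enc ((bstep k v ^^ (N + length ps)) ([(v, 0, [], [])], [0..<length ps], \<beta>))"
    by (simp add: length_list_of_tree n)
  have i: "Node (Node (tree_of_nat v) (Node Leaf (Node Leaf Leaf))) Leaf = encM [(v, 0, [], [])]"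
    by (simp add: encM_def encE_def nl_def)
  show ?thesis unfolding outT_def foldT_fold i out_def using f by (simp add: case_prod_unfold)
qed

definition lostc :: "entry list \<Rightarrow> nat \<times> nat \<times> nat \<Rightarrow> bool" where
  "lostc M = lost (cons_edge (\<lambda>u. set (pth M u))) M"

lemma lost_sim: "lostT orc (encM M) (encA x cs) = encA x (filter (lostc M) cs)"
proof -
  have "andT (orT (inT (encM M) (srcT (encC x c))) (inT (encM M) (tgtT (encC x c))))
     (notT (andT (inT (encM M) (srcT (encC x c))) (andT (inT (encM M) (tgtT (encC x c)))
        (cyT orc (encM M) (encC x c))))) = tree_of_bool (lostc M c)" for c
  proof -
    obtain i a b where c: "c = (i, a, b)" by (cases c)
    show ?thesis
      by (cases "a \<in> dom_of M"; cases "b \<in> dom_of M") (simp_all add: c lostc_def lost_def cy_sim)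
  qed
  then show ?thesis by (simp add: lostT_def filterT_eq encA_def filter_map comp_def)
qed

end

section \<open>Choosing balanced subgraphs\<close>

context rgraph
begin

definition bconn :: "nat \<Rightarrow> nat set \<Rightarrow> bool" where
  "bconn v E \<longleftrightarrow> v \<in> verts G \<and> E \<subseteq> edges G \<and> bal E \<and> (\<forall>e\<in>E. ends G e \<subseteq> reach G E v)"

text \<open>For a tree this is the largest balanced edge set on its vertices that contains the tree
  edges: it is balanced by \<open>cons_bal\<close>, and every such set passes the test by
  \<open>bal_cons_edge\<close>.\<close>

definition kept :: "entry list \<Rightarrow> nat set" where
  "kept M = {i \<in> edges G. ends G i \<subseteq> dom_of M \<and>
     (\<forall>a b. ends G i = {a, b} \<longrightarrow> cons_edge (\<lambda>u. set (pth M u)) i a b)}"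

definition cut :: "entry list \<Rightarrow> nat set" where
  "cut M = {i \<in> edges G. ends G i \<inter> dom_of M \<noteq> {} \<and> i \<notin> kept M}"

lemma csum_card: "csum (edges G) X E = card {e \<in> edges G. ends G e \<inter> X \<noteq> {} \<and> e \<notin> E}"
proof -
  have "csum (edges G) X E = (\<Sum>e\<in>edges G. if e \<in> {e \<in> edges G. ends G e \<inter> X \<noteq> {} \<and> e \<notin> E} then 1 else 0)"
    unfolding csum_def by (intro sum.cong) (auto simp: ct_def)
  also have "\<dots> = card {e \<in> edges G. ends G e \<inter> X \<noteq> {} \<and> e \<notin> E}"
    using finite_edges by (subst sum.inter_restrict[symmetric]) (auto simp: Int_def)
  finally show ?thesis .
qed

lemma csum_kept: "csum (edges G) (dom_of M) (kept M) = card (cut M)"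
  by (simp add: csum_card cut_def)

lemma finite_cut: "finite (cut M)"
  using finite_edges by (simp add: cut_def)

lemma tree_bconn:
  assumes ti: "tree_inv v M"
  shows "bconn v (kept M)" "reach G (kept M) v = dom_of M"
proof -
  have t: "tree_ok v (\<lambda>u. set (pth M u)) (dom_of M) (tree_edges M)" using ti by (simp add: tree_inv_def)
  have Tk: "tree_edges M \<subseteq> kept M"
  proof
    fix e assume e: "e \<in> tree_edges M"
    have "cons_edge (\<lambda>u. set (pth M u)) e a b" if "ends G e = {a, b}" for a b
      using tree_ok_sdiff[OF t e that] by (simp add: cons_edge_def)
    moreover have "tree_edges M \<subseteq> edges G" using t by (simp add: tree_ok_def)
    then have "e \<in> edges G" using e by (rule subsetD)
    ultimately show "e \<in> kept M" using tree_ok_ends[OF t e] by (simp add: kept_def)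
  qed
  have v: "v \<in> dom_of M" "v \<in> verts G" using t by (simp_all add: tree_ok_def)
  have "dom_of M \<subseteq> reach G (kept M) v"
    using reach_mono[OF Tk, of G v] tree_inv_reach[OF ti] by simp
  moreover have "reach G (kept M) v \<subseteq> dom_of M"
  proof
    fix u assume "u \<in> reach G (kept M) v"
    then show "u \<in> dom_of M"
    proof (rule reach_closed[OF _ v(1)])
      fix e a b assume "e \<in> kept M" "ends G e = {a, b}"
      then have "{a, b} \<subseteq> dom_of M" by (simp add: kept_def)
      then show "b \<in> dom_of M" by simp
    qed
  qed
  ultimately show r: "reach G (kept M) v = dom_of M" by simp
  have "bal (kept M)"
  proof (rule bal_mono)
    show "bal (kept M \<union> tree_edges M)"
    proof (rule cons_bal[OF t])
      show "kept M \<subseteq> edges G" by (auto simp: kept_def)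
      fix e a b assume e: "e \<in> kept M" "ends G e = {a, b}"
      then have "{a, b} \<subseteq> dom_of M" "cons_edge (\<lambda>u. set (pth M u)) e a b" by (simp_all add: kept_def)
      then show "a \<in> dom_of M \<and> b \<in> dom_of M \<and> cons_edge (\<lambda>u. set (pth M u)) e a b" by simp
    qed
  qed simp
  then show "bconn v (kept M)" unfolding bconn_def r using v by (simp add: kept_def subset_iff)
qed

lemma bconn_change_root:
  assumes "bconn v E" "u \<in> reach G E v"
  shows "bconn u E" "reach G E u = reach G E v"
proof -
  have 1: "reach G E v \<subseteq> reach G E u"
    by (rule subsetI) (rule reach_trans[OF _ reach_sym[OF assms(2)]])
  have 2: "reach G E u \<subseteq> reach G E v"
    by (rule subsetI) (rule reach_trans[OF _ assms(2)])
  show "reach G E u = reach G E v" using 1 2 by simp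
  then show "bconn u E" using assms reach_verts[OF assms(2)] unfolding bconn_def by simp
qed

lemma out_tree: "v < N \<Longrightarrow> tree_inv v (out k v \<beta>)"
  using out_inv[of v k \<beta>] by (auto simp: state_inv_def)

lemma out_bconn:
  assumes "v < N"
  shows "bconn v (kept (out k v \<beta>))" "reach G (kept (out k v \<beta>)) v = dom_of (out k v \<beta>)"
    "v \<in> dom_of (out k v \<beta>)" "dom_of (out k v \<beta>) \<subseteq> {..<N}"
  using tree_bconn[OF out_tree[OF assms]] tree_inv_dom[OF out_tree[OF assms]] by blast+

text \<open>Quantifying over the tail \<open>\<gamma>\<close> allows the sequence to be padded to
  the common length 2k and, for \<open>r = 0\<close>, makes every sequence successful.\<close>

lemma cover:
  assumes b: "bconn v E" and c: "csum (edges G) (reach G E v) E \<le> r" and rk: "r \<le> k"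
  shows "\<exists>\<beta>. length \<beta> \<le> 2 * r \<and> (\<forall>\<gamma>. reach G E v \<subseteq> dom_of (out k v (\<beta> @ \<gamma>)) \<and> card (cut (out k v (\<beta> @ \<gamma>))) \<le> r)"
proof -
  have v: "v < N" using b verts_eq by (auto simp: bconn_def)
  have s: "set [0..<length ps] = edges G" unfolding edges_eq by auto
  have te: "tree_edges [(v, 0, [], [])] = {}" by (simp add: tree_edges_def pth_def)
  have f: "feas v (set [0..<length ps]) (tree_edges [(v, 0, [], [])]) E"
    using b unfolding s te feas_def bconn_def by simp
  have c': "csum (set [0..<length ps]) (reach G E v) E \<le> r" using c unfolding s .
  \<comment> \<open>The minimum weight is at least 0, so 2r is a valid initial budget. This is where
    the length of the coin sequences comes from.\<close>
  have l: "2 * r \<le> p + 2 * r" for p by simp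
  have m: "N - card (dom_of [(v, 0, [], [])]) + length [0..<length ps] \<le> N + length ps" by simp
  obtain \<beta> where \<beta>: "length \<beta> \<le> 2 * r" and st: "\<forall>\<gamma>. \<exists>M' ids' \<delta> E'.
    (bstep k v ^^ (N + length ps)) ([(v, 0, [], [])], [0..<length ps], \<beta> @ \<gamma>) = (M', ids', \<delta>) \<and> state_inv v M' ids' \<and>
    barcs ps M' ids' = [] \<and> feas v (set ids') (tree_edges M') E' \<and> reach G E v \<subseteq> reach G E' v \<and>
    csum (set ids') (reach G E' v) E' + (length [0..<length ps] - length ids') \<le> r \<and>
    length ids' \<le> length [0..<length ps]"
    using branching_covers[OF init_inv[OF v] f c' rk l m] by (elim exE conjE)
  have "reach G E v \<subseteq> dom_of (out k v (\<beta> @ \<gamma>)) \<and> card (cut (out k v (\<beta> @ \<gamma>))) \<le> r" for \<gamma>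
  proof -
    obtain M' ids' \<delta> E' where *: "(bstep k v ^^ (N + length ps)) ([(v, 0, [], [])], [0..<length ps], \<beta> @ \<gamma>) = (M', ids', \<delta>)"
      "state_inv v M' ids'" "barcs ps M' ids' = []" "feas v (set ids') (tree_edges M') E'"
      "reach G E v \<subseteq> reach G E' v" "csum (set ids') (reach G E' v) E' + (length [0..<length ps] - length ids') \<le> r"
      "length ids' \<le> length [0..<length ps]" using spec[OF st, of \<gamma>] by (elim exE conjE)
    have o: "out k v (\<beta> @ \<gamma>) = M'" using *(1) by (simp add: out_def)
    have ids: "set ids' \<subseteq> edges G" "distinct ids'" and ti: "tree_inv v M'" using *(2) by (auto simp: state_inv_def)
    have t: "tree_ok v (\<lambda>u. set (pth M' u)) (dom_of M') (tree_edges M')" using ti by (simp add: tree_inv_def)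
    have E': "tree_edges M' \<subseteq> E'" "E' \<subseteq> set ids'" "bal E'" "\<And>e. e \<in> E' \<Longrightarrow> ends G e \<subseteq> reach G E' v"
      using *(4) by (auto simp: feas_def)
    have vd: "v \<in> dom_of M'" using tree_inv_dom[OF ti] by simp
    have r1: "reach G E' v \<subseteq> dom_of M'"
    proof
      fix u assume u: "u \<in> reach G E' v"
      show "u \<in> dom_of M'"
      proof (rule ccontr)
        assume "u \<notin> dom_of M'"
        then obtain i a b where "(i, a, b) \<in> set (barcs ps M' ids')"
          using leaving_arc[OF ids(1) E'(2) vd u] by blast
        then show False using *(3) by simp
      qed
    qed
    have "dom_of M' \<subseteq> reach G E' v" using reach_mono[OF E'(1), of G v] tree_inv_reach[OF ti] by simp
    then have r: "reach G E' v = dom_of M'" using r1 by simp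
    \<comment> \<open>A cut edge was deleted or is missing from \<open>E'\<close>: the edges of
      \<open>E'\<close> pass the consistency test, because \<open>E'\<close> is balanced and
      contains the whole tree. The two kinds are charged to the number of deletions and to the
      remaining count.\<close>
    have "cut M' \<subseteq> {e \<in> set ids'. ends G e \<inter> reach G E' v \<noteq> {} \<and> e \<notin> E'} \<union> (edges G - set ids')"
    proof
      fix e assume e: "e \<in> cut M'"
      have "e \<notin> E'"
      proof
        assume eE: "e \<in> E'"
        have eX: "ends G e \<subseteq> dom_of M'" using E'(4)[OF eE] r by simp
        have "cons_edge (\<lambda>u. set (pth M' u)) e a b" if ab: "ends G e = {a, b}" for a b
        proof (rule bal_cons_edge[OF t E'(3) _ _ eE _ ab])
          show ad: "a \<in> dom_of M'" and bd: "b \<in> dom_of M'" using eX ab by auto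
          show "set (pth M' a) \<subseteq> E'" "set (pth M' b) \<subseteq> E'"
            using E'(1) ad bd by (auto simp: tree_edges_def)
          show "e \<in> edges G" using e by (simp add: cut_def)
        qed
        then have "e \<in> kept M'" using e eX by (simp add: kept_def cut_def)
        then show False using e by (simp add: cut_def)
      qed
      then show "e \<in> {e \<in> set ids'. ends G e \<inter> reach G E' v \<noteq> {} \<and> e \<notin> E'} \<union> (edges G - set ids')"
        using e r by (auto simp: cut_def)
    qed
    then have "card (cut M') \<le> card ({e \<in> set ids'. ends G e \<inter> reach G E' v \<noteq> {} \<and> e \<notin> E'} \<union> (edges G - set ids'))"
      by (intro card_mono) (use finite_edges in auto)
    also have "\<dots> \<le> card {e \<in> set ids'. ends G e \<inter> reach G E' v \<noteq> {} \<and> e \<notin> E'} + card (edges G - set ids')"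
      by (rule card_Un_le)
    also have "card (edges G - set ids') = length ps - length ids'"
      using ids edges_eq by (subst card_Diff_subset) (auto simp: distinct_card)
    also have "card {e \<in> set ids'. ends G e \<inter> reach G E' v \<noteq> {} \<and> e \<notin> E'} = csum (set ids') (reach G E' v) E'"
    proof -
      have "csum (set ids') (reach G E' v) E' =
          (\<Sum>e\<in>set ids'. if e \<in> {e \<in> set ids'. ends G e \<inter> reach G E' v \<noteq> {} \<and> e \<notin> E'} then 1 else 0)"
        unfolding csum_def by (intro sum.cong) (auto simp: ct_def)
      also have "\<dots> = card {e \<in> set ids'. ends G e \<inter> reach G E' v \<noteq> {} \<and> e \<notin> E'}"
        by (subst sum.inter_restrict[symmetric]) (auto simp: Int_def)
      finally show ?thesis by simp
    qed
    finally have "card (cut M') \<le> r" using *(6) by simp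
    then show ?thesis using o r *(5) by simp
  qed
  then show ?thesis using \<beta> by blast
qed

definition acc :: "nat \<Rightarrow> nat \<Rightarrow> bool list \<Rightarrow> bool" where
  "acc k v \<beta> \<longleftrightarrow> card (cut (out k v \<beta>)) \<le> k \<and> (\<forall>u\<in>dom_of (out k v \<beta>). v \<le> u) \<and>
     \<not> (\<exists>\<beta>'. length \<beta>' = 2 * k \<and> dom_of (out k v \<beta>) \<subset> dom_of (out k v \<beta>') \<and>
         card (cut (out k v \<beta>')) \<le> card (cut (out k v \<beta>)))"

lemma cover_exact:
  assumes b: "bconn v E" and c: "csum (edges G) (reach G E v) E \<le> k"
  obtains \<beta> where "length \<beta> = 2 * k" "reach G E v \<subseteq> dom_of (out k v \<beta>)"
    "card (cut (out k v \<beta>)) \<le> csum (edges G) (reach G E v) E"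
proof -
  obtain \<beta> where \<beta>: "length \<beta> \<le> 2 * csum (edges G) (reach G E v) E"
    "\<And>\<gamma>. reach G E v \<subseteq> dom_of (out k v (\<beta> @ \<gamma>)) \<and> card (cut (out k v (\<beta> @ \<gamma>))) \<le> csum (edges G) (reach G E v) E"
    using cover[OF b le_refl c] by blast
  show ?thesis
    by (rule that[of "\<beta> @ replicate (2 * k - length \<beta>) False"]) (use \<beta> c in auto)
qed

text \<open>The test compares only with results at the same root, yet it excludes every larger
  connected balanced subgraph of no higher cost: such a subgraph contains \<open>v\<close>, can be
  rooted there, and is covered by the result of some coin sequence at \<open>v\<close>.\<close>

lemma acc_maximal:
  assumes a: "acc k v \<beta>" and v: "v < N" and b: "bconn u E" and s: "dom_of (out k v \<beta>) \<subset> reach G E u"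
    and c: "csum (edges G) (reach G E u) E \<le> card (cut (out k v \<beta>))"
  shows False
proof -
  have vr: "v \<in> reach G E u" using out_bconn(3)[OF v] s by blast
  note cr = bconn_change_root[OF b vr]
  have "csum (edges G) (reach G E v) E \<le> k" using a c cr(2) by (simp add: acc_def)
  then obtain \<beta>' where "length \<beta>' = 2 * k" "reach G E v \<subseteq> dom_of (out k v \<beta>')"
    "card (cut (out k v \<beta>')) \<le> csum (edges G) (reach G E v) E"
    using cover_exact[OF cr(1)] by blast
  then have "length \<beta>' = 2 * k \<and> dom_of (out k v \<beta>) \<subset> dom_of (out k v \<beta>') \<and>
      card (cut (out k v \<beta>')) \<le> card (cut (out k v \<beta>))" using s c cr(2) by auto
  then show False using a unfolding acc_def by blast
qed

text \<open>Started at \<open>x\<close>, some coin sequence covers the accepted set with no more cut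
  edges, and by maximality it cannot cover more than this set.\<close>

lemma acc_rerooted:
  assumes a: "acc k v \<beta>" and v: "v < N" and x: "x \<in> dom_of (out k v \<beta>)"
  obtains \<beta>' where "length \<beta>' = 2 * k" "dom_of (out k x \<beta>') = dom_of (out k v \<beta>)"
proof -
  let ?E = "kept (out k v \<beta>)" and ?Y = "dom_of (out k v \<beta>)"
  have xr: "x \<in> reach G ?E v" using x out_bconn(2)[OF v] by simp
  note cr = bconn_change_root[OF out_bconn(1)[OF v] xr]
  have r: "reach G ?E x = ?Y" using cr(2) out_bconn(2)[OF v] by simp
  have xN: "x < N" using x out_bconn(4)[OF v] by auto
  have "csum (edges G) (reach G ?E x) ?E \<le> k" using a unfolding r csum_kept by (simp add: acc_def)
  then obtain \<beta>' where \<beta>': "length \<beta>' = 2 * k" "?Y \<subseteq> dom_of (out k x \<beta>')" "card (cut (out k x \<beta>')) \<le> card (cut (out k v \<beta>))"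
    using cover_exact[OF cr(1)] unfolding r csum_kept by blast
  have "\<not> ?Y \<subset> dom_of (out k x \<beta>')"
    using acc_maximal[OF a v out_bconn(1)[OF xN, of k \<beta>']] \<beta>'(3) unfolding out_bconn(2)[OF xN] csum_kept by blast
  then show ?thesis using that[OF \<beta>'(1)] \<beta>'(2) by blast
qed

lemma card_bitlists: "card {\<beta> :: bool list. length \<beta> = n} = 2 ^ n"
  using card_lists_length_eq[of "UNIV :: bool set" n] by simp

lemma finite_bitlists: "finite {\<beta> :: bool list. length \<beta> = n}"
  using finite_lists_length_eq[of "UNIV :: bool set" n] by simp

text \<open>An accepted set containing \<open>x\<close> reappears as a result at \<open>x\<close>,
  and its root is its least vertex. The coin sequence used at \<open>x\<close> therefore determines
  the root, and there are 4^k sequences.\<close>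

lemma acc_count:
  "card {v. v < N \<and> (\<exists>\<beta>. acc k v \<beta> \<and> x \<in> dom_of (out k v \<beta>))} \<le> 4 ^ k"
proof -
  let ?V = "{v. v < N \<and> (\<exists>\<beta>. acc k v \<beta> \<and> x \<in> dom_of (out k v \<beta>))}"
  have "\<forall>v\<in>?V. \<exists>\<beta>'. length \<beta>' = 2 * k \<and> v \<in> dom_of (out k x \<beta>') \<and> (\<forall>u\<in>dom_of (out k x \<beta>'). v \<le> u)"
  proof
    fix v assume "v \<in> ?V"
    then obtain \<beta> where v: "v < N" "acc k v \<beta>" "x \<in> dom_of (out k v \<beta>)" by auto
    obtain \<beta>' where "length \<beta>' = 2 * k" "dom_of (out k x \<beta>') = dom_of (out k v \<beta>)"
      by (rule acc_rerooted[OF v(2,1,3)])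
    then show "\<exists>\<beta>'. length \<beta>' = 2 * k \<and> v \<in> dom_of (out k x \<beta>') \<and> (\<forall>u\<in>dom_of (out k x \<beta>'). v \<le> u)"
      using v(2) out_bconn(3)[OF v(1), of k \<beta>] by (auto simp: acc_def)
  qed
  from bchoice[OF this] obtain g where
    g': "\<forall>v\<in>?V. length (g v) = 2 * k \<and> v \<in> dom_of (out k x (g v)) \<and> (\<forall>u\<in>dom_of (out k x (g v)). v \<le> u)" ..
  have g: "length (g v) = 2 * k \<and> v \<in> dom_of (out k x (g v)) \<and> (\<forall>u\<in>dom_of (out k x (g v)). v \<le> u)"
    if "v \<in> ?V" for v using bspec[OF g' that] .
  have "inj_on g ?V"
  proof (rule inj_onI)
    fix v w assume v: "v \<in> ?V" and w: "w \<in> ?V" and eq: "g v = g w"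
    have "w \<in> dom_of (out k x (g v))" "v \<in> dom_of (out k x (g w))"
      using g[OF v] g[OF w] unfolding eq by blast+
    then have "v \<le> w" "w \<le> v" using g[OF v] g[OF w] by blast+
    then show "v = w" by (rule order_antisym)
  qed
  moreover have "g ` ?V \<subseteq> {\<beta>. length \<beta> = 2 * k}" using g by auto
  ultimately have "card ?V \<le> card {\<beta> :: bool list. length \<beta> = 2 * k}"
    using card_inj_on_le[of g ?V "{\<beta>. length \<beta> = 2 * k}"] finite_bitlists by simp
  also have "\<dots> = 4 ^ k" unfolding card_bitlists by (simp add: power_mult)
  finally show ?thesis .
qed

section \<open>Soundness of the output\<close>

definition family_ok :: "(nat \<times> entry list) set \<Rightarrow> bool" where
  "family_ok R \<longleftrightarrow> finite R \<and> (\<forall>(v, M)\<in>R. tree_inv v M)"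

definition out_verts :: "(nat \<times> entry list) set \<Rightarrow> nat set" where
  "out_verts R = (\<Union>(v, M)\<in>R. dom_of M)"

definition out_edges :: "(nat \<times> entry list) set \<Rightarrow> nat set" where
  "out_edges R = (\<Union>(v, M)\<in>{(v, M) \<in> R. \<not> (\<exists>(v', M')\<in>R. dom_of M \<subset> dom_of M')}. cut M)"

lemma maximal_member:
  assumes R: "family_ok R" and x: "x \<in> out_verts R"
  obtains v M where "(v, M) \<in> R" "x \<in> dom_of M" "tree_inv v M" "cut M \<subseteq> out_edges R"
proof -
  let ?D = "(\<lambda>(v, M). dom_of M) ` {(v, M) \<in> R. x \<in> dom_of M}"
  have "finite {(v, M) \<in> R. x \<in> dom_of M}"
    by (rule finite_subset[of _ R]) (use R in \<open>auto simp: family_ok_def\<close>)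
  then have "finite ?D" by simp
  moreover have "?D \<noteq> {}" using x by (auto simp: out_verts_def)
  ultimately have "\<exists>Y\<in>?D. \<forall>Y'\<in>?D. Y \<subseteq> Y' \<longrightarrow> Y = Y'" by (rule finite_has_maximal)
  then obtain Y where Y1: "Y \<in> ?D" and Y2: "\<forall>Y'\<in>?D. Y \<subseteq> Y' \<longrightarrow> Y = Y'" by (elim bexE)
  from Y1 obtain v M where M: "(v, M) \<in> R" "x \<in> dom_of M" "Y = dom_of M" by auto
  have "\<not> (\<exists>(v', M')\<in>R. dom_of M \<subset> dom_of M')"
  proof
    assume "\<exists>(v', M')\<in>R. dom_of M \<subset> dom_of M'"
    then obtain v' M' where M': "(v', M') \<in> R" "dom_of M \<subset> dom_of M'" by auto
    then have "x \<in> dom_of M'" using M(2) by blast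
    then have "dom_of M' \<in> ?D" using M'(1) by force
    then have "Y = dom_of M'" using bspec[OF Y2, of "dom_of M'"] M(3) M'(2) by simp
    then show False using M'(2) M(3) by simp
  qed
  then have "(v, M) \<in> {(v, M) \<in> R. \<not> (\<exists>(v', M')\<in>R. dom_of M \<subset> dom_of M')}" using M(1) by simp
  then have "cut M \<subseteq> out_edges R" unfolding out_edges_def by blast
  then show ?thesis using that M R by (auto simp: family_ok_def)
qed

lemma cycle_connected:
  assumes "is_cycle G C" "a \<in> \<Union>(ends G ` C)" "b \<in> \<Union>(ends G ` C)"
  shows "b \<in> reach G C a"
proof (cases "a = b")
  case True then show ?thesis by (simp add: reach_refl)
next
  case False
  obtain p q ps qs where "path_between G a b ps p" "C = set p \<union> set q"
    using cycle_split[OF assms False] by metis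
  then show ?thesis using path_reach[of G a b ps p b] path_ends_in[of G a b ps p] reach_mono[of "set p" C G a] by auto
qed

text \<open>Every output vertex lies in an inclusion-maximal result, all of whose cut edges are
  deleted. Thus a remaining cycle that touches such a result consists of its kept edges, and these
  are balanced; for a boundary edge the same result supplies the cut.\<close>

lemma output_sound:
  assumes R: "family_ok R"
  shows "out_verts R \<subseteq> verts G" "out_edges R \<subseteq> edges G" "boundary G (out_verts R) \<subseteq> out_edges R"
    "balanced \<B> (induced (delete_edges G (out_edges R)) (out_verts R))"
proof -
  let ?S = "out_verts R" and ?F = "out_edges R"
  show "?S \<subseteq> verts G"
    using R tree_inv_dom verts_eq unfolding family_ok_def out_verts_def by fastforce
  show "?F \<subseteq> edges G" by (auto simp: out_edges_def cut_def)
  show "boundary G ?S \<subseteq> ?F"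
  proof
    fix e assume e: "e \<in> boundary G ?S"
    then obtain x where x: "x \<in> ends G e" "x \<in> ?S" by (auto simp: boundary_def)
    obtain v M where M: "(v, M) \<in> R" "x \<in> dom_of M" "cut M \<subseteq> ?F" by (rule maximal_member[OF R x(2)])
    have "dom_of M \<subseteq> ?S" using M(1) by (auto simp: out_verts_def)
    then have "\<not> ends G e \<subseteq> dom_of M" using e by (auto simp: boundary_def)
    then have "e \<in> cut M" using e x M(2) by (auto simp: cut_def kept_def boundary_def)
    then show "e \<in> ?F" using M(3) by auto
  qed
  show "balanced \<B> (induced (delete_edges G ?F) ?S)"
    unfolding balanced_def
  proof (intro allI impI)
    fix C assume C: "is_cycle (induced (delete_edges G ?F) ?S) C"
    have "walk G vs es" if "walk (induced (delete_edges G ?F) ?S) vs es" for vs es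
      using that by (auto simp: walk_def induced_def delete_edges_def)
    then have cG: "is_cycle G C" using C unfolding is_cycle_def by blast
    have Ce: "C \<subseteq> edges G - ?F" "\<And>e. e \<in> C \<Longrightarrow> ends G e \<subseteq> ?S"
      using cycle_ne[OF C] by (auto simp: induced_def delete_edges_def)
    obtain e0 where e0: "e0 \<in> C" using cycle_ne[OF cG] by auto
    then obtain x y where xy: "ends G e0 = {x, y}" using edge_ends_ex Ce(1) by blast
    then have x: "x \<in> ?S" using Ce(2)[OF e0] by simp
    obtain v M where M: "(v, M) \<in> R" "x \<in> dom_of M" "tree_inv v M" "cut M \<subseteq> ?F" by (rule maximal_member[OF R x])
    have st: "e \<in> kept M" if "e \<in> C" "ends G e \<inter> dom_of M \<noteq> {}" for e
      using that Ce(1) M(4) by (auto simp: cut_def)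
    have all: "b \<in> dom_of M" if "b \<in> \<Union>(ends G ` C)" for b
    proof -
      have "b \<in> reach G C x" using cycle_connected[OF cG _ that] e0 xy by auto
      then show ?thesis
      proof (rule reach_closed[OF _ M(2)])
        fix e a c assume "e \<in> C" "ends G e = {a, c}" "a \<in> dom_of M"
        then show "c \<in> dom_of M" using st[of e] by (auto simp: kept_def)
      qed
    qed
    have "C \<subseteq> kept M"
    proof
      fix e assume e: "e \<in> C"
      then obtain a c where "ends G e = {a, c}" using edge_ends_ex Ce(1) by blast
      then show "e \<in> kept M" using st[OF e] all[of a] e by auto
    qed
    then show "C \<in> \<B>" using tree_bconn(1)[OF M(3)] cG by (auto simp: bconn_def bal_def)
  qed
qed

end

section \<open>Success of the random choices\<close>

context rgraph
begin

definition miss :: "nat set \<Rightarrow> nat set \<Rightarrow> nat set" where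
  "miss X E = {e \<in> edges G. ends G e \<inter> X \<noteq> {} \<and> e \<notin> E}"

definition sol :: "nat set \<Rightarrow> nat set \<Rightarrow> bool" where
  "sol X E \<longleftrightarrow> X \<subseteq> verts G \<and> E \<subseteq> edges G \<and> (\<forall>e\<in>E. ends G e \<subseteq> X) \<and> bal E"

text \<open>The two parts of the conclusion say that the vertex set cannot grow without raising the
  cost, and that no other edge set on the same vertices is cheaper.\<close>

definition opt :: "nat set \<Rightarrow> nat set \<Rightarrow> bool" where
  "opt X E \<longleftrightarrow> sol X E \<and> (\<forall>X' E'. sol X' E' \<longrightarrow> X \<subseteq> X' \<longrightarrow> card (miss X' E') \<le> card (miss X E) \<longrightarrow>
     X' = X \<and> card (miss X' E') = card (miss X E))"

definition sel :: "nat \<Rightarrow> (nat \<Rightarrow> bool list) \<Rightarrow> (nat \<Rightarrow> bool) \<Rightarrow> (nat \<times> entry list) set" where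
  "sel k \<beta> \<gamma> = (\<lambda>v. (v, out k v (\<beta> v))) ` {v. v < N \<and> acc k v (\<beta> v) \<and> (cut (out k v (\<beta> v)) = {} \<or> \<gamma> v)}"

lemma finite_miss: "finite (miss X E)"
  using finite_edges by (simp add: miss_def)

lemma csum_miss: "csum (edges G) X E = card (miss X E)"
  by (simp add: csum_card miss_def)

lemma finite_verts: "finite (verts G)"
  by (simp add: verts_eq)

lemma opt_exists:
  assumes s: "sol X0 E0"
  obtains X E where "opt X E" "X0 \<subseteq> X" "card (miss X E) \<le> card (miss X0 E0)"
proof -
  define m where "m = card (miss X0 E0)"
  define P where "P = (\<lambda>(X, E). sol X E \<and> X0 \<subseteq> X \<and> card (miss X E) \<le> m)"
  \<comment> \<open>A lexicographic order in one number: the second summand is at most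
    \<open>m\<close>, so the number of vertices dominates.\<close>
  define f where "f = (\<lambda>(X, E). card X * Suc m + (m - card (miss X E)))"
  have P0: "P (X0, E0)" using s by (simp add: P_def m_def)
  have bd: "f p \<le> card (verts G) * Suc m + m" if "P p" for p
  proof (cases p)
    case (Pair X E)
    then have "card X \<le> card (verts G)" using that finite_verts by (auto simp: P_def sol_def intro: card_mono)
    then have "card X * Suc m \<le> card (verts G) * Suc m" by (rule mult_le_mono1)
    then show ?thesis using Pair by (simp add: f_def add_mono del: mult_Suc_right)
  qed
  have "\<forall>p. P p \<longrightarrow> f p < Suc (card (verts G) * Suc m + m)" using bd by (simp add: less_Suc_eq_le)
  from Lattices_Big.ex_has_greatest_nat[OF P0 this] obtain p where p1: "P p" "\<forall>q. P q \<longrightarrow> f q \<le> f p"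
    by (elim exE conjE)
  have p: "P p" "P q \<Longrightarrow> f q \<le> f p" for q using p1(1) spec[OF p1(2), of q] by simp_all
  obtain X E where XE: "p = (X, E)" by (cases p)
  have PX: "sol X E" "X0 \<subseteq> X" "card (miss X E) \<le> m" using p(1) by (simp_all add: XE P_def)
  have "X' = X \<and> card (miss X' E') = card (miss X E)"
    if X': "sol X' E'" "X \<subseteq> X'" "card (miss X' E') \<le> card (miss X E)" for X' E'
  proof -
    have "P (X', E')" using X' PX by (simp add: P_def)
    from p(2)[OF this] have f: "card X' * Suc m + (m - card (miss X' E')) \<le> card X * Suc m + (m - card (miss X E))"
      by (simp add: f_def XE del: mult_Suc_right)
    have fX': "finite X'" using X'(1) finite_verts by (auto simp: sol_def intro: finite_subset)
    have c: "card X \<le> card X'" by (rule card_mono[OF fX' X'(2)])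
    have "\<not> card X < card X'"
    proof
      assume "card X < card X'"
      then have "Suc (card X) * Suc m \<le> card X' * Suc m" by (intro mult_le_mono1) simp
      then have "card X * Suc m + Suc m \<le> card X' * Suc m" by (simp only: mult_Suc add.commute)
      then show False using f by linarith
    qed
    then have eq: "card X = card X'" using c by simp
    then have "X = X'" using card_subset_eq[OF fX' X'(2)] by simp
    then show ?thesis using f eq X'(3) PX(3) by simp
  qed
  then have "opt X E" using PX(1) by (simp add: opt_def)
  then show ?thesis using that PX by (simp add: m_def)
qed

lemma subgraph_sol:
  assumes H: "subgraph H G" "balanced \<B> H"
  shows "sol (verts H) (edges H)" "card (miss (verts H) (edges H)) = cost G H"
proof -
  have wfH: "wf_mgraph H" and V: "verts H \<subseteq> verts G" and E: "edges H \<subseteq> edges G"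
    and en: "\<And>e. e \<in> edges H \<Longrightarrow> ends H e = ends G e" using H(1) by (auto simp: subgraph_def)
  have ev: "ends G e \<subseteq> verts H" if "e \<in> edges H" for e using wf_ends[OF wfH that] en[OF that] by simp
  have "bal (edges H)"
    unfolding bal_def
  proof (intro allI impI)
    fix C assume C: "is_cycle G C" "C \<subseteq> edges H"
    from C(1) obtain vs es where w: "walk G vs es" "es \<noteq> []" and cy: "hd vs = last vs" "distinct (tl vs)" "distinct es" "C = set es"
      unfolding is_cycle_def by blast
    have l: "length vs = Suc (length es)" and i: "\<And>i. i < length es \<Longrightarrow> ends G (es ! i) = {vs ! i, vs ! Suc i}"
      using w(1) by (simp_all add: walk_def)
    have m: "es ! i \<in> edges H" if "i < length es" for i using C(2) cy(4) nth_mem[OF that] by blast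
    have "vs ! j \<in> verts H" if "j < length vs" for j
    proof (cases "j < length es")
      case True
      then show ?thesis using ev[OF m[OF True]] i[OF True] by simp
    next
      case False
      then have "j = Suc (length es - 1)" "length es - 1 < length es" using that l w(2) by auto
      then show ?thesis using ev[OF m[of "length es - 1"]] i[of "length es - 1"] by simp
    qed
    then have "set vs \<subseteq> verts H" by (auto simp: in_set_conv_nth)
    then have "walk H vs es" using l C(2) cy(4) m en i by (simp add: walk_def)
    then have "is_cycle H C" unfolding is_cycle_def using w(2) cy by blast
    then show "C \<in> \<B>" using H(2) by (simp add: balanced_def)
  qed
  then show "sol (verts H) (edges H)" using V E ev by (simp add: sol_def)
  have "miss (verts H) (edges H) = boundary G (verts H) \<union> (edges (induced G (verts H)) - edges H)"
  proof (intro set_eqI iffI)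
    fix e assume "e \<in> miss (verts H) (edges H)"
    then show "e \<in> boundary G (verts H) \<union> (edges (induced G (verts H)) - edges H)"
      by (auto simp: miss_def boundary_def induced_def)
  next
    fix e assume e: "e \<in> boundary G (verts H) \<union> (edges (induced G (verts H)) - edges H)"
    then have eG: "e \<in> edges G" by (auto simp: boundary_def induced_def)
    then obtain a b where "ends G e = {a, b}" using edge_ends_ex by blast
    then show "e \<in> miss (verts H) (edges H)"
      using e ev[of e] by (auto simp: miss_def boundary_def induced_def)
  qed
  moreover have "boundary G (verts H) \<inter> (edges (induced G (verts H)) - edges H) = {}"
    by (auto simp: boundary_def induced_def)
  moreover have "finite (boundary G (verts H))" "finite (edges (induced G (verts H)) - edges H)"
    using finite_edges by (simp_all add: boundary_def induced_def)
  ultimately show "card (miss (verts H) (edges H)) = cost G H"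
    unfolding cost_def by (simp add: card_Un_disjoint)
qed

end

section \<open>Components of an optimal solution\<close>

locale opt_sol = rgraph +
  fixes X E :: "nat set"
  assumes opt: "opt X E"
begin

definition K :: "nat \<Rightarrow> nat set" where "K u = reach G E u"
definition EK :: "nat \<Rightarrow> nat set" where "EK u = E \<inter> {e. ends G e \<subseteq> K u}"
definition MK :: "nat \<Rightarrow> nat set" where "MK u = {e \<in> miss X E. ends G e \<inter> K u \<noteq> {}}"

lemma sol: "sol X E" and X_verts: "X \<subseteq> verts G" and E_edges: "E \<subseteq> edges G" and bal_E: "bal E"
  and E_ends: "e \<in> E \<Longrightarrow> ends G e \<subseteq> X"
  using opt by (auto simp: opt_def sol_def)

lemma K_self: "u \<in> K u"
  by (simp add: K_def reach_refl)

lemma K_sub: "u \<in> X \<Longrightarrow> K u \<subseteq> X"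
proof
  fix w assume u: "u \<in> X" and "w \<in> K u"
  then show "w \<in> X" unfolding K_def
    by (elim reach_closed) (use E_ends in auto)
qed

lemma K_eq: "w \<in> K u \<Longrightarrow> K w = K u"
proof -
  assume w: "w \<in> K u"
  then have r: "w \<in> reach G E u" by (simp add: K_def)
  show ?thesis unfolding K_def
  proof
    show "reach G E w \<subseteq> reach G E u" by (rule subsetI) (rule reach_trans[OF _ r])
    show "reach G E u \<subseteq> reach G E w" by (rule subsetI) (rule reach_trans[OF _ reach_sym[OF r]])
  qed
qed

lemma K_edge: "e \<in> E \<Longrightarrow> ends G e \<inter> K u \<noteq> {} \<Longrightarrow> ends G e \<subseteq> K u"
proof -
  assume e: "e \<in> E" and t: "ends G e \<inter> K u \<noteq> {}"
  obtain a b where ab: "ends G e = {a, b}" using edge_ends_ex E_edges e by blast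
  have "a \<in> K u \<longleftrightarrow> b \<in> K u" unfolding K_def by (rule reach_endsI[OF e ab])
  then show ?thesis using t ab by auto
qed

lemma EK_reach: "reach G (EK u) u = K u"
  unfolding EK_def K_def by (rule reach_inside)

lemma bconn_K: "u \<in> X \<Longrightarrow> bconn u (EK u)"
  using X_verts E_edges bal_mono[OF bal_E, of "EK u"] unfolding bconn_def EK_reach by (auto simp: EK_def)

lemma csum_K: "u \<in> X \<Longrightarrow> csum (edges G) (reach G (EK u) u) (EK u) = card (MK u)"
proof -
  assume u: "u \<in> X"
  have "miss (K u) (EK u) = MK u"
  proof (intro set_eqI iffI)
    fix e assume "e \<in> miss (K u) (EK u)"
    then have e: "e \<in> edges G" "ends G e \<inter> K u \<noteq> {}" "e \<notin> EK u" by (auto simp: miss_def)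
    have "e \<notin> E" using e(3) K_edge[OF _ e(2)] by (auto simp: EK_def)
    moreover have "ends G e \<inter> X \<noteq> {}" using e(2) K_sub[OF u] by blast
    ultimately show "e \<in> MK u" using e by (simp add: MK_def miss_def)
  next
    fix e assume "e \<in> MK u"
    then show "e \<in> miss (K u) (EK u)" by (simp add: MK_def miss_def EK_def)
  qed
  then show ?thesis unfolding EK_reach csum_miss by simp
qed

text \<open>An edge between two components could be added as a bridge.\<close>

lemma no_bridge:
  assumes e: "e \<in> edges G" "ends G e = {a, b}" and a: "a \<in> X" and b: "b \<in> X"
  shows "b \<in> K a"
proof (rule ccontr)
  assume n: "b \<notin> K a"
  have eE: "e \<notin> E" using K_edge[of e a] e(2) n K_self[of a] by auto
  have "bal (insert e E)"
  proof (rule bal_bridge[OF bal_E e K_self n])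
    fix f x y assume f: "f \<in> E" "ends G f = {x, y}" "x \<in> K a"
    then have "ends G f \<subseteq> K a" by (intro K_edge) auto
    then show "y \<in> K a" using f by simp
  qed
  then have s: "sol X (insert e E)" using sol e a b by (simp add: sol_def)
  have "miss X (insert e E) = miss X E - {e}" by (auto simp: miss_def)
  moreover have em: "e \<in> miss X E" using e eE a by (simp add: miss_def)
  ultimately have lt: "card (miss X (insert e E)) < card (miss X E)"
    using finite_miss card_Diff1_less[of "miss X E" e] by simp
  then have "card (miss X (insert e E)) = card (miss X E)"
    using opt s unfolding opt_def by (meson less_imp_le subset_refl)
  then show False using lt by simp
qed

text \<open>Replacing everything that touches the larger connected set by that set gives another
  solution. Its missing edges are those of the new part and those not charged to the component of
  \<open>u\<close>, so it costs no more, and optimality forces its vertices to lie in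
  \<open>X\<close>.\<close>

lemma exchange:
  assumes u: "u \<in> X" and b: "bconn w E'" and sub: "K u \<subset> reach G E' w"
    and c: "csum (edges G) (reach G E' w) E' \<le> card (MK u)"
  shows False
proof -
  let ?Y = "reach G E' w"
  let ?E1 = "{e \<in> E. ends G e \<inter> ?Y = {}}"
  have E': "w \<in> verts G" "E' \<subseteq> edges G" "bal E'" "\<And>e. e \<in> E' \<Longrightarrow> ends G e \<subseteq> ?Y" using b by (auto simp: bconn_def)
  have Yv: "?Y \<subseteq> verts G" using reach_verts[OF _ E'(2,1)] by (rule subsetI)
  have "bal (?E1 \<union> E')"
  proof (rule bal_union[OF _ E'(3) _ E'(2,1)])
    show "bal ?E1" by (rule bal_mono[OF bal_E]) simp
    show "?E1 \<subseteq> edges G" using E_edges by blast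
    have "\<Union>(ends G ` E') \<subseteq> ?Y" by (rule UN_least) (rule E'(4))
    moreover have "\<Union>(ends G ` ?E1) \<inter> ?Y = {}" by blast
    ultimately have "\<Union>(ends G ` ?E1) \<inter> \<Union>(ends G ` E') = {}" by blast
    then show "\<Union>(ends G ` ?E1) \<inter> \<Union>(ends G ` E') \<subseteq> reach G (?E1 \<inter> E') w" by simp
  qed
  moreover have "ends G e \<subseteq> X \<union> ?Y" if "e \<in> ?E1 \<union> E'" for e
    using that E_ends[of e] E'(4)[of e] by blast
  moreover have "?E1 \<union> E' \<subseteq> edges G" using E_edges E'(2) by blast
  ultimately have s: "sol (X \<union> ?Y) (?E1 \<union> E')" unfolding sol_def using X_verts Yv by simp
  have "miss (X \<union> ?Y) (?E1 \<union> E') \<subseteq> miss ?Y E' \<union> (miss X E - MK u)"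
  proof
    fix e assume e: "e \<in> miss (X \<union> ?Y) (?E1 \<union> E')"
    then have eG: "e \<in> edges G" "e \<notin> E'" "e \<in> E \<Longrightarrow> ends G e \<inter> ?Y \<noteq> {}" "ends G e \<inter> (X \<union> ?Y) \<noteq> {}"
      by (auto simp: miss_def)
    show "e \<in> miss ?Y E' \<union> (miss X E - MK u)"
    proof (cases "ends G e \<inter> ?Y = {}")
      case True
      then have "e \<notin> E" "ends G e \<inter> X \<noteq> {}" "ends G e \<inter> K u = {}" using eG(3,4) sub by blast+
      then show ?thesis using eG(1) by (simp add: miss_def MK_def)
    next
      case False then show ?thesis using eG by (simp add: miss_def)
    qed
  qed
  then have "card (miss (X \<union> ?Y) (?E1 \<union> E')) \<le> card (miss ?Y E' \<union> (miss X E - MK u))"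
    by (intro card_mono) (simp_all add: finite_miss)
  also have "\<dots> \<le> card (miss ?Y E') + card (miss X E - MK u)" by (rule card_Un_le)
  also have "card (miss X E - MK u) = card (miss X E) - card (MK u)"
    by (rule card_Diff_subset) (auto simp: MK_def finite_miss)
  also have "card (miss ?Y E') + (card (miss X E) - card (MK u)) \<le> card (miss X E)"
  proof -
    have "card (MK u) \<le> card (miss X E)" by (rule card_mono[OF finite_miss]) (simp add: MK_def)
    then show ?thesis using c unfolding csum_miss by linarith
  qed
  finally have "card (miss (X \<union> ?Y) (?E1 \<union> E')) \<le> card (miss X E)" .
  then have XY: "X \<union> ?Y = X" using opt s unfolding opt_def by (meson sup_ge1)
  have uY: "u \<in> ?Y" using sub K_self by blast
  \<comment> \<open>Now \<open>?Y\<close> lies in \<open>X\<close>, where by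
    \<open>no_bridge\<close> no edge of \<open>G\<close> joins two components; being connected, it
    stays within \<open>K u\<close>.\<close>
  have "?Y \<subseteq> K u"
  proof
    fix y assume "y \<in> ?Y"
    then have "y \<in> reach G E' u" using reach_trans[OF _ reach_sym[OF uY]] by simp
    then show "y \<in> K u"
    proof (rule reach_closed[OF _ K_self])
      fix e a b assume e: "e \<in> E'" "ends G e = {a, b}" "a \<in> K u"
      have "{a, b} \<subseteq> X" using E'(4)[OF e(1)] XY e(2) by blast
      then have "b \<in> K a" using no_bridge[of e a b] E'(2) e(1,2) by auto
      then show "b \<in> K u" using K_eq[OF e(3)] by simp
    qed
  qed
  then show False using sub by simp
qed

definition good :: "nat set" where "good = {v \<in> X. \<forall>u\<in>K v. v \<le> u}"

lemma good_less: "v \<in> good \<Longrightarrow> v < N"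
  using X_verts verts_eq by (auto simp: good_def)

lemma good_ex: "u \<in> X \<Longrightarrow> \<exists>v\<in>good. K v = K u"
proof -
  assume u: "u \<in> X"
  let ?v = "LEAST v. v \<in> K u"
  have v: "?v \<in> K u" using K_self by (rule LeastI)
  have "?v \<le> w" if "w \<in> K u" for w using that by (rule Least_le)
  then have "?v \<in> good" using K_eq[OF v] v K_sub[OF u] by (auto simp: good_def)
  then show ?thesis using K_eq[OF v] by blast
qed

lemma good_inj: "v \<in> good \<Longrightarrow> w \<in> good \<Longrightarrow> K v = K w \<Longrightarrow> v = w"
  using K_self[of v] K_self[of w] unfolding good_def by (metis (no_types, lifting) mem_Collect_eq order_antisym)

text \<open>A missing edge at two components would join them, against \<open>no_bridge\<close>.
  Hence the costs of the components add up to at most the total cost.\<close>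

lemma MK_disjoint:
  assumes v: "v \<in> good" "w \<in> good" "v \<noteq> w"
  shows "MK v \<inter> MK w = {}"
proof (rule ccontr)
  assume "MK v \<inter> MK w \<noteq> {}"
  then obtain e where e: "e \<in> edges G" "ends G e \<inter> K v \<noteq> {}" "ends G e \<inter> K w \<noteq> {}"
    by (auto simp: MK_def miss_def)
  obtain x y where xy: "x \<in> ends G e" "x \<in> K v" "y \<in> ends G e" "y \<in> K w" using e by blast
  have X: "x \<in> X" "y \<in> X" using xy K_sub v by (auto simp: good_def)
  have "y \<in> K x"
  proof (cases "x = y")
    case True then show ?thesis by (simp add: K_self)
  next
    case False
    obtain a b where "ends G e = {a, b}" using edge_ends_ex e(1) by blast
    then have "ends G e = {x, y}" using xy False by auto
    then show ?thesis using no_bridge e(1) X by blast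
  qed
  then have "K v = K w" using K_eq xy by metis
  then show False using good_inj v by blast
qed

text \<open>A component without missing edges needs no coin, so all sequences succeed for it. Only
  the components with missing edges, at most k in number, put conditions on the coins. Acceptance
  follows from \<open>exchange\<close>.\<close>

lemma good_cover:
  assumes v: "v \<in> good" and k: "card (MK v) \<le> k"
  shows "\<exists>\<beta>. length \<beta> = 2 * k \<and> (\<forall>\<beta>'. (\<beta>' = \<beta> \<or> MK v = {}) \<longrightarrow>
    dom_of (out k v \<beta>') = K v \<and> card (cut (out k v \<beta>')) \<le> card (MK v) \<and> acc k v \<beta>')"
proof -
  have vX: "v \<in> X" and least: "\<And>u. u \<in> K v \<Longrightarrow> v \<le> u" using v by (auto simp: good_def)
  have vN: "v < N" by (rule good_less[OF v])
  have c: "csum (edges G) (reach G (EK v) v) (EK v) \<le> card (MK v)" by (simp add: csum_K[OF vX])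
  obtain \<beta> where \<beta>: "length \<beta> \<le> 2 * card (MK v)"
    "\<And>\<gamma>. K v \<subseteq> dom_of (out k v (\<beta> @ \<gamma>)) \<and> card (cut (out k v (\<beta> @ \<gamma>))) \<le> card (MK v)"
    using cover[OF bconn_K[OF vX] c k] unfolding EK_reach by blast
  define ok where "ok = (\<lambda>\<beta>'. dom_of (out k v \<beta>') = K v \<and> card (cut (out k v \<beta>')) \<le> card (MK v) \<and> acc k v \<beta>')"
  have max: "\<not> K v \<subset> dom_of (out k v \<beta>')" if "card (cut (out k v \<beta>')) \<le> card (MK v)" for \<beta>'
    using exchange[OF vX out_bconn(1)[OF vN, of k \<beta>']] that unfolding out_bconn(2)[OF vN] csum_kept by blast
  have 1: "ok (\<beta> @ \<gamma>)" for \<gamma>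
  proof -
    have d: "dom_of (out k v (\<beta> @ \<gamma>)) = K v" using \<beta>(2)[of \<gamma>] max[of "\<beta> @ \<gamma>"] by blast
    have "acc k v (\<beta> @ \<gamma>)" unfolding acc_def d
    proof (intro conjI ballI notI)
      show "card (cut (out k v (\<beta> @ \<gamma>))) \<le> k" using \<beta>(2)[of \<gamma>] k by simp
      show "v \<le> u" if "u \<in> K v" for u by (rule least[OF that])
      assume "\<exists>\<beta>'. length \<beta>' = 2 * k \<and> K v \<subset> dom_of (out k v \<beta>') \<and> card (cut (out k v \<beta>')) \<le> card (cut (out k v (\<beta> @ \<gamma>)))"
      then obtain \<beta>' where "K v \<subset> dom_of (out k v \<beta>')" "card (cut (out k v \<beta>')) \<le> card (cut (out k v (\<beta> @ \<gamma>)))"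
        by blast
      then show False using max[of \<beta>'] \<beta>(2)[of \<gamma>] by simp
    qed
    then show ?thesis using d \<beta>(2)[of \<gamma>] by (simp add: ok_def)
  qed
  show ?thesis
  proof (intro exI conjI allI impI)
    show "length (\<beta> @ replicate (2 * k - length \<beta>) False) = 2 * k" using \<beta>(1) k by simp
    fix \<beta>' assume h: "\<beta>' = \<beta> @ replicate (2 * k - length \<beta>) False \<or> MK v = {}"
    have "ok \<beta>'"
    proof (cases "MK v = {}")
      case True
      then have "\<beta> = []" using \<beta>(1) by simp
      then show ?thesis using 1[of \<beta>'] by simp
    next
      case False
      then show ?thesis using h 1 by simp
    qed
    then show "dom_of (out k v \<beta>') = K v" "card (cut (out k v \<beta>')) \<le> card (MK v)" "acc k v \<beta>'"
      by (simp_all add: ok_def)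
  qed
qed

definition W :: "nat set" where "W = \<Union>(ends G ` miss X E)"

text \<open>The quantifier over \<open>\<beta>\<close> makes this set independent of the coins
  drawn, so that it can be fixed before probabilities are computed.\<close>

definition bad :: "nat \<Rightarrow> nat set" where
  "bad k = {v. v < N \<and> v \<notin> good \<and> (\<exists>\<beta>. acc k v \<beta> \<and> dom_of (out k v \<beta>) \<inter> W \<noteq> {})}"

lemma card_ends_le: "e \<in> edges G \<Longrightarrow> card (ends G e) \<le> 2"
proof -
  assume "e \<in> edges G"
  then obtain a b where "ends G e = {a, b}" using edge_ends_ex by blast
  then show ?thesis by (simp add: card_insert_if)
qed

lemma card_bad:
  assumes "card (miss X E) \<le> k"
  shows "card (bad k) \<le> 2 * k * 4 ^ k"
proof -
  have "card W \<le> (\<Sum>e\<in>miss X E. card (ends G e))" unfolding W_def by (rule card_UN_le[OF finite_miss])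
  also have "\<dots> \<le> (\<Sum>e\<in>miss X E. 2)" by (rule sum_mono) (rule card_ends_le, simp add: miss_def)
  finally have W: "card W \<le> 2 * k" using assms by simp
  have fW: "finite W" unfolding W_def
  proof (rule finite_UN_I[OF finite_miss])
    fix e assume "e \<in> miss X E"
    then have "e \<in> edges G" by (simp add: miss_def)
    then obtain a b where "ends G e = {a, b}" using edge_ends_ex by blast
    then show "finite (ends G e)" by simp
  qed
  let ?A = "\<lambda>x. {v. v < N \<and> (\<exists>\<beta>. acc k v \<beta> \<and> x \<in> dom_of (out k v \<beta>))}"
  have "bad k \<subseteq> (\<Union>x\<in>W. ?A x)" unfolding bad_def by blast
  then have "card (bad k) \<le> card (\<Union>x\<in>W. ?A x)" by (intro card_mono) (simp_all add: fW)
  also have "\<dots> \<le> (\<Sum>x\<in>W. card (?A x))" by (rule card_UN_le[OF fW])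
  also have "\<dots> \<le> (\<Sum>x\<in>W. 4 ^ k)" by (rule sum_mono) (rule acc_count)
  also have "\<dots> \<le> 2 * k * 4 ^ k" using W by simp
  finally show ?thesis .
qed

text \<open>A selected result at any other root which cuts an edge at \<open>X\<close> would avoid
  the ends of all missing edges. It could then spread from \<open>X\<close> only along edges of
  \<open>E\<close>, hence within one component, and as an inclusion-maximal selected result it would
  equal that component. Its least vertex would make the root a good one.\<close>

lemma success_opt:
  assumes k: "card (miss X E) \<le> k"
    and b: "\<And>v \<beta>'. v \<in> good \<Longrightarrow> \<beta>' = b v \<or> MK v = {} \<Longrightarrow>
      dom_of (out k v \<beta>') = K v \<and> card (cut (out k v \<beta>')) \<le> card (MK v) \<and> acc k v \<beta>'"
    and A: "\<And>v. v \<in> good \<Longrightarrow> MK v \<noteq> {} \<Longrightarrow> \<beta> v = b v \<and> \<gamma> v"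
    and B: "\<And>v. v \<in> bad k \<Longrightarrow> \<not> \<gamma> v"
  shows "X \<subseteq> out_verts (sel k \<beta> \<gamma>)" "card {e \<in> out_edges (sel k \<beta> \<gamma>). ends G e \<inter> X \<noteq> {}} \<le> k"
proof -
  let ?R = "sel k \<beta> \<gamma>"
  let ?M = "\<lambda>v. out k v (\<beta> v)"
  have g: "dom_of (?M v) = K v" "card (cut (?M v)) \<le> card (MK v)" "acc k v (\<beta> v)" if "v \<in> good" for v
    using b[OF that, of "\<beta> v"] A[OF that] by blast+
  have gR: "(v, ?M v) \<in> ?R" if v: "v \<in> good" for v
  proof -
    have "cut (?M v) = {} \<or> \<gamma> v"
    proof (cases "MK v = {}")
      case True then show ?thesis using g(2)[OF v] finite_cut by simp
    next
      case False then show ?thesis using A[OF v] by simp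
    qed
    then show ?thesis unfolding sel_def using g(3)[OF v] good_less[OF v] by (intro imageI) simp
  qed
  show "X \<subseteq> out_verts ?R"
  proof
    fix x assume x: "x \<in> X"
    then obtain v where v: "v \<in> good" "K v = K x" using good_ex by blast
    then have "x \<in> dom_of (?M v)" using g(1) K_self by simp
    then show "x \<in> out_verts ?R" using gR[OF v(1)] unfolding out_verts_def by blast
  qed
  have "{e \<in> out_edges ?R. ends G e \<inter> X \<noteq> {}} \<subseteq> (\<Union>v\<in>good. cut (?M v))"
  proof
    fix e assume "e \<in> {e \<in> out_edges ?R. ends G e \<inter> X \<noteq> {}}"
    then have eo: "e \<in> out_edges ?R" and eX: "ends G e \<inter> X \<noteq> {}" by simp_all
    from eo obtain v M where R: "(v, M) \<in> ?R" and mx: "\<not> (\<exists>(v', M')\<in>?R. dom_of M \<subset> dom_of M')" and e: "e \<in> cut M"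
      unfolding out_edges_def by blast
    have v: "M = ?M v" "v < N" "acc k v (\<beta> v)" "cut M = {} \<or> \<gamma> v" using R by (auto simp: sel_def)
    show "e \<in> (\<Union>v\<in>good. cut (?M v))"
    proof (cases "v \<in> good")
      case True then show ?thesis using e v(1) by blast
    next
      case False
      let ?Y = "dom_of M"
      \<comment> \<open>Something was cut, so selection required the second test to succeed, which
        by assumption it does not at a bad root.\<close>
      have "v \<notin> bad k" using B v(4) e by blast
      then have YW: "?Y \<inter> W = {}" using v False by (auto simp: bad_def)
      have eG: "e \<in> edges G" and eY: "ends G e \<inter> ?Y \<noteq> {}" using e by (auto simp: cut_def)
      have noY: "f \<in> E" if f: "f \<in> edges G" "ends G f \<inter> X \<noteq> {}" "ends G f \<inter> ?Y \<noteq> {}" for f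
      proof (rule ccontr)
        assume "f \<notin> E"
        then have "f \<in> miss X E" using f by (simp add: miss_def)
        then have "ends G f \<subseteq> W" by (auto simp: W_def)
        then show False using f(3) YW by blast
      qed
      have "ends G e \<subseteq> X" using E_ends[OF noY[OF eG eX eY]] .
      then obtain z where z: "z \<in> X" "z \<in> ?Y" using eY by blast
      have r: "reach G (kept M) v = ?Y" "kept M \<subseteq> edges G" using out_bconn(2)[OF v(2)] v(1) by (simp_all add: kept_def)
      have zr: "z \<in> reach G (kept M) v" using z r by simp
      have "?Y \<subseteq> K z"
      proof
        fix y assume "y \<in> ?Y"
        then have "y \<in> reach G (kept M) z" using reach_trans[OF _ reach_sym[OF zr], of y] r(1) by simp
        then show "y \<in> K z"
        proof (rule reach_closed[OF _ K_self])
          fix f p q assume f: "f \<in> kept M" "ends G f = {p, q}" "p \<in> K z"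
          have "p \<in> X" using f(3) K_sub[OF z(1)] by blast
          moreover have "p \<in> ?Y" using f(1,2) by (simp add: kept_def)
          ultimately have "f \<in> E" using noY[of f] f r(2) by auto
          then have "ends G f \<subseteq> K z" using K_edge[of f z] f by auto
          then show "q \<in> K z" using f by simp
        qed
      qed
      moreover obtain w where w: "w \<in> good" "K w = K z" using good_ex[OF z(1)] by blast
      \<comment> \<open>The result for the component \<open>K w\<close> is itself selected, and only
        cuts of inclusion-maximal results enter the output.\<close>
      moreover have "\<not> ?Y \<subset> K w" using mx gR[OF w(1)] g(1)[OF w(1)] by blast
      ultimately have Y: "?Y = K w" by blast
      have "v \<in> K w" using out_bconn(3)[OF v(2)] v(1) Y by blast
      moreover have "v \<le> u" if "u \<in> K w" for u using v(1,3) Y that by (auto simp: acc_def)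
      ultimately have "v \<in> good" using K_eq[of v w] K_sub[of w] w(1) by (auto simp: good_def)
      then show ?thesis using False by simp
    qed
  qed
  moreover have fg: "finite good" by (rule finite_subset[of _ "{..<N}"]) (use good_less in auto)
  ultimately have "card {e \<in> out_edges ?R. ends G e \<inter> X \<noteq> {}} \<le> card (\<Union>v\<in>good. cut (?M v))"
    by (intro card_mono) (simp_all add: finite_cut)
  also have "\<dots> \<le> (\<Sum>v\<in>good. card (cut (?M v)))" by (rule card_UN_le[OF fg])
  also have "\<dots> \<le> (\<Sum>v\<in>good. card (MK v))" by (rule sum_mono) (rule g(2))
  also have "\<dots> = card (\<Union>v\<in>good. MK v)"
    by (rule card_UN_disjoint[symmetric]) (use fg MK_disjoint in \<open>auto simp: MK_def finite_miss\<close>)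
  also have "\<dots> \<le> card (miss X E)" by (rule card_mono[OF finite_miss]) (auto simp: MK_def)
  also have "\<dots> \<le> k" by (rule k)
  finally show "card {e \<in> out_edges ?R. ends G e \<inter> X \<noteq> {}} \<le> k" .
qed

lemma card_pos_good: "card {v \<in> good. MK v \<noteq> {}} \<le> card (miss X E)"
proof -
  have fg: "finite good" by (rule finite_subset[of _ "{..<N}"]) (use good_less in auto)
  have fM: "finite (MK v)" for v by (simp add: MK_def finite_miss)
  have "card {v \<in> good. MK v \<noteq> {}} = (\<Sum>v\<in>{v \<in> good. MK v \<noteq> {}}. 1)" by simp
  also have "\<dots> \<le> (\<Sum>v\<in>{v \<in> good. MK v \<noteq> {}}. card (MK v))"
    by (rule sum_mono) (use fM in \<open>simp add: Suc_le_eq card_gt_0_iff\<close>)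
  also have "\<dots> \<le> (\<Sum>v\<in>good. card (MK v))" by (rule sum_mono2) (use fg in auto)
  also have "\<dots> = card (\<Union>v\<in>good. MK v)"
    by (rule card_UN_disjoint[symmetric]) (use fg fM MK_disjoint in auto)
  also have "\<dots> \<le> card (miss X E)" by (rule card_mono[OF finite_miss]) (auto simp: MK_def)
  finally show ?thesis .
qed

end

context rgraph
begin

lemma success:
  assumes H: "subgraph H G" "balanced \<B> H" "cost G H \<le> k"
  obtains A B b where "A \<subseteq> {..<N}" "B \<subseteq> {..<N}" "A \<inter> B = {}" "card A \<le> k" "card B \<le> 2 * k * 4 ^ k"
    "\<And>v. v \<in> A \<Longrightarrow> length (b v) = 2 * k"
    "\<And>\<beta> \<gamma>. (\<forall>v\<in>A. \<beta> v = b v \<and> \<gamma> v) \<Longrightarrow> (\<forall>v\<in>B. \<not> \<gamma> v) \<Longrightarrow>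
      verts H \<subseteq> out_verts (sel k \<beta> \<gamma>) \<and> card {e \<in> out_edges (sel k \<beta> \<gamma>). ends G e \<inter> verts H \<noteq> {}} \<le> k"
proof -
  obtain X E where o: "opt X E" "verts H \<subseteq> X" "card (miss X E) \<le> card (miss (verts H) (edges H))"
    by (rule opt_exists[OF subgraph_sol(1)[OF H(1,2)]])
  have mk: "card (miss X E) \<le> k" using o(3) H(3) subgraph_sol(2)[OF H(1,2)] by simp
  interpret opt_sol G \<B> N ps X E by unfold_locales (rule o(1))
  have "card (MK v) \<le> k" for v
    using card_mono[OF finite_miss, of "MK v" X E] mk by (force simp: MK_def)
  then have "\<forall>v\<in>good. \<exists>\<beta>. length \<beta> = 2 * k \<and> (\<forall>\<beta>'. (\<beta>' = \<beta> \<or> MK v = {}) \<longrightarrow>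
    dom_of (out k v \<beta>') = K v \<and> card (cut (out k v \<beta>')) \<le> card (MK v) \<and> acc k v \<beta>')"
    using good_cover by blast
  from bchoice[OF this] obtain b where b: "\<forall>v\<in>good. length (b v) = 2 * k \<and> (\<forall>\<beta>'. (\<beta>' = b v \<or> MK v = {}) \<longrightarrow>
    dom_of (out k v \<beta>') = K v \<and> card (cut (out k v \<beta>')) \<le> card (MK v) \<and> acc k v \<beta>')" ..
  show ?thesis
  proof (rule that[of "{v \<in> good. MK v \<noteq> {}}" "bad k" b])
    show "{v \<in> good. MK v \<noteq> {}} \<subseteq> {..<N}" using good_less by auto
    show "bad k \<subseteq> {..<N}" "{v \<in> good. MK v \<noteq> {}} \<inter> bad k = {}" by (auto simp: bad_def)
    show "card {v \<in> good. MK v \<noteq> {}} \<le> k" using card_pos_good mk by simp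
    show "card (bad k) \<le> 2 * k * 4 ^ k" by (rule card_bad[OF mk])
    show "length (b v) = 2 * k" if "v \<in> {v \<in> good. MK v \<noteq> {}}" for v using b that by simp
    fix \<beta> :: "nat \<Rightarrow> bool list" and \<gamma> :: "nat \<Rightarrow> bool"
    assume A: "\<forall>v\<in>{v \<in> good. MK v \<noteq> {}}. \<beta> v = b v \<and> \<gamma> v" and B: "\<forall>v\<in>bad k. \<not> \<gamma> v"
    have 1: "dom_of (out k v \<beta>') = K v \<and> card (cut (out k v \<beta>')) \<le> card (MK v) \<and> acc k v \<beta>'"
      if "v \<in> good" "\<beta>' = b v \<or> MK v = {}" for v \<beta>'
      using bspec[OF b that(1)] that(2) by blast
    have 2: "\<beta> v = b v \<and> \<gamma> v" if "v \<in> good" "MK v \<noteq> {}" for v using A that by simp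
    have 3: "\<not> \<gamma> v" if "v \<in> bad k" for v using B that by simp
    have s: "X \<subseteq> out_verts (sel k \<beta> \<gamma>)" "card {e \<in> out_edges (sel k \<beta> \<gamma>). ends G e \<inter> X \<noteq> {}} \<le> k"
      by (rule success_opt[where b=b and \<beta>=\<beta> and \<gamma>=\<gamma>, OF mk], (rule 1 2 3, assumption+)+)+
    have fo: "finite (out_edges (sel k \<beta> \<gamma>))"
      by (rule finite_subset[OF _ finite_edges]) (auto simp: out_edges_def cut_def)
    have "card {e \<in> out_edges (sel k \<beta> \<gamma>). ends G e \<inter> verts H \<noteq> {}} \<le> card {e \<in> out_edges (sel k \<beta> \<gamma>). ends G e \<inter> X \<noteq> {}}"
      by (rule card_mono) (use fo o(2) in auto)
    then show "verts H \<subseteq> out_verts (sel k \<beta> \<gamma>) \<and> card {e \<in> out_edges (sel k \<beta> \<gamma>). ends G e \<inter> verts H \<noteq> {}} \<le> k"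
      using s o(2) by simp
  qed
qed

lemma sel_family_ok: "family_ok (sel k \<beta> \<gamma>)"
  unfolding family_ok_def sel_def using out_tree by auto

end

section \<open>Coin flips\<close>

abbreviation coin :: "bool pmf" where "coin \<equiv> bernoulli_pmf (1/2)"

definition blk :: "nat \<Rightarrow> nat \<Rightarrow> 'a list \<Rightarrow> 'a list" where
  "blk L i bs = take L (drop (i * L) bs)"

lemma replicate_pmf_add:
  "replicate_pmf (m + n) p = map_pmf (\<lambda>(xs, ys). xs @ ys) (pair_pmf (replicate_pmf m p) (replicate_pmf n p))"
  by (simp add: replicate_pmf_distrib pair_pmf_def map_bind_pmf)

lemma prob_append:
  fixes p :: "bool pmf"
  assumes "\<And>xs ys. length xs = m \<Longrightarrow> length ys = n \<Longrightarrow> xs @ ys \<in> C \<longleftrightarrow> xs \<in> A \<and> ys \<in> B"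
  shows "measure_pmf.prob (replicate_pmf (m + n) p) C =
    measure_pmf.prob (replicate_pmf m p) A * measure_pmf.prob (replicate_pmf n p) B"
proof -
  let ?Q = "pair_pmf (replicate_pmf m p) (replicate_pmf n p)"
  have "measure_pmf.prob (replicate_pmf (m + n) p) C = measure_pmf.prob ?Q ((\<lambda>(xs, ys). xs @ ys) -` C)"
    by (simp add: replicate_pmf_add)
  also have "\<dots> = measure_pmf.prob ?Q ((\<lambda>(xs, ys). xs @ ys) -` C \<inter> set_pmf ?Q)"
    by (rule measure_Int_set_pmf[symmetric])
  also have "(\<lambda>(xs, ys). xs @ ys) -` C \<inter> set_pmf ?Q = (A \<times> B) \<inter> set_pmf ?Q"
    using assms by (auto simp: set_replicate_pmf)
  also have "measure_pmf.prob ?Q ((A \<times> B) \<inter> set_pmf ?Q) = measure_pmf.prob ?Q (A \<times> B)"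
    by (rule measure_Int_set_pmf)
  also have "\<dots> = measure_pmf.prob (replicate_pmf m p) A * measure_pmf.prob (replicate_pmf n p) B"
    by (rule measure_pmf_prob_product) simp_all
  finally show ?thesis .
qed

lemma prob_blocks:
  fixes p :: "bool pmf"
  shows "measure_pmf.prob (replicate_pmf (n * L) p) {bs. \<forall>i<n. blk L i bs \<in> S i} =
    (\<Prod>i<n. measure_pmf.prob (replicate_pmf L p) (S i))"
proof (induction n arbitrary: S)
  case (Suc n)
  have "measure_pmf.prob (replicate_pmf (L + n * L) p) {bs. \<forall>i<Suc n. blk L i bs \<in> S i} =
      measure_pmf.prob (replicate_pmf L p) (S 0) * measure_pmf.prob (replicate_pmf (n * L) p) {bs. \<forall>i<n. blk L i bs \<in> S (Suc i)}"
  proof (rule prob_append)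
    fix xs ys :: "bool list" assume l: "length xs = L" "length ys = n * L"
    have 0: "blk L 0 (xs @ ys) = xs" and s: "blk L (Suc i) (xs @ ys) = blk L i ys" for i
      using l by (simp_all add: blk_def)
    show "xs @ ys \<in> {bs. \<forall>i<Suc n. blk L i bs \<in> S i} \<longleftrightarrow> xs \<in> S 0 \<and> ys \<in> {bs. \<forall>i<n. blk L i bs \<in> S (Suc i)}"
      by (simp only: mem_Collect_eq All_less_Suc2 0 s)
  qed
  then show ?case by (simp add: Suc.IH prod.lessThan_Suc_shift del: prod.lessThan_Suc)
qed simp

lemma prob_bits: "length xs = n \<Longrightarrow> measure_pmf.prob (replicate_pmf n coin) {xs} = (1/2) ^ n"
proof (induction n arbitrary: xs)
  case (Suc n)
  obtain b ys where xs: "xs = b # ys" "length ys = n" using Suc.prems by (cases xs) auto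
  have "measure_pmf.prob (replicate_pmf (1 + n) coin) {xs} =
      measure_pmf.prob (replicate_pmf 1 coin) {[b]} * measure_pmf.prob (replicate_pmf n coin) {ys}"
  proof (rule prob_append)
    show "zs @ ws \<in> {xs} \<longleftrightarrow> zs \<in> {[b]} \<and> ws \<in> {ys}" if "length zs = 1" "length ws = n" for zs ws
      using that xs by (cases zs) auto
  qed
  moreover have "measure_pmf.prob (replicate_pmf 1 coin) {[b]} = pmf coin b"
    unfolding replicate_pmf_1 measure_pmf_single by (rule pmf_map_inj') (simp add: inj_def)
  moreover have "pmf coin b = 1/2" by (cases b) simp_all
  ultimately show ?case using Suc.IH[OF xs(2)] by simp
qed simp

lemma prob_not_all:
  "measure_pmf.prob (replicate_pmf (m + n) coin) {b. drop m b \<noteq> replicate n True} = 1 - (1/2) ^ n"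
proof -
  let ?M = "measure_pmf (replicate_pmf (m + n) coin)"
  have "measure_pmf.prob (replicate_pmf (m + n) coin) {b. drop m b = replicate n True} =
      measure_pmf.prob (replicate_pmf m coin) UNIV * measure_pmf.prob (replicate_pmf n coin) {replicate n True}"
    by (rule prob_append) simp
  then have 1: "measure_pmf.prob (replicate_pmf (m + n) coin) {b. drop m b = replicate n True} = (1/2) ^ n"
    by (simp add: prob_bits)
  have "{b. drop m b \<noteq> replicate n True} = space ?M - {b. drop m b = replicate n True}" by auto
  then show ?thesis using measure_pmf.prob_compl[of "{b. drop m b = replicate n True}" "replicate_pmf (m + n) coin"] 1
    by simp
qed

text \<open>With the full exponent, Bernoulli's inequality would yield only 0. With half of it the
  inequality yields 1/2, and squaring gives the bound.\<close>

lemma one_minus_power: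
  assumes "k \<ge> (1::nat)"
  shows "(1 - (1/2::real) ^ (2 * k)) ^ 4 ^ k \<ge> 1 / 4"
proof -
  let ?h = "2 * 4 ^ (k - 1) :: nat" and ?x = "(1/2::real) ^ (2 * k)"
  have e: "4 ^ k = ?h * 2" using assms by (cases k) simp_all
  have x: "?x = 1 / 4 ^ k" by (simp add: power_mult power_one_over[symmetric] power2_eq_square)
  have "?x \<le> 1" by (simp add: power_le_one)
  then have "1 + real ?h * (- ?x) \<le> (1 + (- ?x)) ^ ?h" by (intro Bernoulli_inequality) simp
  moreover have "real ?h * ?x = 1 / 2"
    using assms unfolding x by (cases k) simp_all
  ultimately have "1 / 2 \<le> (1 - ?x) ^ ?h" by simp
  then have "(1 / 2) ^ 2 \<le> ((1 - ?x) ^ ?h) ^ 2" by (intro power_mono) simp_all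
  then show ?thesis unfolding e power_mult by (simp add: power2_eq_square)
qed

text \<open>A prescribed block has probability 2^-4k, and there are at most k of them. The at most
  2k 4^k tests that must fail are compared with 2k groups of 4^k tests, each group contributing at
  least 1/4 by \<open>one_minus_power\<close>. This explains both summands of the exponent.\<close>

lemma prob_coins:
  assumes AB: "A \<subseteq> {..<n}" "B \<subseteq> {..<n}" "A \<inter> B = {}" "card A \<le> k" "card B \<le> 2 * k * 4 ^ k"
    and b: "\<And>v. v \<in> A \<Longrightarrow> length (b v) = 2 * k"
  shows "measure_pmf.prob (replicate_pmf (n * (4 * k)) coin)
    {bs. (\<forall>v\<in>A. take (2 * k) (blk (4 * k) v bs) = b v \<and> drop (2 * k) (blk (4 * k) v bs) = replicate (2 * k) True) \<and>
       (\<forall>v\<in>B. drop (2 * k) (blk (4 * k) v bs) \<noteq> replicate (2 * k) True)} \<ge> (1/2) ^ (4 * k ^ 2 + 4 * k)"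
    (is "measure_pmf.prob ?P ?E \<ge> _")
proof -
  define S where "S = (\<lambda>v. if v \<in> A then {b v @ replicate (2 * k) True}
    else if v \<in> B then {b. drop (2 * k) b \<noteq> replicate (2 * k) True} else UNIV)"
  let ?x = "(1/2::real) ^ (4 * k)" and ?y = "1 - (1/2::real) ^ (2 * k)"
  let ?g = "\<lambda>v. (if v \<in> A then ?x else 1) * (if v \<in> B then ?y else 1)"
  have x: "0 \<le> ?x" "?x \<le> 1" and y: "0 \<le> ?y" "?y \<le> 1" by (simp_all add: power_le_one)
  have "4 * k = 2 * k + 2 * k" by simp
  then have pB: "measure_pmf.prob (replicate_pmf (4 * k) coin) {b. drop (2 * k) b \<noteq> replicate (2 * k) True} = ?y"
    by (simp only: prob_not_all)
  have "?g v = measure_pmf.prob (replicate_pmf (4 * k) coin) (S v)" for v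
    using AB(3) prob_bits[of "b v @ replicate (2 * k) True" "4 * k"] b[of v] pB by (auto simp: S_def)
  then have "measure_pmf.prob ?P {bs. \<forall>v<n. blk (4 * k) v bs \<in> S v} = (\<Prod>v<n. ?g v)"
    by (simp add: prob_blocks)
  also have "\<dots> = (\<Prod>v<n. if v \<in> A then ?x else 1) * (\<Prod>v<n. if v \<in> B then ?y else 1)"
    by (rule prod.distrib)
  also have "(\<Prod>v<n. if v \<in> A then ?x else 1) = (\<Prod>v\<in>A. ?x)"
    using AB(1) by (simp only: prod.inter_restrict[symmetric] finite_lessThan Int_absorb1)
  also have "(\<Prod>v<n. if v \<in> B then ?y else 1) = (\<Prod>v\<in>B. ?y)"
    using AB(2) by (simp only: prod.inter_restrict[symmetric] finite_lessThan Int_absorb1)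
  finally have e: "measure_pmf.prob ?P {bs. \<forall>v<n. blk (4 * k) v bs \<in> S v} = ?x ^ card A * ?y ^ card B" by simp
  have "?x ^ k \<le> ?x ^ card A" using AB(4) x by (intro power_decreasing)
  moreover have "(1 / 4) ^ (2 * k) \<le> ?y ^ card B"
  proof (cases "k = 0")
    case True
    then show ?thesis using AB(5) by simp
  next
    case False
    then have "(1 / 4) ^ (2 * k) \<le> (?y ^ 4 ^ k) ^ (2 * k)" by (intro power_mono one_minus_power) simp_all
    also have "\<dots> = ?y ^ (2 * k * 4 ^ k)" by (simp add: power_mult[symmetric] mult.commute)
    also have "\<dots> \<le> ?y ^ card B" using AB(5) y by (intro power_decreasing)
    finally show ?thesis .
  qed
  ultimately have "?x ^ k * (1 / 4) ^ (2 * k) \<le> ?x ^ card A * ?y ^ card B"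
    using x by (intro mult_mono) simp_all
  moreover have "?x ^ k * (1 / 4) ^ (2 * k) = (1 / 2) ^ (4 * k ^ 2 + 4 * k)"
  proof -
    have "(1 / 4 :: real) = (1 / 2) ^ 2" by (simp add: power2_eq_square)
    then have "(1 / 4 :: real) ^ (2 * k) = (1 / 2) ^ (4 * k)" by (simp only: power_mult[symmetric]) simp
    moreover have "?x ^ k = (1 / 2) ^ (4 * k ^ 2)" by (simp only: power_mult[symmetric]) (simp add: power2_eq_square mult.assoc)
    ultimately show ?thesis by (simp add: power_add)
  qed
  moreover have "measure_pmf.prob ?P {bs. \<forall>v<n. blk (4 * k) v bs \<in> S v} \<le> measure_pmf.prob ?P ?E"
  proof (rule measure_pmf.finite_measure_mono)
    show "{bs. \<forall>v<n. blk (4 * k) v bs \<in> S v} \<subseteq> ?E"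
    proof (intro subsetI CollectI conjI ballI)
      fix bs v assume bs: "bs \<in> {bs. \<forall>v<n. blk (4 * k) v bs \<in> S v}"
      {
        assume v: "v \<in> A"
        then have "blk (4 * k) v bs \<in> S v" using bs AB(1) by auto
        then have "blk (4 * k) v bs = b v @ replicate (2 * k) True" using v by (simp add: S_def)
        then show "take (2 * k) (blk (4 * k) v bs) = b v" "drop (2 * k) (blk (4 * k) v bs) = replicate (2 * k) True"
          using b[OF v] by simp_all
      next
        assume v: "v \<in> B"
        then have "blk (4 * k) v bs \<in> S v" "v \<notin> A" using bs AB(2,3) by auto
        then show "drop (2 * k) (blk (4 * k) v bs) \<noteq> replicate (2 * k) True" using v by (simp add: S_def)
      }
    qed
  qed simp
  ultimately show ?thesis using e by simp
qed

section \<open>Drawing the coins\<close>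

lemma steps_Seq_runs:
  assumes "runs orc c1 s t1 s1" "\<forall>cf\<in>set_pmf (steps orc t2 (c2, s1)). fst cf = Skip"
  shows "steps orc (t1 + 1 + t2) (Seq c1 c2, s) = steps orc t2 (c2, s1)"
  using steps_Seq[of orc t1 c1 s t2 c2] assms by (simp add: runs_def bind_return_pmf del: steps.simps)

text \<open>Variable 3 is a unary counter and variable 4 collects the bits in reverse order; the
  selection program reverses them once more.\<close>

definition flip_body :: com where
  "flip_body = Seq (Flip 5) (Seq (Assign 4 (Cons_tree (Var 5) (Var 4))) (Assign 3 (Right (Var 3))))"

definition flip_loop :: com where "flip_loop = While (Var 3) flip_body"

definition flip_prog :: com where
  "flip_prog = Seq (Assign 3 (Right (Var 0))) (Seq (Assign 4 Nil_tree)
     (Seq flip_loop (Assign 0 (Cons_tree (Left (Var 0)) (Var 4)))))"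

lemma flip_body_steps:
  "steps orc 5 (flip_body, s) = map_pmf (\<lambda>b. (Skip,
     s(5 := tree_of_bool b, 4 := Node (tree_of_bool b) (s 4), 3 := right_tree (s 3)))) coin"
proof -
  let ?R = "Seq (Assign 4 (Cons_tree (Var 5) (Var 4))) (Assign 3 (Right (Var 3)))"
  have R: "steps orc 3 (?R, s') = return_pmf (Skip, s'(4 := Node (s' 5) (s' 4), 3 := right_tree (s' 3)))" for s'
    by (simp add: numeral_3_eq_3 bind_return_pmf)
  have F: "steps orc 1 (Flip 5, s) = map_pmf (\<lambda>b. (Skip, s(5 := tree_of_bool b))) coin"
  proof -
    have "steps orc 0 = return_pmf" by (rule ext) simp
    then show ?thesis by (simp add: bind_return_pmf')
  qed
  have "steps orc (1 + 1 + 3) (flip_body, s) = bind_pmf (steps orc 1 (Flip 5, s)) (\<lambda>cf. steps orc 3 (?R, snd cf))"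
    unfolding flip_body_def by (rule steps_Seq) (unfold F R, auto)
  then show ?thesis unfolding F R by (simp add: map_pmf_def bind_assoc_pmf bind_return_pmf)
qed

text \<open>A round takes seven steps: one unfolds the loop, five run the body, one leaves the
  composition. The final store is given as a function \<open>g\<close> of the bits, so that the
  distribution is an image of independent coin flips.\<close>

lemma flip_loop_steps:
  assumes "nat_of_tree (s 3) = n"
  shows "\<exists>g. steps orc (7 * n + 1) (flip_loop, s) = map_pmf (\<lambda>bs. (Skip, g bs)) (replicate_pmf n coin) \<and>
    (\<forall>bs. length bs = n \<longrightarrow> g bs 0 = s 0 \<and> g bs 4 = tree_of_list (rev (map tree_of_bool bs) @ list_of_tree (s 4)))"
  using assms
proof (induction n arbitrary: s)
  case 0
  then have "s 3 = Leaf" by (cases "s 3") auto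
  then show ?case
    by (intro exI[of _ "\<lambda>_. s"]) (simp add: flip_loop_def bind_return_pmf)
next
  case (Suc n)
  define s' where "s' = (\<lambda>b. s(5 := tree_of_bool b, 4 := Node (tree_of_bool b) (s 4), 3 := right_tree (s 3)))"
  have nl: "s 3 \<noteq> Leaf" and n: "nat_of_tree (right_tree (s 3)) = n" using Suc.prems by (cases "s 3"; simp)+
  then have "\<forall>b. \<exists>g. steps orc (7 * n + 1) (flip_loop, s' b) = map_pmf (\<lambda>bs. (Skip, g bs)) (replicate_pmf n coin) \<and>
    (\<forall>bs. length bs = n \<longrightarrow> g bs 0 = s' b 0 \<and> g bs 4 = tree_of_list (rev (map tree_of_bool bs) @ list_of_tree (s' b 4)))"
    by (intro allI Suc.IH) (simp add: s'_def)
  from choice[OF this] obtain g where g: "\<And>b. steps orc (7 * n + 1) (flip_loop, s' b) = map_pmf (\<lambda>bs. (Skip, g b bs)) (replicate_pmf n coin)"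
    "\<And>b bs. length bs = n \<Longrightarrow> g b bs 0 = s' b 0" "\<And>b bs. length bs = n \<Longrightarrow> g b bs 4 = tree_of_list (rev (map tree_of_bool bs) @ list_of_tree (s' b 4))"
    by blast
  have W: "steps orc (Suc m) (flip_loop, s) = steps orc m (Seq flip_body flip_loop, s)" for m
    using nl by (simp add: flip_loop_def bind_return_pmf)
  have B: "steps orc 5 (flip_body, s) = map_pmf (\<lambda>b. (Skip, s' b)) coin"
    unfolding flip_body_steps s'_def ..
  have "steps orc (5 + 1 + (7 * n + 1)) (Seq flip_body flip_loop, s) =
      bind_pmf (steps orc 5 (flip_body, s)) (\<lambda>cf. steps orc (7 * n + 1) (flip_loop, snd cf))"
  proof (rule steps_Seq; unfold B set_map_pmf; intro ballI; elim imageE)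
    show "fst cf' = Skip" if "cf = (Skip, s' b)" "cf' \<in> set_pmf (steps orc (7 * n + 1) (flip_loop, snd cf))" for cf cf' b
      using that by (auto simp only: g(1) snd_conv set_map_pmf fst_conv)
  qed simp
  also have "\<dots> = bind_pmf coin (\<lambda>b. map_pmf (\<lambda>bs. (Skip, g b bs)) (replicate_pmf n coin))"
    unfolding B by (simp only: bind_map_pmf snd_conv g(1))
  also have "\<dots> = map_pmf (\<lambda>bs. (Skip, g (hd bs) (tl bs))) (replicate_pmf (Suc n) coin)"
    by (simp add: map_pmf_def bind_assoc_pmf bind_return_pmf)
  finally have "steps orc (5 + 1 + (7 * n + 1)) (Seq flip_body flip_loop, s) =
    map_pmf (\<lambda>bs. (Skip, g (hd bs) (tl bs))) (replicate_pmf (Suc n) coin)" .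
  moreover have "steps orc (Suc (5 + 1 + (7 * n + 1))) (flip_loop, s) = steps orc (5 + 1 + (7 * n + 1)) (Seq flip_body flip_loop, s)"
    by (rule W)
  moreover have "7 * Suc n + 1 = Suc (5 + 1 + (7 * n + 1))" by simp
  ultimately have st: "steps orc (7 * Suc n + 1) (flip_loop, s) =
    map_pmf (\<lambda>bs. (Skip, g (hd bs) (tl bs))) (replicate_pmf (Suc n) coin)" by (simp only:)
  show ?case
  proof (intro exI conjI allI impI)
    show "steps orc (7 * Suc n + 1) (flip_loop, s) =
      map_pmf (\<lambda>bs. (Skip, g (hd bs) (tl bs))) (replicate_pmf (Suc n) coin)" by (rule st)
    fix bs :: "bool list" assume "length bs = Suc n"
    then obtain b cs where bs: "bs = b # cs" "length cs = n" by (cases bs) auto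
    show "g (hd bs) (tl bs) 0 = s 0" using g(2)[OF bs(2), of b] bs by (simp add: s'_def)
    show "g (hd bs) (tl bs) 4 = tree_of_list (rev (map tree_of_bool bs) @ list_of_tree (s 4))"
      using g(3)[OF bs(2), of b] bs by (simp add: s'_def)
  qed
qed

lemma flip_prog_steps:
  assumes n: "nat_of_tree (right_tree (s 0)) = n"
  shows "\<exists>g. steps orc (7 * n + 8) (flip_prog, s) = map_pmf (\<lambda>bs. (Skip, g bs)) (replicate_pmf n coin) \<and>
    (\<forall>bs. length bs = n \<longrightarrow> g bs 0 = Node (left_tree (s 0)) (tree_of_list (rev (map tree_of_bool bs))))"
proof -
  let ?s = "s(3 := right_tree (s 0), 4 := Leaf)"
  let ?Z = "Assign 0 (Cons_tree (Left (Var 0)) (Var 4))"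
  obtain g where g: "steps orc (7 * n + 1) (flip_loop, ?s) = map_pmf (\<lambda>bs. (Skip, g bs)) (replicate_pmf n coin)"
    "\<And>bs. length bs = n \<Longrightarrow> g bs 0 = s 0 \<and> g bs 4 = tree_of_list (rev (map tree_of_bool bs))"
    using flip_loop_steps[of ?s n orc] n by auto
  have z: "steps orc 1 (?Z, s') = return_pmf (Skip, s'(0 := Node (left_tree (s' 0)) (s' 4)))" for s'
    by (simp add: bind_return_pmf)
  have 1: "steps orc (7 * n + 1 + 1 + 1) (Seq flip_loop ?Z, ?s) =
      bind_pmf (steps orc (7 * n + 1) (flip_loop, ?s)) (\<lambda>cf. steps orc 1 (?Z, snd cf))"
    by (rule steps_Seq) (unfold g(1) z, auto)
  also have "\<dots> = map_pmf (\<lambda>bs. (Skip, (g bs)(0 := Node (left_tree (g bs 0)) (g bs 4)))) (replicate_pmf n coin)"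
    unfolding g(1) z by (simp add: map_pmf_def bind_assoc_pmf bind_return_pmf)
  finally have 1: "steps orc (7 * n + 1 + 1 + 1) (Seq flip_loop ?Z, ?s) =
      map_pmf (\<lambda>bs. (Skip, (g bs)(0 := Node (left_tree (g bs 0)) (g bs 4)))) (replicate_pmf n coin)" .
  have h: "\<forall>cf\<in>set_pmf (steps orc (7 * n + 1 + 1 + 1) (Seq flip_loop ?Z, ?s)). fst cf = Skip"
    unfolding 1 by auto
  have 2: "steps orc (1 + 1 + (7 * n + 1 + 1 + 1)) (Seq (Assign 4 Nil_tree) (Seq flip_loop ?Z), s(3 := right_tree (s 0))) =
      steps orc (7 * n + 1 + 1 + 1) (Seq flip_loop ?Z, ?s)"
    using steps_Seq_runs[OF runs_Assign, of orc "7 * n + 1 + 1 + 1" "Seq flip_loop ?Z" "s(3 := right_tree (s 0))" 4 Nil_tree] h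
    by (simp only: value_of.simps)
  have h': "\<forall>cf\<in>set_pmf (steps orc (1 + 1 + (7 * n + 1 + 1 + 1)) (Seq (Assign 4 Nil_tree) (Seq flip_loop ?Z), s(3 := right_tree (s 0)))). fst cf = Skip"
    unfolding 2 by (rule h)
  have 3: "steps orc (1 + 1 + (1 + 1 + (7 * n + 1 + 1 + 1))) (flip_prog, s) =
      steps orc (1 + 1 + (7 * n + 1 + 1 + 1)) (Seq (Assign 4 Nil_tree) (Seq flip_loop ?Z), s(3 := right_tree (s 0)))"
    unfolding flip_prog_def
    using steps_Seq_runs[OF runs_Assign, of orc "1 + 1 + (7 * n + 1 + 1 + 1)" "Seq (Assign 4 Nil_tree) (Seq flip_loop ?Z)" s 3 "Right (Var 0)"] h'
    by (simp only: value_of.simps)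
  have t: "7 * n + 8 \<ge> 1 + 1 + (1 + 1 + (7 * n + 1 + 1 + 1))" by simp
  have "steps orc (7 * n + 8) (flip_prog, s) = steps orc (1 + 1 + (1 + 1 + (7 * n + 1 + 1 + 1))) (flip_prog, s)"
    by (rule steps_halted) (unfold 3 2 1, auto)
  then have "steps orc (7 * n + 8) (flip_prog, s) =
      map_pmf (\<lambda>bs. (Skip, (g bs)(0 := Node (left_tree (g bs 0)) (g bs 4)))) (replicate_pmf n coin)"
    unfolding 3 2 1 .
  then show ?thesis using g(2) by (intro exI[of _ "\<lambda>bs. (g bs)(0 := Node (left_tree (g bs 0)) (g bs 4))"]) simp
qed

section \<open>Programs with one exponential factor\<close>

text \<open>The exponent is a function of the argument alone, which keeps the single factor visible
  through compositions; it becomes 4^k at the end.\<close>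

definition XT :: "(tree \<Rightarrow> nat) \<Rightarrow> tfun \<Rightarrow> bool" where
  "XT \<kappa> f \<longleftrightarrow> (\<exists>T g. RT f T \<and> polyb g \<and> (\<forall>orc x. T orc x \<le> 2 ^ \<kappa> x * g orc x))"

lemma XT_intro: "RT f T \<Longrightarrow> polyb g \<Longrightarrow> (\<And>orc x. T orc x \<le> 2 ^ \<kappa> x * g orc x) \<Longrightarrow> XT \<kappa> f"
  unfolding XT_def by blast

lemma XT_PT: "PT f \<Longrightarrow> XT \<kappa> f"
proof -
  assume "PT f"
  then obtain T where "RT f T" "polyb T" unfolding PT_def by blast
  then show ?thesis by (rule XT_intro) simp
qed

lemma PT_polyb_mu: "PT f \<Longrightarrow> polyb (\<lambda>orc x. mu (f orc x))"
  by (simp add: PT_def)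

lemma XT_comp:
  assumes "XT \<kappa>' f" "XT \<kappa> g" and m: "polyb (\<lambda>orc x. mu (g orc x))" and k: "\<And>orc x. \<kappa>' (g orc x) \<le> \<kappa> x"
  shows "XT \<kappa> (\<lambda>orc x. f orc (g orc x))"
proof -
  obtain Tf gf where f': "RT f Tf" "polyb gf" "\<forall>orc x. Tf orc x \<le> 2 ^ \<kappa>' x * gf orc x"
    using assms(1) unfolding XT_def by (elim exE conjE)
  note f = f'(1,2) f'(3)[rule_format]
  obtain Tg gg where g': "RT g Tg" "polyb gg" "\<forall>orc x. Tg orc x \<le> 2 ^ \<kappa> x * gg orc x"
    using assms(2) unfolding XT_def by (elim exE conjE)
  note g = g'(1,2) g'(3)[rule_format]
  show ?thesis
  proof (rule XT_intro[OF RT_comp[OF f(1) g(1)]])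
    show "polyb (\<lambda>orc x. gg orc x + 1 + gf orc (g orc x))"
      by (intro polyb_add polyb_const g(2) polyb_comp[OF f(2) m])
    fix orc x
    have "Tf orc (g orc x) \<le> 2 ^ \<kappa>' (g orc x) * gf orc (g orc x)" by (rule f(3))
    also have "\<dots> \<le> 2 ^ \<kappa> x * gf orc (g orc x)" using k by (intro mult_right_mono power_increasing) simp_all
    finally have "Tf orc (g orc x) \<le> 2 ^ \<kappa> x * gf orc (g orc x)" .
    moreover have "(1::nat) \<le> 2 ^ \<kappa> x" by simp
    ultimately show "Tg orc x + 1 + Tf orc (g orc x) \<le> 2 ^ \<kappa> x * (gg orc x + 1 + gf orc (g orc x))"
      using g(3)[of orc x] unfolding add_mult_distrib2 mult_1_right by linarith
  qed
qed

lemma XT_Node: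
  assumes "XT \<kappa> f" "XT \<kappa> g"
  shows "XT \<kappa> (\<lambda>orc x. Node (f orc x) (g orc x))"
proof -
  obtain Tf gf where f': "RT f Tf" "polyb gf" "\<forall>orc x. Tf orc x \<le> 2 ^ \<kappa> x * gf orc x"
    using assms(1) unfolding XT_def by (elim exE conjE)
  note f = f'(1,2) f'(3)[rule_format]
  obtain Tg gg where g': "RT g Tg" "polyb gg" "\<forall>orc x. Tg orc x \<le> 2 ^ \<kappa> x * gg orc x"
    using assms(2) unfolding XT_def by (elim exE conjE)
  note g = g'(1,2) g'(3)[rule_format]
  show ?thesis
  proof (rule XT_intro[OF RT_pair[OF f(1) g(1)]])
    show "polyb (\<lambda>orc x. gf orc x + gg orc x + 13)" by (intro polyb_add polyb_const f(2) g(2))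
    fix orc x
    have "(13::nat) \<le> 2 ^ \<kappa> x * 13" by simp
    then show "Tf orc x + Tg orc x + 13 \<le> 2 ^ \<kappa> x * (gf orc x + gg orc x + 13)"
      using f(3)[of orc x] g(3)[of orc x] unfolding add_mult_distrib2 by linarith
  qed
qed

text \<open>Either the number of rounds or the time of a round may be exponential, provided that the
  two exponents together stay below \<open>\<kappa>\<close>. In each application one of them is
  0.\<close>

lemma XT_fold:
  assumes body: "RT (\<lambda>orc y. body orc (left_tree y) (left_tree (right_tree y)) (right_tree (right_tree y))) Tb"
    and l: "XT \<kappa> l" and i: "PT i"
    and B: "polyb B" "\<And>orc x ys h zs. list_of_tree (l orc x) = ys @ h # zs \<Longrightarrow>
      Tb orc (Node x (Node h (fold (body orc x) ys (i orc x)))) \<le> 2 ^ \<kappa>b x * B orc x"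
    and n: "polyb n" "\<And>orc x. nat_of_tree (l orc x) \<le> 2 ^ \<kappa>n x * n orc x"
    and k: "\<And>x. \<kappa>n x + \<kappa>b x \<le> \<kappa> x"
  shows "XT \<kappa> (\<lambda>orc x. foldT (body orc x) (l orc x) (i orc x))"
proof -
  obtain Tl gl where g': "RT l Tl" "polyb gl" "\<forall>orc x. Tl orc x \<le> 2 ^ \<kappa> x * gl orc x"
    using l unfolding XT_def by (elim exE conjE)
  note g = g'(1,2) g'(3)[rule_format]
  obtain Ti where Ti: "RT i Ti" "polyb Ti" using i unfolding PT_def by blast
  show ?thesis
  proof (rule XT_intro[OF RT_fold[OF body g(1) Ti(1) B(2)]])
    show "polyb (\<lambda>orc x. gl orc x + Ti orc x + 30 + n orc x * (B orc x + 11))"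
      by (intro polyb_add polyb_mult polyb_const g(2) Ti(2) B(1) n(1))
    fix orc x
    have "nat_of_tree (l orc x) * (2 ^ \<kappa>b x * B orc x + 11) \<le> (2 ^ \<kappa>n x * n orc x) * (2 ^ \<kappa>b x * (B orc x + 11))"
      using n(2) by (intro mult_mono) (simp_all add: add_mult_distrib2)
    also have "\<dots> = 2 ^ (\<kappa>n x + \<kappa>b x) * (n orc x * (B orc x + 11))" by (simp add: power_add)
    also have "\<dots> \<le> 2 ^ \<kappa> x * (n orc x * (B orc x + 11))" using k by (intro mult_right_mono power_increasing) simp_all
    finally have 1: "nat_of_tree (l orc x) * (2 ^ \<kappa>b x * B orc x + 11) \<le> 2 ^ \<kappa> x * (n orc x * (B orc x + 11))" .
    have 2: "Ti orc x + 30 \<le> 2 ^ \<kappa> x * (Ti orc x + 30)" by simp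
    have "2 ^ \<kappa> x * (gl orc x + Ti orc x + 30 + n orc x * (B orc x + 11)) =
        2 ^ \<kappa> x * gl orc x + 2 ^ \<kappa> x * (Ti orc x + 30) + 2 ^ \<kappa> x * (n orc x * (B orc x + 11))"
      by (simp only: add_mult_distrib2 add.assoc)
    then show "Tl orc x + Ti orc x + 30 + nat_of_tree (l orc x) * (2 ^ \<kappa>b x * B orc x + 11) \<le>
        2 ^ \<kappa> x * (gl orc x + Ti orc x + 30 + n orc x * (B orc x + 11))"
      using g(3)[of orc x] 1 2 by linarith
  qed
qed

definition dblT :: "tree \<Rightarrow> tree" where
  "dblT t = foldT (\<lambda>h a. Node (Node Leaf h) (Node (Node (Node Leaf Leaf) h) a)) t Leaf"
definition blistT :: "tree \<Rightarrow> tree" where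
  "blistT K = foldT (\<lambda>h a. dblT a) K (Node Leaf Leaf)"

lemma dblT_list: "set (list_of_tree (dblT t)) = (\<lambda>(b, h). Node (tree_of_bool b) h) ` (UNIV \<times> set (list_of_tree t))"
  "nat_of_tree (dblT t) = 2 * nat_of_tree t"
proof -
  let ?f = "\<lambda>h a. Node (Node Leaf h) (Node (Node (Node Leaf Leaf) h) a)"
  have "set (list_of_tree (fold ?f hs a)) = (\<lambda>(b, h). Node (tree_of_bool b) h) ` (UNIV \<times> set hs) \<union> set (list_of_tree a)" for hs a
  proof (induction hs arbitrary: a)
    case (Cons h hs)
    have "(\<lambda>(b, h). Node (tree_of_bool b) h) ` (UNIV \<times> set (h # hs)) =
        {Node Leaf h, Node (Node Leaf Leaf) h} \<union> (\<lambda>(b, h). Node (tree_of_bool b) h) ` (UNIV \<times> set hs)"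
      by (auto simp: UNIV_bool tree_of_bool_def image_iff)
    then show ?case using Cons[of "?f h a"] by auto
  qed simp
  then show "set (list_of_tree (dblT t)) = (\<lambda>(b, h). Node (tree_of_bool b) h) ` (UNIV \<times> set (list_of_tree t))"
    by (simp add: dblT_def foldT_fold)
  have "nat_of_tree (fold ?f hs a) = 2 * length hs + nat_of_tree a" for hs a
    by (induction hs arbitrary: a) simp_all
  then show "nat_of_tree (dblT t) = 2 * nat_of_tree t" by (simp add: dblT_def foldT_fold length_list_of_tree)
qed

lemma blist_fold:
  "set (list_of_tree (fold (\<lambda>h a. dblT a) hs (Node Leaf Leaf))) = bl ` {\<beta>. length \<beta> = length hs} \<and>
   nat_of_tree (fold (\<lambda>h a. dblT a) hs (Node Leaf Leaf)) = 2 ^ length hs"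
proof (induction hs rule: rev_induct)
  case Nil
  show ?case by (auto simp: bl_def image_iff)
next
  case (snoc h hs)
  have e: "fold (\<lambda>h a. dblT a) (hs @ [h]) (Node Leaf Leaf) = dblT (fold (\<lambda>h a. dblT a) hs (Node Leaf Leaf))" by simp
  have "bl ` {\<beta>. length \<beta> = length (hs @ [h])} = (\<lambda>(b, h). Node (tree_of_bool b) h) ` (UNIV \<times> bl ` {\<beta>. length \<beta> = length hs})"
  proof (intro set_eqI iffI)
    fix t assume "t \<in> bl ` {\<beta>. length \<beta> = length (hs @ [h])}"
    then obtain \<beta> where b: "t = bl \<beta>" "length \<beta> = Suc (length hs)" by auto
    then obtain c cs where "\<beta> = c # cs" "length cs = length hs" by (cases \<beta>) auto
    then show "t \<in> (\<lambda>(b, h). Node (tree_of_bool b) h) ` (UNIV \<times> bl ` {\<beta>. length \<beta> = length hs})"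
      using b by (auto simp: bl_def intro!: rev_image_eqI[of "(c, bl cs)"])
  next
    fix t assume "t \<in> (\<lambda>(b, h). Node (tree_of_bool b) h) ` (UNIV \<times> bl ` {\<beta>. length \<beta> = length hs})"
    then obtain c cs where "t = Node (tree_of_bool c) (bl cs)" "length cs = length hs" by auto
    then show "t \<in> bl ` {\<beta>. length \<beta> = length (hs @ [h])}"
      by (auto simp: bl_def intro!: image_eqI[of _ _ "c # cs"])
  qed
  then show ?case unfolding e dblT_list using snoc.IH by simp
qed

lemma blist: "set (list_of_tree (blistT K)) = bl ` {\<beta>. length \<beta> = nat_of_tree K}"
  "nat_of_tree (blistT K) = 2 ^ nat_of_tree K"
  unfolding blistT_def foldT_fold using blist_fold[of "list_of_tree K"] by (simp_all add: length_list_of_tree)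

lemma mu_bl: "mu (bl \<beta>) \<le> length \<beta> + 1"
  by (rule mu_leI) (auto simp: bl_def intro: le_trans[OF mu_bool])

lemma RT_dbl: "\<exists>c. RT (\<lambda>orc y. dblT (right_tree (right_tree y))) (\<lambda>orc y. c + nat_of_tree (right_tree (right_tree y)) * c)"
proof -
  let ?b = "\<lambda>(orc :: tree \<Rightarrow> bool) (x :: tree) h a. Node (Node Leaf h) (Node (Node (Node Leaf Leaf) h) a)"
  have rr: "RT (\<lambda>orc y. right_tree (right_tree y)) (\<lambda>_ _. 3)"
    using RT_comp[OF RT_right RT_right] by (rule RT_mono) simp
  have h: "RT (\<lambda>orc y. left_tree (right_tree y)) (\<lambda>_ _. 3)"
    using RT_comp[OF RT_left RT_right] by (rule RT_mono) simp
  have b: "RT (\<lambda>orc y. ?b orc (left_tree y) (left_tree (right_tree y)) (right_tree (right_tree y))) (\<lambda>_ _. 100)"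
    by (rule RT_mono, (rule RT_pair RT_Leaf h rr)+) simp
  have "RT (\<lambda>orc y. foldT (?b orc y) (right_tree (right_tree y)) Leaf)
      (\<lambda>orc x. 3 + 1 + 30 + nat_of_tree (right_tree (right_tree x)) * (100 + 11))"
    by (rule RT_fold[where body="?b", OF b rr RT_Leaf]) simp
  then have "RT (\<lambda>orc y. dblT (right_tree (right_tree y)))
      (\<lambda>orc y. 111 + nat_of_tree (right_tree (right_tree y)) * 111)"
    unfolding dblT_def
  proof (rule RT_mono)
    have "3 + 1 + 30 + n * (100 + 11) \<le> 111 + n * (111::nat)" for n by simp
    then show "3 + 1 + 30 + nat_of_tree (right_tree (right_tree x)) * (100 + 11)
        \<le> 111 + nat_of_tree (right_tree (right_tree x)) * 111" for x .
  qed
  then show ?thesis by (rule exI)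
qed

text \<open>The list doubles in each round, so the last doubling dominates; charging it to all
  rounds loses a polynomial factor only.\<close>

lemma XT_blist: "XT nat_of_tree (\<lambda>orc x. blistT x)"
proof -
  obtain c where c: "RT (\<lambda>orc y. dblT (right_tree (right_tree y))) (\<lambda>orc y. c + nat_of_tree (right_tree (right_tree y)) * c)"
    using RT_dbl by blast
  show ?thesis unfolding blistT_def
  proof (rule XT_fold[where body="\<lambda>orc x h a. dblT a" and \<kappa>b=nat_of_tree and \<kappa>n="\<lambda>_. 0" and B="\<lambda>_ _. 2 * c" and n="\<lambda>_. mu", OF c])
    fix orc :: "tree \<Rightarrow> bool" and x ys h zs assume "list_of_tree x = ys @ h # zs"
    then have "length ys \<le> nat_of_tree x" using length_list_of_tree[of x] by simp
    then have "(2::nat) ^ length ys \<le> 2 ^ nat_of_tree x" by (intro power_increasing) simp_all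
    then have "c + 2 ^ length ys * c \<le> 2 ^ nat_of_tree x * c + 2 ^ nat_of_tree x * c"
      by (intro add_mono mult_right_mono) simp_all
    then show "c + nat_of_tree (right_tree (right_tree (Node x (Node h (fold (\<lambda>h a. dblT a) ys (Node Leaf Leaf)))))) * c
        \<le> 2 ^ nat_of_tree x * (2 * c)" by (simp add: blist_fold)
  qed (simp_all add: XT_PT PT_id PT_Node PT_Leaf polyb_const polyb_mu nat_of_tree_le_mu)
qed

text \<open>The accumulator is a single truth value and every coin sequence has small measure, so
  each of the exponentially many tests takes polynomial time. The list itself has exponential
  measure, which is why \<open>PT_ex\<close> cannot serve here.\<close>

lemma XT_ex_blist:
  assumes p: "PT (\<lambda>orc y. p orc (left_tree y) (right_tree y))" and K: "PT K"
    and k: "\<And>orc x. nat_of_tree (K orc x) = \<kappa> x"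
  shows "XT \<kappa> (\<lambda>orc x. exT (p orc x) (blistT (K orc x)))"
  unfolding exT_def
proof -
  let ?b = "\<lambda>orc x h acc. ifT (p orc x h) (Node Leaf Leaf) acc"
  have "PT (\<lambda>orc y. ?b orc (left_tree y) (left_tree (right_tree y)) (right_tree (right_tree y)))"
    by (intro PT_basic PT_lift p)
  then obtain Tb where Tb: "RT (\<lambda>orc y. ?b orc (left_tree y) (left_tree (right_tree y)) (right_tree (right_tree y))) Tb"
    "polyb Tb" unfolding PT_def by blast
  obtain c where c: "\<And>orc x. Tb orc x \<le> (mu x + 2) ^ c" using Tb(2) unfolding polyb_def by blast
  show "XT \<kappa> (\<lambda>orc x. foldT (?b orc x) (blistT (K orc x)) Leaf)"
  proof (rule XT_fold[where \<kappa>b="\<lambda>_. 0" and \<kappa>n=\<kappa> and B="\<lambda>orc x. (mu x + mu (K orc x) + 6) ^ c" and n="\<lambda>_ _. 1", OF Tb(1)])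
    show "XT \<kappa> (\<lambda>orc x. blistT (K orc x))"
      by (rule XT_comp[where \<kappa>'=nat_of_tree, OF XT_blist XT_PT[OF K] PT_polyb_mu[OF K]]) (simp add: k)
    show "polyb (\<lambda>orc x. (mu x + mu (K orc x) + 6) ^ c)"
      by (intro polyb_power polyb_add polyb_mu polyb_const PT_polyb_mu[OF K])
    fix orc x ys h zs assume e: "list_of_tree (blistT (K orc x)) = ys @ h # zs"
    let ?a = "fold (?b orc x) ys Leaf"
    have "mu (fold (?b orc x) ys a) \<le> 1" if "mu a \<le> 1" for a
      using that by (induction ys arbitrary: a) (simp_all add: ifT_def)
    then have a: "mu ?a \<le> 1" by simp
    have "h \<in> bl ` {\<beta>. length \<beta> = nat_of_tree (K orc x)}" using e unfolding blist(1)[symmetric] by simp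
    then obtain \<beta> where "h = bl \<beta>" "length \<beta> = nat_of_tree (K orc x)" by blast
    then have "mu h \<le> nat_of_tree (K orc x) + 1" using mu_bl[of \<beta>] by simp
    then have "mu h \<le> mu (K orc x) + 1" using nat_of_tree_le_mu[of "K orc x"] by simp
    then have "mu (Node x (Node h ?a)) + 2 \<le> mu x + mu (K orc x) + 6"
      using a mu_Node_le[of x "Node h ?a"] mu_Node_le[of h ?a] by linarith
    then have "(mu (Node x (Node h ?a)) + 2) ^ c \<le> (mu x + mu (K orc x) + 6) ^ c" by (intro power_mono) simp_all
    then show "Tb orc (Node x (Node h ?a)) \<le> 2 ^ 0 * (mu x + mu (K orc x) + 6) ^ c"
      using c[of orc "Node x (Node h ?a)"] by simp
  qed (simp_all add: PT_Leaf polyb_const blist(2) k)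
qed

text \<open>Polynomially many rounds of exponential time. The exponent of the body must be read off
  the context, which stays the same in all rounds, and the growth of the accumulator is bounded
  through the context alone.\<close>

lemma XT_fold_PT:
  assumes body: "XT \<kappa>' (\<lambda>orc y. body orc (left_tree y) (left_tree (right_tree y)) (right_tree (right_tree y)))"
    and k: "\<And>x y. \<kappa>' (Node x y) = \<kappa> x"
    and l: "PT l" and i: "PT i"
    and growth: "polyb g" "\<And>orc x h a. h \<in> set (list_of_tree (l orc x)) \<Longrightarrow> mu (body orc x h a) \<le> mu a + g orc x"
  shows "XT \<kappa> (\<lambda>orc x. foldT (body orc x) (l orc x) (i orc x))"
    "polyb (\<lambda>orc x. mu (foldT (body orc x) (l orc x) (i orc x)))"
proof -
  obtain Tb gb where b': "RT (\<lambda>orc y. body orc (left_tree y) (left_tree (right_tree y)) (right_tree (right_tree y))) Tb" "polyb gb" "\<forall>orc x. Tb orc x \<le> 2 ^ \<kappa>' x * gb orc x"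
    using body unfolding XT_def by (elim exE conjE)
  note b = b'(1,2) b'(3)[rule_format]
  obtain c where c: "\<And>orc x. gb orc x \<le> (mu x + 2) ^ c" using b(2) unfolding polyb_def by blast
  define A where "A = (\<lambda>orc x. mu (i orc x) + mu (l orc x) * g orc x)"
  have A: "polyb A" unfolding A_def by (intro polyb_add polyb_mult growth(1) PT_polyb_mu l i)
  have acc: "mu (fold (body orc x) ys (i orc x)) \<le> A orc x" if e: "list_of_tree (l orc x) = ys @ zs" for orc x ys zs
  proof -
    have "mu (fold (body orc x) ys (i orc x)) \<le> mu (i orc x) + length ys * g orc x"
      by (rule mu_fold_additive) (rule growth(2), simp add: e)
    moreover have "length ys \<le> mu (l orc x)"
      using nat_of_tree_le_mu[of "l orc x"] length_list_of_tree[of "l orc x"] e by simp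
    then have "length ys * g orc x \<le> mu (l orc x) * g orc x" by (rule mult_right_mono) simp
    ultimately show ?thesis unfolding A_def by linarith
  qed
  show "XT \<kappa> (\<lambda>orc x. foldT (body orc x) (l orc x) (i orc x))"
  proof (rule XT_fold[where \<kappa>b=\<kappa> and \<kappa>n="\<lambda>_. 0" and B="\<lambda>orc x. (mu x + mu (l orc x) + A orc x + 4) ^ c" and n="\<lambda>orc x. mu (l orc x)", OF b(1) XT_PT[OF l] i])
    show "polyb (\<lambda>orc x. (mu x + mu (l orc x) + A orc x + 4) ^ c)"
      by (intro polyb_power polyb_add polyb_mu polyb_const A PT_polyb_mu[OF l])
    fix orc x ys h zs assume e: "list_of_tree (l orc x) = ys @ h # zs"
    let ?a = "fold (body orc x) ys (i orc x)"
    have "mu h \<le> mu (l orc x)" using mu_list_of_tree[of h "l orc x"] e by simp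
    then have "mu (Node x (Node h ?a)) + 2 \<le> mu x + mu (l orc x) + A orc x + 4"
      using acc[OF e] mu_Node_le[of x "Node h ?a"] mu_Node_le[of h ?a] by linarith
    then have "(mu (Node x (Node h ?a)) + 2) ^ c \<le> (mu x + mu (l orc x) + A orc x + 4) ^ c" by (intro power_mono) simp_all
    then have "gb orc (Node x (Node h ?a)) \<le> (mu x + mu (l orc x) + A orc x + 4) ^ c" using c le_trans by blast
    then have "2 ^ \<kappa>' (Node x (Node h ?a)) * gb orc (Node x (Node h ?a)) \<le> 2 ^ \<kappa> x * (mu x + mu (l orc x) + A orc x + 4) ^ c"
      unfolding k by (rule mult_left_mono) simp
    then show "Tb orc (Node x (Node h ?a)) \<le> 2 ^ \<kappa> x * (mu x + mu (l orc x) + A orc x + 4) ^ c"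
      using b(3) le_trans by blast
  qed (simp_all add: nat_of_tree_le_mu PT_polyb_mu[OF l])
  show "polyb (\<lambda>orc x. mu (foldT (body orc x) (l orc x) (i orc x)))"
    by (rule polyb_le[OF A]) (simp add: foldT_fold acc)
qed

section \<open>The algorithm\<close>

text \<open>Subtraction and comparison look only at the length of a list, so any list, in particular
  the edge list, can serve as a unary number.\<close>

lemma subT_eq: "subT a b = tree_of_list (drop (nat_of_tree b) (list_of_tree a))"
proof (induction b arbitrary: a)
  case Leaf then show ?case by (simp add: subT_def)
next
  case (Node l r)
  have "list_of_tree (right_tree a) = tl (list_of_tree a)" by (cases a) simp_all
  moreover have "subT a (Node l r) = subT (right_tree a) r" by (simp add: subT_def)
  ultimately show ?case using Node.IH(2)[of "right_tree a"] by (simp add: drop_Suc)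
qed

lemma le_len: "leT a b = tree_of_bool (nat_of_tree a \<le> nat_of_tree b)"
  by (auto simp: leT_def subT_eq notT_def ifT_def tree_of_bool_def length_list_of_tree)

lemma list_of_tree_of_nat: "list_of_tree (tree_of_nat n) = replicate n Leaf"
  by (induction n) simp_all

lemma tree_of_list_Leafs: "tree_of_list (replicate n Leaf) = tree_of_nat n"
  by (induction n) simp_all

lemma sub_len: "subT (tree_of_nat a) b = tree_of_nat (a - nat_of_tree b)"
  by (simp add: subT_eq list_of_tree_of_nat tree_of_list_Leafs)

lemma add_len: "addT a (tree_of_nat b) = tree_of_nat (nat_of_tree a + b)"
proof -
  have "addT a c = addT (tree_of_nat (nat_of_tree a)) c" for c
    by (induction a arbitrary: c) (simp_all add: addT_def)
  then show ?thesis by (simp add: nat_of_tree_of_nat)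
qed

lemma mu_sub: "mu (subT a b) \<le> mu a"
proof (rule mu_leI)
  show "mu h \<le> mu a" if "h \<in> set (list_of_tree (subT a b))" for h
    using that by (auto simp: subT_eq dest!: in_set_dropD intro: mu_list_of_tree)
  show "nat_of_tree (subT a b) \<le> mu a"
    using nat_of_tree_le_mu[of a] by (simp add: subT_eq length_list_of_tree)
qed

text \<open>The length of the accumulator is the next index, so no separate counter is
  carried.\<close>

definition idxT :: "tree \<Rightarrow> tree" where
  "idxT n = revT (foldT (\<lambda>h a. Node (addT a Leaf) a) n Leaf)"
definition arcsT :: "tree \<Rightarrow> tree" where
  "arcsT P = revT (right_tree (foldT (\<lambda>h st. Node (Node Leaf (left_tree st))
     (Node (Node (left_tree st) (Node (right_tree h) (Node (left_tree h) Leaf)))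
       (Node (Node (left_tree st) (Node (left_tree h) (Node (right_tree h) Leaf))) (right_tree st)))) P (Node Leaf Leaf)))"
definition oddT :: "tree \<Rightarrow> tree" where "oddT K = mapT (\<lambda>p. Node Leaf (addT p p)) (idxT (Node Leaf K))"
definition fifthT :: "tree \<Rightarrow> tree" where "fifthT q = mulT q (mulT q (mulT q (mulT q q)))"
text \<open>By truncated subtraction, k - (k - m) is the minimum of k and m, with the edge list as
  unary m. It keeps the number of coins and the exponent of the maximality test bounded in terms of
  the graph.\<close>

definition minkT :: "tree \<Rightarrow> tree" where "minkT x = subT (right_tree x) (subT (right_tree x) (right_tree (left_tree x)))"
definition quadT :: "tree \<Rightarrow> tree" where
  "quadT n = mulT (Node Leaf (Node Leaf (Node Leaf (Node Leaf Leaf)))) n"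
definition ctxT :: "tree \<Rightarrow> tree" where
  "ctxT x = Node (addT (right_tree (left_tree x)) (left_tree (left_tree x)))
     (Node (fifthT (quadT (Node Leaf (addT (right_tree (left_tree x)) (minkT x)))))
       (Node (idxT (left_tree (left_tree x))) (oddT (addT (minkT x) (minkT x)))))"
definition prepT :: "tree \<Rightarrow> tree" where
  "prepT x = Node (Node (addT (minkT x) (minkT x)) (Node (ctxT x) (arcsT (right_tree (left_tree x)))))
     (mulT (left_tree (left_tree x)) (quadT (minkT x)))"

lemma PT_idx: "PT a \<Longrightarrow> PT (\<lambda>orc x. idxT (a orc x))"
  unfolding idxT_def
proof (rule PT_rev, rule PT_fold[where body="\<lambda>orc x h a. Node (addT a Leaf) a" and c=0])
  show "mu (Node (addT a Leaf) a) \<le> mu a + (mu x + mu h + 2) ^ 0" for x h a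
    using mu_NodeI[of "addT a Leaf" "mu a" a] mu_add'[of a Leaf] by simp
qed (rule PT_Node PT_Leaf PT_left PT_right PT_id PT_add | assumption)+

lemma PT_arcs: "PT a \<Longrightarrow> PT (\<lambda>orc x. arcsT (a orc x))"
  unfolding arcsT_def
proof (rule PT_rev, rule PT_right, rule PT_fold[where c=3 and body="\<lambda>orc x h st. Node (Node Leaf (left_tree st))
     (Node (Node (left_tree st) (Node (right_tree h) (Node (left_tree h) Leaf)))
       (Node (Node (left_tree st) (Node (left_tree h) (Node (right_tree h) Leaf))) (right_tree st)))"])
  fix x h st :: tree
  let ?B = "mu st + mu h"
  have b: "mu (left_tree st) \<le> ?B" "mu (right_tree st) \<le> ?B" "mu (left_tree h) \<le> ?B" "mu (right_tree h) \<le> ?B" "mu Leaf \<le> ?B"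
    using mu_left[of st] mu_right[of st] mu_left[of h] mu_right[of h] by simp_all
  have i: "mu s \<le> ?B \<Longrightarrow> mu t \<le> ?B \<Longrightarrow> mu u \<le> ?B \<Longrightarrow> mu (Node s (Node t (Node u Leaf))) \<le> ?B + 3" for s t u
    using mu_Node[of s "Node t (Node u Leaf)"] mu_Node[of t "Node u Leaf"] mu_Node[of u Leaf] by simp
  let ?i1 = "Node (left_tree st) (Node (right_tree h) (Node (left_tree h) Leaf))"
  let ?i2 = "Node (left_tree st) (Node (left_tree h) (Node (right_tree h) Leaf))"
  have 1: "mu (Node ?i2 (right_tree st)) \<le> ?B + 4"
    using mu_Node[of ?i2 "right_tree st"] i[OF b(1,3,4)] b(2) by simp
  have 2: "mu (Node ?i1 (Node ?i2 (right_tree st))) \<le> ?B + 5"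
    using mu_Node[of ?i1 "Node ?i2 (right_tree st)"] i[OF b(1,4,3)] 1 by simp
  have "mu (Node (Node Leaf (left_tree st)) (Node ?i1 (Node ?i2 (right_tree st)))) \<le> ?B + 6"
    using mu_Node[of "Node Leaf (left_tree st)" "Node ?i1 (Node ?i2 (right_tree st))"] 2
      mu_Node[of Leaf "left_tree st"] b(1) by simp
  also have "\<dots> \<le> mu st + (mu x + mu h + 2) ^ 3"
  proof -
    have "mu h + 6 \<le> (mu h + 2) ^ 3" by (simp add: power3_eq_cube algebra_simps)
    also have "\<dots> \<le> (mu x + mu h + 2) ^ 3" by (rule power_mono) simp_all
    finally show ?thesis by simp
  qed
  finally show "mu (Node (Node Leaf (left_tree st)) (Node ?i1 (Node ?i2 (right_tree st)))) \<le> mu st + (mu x + mu h + 2) ^ 3" .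
qed (rule PT_Node PT_Leaf PT_left PT_right PT_id | assumption)+

lemma PT_odd: "PT a \<Longrightarrow> PT (\<lambda>orc x. oddT (a orc x))"
  unfolding oddT_def
  by (rule PT_map[where f="\<lambda>orc x p. Node Leaf (addT p p)"]) (intro PT_basic PT_add PT_idx; assumption)+

lemma PT_mink: "PT (\<lambda>orc x. minkT x)"
  unfolding minkT_def by (intro PT_sub PT_basic)

lemma PT_quad: "PT a \<Longrightarrow> PT (\<lambda>orc x. quadT (a orc x))"
  unfolding quadT_def by (intro PT_mul PT_basic)

lemma PT_prep: "PT (\<lambda>orc x. prepT x)"
  unfolding prepT_def ctxT_def fifthT_def
  by (intro PT_Node PT_arcs PT_mul PT_add PT_idx PT_odd PT_quad PT_mink PT_left PT_right PT_id PT_Leaf)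

lemma idx_sim: "idxT t = nl [0..<nat_of_tree t]"
proof -
  let ?f = "\<lambda>h a. Node (addT a Leaf) a"
  have "fold ?f hs (nl (rev [0..<j])) = nl (rev [0..<j + length hs])" for hs j
  proof (induction hs arbitrary: j)
    case (Cons h hs)
    have "addT (nl (rev [0..<j])) Leaf = tree_of_nat j" using add_len[of "nl (rev [0..<j])" 0] by (simp add: nl_def)
    then have "?f h (nl (rev [0..<j])) = nl (rev [0..<Suc j])" by (simp add: nl_Cons)
    then show ?case using Cons[of "Suc j"] by simp
  qed simp
  from this[of "list_of_tree t" 0] show ?thesis
    by (simp add: idxT_def foldT_fold length_list_of_tree nl_def revT_eq rev_map)
qed

lemma arcs_snoc: "arcs ps [0..<Suc n] = arcs ps [0..<n] @ [(n, fst (ps ! n), snd (ps ! n)), (n, snd (ps ! n), fst (ps ! n))]"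
  by (simp add: arcs_def)

lemma arcs_sim:
  "arcsT (tree_of_list (map (\<lambda>(u, v). Node (tree_of_nat u) (tree_of_nat v)) ps)) = encA (\<lambda>_. 0) (arcs ps [0..<length ps])"
proof -
  let ?e = "\<lambda>(u, v). Node (tree_of_nat u) (tree_of_nat v)"
  let ?f = "\<lambda>h st. Node (Node Leaf (left_tree st))
     (Node (Node (left_tree st) (Node (right_tree h) (Node (left_tree h) Leaf)))
       (Node (Node (left_tree st) (Node (left_tree h) (Node (right_tree h) Leaf))) (right_tree st)))"
  have "fold ?f (map ?e qs) (Node (tree_of_nat (length pre)) (encA (\<lambda>_. 0) (rev (arcs ps [0..<length pre])))) =
      Node (tree_of_nat (length ps)) (encA (\<lambda>_. 0) (rev (arcs ps [0..<length ps])))" if "ps = pre @ qs" for pre qs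
    using that
  proof (induction qs arbitrary: pre)
    case (Cons q qs)
    obtain a b where q: "q = (a, b)" by (cases q)
    let ?n = "length pre"
    have n: "ps ! ?n = (a, b)" using Cons.prems q by simp
    have "?f (?e q) (Node (tree_of_nat ?n) (encA (\<lambda>_. 0) (rev (arcs ps [0..<?n])))) =
        Node (tree_of_nat (length (pre @ [q]))) (encA (\<lambda>_. 0) (rev (arcs ps [0..<length (pre @ [q])])))"
      by (simp add: q arcs_snoc n encA_def encC_def del: upt_Suc)
    then show ?case using Cons.IH[of "pre @ [q]"] Cons.prems by simp
  qed simp
  from this[of "[]" ps] show ?thesis
    by (simp add: arcsT_def foldT_fold encA_def arcs_def[of ps "[]"] revT_eq rev_map)
qed

lemma mink_sim: "minkT (input_tree N ps k) = tree_of_nat (min k (length ps))"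
  by (simp add: minkT_def input_tree_def sub_len nat_of_tree_of_nat min_def)

lemma quad_sim: "quadT (tree_of_nat n) = tree_of_nat (4 * n)"
proof -
  have "Node Leaf (Node Leaf (Node Leaf (Node Leaf Leaf))) = tree_of_nat 4" by (simp add: numeral_eq_Suc)
  then show ?thesis by (simp add: quadT_def)
qed

context rgraph
begin

lemma prep_sim:
  fixes k defines "k' \<equiv> min k (length ps)"
  obtains C where "prepT (input_tree N ps k) = Node (Node (tree_of_nat (2 * k')) (Node C (encA (\<lambda>_. 0) (arcs ps [0..<length ps]))))
      (tree_of_nat (N * (4 * k')))"
    "ctx_ok k' (right_tree C)" "nat_of_tree (left_tree C) = N + length ps"
    "left_tree (right_tree (right_tree C)) = nl [0..<N]"
proof -
  let ?x = "input_tree N ps k" and ?P = "tree_of_list (map (\<lambda>(u, v). Node (tree_of_nat u) (tree_of_nat v)) ps)"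
  let ?C = "ctxT ?x"
  have x: "left_tree (left_tree ?x) = tree_of_nat N" "right_tree (left_tree ?x) = ?P" by (simp_all add: input_tree_def)
  have m: "minkT ?x = tree_of_nat k'" unfolding k'_def by (rule mink_sim)
  have q: "quadT (Node Leaf (addT ?P (minkT ?x))) = tree_of_nat (4 * (length ps + k' + 1))"
    using quad_sim[of "Suc (length ps + k')"] by (simp add: m add_len)
  have T: "nat_of_tree (left_tree (right_tree ?C)) = (4 * (length ps + k' + 1)) ^ 5"
    unfolding ctxT_def x left_tree.simps right_tree.simps q fifthT_def mul_nat nat_of_tree_of_nat
    by (simp only: numeral_eq_Suc power_Suc pred_numeral_simps BitM.simps power_0 mult_1_right arith_simps)
  have PL: "set (list_of_tree (right_tree (right_tree (right_tree ?C)))) = (\<lambda>p. tree_of_nat (2 * p + 1)) ` {..2 * k'}"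
  proof -
    have "Node Leaf (addT (tree_of_nat p) (tree_of_nat p)) = tree_of_nat (2 * p + 1)" for p by (simp add: mult_2)
    then have mp: "mapT (\<lambda>p. Node Leaf (addT p p)) (nl xs) = tree_of_list (map (\<lambda>p. tree_of_nat (2 * p + 1)) xs)" for xs
      by (simp add: mapT_eq nl_def comp_def del: add_nat)
    have "right_tree (right_tree (right_tree ?C)) = tree_of_list (map (\<lambda>p. tree_of_nat (2 * p + 1)) [0..<Suc (k' + k')])"
      unfolding ctxT_def right_tree.simps m add_nat oddT_def idx_sim mp nat_of_tree.simps nat_of_tree_of_nat ..
    moreover have "{0..<Suc (k' + k')} = {..2 * k'}" by auto
    ultimately show ?thesis by (simp only: list_of_tree_of_list set_map set_upt)
  qed
  show ?thesis
  proof (rule that[of ?C])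
    show "left_tree (right_tree (right_tree ?C)) = nl [0..<N]" by (simp add: ctxT_def x idx_sim nat_of_tree_of_nat)
    then show "ctx_ok k' (right_tree ?C)" unfolding ctx_ok_def using T PL by (simp add: nl_def)
    show "nat_of_tree (left_tree ?C) = N + length ps" by (simp add: ctxT_def x add_len nat_of_tree_of_nat)
    show "prepT ?x = Node (Node (tree_of_nat (2 * k')) (Node ?C (encA (\<lambda>_. 0) (arcs ps [0..<length ps])))) (tree_of_nat (N * (4 * k')))"
      unfolding prepT_def x m arcs_sim quad_sim add_nat mul_nat by (simp add: mult_2)
  qed
qed

end

section \<open>Selecting the results\<close>

definition takeT :: "tree \<Rightarrow> tree \<Rightarrow> tree" where "takeT n l = revT (subT (revT l) (subT l n))"
text \<open>On lists of truth values this is the identity. It bounds the measure of a coin block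
  also for arbitrary argument trees, for which the time bounds are stated as well.\<close>

definition normT :: "tree \<Rightarrow> tree" where "normT l = mapT (\<lambda>b. ifT b (Node Leaf Leaf) Leaf) l"
definition candT :: "(tree \<Rightarrow> bool) \<Rightarrow> tree \<Rightarrow> tree \<Rightarrow> tree \<Rightarrow> tree" where
  "candT orc env v \<beta> = (let M = outT orc (left_tree (right_tree env)) (right_tree (right_tree env)) v \<beta>
     in Node (vertsT M) (lostT orc M (right_tree (right_tree env))))"
definition betterT :: "tree \<Rightarrow> tree \<Rightarrow> tree" where
  "betterT c c' = andT (andT (subsetT (left_tree c) (left_tree c')) (notT (subsetT (left_tree c') (left_tree c))))
     (leT (right_tree c') (right_tree c))"
definition dominatedT :: "(tree \<Rightarrow> bool) \<Rightarrow> tree \<Rightarrow> tree" where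
  "dominatedT orc D = exT (\<lambda>\<beta>. betterT (right_tree (right_tree D)) (candT orc (left_tree D) (left_tree (right_tree D)) \<beta>))
     (blistT (left_tree (left_tree D)))"
definition okT :: "tree \<Rightarrow> tree \<Rightarrow> tree \<Rightarrow> tree \<Rightarrow> tree" where
  "okT env v \<gamma> c = andT (leT (right_tree c) (left_tree env))
     (andT (allT (\<lambda>u. leT v u) (left_tree c)) (orT (notT (right_tree c)) (allT (\<lambda>b. b) \<gamma>)))"
definition bitsT :: "tree \<Rightarrow> tree \<Rightarrow> tree" where
  "bitsT env bits = normT (takeT (left_tree env) bits)"
text \<open>The entry \<open>left_tree env\<close> is 2k in unary; dropping so many bits twice moves
  on to the block of the next vertex, the second half being the additional test.\<close>

definition finT :: "tree \<Rightarrow> tree \<Rightarrow> tree \<Rightarrow> tree \<Rightarrow> tree \<Rightarrow> tree" where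
  "finT env v st c d = Node (subT (subT (left_tree st) (left_tree env)) (left_tree env))
     (ifT (andT (okT env v (bitsT env (subT (left_tree st) (left_tree env))) c) (notT d)) (Node c (right_tree st)) (right_tree st))"
definition bodyT :: "(tree \<Rightarrow> bool) \<Rightarrow> tree \<Rightarrow> tree \<Rightarrow> tree \<Rightarrow> tree" where
  "bodyT orc env v st = finT env v st (candT orc env v (bitsT env (left_tree st)))
     (dominatedT orc (Node env (Node v (candT orc env v (bitsT env (left_tree st))))))"
definition maximalT :: "tree \<Rightarrow> tree" where
  "maximalT R = filterT (\<lambda>c. notT (exT (\<lambda>c'. andT (subsetT (left_tree c) (left_tree c'))
     (notT (subsetT (left_tree c') (left_tree c)))) R)) R"
definition unionT :: "tree \<Rightarrow> tree" where "unionT L = foldT appT L Leaf"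
definition postT :: "tree \<Rightarrow> tree" where
  "postT R = Node (unionT (mapT left_tree R)) (unionT (mapT (\<lambda>c. mapT left_tree (right_tree c)) (maximalT R)))"
definition selT :: "(tree \<Rightarrow> bool) \<Rightarrow> tree \<Rightarrow> tree" where
  "selT orc x = foldT (bodyT orc (left_tree x)) (left_tree (right_tree (right_tree (left_tree (right_tree (left_tree x))))))
     (Node (revT (right_tree x)) Leaf)"
definition mainT :: "(tree \<Rightarrow> bool) \<Rightarrow> tree \<Rightarrow> tree" where
  "mainT orc x = postT (right_tree (selT orc x))"

lemma PT_take: "PT a \<Longrightarrow> PT b \<Longrightarrow> PT (\<lambda>orc x. takeT (a orc x) (b orc x))"
  unfolding takeT_def by (intro PT_rev PT_sub)

lemma PT_bits: "PT a \<Longrightarrow> PT b \<Longrightarrow> PT (\<lambda>orc x. bitsT (a orc x) (b orc x))"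
  unfolding bitsT_def normT_def
  by (rule PT_map[where f="\<lambda>orc x b. ifT b (Node Leaf Leaf) Leaf"]) (intro PT_basic PT_take; assumption)+

lemma PT_cand: "PT a \<Longrightarrow> PT b \<Longrightarrow> PT c \<Longrightarrow> PT (\<lambda>orc x. candT orc (a orc x) (b orc x) (c orc x))"
  unfolding candT_def Let_def by (intro PT_Node PT_verts PT_lost PT_out PT_left PT_right)

lemma PT_better: "PT a \<Longrightarrow> PT b \<Longrightarrow> PT (\<lambda>orc x. betterT (a orc x) (b orc x))"
  unfolding betterT_def by (intro PT_and PT_not PT_subset PT_le PT_left PT_right)

lemma PT_ok: "PT a \<Longrightarrow> PT b \<Longrightarrow> PT c \<Longrightarrow> PT d \<Longrightarrow> PT (\<lambda>orc x. okT (a orc x) (b orc x) (c orc x) (d orc x))"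
proof (rule PT4[where F="\<lambda>orc. okT"])
  show "PT (\<lambda>orc x. okT (left_tree x) (left_tree (right_tree x)) (left_tree (right_tree (right_tree x))) (right_tree (right_tree (right_tree x))))"
    unfolding okT_def
    by (intro PT_and PT_or PT_not PT_le PT_left PT_right PT_id
        PT_all[where p="\<lambda>orc x u. leT (left_tree (right_tree x)) u"] PT_all[where p="\<lambda>orc x b. b"])
qed

lemma PT_fin: "PT a \<Longrightarrow> PT b \<Longrightarrow> PT c \<Longrightarrow> PT d \<Longrightarrow> PT e \<Longrightarrow>
    PT (\<lambda>orc x. finT (a orc x) (b orc x) (c orc x) (d orc x) (e orc x))"
  unfolding finT_def by (intro PT_Node PT_if PT_and PT_not PT_ok PT_bits PT_sub PT_left PT_right)

lemma PT_maximal: "PT a \<Longrightarrow> PT (\<lambda>orc x. maximalT (a orc x))"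
proof -
  have "PT (\<lambda>orc x. maximalT x)"
    unfolding maximalT_def
    by (rule PT_filter[where p="\<lambda>orc R c. notT (exT (\<lambda>c'. andT (subsetT (left_tree c) (left_tree c'))
         (notT (subsetT (left_tree c') (left_tree c)))) R)"], rule PT_not,
        rule PT_ex[where p="\<lambda>orc y c'. andT (subsetT (left_tree (right_tree y)) (left_tree c'))
         (notT (subsetT (left_tree c') (left_tree (right_tree y))))"])
      (intro PT_and PT_not PT_subset PT_left PT_right PT_id)+
  then show "PT a \<Longrightarrow> PT (\<lambda>orc x. maximalT (a orc x))" by (rule PT_comp)
qed

lemma PT_union: "PT a \<Longrightarrow> PT (\<lambda>orc x. unionT (a orc x))"
  unfolding unionT_def
proof (rule PT_fold[where body="\<lambda>orc x. appT" and c=1])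
  show "mu (appT h a) \<le> mu a + (mu x + mu h + 2) ^ 1" for x h a using mu_app[of h a] by simp
qed (rule PT_app PT_left PT_right PT_id PT_Leaf | assumption)+

lemma PT_post: "PT (\<lambda>orc x. postT x)"
  unfolding postT_def
  by (intro PT_Node PT_union PT_maximal PT_id PT_left PT_right
      PT_map[where f="\<lambda>orc x c. left_tree c"] PT_map[where f="\<lambda>orc x c. mapT left_tree (right_tree c)"])

lemma XT_dominated: "XT (\<lambda>D. nat_of_tree (left_tree (left_tree D))) dominatedT"
  unfolding dominatedT_def
  by (rule XT_ex_blist[where p="\<lambda>orc D \<beta>. betterT (right_tree (right_tree D)) (candT orc (left_tree D) (left_tree (right_tree D)) \<beta>)"])
    (intro PT_better PT_cand PT_left PT_right PT_id | simp)+

lemma mu_bits: "mu (bitsT env bits) \<le> mu env + 1"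
proof (rule mu_leI)
  have l: "nat_of_tree (left_tree env) \<le> mu env" using nat_of_tree_le_mu[of "left_tree env"] mu_left[of env] by linarith
  show "mu h \<le> mu env + 1" if "h \<in> set (list_of_tree (bitsT env bits))" for h
    using that by (auto simp: bitsT_def normT_def mapT_eq ifT_def)
  have "nat_of_tree (bitsT env bits) \<le> nat_of_tree (left_tree env)"
    by (simp add: bitsT_def normT_def mapT_eq takeT_def revT_eq subT_eq)
  then show "nat_of_tree (bitsT env bits) \<le> mu env + 1" using l by simp
qed

text \<open>A round adds at most one candidate to the list. Its measure depends on the environment
  alone, since the coin block it is computed from has been cut to length and normalised.\<close>

lemma mu_body_bound:
  "\<exists>c. \<forall>orc env v st. mu v \<le> mu env \<longrightarrow> mu (bodyT orc env v st) \<le> mu st + (3 * mu env + 6) ^ c"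
proof -
  have "polyb (\<lambda>orc x. mu (candT orc (left_tree x) (left_tree (right_tree x)) (right_tree (right_tree x))))"
    by (intro PT_polyb_mu PT_cand PT_left PT_right PT_id)
  then obtain c where c: "\<forall>orc x. mu (candT orc (left_tree x) (left_tree (right_tree x)) (right_tree (right_tree x))) \<le> (mu x + 2) ^ c"
    unfolding polyb_def by (elim exE)
  have "mu (bodyT orc env v st) \<le> mu st + (3 * mu env + 6) ^ Suc c" if v: "mu v \<le> mu env" for orc env v st
  proof -
    let ?b = "bitsT env (left_tree st)"
    let ?c = "candT orc env v ?b"
    let ?X = "subT (subT (left_tree st) (left_tree env)) (left_tree env)"
    define q where "q = (3 * mu env + 6) ^ c"
    have q: "q \<ge> 1" by (simp add: q_def)
    have "mu (Node env (Node v ?b)) + 2 \<le> 3 * mu env + 6"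
      using mu_Node_le[of env "Node v ?b"] mu_Node_le[of v ?b] mu_bits[of env "left_tree st"] v by linarith
    then have "(mu (Node env (Node v ?b)) + 2) ^ c \<le> q" unfolding q_def by (intro power_mono) simp_all
    then have cc: "mu ?c \<le> q" using c[rule_format, of orc "Node env (Node v ?b)"] by simp
    have X: "mu ?X \<le> mu st" using mu_sub[of "subT (left_tree st) (left_tree env)" "left_tree env"]
        mu_sub[of "left_tree st" "left_tree env"] mu_left[of st] by linarith
    have Y: "mu (ifT d (Node ?c (right_tree st)) (right_tree st)) \<le> mu st + q + 1" for d
    proof (rule mu_ifT)
      show "mu (Node ?c (right_tree st)) \<le> mu st + q + 1"
        using mu_Node_le[of ?c "right_tree st"] mu_Node[of ?c "right_tree st"] cc mu_right[of st] by linarith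
      show "mu (right_tree st) \<le> mu st + q + 1" using mu_right[of st] by simp
    qed
    have "mu (bodyT orc env v st) \<le> mu st + q + 2"
      unfolding bodyT_def finT_def using mu_NodeI[of ?X "mu st + q + 1", OF _ Y] X by simp
    also have "\<dots> \<le> mu st + 6 * q" using q by simp
    also have "\<dots> \<le> mu st + (3 * mu env + 6) * q" by simp
    finally show ?thesis by (simp add: q_def)
  qed
  then show ?thesis by blast
qed

text \<open>Only the maximality test is exponential, and it runs once per vertex; everything around
  it is polynomial.\<close>

lemma XT_main: "XT (\<lambda>x. nat_of_tree (left_tree (left_tree x))) mainT"
proof -
  let ?\<kappa> = "\<lambda>x. nat_of_tree (left_tree (left_tree x))"
  obtain c where c: "\<forall>orc env v st. mu v \<le> mu env \<longrightarrow> mu (bodyT orc env v st) \<le> mu st + (3 * mu env + 6) ^ c"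
    using mu_body_bound by (elim exE)
  let ?b = "\<lambda>orc x. bodyT orc (left_tree x)"
  let ?V = "\<lambda>x. left_tree (right_tree (right_tree (left_tree (right_tree (left_tree x)))))"
  have "XT (\<lambda>y. nat_of_tree (left_tree (left_tree (left_tree y))))
      (\<lambda>orc y. bodyT orc (left_tree (left_tree y)) (left_tree (right_tree y)) (right_tree (right_tree y)))"
  proof -
    let ?k = "\<lambda>y. nat_of_tree (left_tree (left_tree (left_tree y)))"
    let ?env = "\<lambda>y. left_tree (left_tree y)" and ?v = "\<lambda>y. left_tree (right_tree y)" and ?st = "\<lambda>y. right_tree (right_tree y)"
    let ?c = "\<lambda>orc y. candT orc (?env y) (?v y) (bitsT (?env y) (left_tree (?st y)))"
    let ?D = "\<lambda>orc y. Node (?env y) (Node (?v y) (?c orc y))"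
    let ?G = "\<lambda>z. finT (?env (left_tree z)) (?v (left_tree z)) (?st (left_tree z)) (left_tree (right_tree z)) (right_tree (right_tree z))"
    have pc: "PT ?c" by (intro PT_cand PT_bits PT_left PT_right PT_id)
    have pD: "PT ?D" by (intro PT_Node pc PT_left PT_right PT_id)
    have G: "PT (\<lambda>orc z. ?G z)" by (intro PT_fin PT_left PT_right PT_id)
    have d: "XT ?k (\<lambda>orc y. dominatedT orc (?D orc y))"
      by (rule XT_comp[OF XT_dominated XT_PT[OF pD] PT_polyb_mu[OF pD]]) simp
    have n: "XT ?k (\<lambda>orc y. Node y (Node (?c orc y) (dominatedT orc (?D orc y))))"
      by (intro XT_Node d XT_PT pc PT_id)
    have "mu (dominatedT orc z) \<le> 1" for orc z unfolding dominatedT_def by (rule mu_ex)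
    then have dm: "polyb (\<lambda>orc y. mu (dominatedT orc (?D orc y)))" by (intro polyb_le[OF polyb_const[of 1]])
    have "polyb (\<lambda>orc y. mu y + (mu (?c orc y) + mu (dominatedT orc (?D orc y)) + 1) + 1)"
      by (intro polyb_add polyb_mu PT_polyb_mu[OF pc] dm polyb_const)
    then have m: "polyb (\<lambda>orc y. mu (Node y (Node (?c orc y) (dominatedT orc (?D orc y)))))"
    proof (rule polyb_le)
      show "mu (Node s (Node t u)) \<le> mu s + (mu t + mu u + 1) + 1" for s t u
        using mu_Node_le[of s "Node t u"] mu_Node_le[of t u] by linarith
    qed
    have "XT ?k (\<lambda>orc y. ?G (Node y (Node (?c orc y) (dominatedT orc (?D orc y)))))"
      by (rule XT_comp[where f="\<lambda>orc. ?G" and \<kappa>'="\<lambda>_. 0", OF XT_PT[OF G] n m]) simp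
    then show ?thesis by (simp add: bodyT_def)
  qed
  then have body: "XT (\<lambda>y. nat_of_tree (left_tree (left_tree (left_tree y))))
      (\<lambda>orc y. ?b orc (left_tree y) (left_tree (right_tree y)) (right_tree (right_tree y)))" .
  have l: "PT (\<lambda>orc x. ?V x)" by (intro PT_left PT_right PT_id)
  have i: "PT (\<lambda>orc x. Node (revT (right_tree x)) Leaf)" by (intro PT_Node PT_rev PT_right PT_id PT_Leaf)
  have g: "polyb (\<lambda>orc x. (3 * mu x + 6) ^ c)"
    by (intro polyb_power polyb_add polyb_mult polyb_const polyb_mu)
  have gr: "mu (?b orc x h a) \<le> mu a + (3 * mu x + 6) ^ c" if "h \<in> set (list_of_tree (?V x))" for orc x h a
  proof -
    have "mu h \<le> mu (?V x)" by (rule mu_list_of_tree[OF that])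
    also have "\<dots> \<le> mu (left_tree x)" using mu_left mu_right le_trans by meson
    finally have "mu (?b orc x h a) \<le> mu a + (3 * mu (left_tree x) + 6) ^ c" using c by simp
    moreover have "(3 * mu (left_tree x) + 6) ^ c \<le> (3 * mu x + 6) ^ c" using mu_left[of x] by (intro power_mono) simp_all
    ultimately show ?thesis by linarith
  qed
  have s: "XT ?\<kappa> selT" "polyb (\<lambda>orc x. mu (selT orc x))"
    unfolding selT_def by (rule XT_fold_PT[where body="?b" and l="\<lambda>orc. ?V", OF body _ l i g gr]; simp)+
  have p: "PT (\<lambda>orc x. postT (right_tree x))" by (rule PT_comp[OF PT_post]) (intro PT_right PT_id)
  show ?thesis unfolding mainT_def
    by (rule XT_comp[where f="\<lambda>orc x. postT (right_tree x)" and \<kappa>'="\<lambda>_. 0", OF XT_PT[OF p] s]) simp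
qed

lemma power_le_fact_choose: "Suc j ^ c \<le> fact c * ((j + c) choose c)"
proof (induction c)
  case (Suc c)
  have "Suc j ^ Suc c \<le> Suc (j + c) * (fact c * ((j + c) choose c))"
    using Suc by (simp only: power_Suc) (rule mult_mono, simp_all)
  also have "\<dots> = fact c * (Suc (j + c) * ((j + c) choose c))" by (rule mult.left_commute)
  also have "Suc (j + c) * ((j + c) choose c) = Suc c * (Suc (j + c) choose Suc c)"
    by (rule Suc_times_binomial[symmetric])
  finally show ?case by (simp add: algebra_simps)
qed simp

text \<open>A power of j + 1 is compared with the binomial coefficient of j + c over c, which is at
  most 2^(j + c). It serves to charge polynomials in the excess of k over the number of edges to the
  factor 4^k.\<close>

lemma poly_le_exp: "Suc j ^ c \<le> (fact c * 2 ^ c) * 4 ^ j"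
proof -
  have "Suc j ^ c \<le> fact c * 2 ^ (j + c)"
    using power_le_fact_choose[of j c] binomial_le_pow2[of "j + c" c] by (meson le_trans mult_le_mono2)
  also have "\<dots> = (fact c * 2 ^ c) * 2 ^ j" by (simp add: power_add)
  also have "(2::nat) ^ j \<le> 4 ^ j" by (rule power_mono) simp_all
  finally show ?thesis by simp
qed

context rgraph
begin

definition encR :: "entry list \<Rightarrow> tree" where
  "encR M = Node (nl (map fst M)) (encA (\<lambda>_. 0) (arcs ps (filter (\<lambda>i. i \<in> cut M) [0..<length ps])))"

lemma lostc_cut:
  assumes "i < length ps" "{a, b} = {fst (ps ! i), snd (ps ! i)}"
  shows "lostc M (i, a, b) \<longleftrightarrow> i \<in> cut M"
proof -
  have e: "i \<in> edges G" "ends G i = {a, b}" using assms edges_eq ends_eq by auto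
  have c: "(\<forall>x y. {a, b} = {x, y} \<longrightarrow> cons_edge (\<lambda>u. set (pth M u)) i x y) \<longleftrightarrow> cons_edge (\<lambda>u. set (pth M u)) i a b"
    using cons_edge_commute[of "\<lambda>u. set (pth M u)" i a b] by (auto simp: doubleton_eq_iff)
  show ?thesis unfolding lostc_def lost_def cut_def kept_def using e c by auto
qed

lemma filter_lostc: "set ids \<subseteq> {..<length ps} \<Longrightarrow>
    filter (lostc M) (arcs ps ids) = arcs ps (filter (\<lambda>i. i \<in> cut M) ids)"
proof (induction ids)
  case (Cons i ids)
  have i: "i < length ps" using Cons.prems by simp
  have IH: "filter (lostc M) (arcs ps ids) = arcs ps (filter (\<lambda>i. i \<in> cut M) ids)" using Cons by simp
  have c: "lostc M (i, fst (ps ! i), snd (ps ! i)) \<longleftrightarrow> i \<in> cut M" by (rule lostc_cut[OF i refl])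
  have c': "lostc M (i, snd (ps ! i), fst (ps ! i)) \<longleftrightarrow> i \<in> cut M" by (rule lostc_cut[OF i insert_commute])
  have a: "arcs ps (j # js) = (j, fst (ps ! j), snd (ps ! j)) # (j, snd (ps ! j), fst (ps ! j)) # arcs ps js" for j js
    by (simp add: arcs_def)
  show ?case by (cases "i \<in> cut M") (simp_all only: filter.simps a c c' IH if_True if_False)
qed (simp add: arcs_def)

lemma cut_list: "set (filter (\<lambda>i. i \<in> cut M) [0..<length ps]) = cut M"
  using edges_eq by (auto simp: cut_def)

text \<open>Each cut edge is listed with both arcs. Comparisons between results are not affected,
  and the bound k on the cut becomes 2k, the number that \<open>env\<close> holds already as the
  length of a coin sequence.\<close>

lemma length_cut: "length (arcs ps (filter (\<lambda>i. i \<in> cut M) [0..<length ps])) = 2 * card (cut M)"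
proof -
  have "length (arcs ps ids) = 2 * length ids" for ids by (induction ids) (simp_all add: arcs_def)
  moreover have "length (filter (\<lambda>i. i \<in> cut M) [0..<length ps]) = card (cut M)"
    using distinct_card[of "filter (\<lambda>i. i \<in> cut M) [0..<length ps]"] cut_list[of M] by simp
  ultimately show ?thesis by simp
qed

lemma encR_simps: "left_tree (encR M) = nl (map fst M)" "set (map fst M) = dom_of M"
  "nat_of_tree (right_tree (encR M)) = 2 * card (cut M)" "right_tree (encR M) = Leaf \<longleftrightarrow> cut M = {}"
proof -
  show "nat_of_tree (right_tree (encR M)) = 2 * card (cut M)" by (simp add: encR_def encA_def length_cut)
  then show "right_tree (encR M) = Leaf \<longleftrightarrow> cut M = {}"
    using finite_cut[of M] by (cases "right_tree (encR M)") auto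
qed (simp_all add: encR_def dom_of_def)

lemma better_sim: "betterT (encR M) (encR M') =
    tree_of_bool (dom_of M \<subset> dom_of M' \<and> card (cut M') \<le> card (cut M))"
  unfolding betterT_def encR_simps subset_sim le_len bool_simps
  by (rule arg_cong[where f=tree_of_bool]) auto

lemma bl_simps: "subT (bl xs) t = bl (drop (nat_of_tree t) xs)" "takeT t (bl xs) = bl (take (nat_of_tree t) xs)"
  "normT (bl xs) = bl xs" "list_of_tree (bl xs) = map tree_of_bool xs"
proof -
  show 1: "subT (bl xs) t = bl (drop (nat_of_tree t) xs)" for xs t by (simp add: subT_eq bl_def drop_map)
  have r: "revT (bl xs) = bl (rev xs)" for xs by (simp add: revT_eq bl_def rev_map)
  have l: "nat_of_tree (bl xs) = length xs" for xs by (simp add: bl_def)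
  show "takeT t (bl xs) = bl (take (nat_of_tree t) xs)"
    unfolding takeT_def 1 r l by (cases "nat_of_tree t \<le> length xs") (simp_all add: drop_rev)
  show "normT (bl xs) = bl xs" by (simp add: normT_def mapT_eq bl_def comp_def flip: tree_of_bool_def)
  show "list_of_tree (bl xs) = map tree_of_bool xs" by (simp add: bl_def)
qed

lemma tob_Leaf [simp]: "tree_of_bool b = Leaf \<longleftrightarrow> \<not> b"
  by (simp add: tree_of_bool_def)

lemma notT_bool: "notT t = tree_of_bool (t = Leaf)"
  by (simp add: notT_def ifT_def tree_of_bool_def)

lemma ok_sim:
  assumes "left_tree env = tree_of_nat (2 * k)"
  shows "okT env (tree_of_nat v) (bl \<gamma>) (encR M) = tree_of_bool (card (cut M) \<le> k \<and> (\<forall>u\<in>dom_of M. v \<le> u) \<and>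
    (cut M = {} \<or> (\<forall>b\<in>set \<gamma>. b)))"
proof -
  have a: "allT (\<lambda>u. leT (tree_of_nat v) u) (nl (map fst M)) = tree_of_bool (\<forall>u\<in>dom_of M. v \<le> u)"
    by (simp add: allT_eq nl_def flip: encR_simps(2))
  have b: "allT (\<lambda>b. b) (bl \<gamma>) = tree_of_bool (\<forall>b\<in>set \<gamma>. b)" by (simp add: allT_eq bl_simps)
  show ?thesis
    unfolding okT_def assms encR_simps(1,3) le_len nat_of_tree_of_nat a b notT_bool encR_simps(4) bool_simps
    by (rule arg_cong[where f=tree_of_bool]) auto
qed

context
  fixes k :: nat and C env :: tree
  assumes C: "ctx_ok k (right_tree C)" "nat_of_tree (left_tree C) = N + length ps"
    "left_tree (right_tree (right_tree C)) = nl [0..<N]"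
    and env: "env = Node (tree_of_nat (2 * k)) (Node C (encA (\<lambda>_. 0) (arcs ps [0..<length ps])))"
begin

lemma env_simps: "left_tree env = tree_of_nat (2 * k)" "left_tree (right_tree env) = C"
  "right_tree (right_tree env) = encA (\<lambda>_. 0) (arcs ps [0..<length ps])"
  by (simp_all add: env)

lemma cand_sim:
  assumes v: "v < N"
  shows "candT orc env (tree_of_nat v) (bl \<beta>) = encR (out k v \<beta>)"
proof -
  have "filter (lostc (out k v \<beta>)) (arcs ps [0..<length ps]) = arcs ps (filter (\<lambda>i. i \<in> cut (out k v \<beta>)) [0..<length ps])"
    by (rule filter_lostc) auto
  then show ?thesis
    unfolding candT_def Let_def env_simps out_sim[OF C(1,2) v] lost_sim verts_sim encR_def by simp
qed

lemma dominated_sim: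
  assumes v: "v < N"
  shows "dominatedT orc (Node env (Node (tree_of_nat v) (encR M))) =
    tree_of_bool (\<exists>\<beta>'. length \<beta>' = 2 * k \<and> dom_of M \<subset> dom_of (out k v \<beta>') \<and> card (cut (out k v \<beta>')) \<le> card (cut M))"
  unfolding dominatedT_def exT_eq left_tree.simps right_tree.simps env_simps blist nat_of_tree_of_nat
  by (auto simp: cand_sim[OF v] better_sim intro!: arg_cong[where f=tree_of_bool])

lemma body_sim:
  assumes v: "v < N" and M: "M = out k v (take (2 * k) bs)"
  shows "bodyT orc env (tree_of_nat v) (Node (bl bs) R) = Node (bl (drop (4 * k) bs))
    (if acc k v (take (2 * k) bs) \<and> (cut M = {} \<or> (\<forall>b\<in>set (take (2 * k) (drop (2 * k) bs)). b)) then Node (encR M) R else R)"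
proof -
  have b: "bitsT env (bl xs) = bl (take (2 * k) xs)" for xs
    by (simp add: bitsT_def env_simps bl_simps nat_of_tree_of_nat)
  have "bodyT orc env (tree_of_nat v) (Node (bl bs) R) = Node (bl (drop (2 * k) (drop (2 * k) bs)))
    (if (card (cut M) \<le> k \<and> (\<forall>u\<in>dom_of M. v \<le> u) \<and> (cut M = {} \<or> (\<forall>b\<in>set (take (2 * k) (drop (2 * k) bs)). b))) \<and>
      \<not> (\<exists>\<beta>'. length \<beta>' = 2 * k \<and> dom_of M \<subset> dom_of (out k v \<beta>') \<and> card (cut (out k v \<beta>')) \<le> card (cut M))
     then Node (encR M) R else R)"
    unfolding bodyT_def left_tree.simps right_tree.simps b cand_sim[OF v] M[symmetric] dominated_sim[OF v] finT_def
      bl_simps(1) env_simps nat_of_tree_of_nat ok_sim[OF env_simps(1)] bool_simps ..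
  also have "drop (2 * k) (drop (2 * k) bs) = drop (4 * k) bs" by simp
  finally show ?thesis unfolding acc_def M[symmetric] by (simp only: conj_assoc conj_commute conj_left_commute)
qed

definition bet :: "bool list \<Rightarrow> nat \<Rightarrow> bool list" where "bet bs v = take (2 * k) (drop (v * (4 * k)) bs)"
definition gam :: "bool list \<Rightarrow> nat \<Rightarrow> bool" where
  "gam bs v = (\<forall>b\<in>set (take (2 * k) (drop (2 * k) (drop (v * (4 * k)) bs))). b)"

lemma sel_sim:
  "right_tree (selT orc (Node env (tree_of_list (rev (map tree_of_bool bs))))) = tree_of_list (rev (map (\<lambda>v. encR (out k v (bet bs v)))
    (filter (\<lambda>v. acc k v (bet bs v) \<and> (cut (out k v (bet bs v)) = {} \<or> gam bs v)) [0..<N])))"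
proof -
  let ?S = "\<lambda>v. acc k v (bet bs v) \<and> (cut (out k v (bet bs v)) = {} \<or> gam bs v)"
  have "fold (bodyT orc env) (map tree_of_nat [0..<n]) (Node (bl bs) Leaf) = Node (bl (drop (n * (4 * k)) bs))
      (tree_of_list (rev (map (\<lambda>v. encR (out k v (bet bs v))) (filter ?S [0..<n]))))" if "n \<le> N" for n
    using that
  proof (induction n)
    case (Suc n)
    have n: "n < N" using Suc.prems by simp
    have d: "drop (4 * k) (drop (n * (4 * k)) bs) = drop (Suc n * (4 * k)) bs" by (simp add: add.commute)
    have "fold (bodyT orc env) (map tree_of_nat [0..<Suc n]) (Node (bl bs) Leaf) =
        bodyT orc env (tree_of_nat n) (Node (bl (drop (n * (4 * k)) bs))
          (tree_of_list (rev (map (\<lambda>v. encR (out k v (bet bs v))) (filter ?S [0..<n])))))"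
      using Suc by simp
    also have "\<dots> = Node (bl (drop (Suc n * (4 * k)) bs)) (tree_of_list (rev (map (\<lambda>v. encR (out k v (bet bs v))) (filter ?S [0..<Suc n]))))"
      unfolding body_sim[OF n refl] d bet_def[symmetric] gam_def[symmetric] by simp
    finally show ?case .
  qed (simp add: bl_def)
  moreover have "revT (tree_of_list (rev (map tree_of_bool bs))) = bl bs" by (simp add: revT_eq bl_def)
  ultimately show ?thesis
    by (simp add: selT_def env_simps C(3) foldT_fold nl_def)
qed

lemma union_sim: "set (list_of_tree (unionT L)) = (\<Union>t\<in>set (list_of_tree L). set (list_of_tree t))"
proof -
  have "set (list_of_tree (fold appT ts a)) = (\<Union>t\<in>set ts. set (list_of_tree t)) \<union> set (list_of_tree a)" for ts a
    by (induction ts arbitrary: a) (auto simp: appT_eq)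
  then show ?thesis by (simp add: unionT_def foldT_fold)
qed

lemma maximal_sim: "maximalT (tree_of_list (map encR Ms)) =
    tree_of_list (map encR (filter (\<lambda>M. \<not> (\<exists>M'\<in>set Ms. dom_of M \<subset> dom_of M')) Ms))"
proof -
  have "andT (subsetT (left_tree (encR M)) (left_tree (encR M'))) (notT (subsetT (left_tree (encR M')) (left_tree (encR M)))) =
      tree_of_bool (dom_of M \<subset> dom_of M')" for M M'
    unfolding encR_simps subset_sim bool_simps by (rule arg_cong[where f=tree_of_bool]) auto
  then show ?thesis by (simp add: maximalT_def filterT_eq exT_eq filter_map comp_def)
qed

lemma post_sim: "decode_output (postT (tree_of_list (map encR Ms))) =
    (\<Union>M\<in>set Ms. dom_of M, \<Union>M\<in>{M \<in> set Ms. \<not> (\<exists>M'\<in>set Ms. dom_of M \<subset> dom_of M')}. cut M)"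
proof -
  have n: "nat_of_tree ` set (list_of_tree (nl xs)) = set xs" for xs by (simp add: nl_def image_image nat_of_tree_of_nat)
  have f: "fst ` set (arcs ps ids) = set ids" for ids by (force simp: arcs_def)
  have l: "left_tree (encC x c) = tree_of_nat (fst c)" for x c by (cases c) (simp add: encC_def)
  have c: "nat_of_tree ` set (list_of_tree (mapT left_tree (right_tree (encR M)))) = cut M" for M
  proof -
    have "mapT left_tree (right_tree (encR M)) = nl (map fst (arcs ps (filter (\<lambda>i. i \<in> cut M) [0..<length ps])))"
      by (simp add: encR_def mapT_eq encA_def nl_def l comp_def)
    then show ?thesis unfolding n by (simp only: n set_map f cut_list)
  qed
  have "set_of_tree (unionT (mapT left_tree (tree_of_list (map encR Ms)))) = (\<Union>M\<in>set Ms. dom_of M)"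
    unfolding set_of_tree_def union_sim image_UN mapT_eq list_of_tree_of_list map_map set_map
    by (simp add: encR_simps(1) n encR_simps(2)[simplified])
  moreover have "set_of_tree (unionT (mapT (\<lambda>c. mapT left_tree (right_tree c)) (tree_of_list (map encR Ms')))) = (\<Union>M\<in>set Ms'. cut M)" for Ms'
    unfolding set_of_tree_def union_sim image_UN mapT_eq[of "\<lambda>c. mapT left_tree (right_tree c)"] list_of_tree_of_list map_map set_map
    by (simp add: c)
  ultimately show ?thesis by (simp add: decode_output_def postT_def maximal_sim)
qed

lemma main_sim:
  "decode_output (mainT orc (Node env (tree_of_list (rev (map tree_of_bool bs))))) =
    (out_verts (sel k (bet bs) (gam bs)), out_edges (sel k (bet bs) (gam bs)))"
proof -
  let ?S = "\<lambda>v. acc k v (bet bs v) \<and> (cut (out k v (bet bs v)) = {} \<or> gam bs v)"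
  define Ms where "Ms = rev (map (\<lambda>v. out k v (bet bs v)) (filter ?S [0..<N]))"
  have R: "right_tree (selT orc (Node env (tree_of_list (rev (map tree_of_bool bs))))) = tree_of_list (map encR Ms)"
    unfolding sel_sim Ms_def by (simp add: rev_map comp_def)
  have Ms: "set Ms = snd ` sel k (bet bs) (gam bs)" by (auto simp: Ms_def sel_def image_image)
  have 1: "out_verts (sel k (bet bs) (gam bs)) = (\<Union>M\<in>set Ms. dom_of M)"
    unfolding Ms out_verts_def by (simp add: case_prod_beta)
  have d: "(\<exists>(v', M')\<in>sel k (bet bs) (gam bs). dom_of M \<subset> dom_of M') \<longleftrightarrow> (\<exists>M'\<in>set Ms. dom_of M \<subset> dom_of M')" for M
    unfolding Ms case_prod_unfold by (simp only: Set.bex_simps)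
  have "{M \<in> set Ms. \<not> (\<exists>M'\<in>set Ms. dom_of M \<subset> dom_of M')} =
      snd ` {(v, M) \<in> sel k (bet bs) (gam bs). \<not> (\<exists>M'\<in>set Ms. dom_of M \<subset> dom_of M')}"
    unfolding Ms case_prod_unfold prod.collapse by (rule Compr_image_eq)
  then have 2: "out_edges (sel k (bet bs) (gam bs)) = (\<Union>M\<in>{M \<in> set Ms. \<not> (\<exists>M'\<in>set Ms. dom_of M \<subset> dom_of M')}. cut M)"
    unfolding out_edges_def d by (simp only: case_prod_unfold prod.collapse SUP_image comp_def)
  show ?thesis unfolding mainT_def R post_sim 1 2 ..
qed

lemma success_prob:
  assumes H: "subgraph H G" "balanced \<B> H" "cost G H \<le> k"
  shows "measure_pmf.prob (replicate_pmf (N * (4 * k)) coin)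
    {bs. verts H \<subseteq> out_verts (sel k (bet bs) (gam bs)) \<and>
      card {e \<in> out_edges (sel k (bet bs) (gam bs)). ends G e \<inter> verts H \<noteq> {}} \<le> k} \<ge> (1/2) ^ (4 * k ^ 2 + 4 * k)"
    (is "measure_pmf.prob ?P ?E \<ge> _")
proof -
  show ?thesis
  proof (rule success[OF H])
  fix A B b assume AB: "A \<subseteq> {..<N}" "B \<subseteq> {..<N}" "A \<inter> B = {}" "card A \<le> k" "card B \<le> 2 * k * 4 ^ k"
    "\<And>v. v \<in> A \<Longrightarrow> length (b v) = 2 * k"
    and s: "\<And>\<beta> \<gamma>. (\<forall>v\<in>A. \<beta> v = b v \<and> \<gamma> v) \<Longrightarrow> (\<forall>v\<in>B. \<not> \<gamma> v) \<Longrightarrow>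
      verts H \<subseteq> out_verts (sel k \<beta> \<gamma>) \<and> card {e \<in> out_edges (sel k \<beta> \<gamma>). ends G e \<inter> verts H \<noteq> {}} \<le> k"
  let ?D = "{bs. (\<forall>v\<in>A. take (2 * k) (blk (4 * k) v bs) = b v \<and> drop (2 * k) (blk (4 * k) v bs) = replicate (2 * k) True) \<and>
       (\<forall>v\<in>B. drop (2 * k) (blk (4 * k) v bs) \<noteq> replicate (2 * k) True)}"
  have "(1/2) ^ (4 * k ^ 2 + 4 * k) \<le> measure_pmf.prob ?P ?D" by (rule prob_coins[OF AB])
  also have "\<dots> = measure_pmf.prob ?P (?D \<inter> set_pmf ?P)" by (rule measure_Int_set_pmf[symmetric])
  also have "\<dots> \<le> measure_pmf.prob ?P ?E"
  proof (rule measure_pmf.finite_measure_mono)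
    show "?D \<inter> set_pmf ?P \<subseteq> ?E"
    proof
      fix bs assume bs: "bs \<in> ?D \<inter> set_pmf ?P"
      then have l: "length bs = N * (4 * k)" by (simp add: set_replicate_pmf)
      have t: "take (2 * k) (blk (4 * k) v bs) = bet bs v" for v by (simp add: blk_def bet_def)
      \<comment> \<open>The coin list has full length, so every half block has exactly 2k bits and
        the test for only heads amounts to equality with the constant list.\<close>
      have g: "gam bs v \<longleftrightarrow> drop (2 * k) (blk (4 * k) v bs) = replicate (2 * k) True" if v: "v < N" for v
      proof -
        let ?d = "drop (2 * k) (blk (4 * k) v bs)"
        have "Suc v * (4 * k) \<le> N * (4 * k)" using v by (intro mult_le_mono1) simp
        then have ld: "length ?d = 2 * k" using l by (simp add: blk_def)
        have e: "take (2 * k) (drop (2 * k) (drop (v * (4 * k)) bs)) = ?d" by (simp add: blk_def drop_take)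
        show ?thesis unfolding gam_def e
        proof
          assume "\<forall>b\<in>set ?d. b"
          then show "?d = replicate (2 * k) True" by (intro replicate_eqI[OF ld]) (drule (1) bspec, simp)
        next
          assume r: "?d = replicate (2 * k) True"
          show "\<forall>b\<in>set ?d. b" unfolding r by simp
        qed
      qed
      have "\<forall>v\<in>A. bet bs v = b v \<and> gam bs v" "\<forall>v\<in>B. \<not> gam bs v"
        using bs AB(1,2) by (auto simp: t g subset_iff)
      then show "bs \<in> ?E" using s by simp
    qed
  qed simp
  finally show ?thesis .
  qed
qed

end

lemma mu_input: "mu (input_tree N ps k) \<le> 2 * N + length ps + k + 5"
proof -
  have n: "mu (tree_of_nat n) = n" for n by (induction n) (simp_all add: mu.simps(2) nat_of_tree_of_nat)
  let ?P = "tree_of_list (map (\<lambda>(u, v). Node (tree_of_nat u) (tree_of_nat v)) ps)"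
  have "mu ?P \<le> 2 * N + length ps + 1"
  proof (rule mu_leI)
    fix h assume "h \<in> set (list_of_tree ?P)"
    then obtain i where i: "i < length ps" "h = Node (tree_of_nat (fst (ps ! i))) (tree_of_nat (snd (ps ! i)))"
      by (auto simp: in_set_conv_nth split: prod.splits)
    then have "i \<in> edges G" "ends G i = {fst (ps ! i), snd (ps ! i)}" using edges_eq ends_eq by auto
    then have "fst (ps ! i) < N" "snd (ps ! i) < N" using wf_ends[OF wf, of i] verts_eq by auto
    then show "mu h \<le> 2 * N + length ps + 1" unfolding i(2) using mu_Node_le[of "tree_of_nat (fst (ps ! i))" "tree_of_nat (snd (ps ! i))"] n by simp
  qed simp
  then show ?thesis unfolding input_tree_def
    using mu_Node_le[of "Node (tree_of_nat N) ?P" "tree_of_nat k"] mu_Node[of "tree_of_nat N" ?P] n[of N] n[of k] by simp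
qed

end

text \<open>All randomness sits in the middle phase. The output distribution is therefore the image
  of independent bits under a deterministic map, and one time bound covers all outcomes of the last
  phase.\<close>

lemma three_phases:
  assumes C1: "\<And>s. \<exists>s'. runs orc C1 s (T1 orc (s 0)) s' \<and> s' 0 = prep (s 0)"
    and C3: "\<And>s. \<exists>s'. runs orc C3 s (T3 orc (s 0)) s' \<and> s' 0 = main orc (s 0)"
    and n: "nat_of_tree (right_tree (prep inp)) = n"
    and t: "\<And>bs. length bs = n \<Longrightarrow> T3 orc (Node (left_tree (prep inp)) (tree_of_list (rev (map tree_of_bool bs)))) \<le> t"
  shows "\<exists>h. steps orc (T1 orc inp + 1 + (7 * n + 8 + 1 + t)) (initial (Seq C1 (Seq flip_prog C3)) inp) =
      map_pmf (\<lambda>bs. (Skip, h bs)) (replicate_pmf n coin) \<and>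
    (\<forall>bs. length bs = n \<longrightarrow> h bs 0 = main orc (Node (left_tree (prep inp)) (tree_of_list (rev (map tree_of_bool bs)))))"
proof -
  let ?s0 = "(\<lambda>_. Leaf)(0 := inp)"
  let ?R = "replicate_pmf n coin"
  let ?Z = "\<lambda>bs. Node (left_tree (prep inp)) (tree_of_list (rev (map tree_of_bool bs)))"
  obtain s1 where s1: "runs orc C1 ?s0 (T1 orc inp) s1" "s1 0 = prep inp" using C1[of ?s0] by auto
  have n1: "nat_of_tree (right_tree (s1 0)) = n" using n s1(2) by simp
  obtain g where g: "steps orc (7 * n + 8) (flip_prog, s1) = map_pmf (\<lambda>bs. (Skip, g bs)) ?R"
    and g0: "\<forall>bs. length bs = n \<longrightarrow> g bs 0 = Node (left_tree (s1 0)) (tree_of_list (rev (map tree_of_bool bs)))"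
    using flip_prog_steps[where s=s1 and orc=orc, OF n1] by (elim exE conjE)
  have "\<forall>bs. \<exists>s'. length bs = n \<longrightarrow> runs orc C3 (g bs) t s' \<and> s' 0 = main orc (?Z bs)"
  proof
    fix bs
    show "\<exists>s'. length bs = n \<longrightarrow> runs orc C3 (g bs) t s' \<and> s' 0 = main orc (?Z bs)"
    proof (cases "length bs = n")
      case True
      then have z: "g bs 0 = ?Z bs" using g0 s1(2) by simp
      obtain s' where "runs orc C3 (g bs) (T3 orc (g bs 0)) s'" "s' 0 = main orc (g bs 0)" using C3[of "g bs"] by blast
      then show ?thesis using runs_mono[of orc C3 "g bs" "T3 orc (g bs 0)" s' t] t[OF True] unfolding z by blast
    qed simp
  qed
  from choice[OF this] obtain h where h: "\<forall>bs. length bs = n \<longrightarrow> runs orc C3 (g bs) t (h bs) \<and> h bs 0 = main orc (?Z bs)" ..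
  have l: "length bs = n" if "bs \<in> set_pmf ?R" for bs using that by (simp add: set_replicate_pmf)
  have st: "steps orc t (C3, g bs) = return_pmf (Skip, h bs)" if "bs \<in> set_pmf ?R" for bs
    using h l[OF that] by (simp add: runs_def)
  have 2: "steps orc (7 * n + 8 + 1 + t) (Seq flip_prog C3, s1) =
      bind_pmf (steps orc (7 * n + 8) (flip_prog, s1)) (\<lambda>cf. steps orc t (C3, snd cf))"
  proof (rule steps_Seq; unfold g set_map_pmf; intro ballI; elim imageE)
    show "fst cf' = Skip" if "cf' \<in> set_pmf (steps orc t (C3, snd cf))" "cf = (Skip, g bs)" "bs \<in> set_pmf ?R" for cf cf' bs
      using that st[OF that(3)] by simp
  qed simp
  also have "\<dots> = bind_pmf ?R (\<lambda>bs. steps orc t (C3, g bs))" unfolding g bind_map_pmf by simp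
  also have "\<dots> = bind_pmf ?R (\<lambda>bs. return_pmf (Skip, h bs))" by (rule bind_pmf_cong[OF refl st])
  finally have 3: "steps orc (7 * n + 8 + 1 + t) (Seq flip_prog C3, s1) = map_pmf (\<lambda>bs. (Skip, h bs)) ?R"
    by (simp only: map_pmf_def)
  have "steps orc (T1 orc inp + 1 + (7 * n + 8 + 1 + t)) (Seq C1 (Seq flip_prog C3), ?s0) =
      steps orc (7 * n + 8 + 1 + t) (Seq flip_prog C3, s1)"
    by (rule steps_Seq_runs[OF s1(1)]) (unfold 3, auto)
  then show ?thesis using h unfolding 3 initial_def by blast
qed

text \<open>The coefficients 1, 1, 7, 8, 1, 1 of the summands add up to 19 once each is bounded by
  the largest power of \<open>q\<close>. The power of \<open>Suc (k - min k m)\<close> that comes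
  from reading the unary k is bounded by 4 to the excess, which completes the exponent of the
  maximality test to k.\<close>

lemma time_bound:
  fixes q :: nat
  assumes q: "q \<le> 7 * Suc s * Suc (k - min k m)" "2 \<le> q"
    and t1: "t1 \<le> q ^ c1" and n: "n \<le> q ^ c2" and t3: "t3 \<le> 2 ^ (2 * min k m) * q ^ c3"
  defines "c \<equiv> c1 + c2 + c3"
  shows "t1 + 1 + (7 * n + 8 + 1 + t3) \<le> (19 * 7 ^ c * (fact c * 2 ^ c)) * 4 ^ k * (s + 1) ^ c"
proof -
  let ?k = "min k m"
  have e: "q ^ c1 \<le> q ^ c" "q ^ c2 \<le> q ^ c" "q ^ c3 \<le> q ^ c"
    using q(2) by (auto simp: c_def intro!: power_increasing)
  have one: "1 \<le> q ^ c" using q(2) by simp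
  have f: "2 ^ (2 * ?k) = (4::nat) ^ ?k" by (simp add: power_mult)
  have "t3 \<le> 4 ^ ?k * q ^ c" using t3 e(3) unfolding f by (meson le_trans mult_le_mono2)
  moreover have "q ^ c \<le> 4 ^ ?k * q ^ c" by simp
  ultimately have "t1 + 1 + (7 * n + 8 + 1 + t3) \<le> 19 * (4 ^ ?k * q ^ c)"
    using t1 n e one by linarith
  also have "q ^ c \<le> (7 * Suc s * Suc (k - ?k)) ^ c" using q(1) by (rule power_mono) simp
  also have "\<dots> = 7 ^ c * (s + 1) ^ c * Suc (k - ?k) ^ c" by (simp only: power_mult_distrib Suc_eq_plus1)
  also have "Suc (k - ?k) ^ c \<le> (fact c * 2 ^ c) * 4 ^ (k - ?k)" by (rule poly_le_exp)
  finally have "t1 + 1 + (7 * n + 8 + 1 + t3) \<le>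
      19 * (4 ^ ?k * (7 ^ c * (s + 1) ^ c * (fact c * 2 ^ c * 4 ^ (k - ?k))))" by simp
  also have "\<dots> = (19 * 7 ^ c * (fact c * 2 ^ c)) * (4 ^ ?k * 4 ^ (k - ?k)) * (s + 1) ^ c"
    by (simp only: mult.assoc mult.commute mult.left_commute)
  also have "(4::nat) ^ ?k * 4 ^ (k - ?k) = 4 ^ k" by (simp add: power_add[symmetric])
  finally show ?thesis .
qed

theorem theorem2:
  "\<exists>(P :: com) (a :: nat) (d :: nat) (f :: nat \<Rightarrow> real).
     f \<in> O(\<lambda>k. real k ^ 2) \<and>
     (\<forall>(G :: (nat, nat) mgraph) (\<B> :: nat set set) (N :: nat) (ps :: (nat \<times> nat) list) (k :: nat).
        biased_graph G \<B> \<and> represents N ps G \<longrightarrow>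
        (let orc = membership_oracle \<B>;
             inp = input_tree N ps k;
             T = a * 4 ^ k * (graph_size G + 1) ^ d;
             D = map_pmf decode_output (output_dist orc P inp T)
         in halts_within orc P inp T \<and>
            (\<forall>(S, F) \<in> set_pmf D.
               S \<subseteq> verts G \<and> F \<subseteq> edges G \<and>
               boundary G S \<subseteq> F \<and>
               balanced \<B> (induced (delete_edges G F) S)) \<and>
            (\<forall>H. subgraph H G \<and> balanced \<B> H \<and> cost G H \<le> k \<longrightarrow>
               measure_pmf.prob D
                 {(S, F). verts H \<subseteq> S \<and> card {e \<in> F. ends G e \<inter> verts H \<noteq> {}} \<le> k}
               \<ge> 1 / 2 powr f k)))"
proof -
  obtain T1 where T1: "RT (\<lambda>orc x. prepT x) T1" "polyb T1" using PT_prep unfolding PT_def by (elim exE conjE)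
  obtain C1 where C1: "\<forall>orc s. \<exists>s'. runs orc C1 s (T1 orc (s 0)) s' \<and> s' 0 = prepT (s 0) \<and> s' 1 = s 1"
    using T1(1) unfolding RT_def by (elim exE)
  obtain c1 where c1: "\<forall>orc x. T1 orc x \<le> (mu x + 2) ^ c1" using T1(2) unfolding polyb_def by (elim exE)
  obtain c2 where c2: "\<forall>(orc :: tree \<Rightarrow> bool) x. mu (prepT x) \<le> (mu x + 2) ^ c2"
    using PT_polyb_mu[OF PT_prep] unfolding polyb_def by (elim exE)
  obtain T3 g3 where T3: "RT mainT T3" "polyb g3"
    "\<forall>orc x. T3 orc x \<le> 2 ^ nat_of_tree (left_tree (left_tree x)) * g3 orc x"
    using XT_main unfolding XT_def by (elim exE conjE)
  obtain C3 where C3: "\<forall>orc s. \<exists>s'. runs orc C3 s (T3 orc (s 0)) s' \<and> s' 0 = mainT orc (s 0) \<and> s' 1 = s 1"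
    using T3(1) unfolding RT_def by (elim exE)
  obtain c3 where c3: "\<forall>orc x. g3 orc x \<le> (mu x + 2) ^ c3" using T3(2) unfolding polyb_def by (elim exE)
  \<comment> \<open>The last phase runs on the prepared environment together with the coins. Both
    are polynomial in the input with exponent \<open>c2\<close>, and passing to the pair adds 3 to
    it; composing with the bound of the last phase multiplies by \<open>c3\<close>.\<close>
  define c where "c = c1 + c2 + (c2 + 3) * c3"
  define P where "P = Seq C1 (Seq flip_prog C3)"
  define f where "f = (\<lambda>k. 4 * real k ^ 2 + 4 * real k)"
  have "f \<in> O(\<lambda>k. real k ^ 2)"
  proof (rule bigoI[of _ 8])
    have "norm (f k) \<le> 8 * norm (real k ^ 2)" for k
    proof -
      have "real k \<le> real k ^ 2" unfolding of_nat_power[symmetric] of_nat_le_iff by (simp add: power2_eq_square)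
      then show ?thesis by (simp add: f_def)
    qed
    then show "\<forall>\<^sub>F k in sequentially. norm (f k) \<le> 8 * norm (real k ^ 2)" by simp
  qed
  moreover have "let orc = membership_oracle \<B>; inp = input_tree N ps k;
             T = (19 * 7 ^ c * (fact c * 2 ^ c)) * 4 ^ k * (graph_size G + 1) ^ c;
             D = map_pmf decode_output (output_dist orc P inp T)
         in halts_within orc P inp T \<and>
            (\<forall>(S, F) \<in> set_pmf D. S \<subseteq> verts G \<and> F \<subseteq> edges G \<and> boundary G S \<subseteq> F \<and>
               balanced \<B> (induced (delete_edges G F) S)) \<and>
            (\<forall>H. subgraph H G \<and> balanced \<B> H \<and> cost G H \<le> k \<longrightarrow>
               measure_pmf.prob D {(S, F). verts H \<subseteq> S \<and> card {e \<in> F. ends G e \<inter> verts H \<noteq> {}} \<le> k} \<ge> 1 / 2 powr f k)"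
    if bg: "biased_graph G \<B>" and rep: "represents N ps G" for G :: "(nat, nat) mgraph" and \<B> N ps k
  proof -
    interpret rgraph G \<B> N ps by unfold_locales (rule bg rep)+
    let ?inp = "input_tree N ps k" and ?T = "(19 * 7 ^ c * (fact c * 2 ^ c)) * 4 ^ k * (graph_size G + 1) ^ c"
    define k' where "k' = min k (length ps)"
    obtain C where pr: "prepT ?inp = Node (Node (tree_of_nat (2 * k')) (Node C (encA (\<lambda>_. 0) (arcs ps [0..<length ps]))))
        (tree_of_nat (N * (4 * k')))"
      and C: "ctx_ok k' (right_tree C)" "nat_of_tree (left_tree C) = N + length ps" "left_tree (right_tree (right_tree C)) = nl [0..<N]"
      unfolding k'_def by (rule prep_sim)
    define env where "env = Node (tree_of_nat (2 * k')) (Node C (encA (\<lambda>_. 0) (arcs ps [0..<length ps])))"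
    note sim = main_sim[OF C env_def] and prob = success_prob[OF C env_def]
    define n where "n = N * (4 * k')"
    let ?R = "replicate_pmf n coin"
    have pe: "prepT ?inp = Node env (tree_of_nat n)" using pr by (simp add: env_def n_def)
    define q where "q = mu ?inp + 2"
    have size: "graph_size G = N + length ps" by (simp add: graph_size_def verts_eq edges_eq)
    \<comment> \<open>Writing k as the minimum \<open>k'\<close> plus the excess, the first part is
      at most the number of edges; only the excess is not bounded by the size of the graph.\<close>
    have q: "q \<le> 7 * Suc (graph_size G) * Suc (k - k')"
    proof -
      have "q \<le> 2 * N + length ps + k + 7" using mu_input[of k] by (simp add: q_def)
      also have "\<dots> \<le> 7 * Suc (graph_size G) + (k - k')" by (simp add: size k'_def)
      also have "\<dots> \<le> 7 * Suc (graph_size G) + 7 * Suc (graph_size G) * (k - k')" by simp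
      finally show ?thesis by simp
    qed
    have mp: "mu (Node env (tree_of_nat n)) \<le> q ^ c2" using c2[rule_format, of ?inp] by (simp add: pe q_def)
    then have me: "mu env \<le> q ^ c2" and nq: "n \<le> q ^ c2"
      using nat_of_tree_le_mu[of "tree_of_nat n"] mu_left[of "Node env (tree_of_nat n)"] mu_right[of "Node env (tree_of_nat n)"]
      by (simp_all add: nat_of_tree_of_nat)
    let ?z = "\<lambda>bs. Node env (tree_of_list (rev (map tree_of_bool bs)))"
    have t3: "T3 orc (?z bs) \<le> 2 ^ (2 * k') * q ^ ((c2 + 3) * c3)" if l: "length bs = n" for bs
    proof -
      have "mu (tree_of_list (rev (map tree_of_bool bs))) \<le> n + 1"
        using mu_bl[of "rev bs"] l by (simp add: bl_def rev_map)
      then have "mu (?z bs) + 2 \<le> 2 * q ^ c2 + 4"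
        using mu_Node_le[of env "tree_of_list (rev (map tree_of_bool bs))"] me nq by linarith
      \<comment> \<open>Constants are absorbed into powers of \<open>q\<close>, which is at least 2;
        this is the origin of the 3 in the exponent.\<close>
      also have "\<dots> \<le> q ^ c2 * 2 ^ 3"
      proof -
        have "1 \<le> q ^ c2" by (simp add: q_def)
        then show ?thesis by simp
      qed
      also have "\<dots> \<le> q ^ c2 * q ^ 3" by (intro mult_left_mono power_mono) (simp_all add: q_def)
      finally have "mu (?z bs) + 2 \<le> q ^ (c2 + 3)" by (simp only: power_add)
      then have "(mu (?z bs) + 2) ^ c3 \<le> (q ^ (c2 + 3)) ^ c3" by (rule power_mono) simp
      then have "g3 orc (?z bs) \<le> q ^ ((c2 + 3) * c3)"
        using c3[rule_format, of orc "?z bs"] unfolding power_mult by (rule le_trans[rotated])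
      then have m: "2 ^ (2 * k') * g3 orc (?z bs) \<le> 2 ^ (2 * k') * q ^ ((c2 + 3) * c3)" by (rule mult_left_mono) simp
      have e: "nat_of_tree (left_tree (left_tree (?z bs))) = 2 * k'" by (simp add: env_def nat_of_tree_of_nat)
      show ?thesis using T3(3)[rule_format, of orc "?z bs"] unfolding e by (rule le_trans[OF _ m])
    qed
    have "\<exists>h. steps orc (T1 orc ?inp + 1 + (7 * n + 8 + 1 + 2 ^ (2 * k') * q ^ ((c2 + 3) * c3))) (initial (Seq C1 (Seq flip_prog C3)) ?inp) =
        map_pmf (\<lambda>bs. (Skip, h bs)) ?R \<and>
      (\<forall>bs. length bs = n \<longrightarrow> h bs 0 = mainT orc (Node (left_tree (prepT ?inp)) (tree_of_list (rev (map tree_of_bool bs)))))"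
    proof (rule three_phases[where prep=prepT and main=mainT])
      show "\<exists>s'. runs orc C1 s (T1 orc (s 0)) s' \<and> s' 0 = prepT (s 0)" for s using C1 by blast
      show "\<exists>s'. runs orc C3 s (T3 orc (s 0)) s' \<and> s' 0 = mainT orc (s 0)" for s using C3 by blast
      show "nat_of_tree (right_tree (prepT ?inp)) = n" by (simp add: pe nat_of_tree_of_nat)
      show "T3 orc (Node (left_tree (prepT ?inp)) (tree_of_list (rev (map tree_of_bool bs)))) \<le> 2 ^ (2 * k') * q ^ ((c2 + 3) * c3)"
        if "length bs = n" for bs using t3[OF that] by (simp add: pe)
    qed
    then obtain h where h: "steps orc (T1 orc ?inp + 1 + (7 * n + 8 + 1 + 2 ^ (2 * k') * q ^ ((c2 + 3) * c3))) (initial P ?inp) =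
        map_pmf (\<lambda>bs. (Skip, h bs)) ?R" and h0: "\<forall>bs. length bs = n \<longrightarrow> h bs 0 = mainT orc (?z bs)"
      unfolding P_def[symmetric] pe left_tree.simps by (elim exE conjE)
    have "T1 orc ?inp + 1 + (7 * n + 8 + 1 + 2 ^ (2 * k') * q ^ ((c2 + 3) * c3)) \<le> ?T"
      unfolding c_def
    proof (rule time_bound[where m="length ps" and q=q])
      show "q \<le> 7 * Suc (graph_size G) * Suc (k - min k (length ps))" using q by (simp only: k'_def)
      show "2 \<le> q" by (simp add: q_def)
      show "T1 orc ?inp \<le> q ^ c1" using c1 by (simp only: q_def)
      show "n \<le> q ^ c2" by (rule nq)
      show "2 ^ (2 * k') * q ^ ((c2 + 3) * c3) \<le> 2 ^ (2 * min k (length ps)) * q ^ ((c2 + 3) * c3)" by (simp only: k'_def)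
    qed
    then have st: "steps orc ?T (initial P ?inp) = map_pmf (\<lambda>bs. (Skip, h bs)) ?R"
      unfolding h[symmetric] by (intro steps_halted) (unfold h, auto)
    have halts: "halts_within orc P ?inp ?T" unfolding halts_within_def st by auto
    have D: "map_pmf decode_output (output_dist orc P ?inp ?T) = map_pmf (\<lambda>bs. decode_output (h bs 0)) ?R"
      unfolding output_dist_def st by (simp only: map_pmf_comp snd_conv)
    have l: "length bs = n" if "bs \<in> set_pmf ?R" for bs using that by (simp add: set_replicate_pmf)
    let ?S = "\<lambda>bs. sel k' (bet k' bs) (gam k' bs)"
    have dec: "decode_output (h bs 0) = (out_verts (?S bs), out_edges (?S bs))" if "length bs = n" for bs
      using h0 that sim[of bs] by simp
    have sound: "\<forall>(S, F) \<in> set_pmf (map_pmf (\<lambda>bs. decode_output (h bs 0)) ?R). S \<subseteq> verts G \<and> F \<subseteq> edges G \<and>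
        boundary G S \<subseteq> F \<and> balanced \<B> (induced (delete_edges G F) S)"
    proof (intro ballI)
      fix x assume "x \<in> set_pmf (map_pmf (\<lambda>bs. decode_output (h bs 0)) ?R)"
      then obtain bs where "bs \<in> set_pmf ?R" "x = decode_output (h bs 0)" by auto
      then have "x = (out_verts (?S bs), out_edges (?S bs))" using dec l by simp
      then show "case x of (S, F) \<Rightarrow> S \<subseteq> verts G \<and> F \<subseteq> edges G \<and>
          boundary G S \<subseteq> F \<and> balanced \<B> (induced (delete_edges G F) S)"
        using output_sound[OF sel_family_ok[of k' "bet k' bs" "gam k' bs"]] by simp
    qed
    have succ: "measure_pmf.prob (map_pmf (\<lambda>bs. decode_output (h bs 0)) ?R)
        {(S, F). verts H \<subseteq> S \<and> card {e \<in> F. ends G e \<inter> verts H \<noteq> {}} \<le> k} \<ge> 1 / 2 powr f k"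
      if H: "subgraph H G" "balanced \<B> H" "cost G H \<le> k" for H
    proof -
      let ?A = "{(S, F). verts H \<subseteq> S \<and> card {e \<in> F. ends G e \<inter> verts H \<noteq> {}} \<le> k}"
      let ?B = "{bs. verts H \<subseteq> out_verts (?S bs) \<and> card {e \<in> out_edges (?S bs). ends G e \<inter> verts H \<noteq> {}} \<le> k'}"
      \<comment> \<open>No subgraph costs more than the number of edges, so \<open>H\<close> also
        meets the reduced bound \<open>k'\<close>, and nothing is lost by running the algorithm with
        it.\<close>
      have "card (miss (verts H) (edges H)) \<le> card (edges G)" by (rule card_mono[OF finite_edges]) (auto simp: miss_def)
      then have ck: "cost G H \<le> k'" using H(3) by (simp add: k'_def subgraph_sol(2)[OF H(1,2)] edges_eq)
      have kk: "k' \<le> k" by (simp add: k'_def)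
      have "f k' \<le> f k" unfolding f_def using kk by (intro add_mono mult_left_mono power_mono) simp_all
      then have "1 / 2 powr f k \<le> 1 / 2 powr f k'" by (intro divide_left_mono) simp_all
      also have "\<dots> = (1/2) ^ (4 * k' ^ 2 + 4 * k')"
      proof -
        have "f k' = real (4 * k' ^ 2 + 4 * k')" by (simp add: f_def)
        then show ?thesis by (simp only: powr_realpow zero_less_numeral) (simp add: power_one_over)
      qed
      also have "\<dots> \<le> measure_pmf.prob ?R ?B" unfolding n_def by (rule prob[OF H(1,2) ck])
      also have "\<dots> = measure_pmf.prob ?R (?B \<inter> set_pmf ?R)" by (rule measure_Int_set_pmf[symmetric])
      also have "\<dots> \<le> measure_pmf.prob ?R ((\<lambda>bs. decode_output (h bs 0)) -` ?A)"
      proof (rule measure_pmf.finite_measure_mono)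
        show "?B \<inter> set_pmf ?R \<subseteq> (\<lambda>bs. decode_output (h bs 0)) -` ?A"
        proof
          fix bs assume "bs \<in> ?B \<inter> set_pmf ?R"
          then have b: "bs \<in> ?B" "length bs = n" using l by blast+
          then show "bs \<in> (\<lambda>bs. decode_output (h bs 0)) -` ?A" using kk by (simp add: dec)
        qed
      qed simp
      finally show ?thesis by simp
    qed
    show ?thesis unfolding Let_def D using halts sound succ by blast
  qed
  ultimately show ?thesis by blast
qed

end
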